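(* Let $\omega_0$ and $\omega_1$ be germs at $0$ of smooth (respectively $\mathbb R$-analytic) singular symplectic forms on $\mathbb R^{2n}$ with a common structurally smooth Martinet hypersurface $\Sigma_2$ at $0$, let $\iota:\Sigma_2\hookrightarrow\mathbb R^{2n}$ be the inclusion, and suppose $\operatorname{rank}(\iota^{*}\omega_0|_{0})=\operatorname{rank}(\iota^{*}\omega_1|_0)\le 2n-2$. If the canonical orientations of $\Sigma_2$ defined by $\omega_0$ and $\omega_1$ are the same, $\iota^{*}\omega_0=\iota^{*}\omega_1$ and $\ker(\omega_0^{n-1}|_0)=\ker(\omega_1^{n-1}|_0)$, then there exists a smooth (respectively $\mathbb R$-analytic) diffeomorphism-germ $\Psi:(\mathbb R^{2n},0)\to(\mathbb R^{2n},0)$ such that $\Psi^{*}\omega_1=\omega_0$.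
   Context: A closed (smooth or $\mathbb R$-analytic) differential $2$-form-germ $\omega$ at $0$ on $\mathbb R^{2n}$ is called a singular symplectic form-germ if its Martinet hypersurface $\Sigma_2(\omega)=\{p:\omega^n|_p=0\}$ is nowhere dense, where $\omega^n=\omega\wedge\cdots\wedge\omega$ ($n$ times). Write $\omega^n=f\,\Omega$ with $\Omega$ the germ at $0$ of a volume form and $f$ a function-germ, so $\Sigma_2(\omega)=\{f=0\}$. The Martinet hypersurface is called structurally smooth at $0$ if $f(0)=0$ and $df|_0\neq 0$. "Common Martinet hypersurface" means $\Sigma_2(\omega_0)=\Sigma_2(\omega_1)=\Sigma_2$. Canonical orientation of $\Sigma_2$ defined by $\omega$: if $\Sigma_2=\{f=0\}$ with $df|_0\neq0$, it is the orientation determined by the volume form $\Omega_{\Sigma_2}$ on $\Sigma_2$ given by $df\wedge\Omega_{\Sigma_2}=\omega^n/f$ (at points of $\Sigma_2$); it does not depend on the choice of such $f$. For such $\omega$, $\ker(\omega^{n-1}|_0)=\{v\in T_0\mathbb R^{2n}: v\rfloor(\omega^{n-1}|_0)=0\}$, where $v\rfloor$ denotes interior product. The rank of a $2$-form at a point is its rank as a skew-symmetric bilinear form. *)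

theory Defs
  imports "HOL-Analysis.Analysis"
begin

section \<open>Regularity classes\<close>

primrec Ck_on :: "nat \<Rightarrow> 'a::real_normed_vector set \<Rightarrow> ('a \<Rightarrow> 'b::real_normed_vector) \<Rightarrow> bool" where
  "Ck_on 0 S f \<longleftrightarrow> continuous_on S f"
| "Ck_on (Suc k) S f \<longleftrightarrow> (\<forall>x\<in>S. f differentiable (at x)) \<and>
     (\<forall>v. Ck_on k S (\<lambda>x. frechet_derivative f (at x) v))"

definition smooth_on :: "'a::real_normed_vector set \<Rightarrow> ('a \<Rightarrow> 'b::real_normed_vector) \<Rightarrow> bool" where
  "smooth_on S f \<longleftrightarrow> (\<forall>k. Ck_on k S f)"

text \<open>Near each point the function is the sum of a power series; \<open>\<alpha>\<close> ranges over all multi-indices.\<close>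

definition real_analytic_on :: "(real^'d) set \<Rightarrow> (real^'d \<Rightarrow> 'b::real_normed_vector) \<Rightarrow> bool" where
  "real_analytic_on S f \<longleftrightarrow> (\<forall>p\<in>S. \<exists>r>0. \<exists>a :: ('d \<Rightarrow> nat) \<Rightarrow> 'b. \<forall>x\<in>ball p r.
     ((\<lambda>\<alpha>. (\<Prod>i\<in>UNIV. (x $ i - p $ i) ^ \<alpha> i) *\<^sub>R a \<alpha>) has_sum f x) UNIV)"

datatype regularity = Smooth | Analytic

definition regular_on :: "regularity \<Rightarrow> (real^'d) set \<Rightarrow> (real^'d \<Rightarrow> 'b::real_normed_vector) \<Rightarrow> bool" where
  "regular_on r S f = (case r of Smooth \<Rightarrow> smooth_on S f | Analytic \<Rightarrow> real_analytic_on S f)"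

section \<open>Germs at the origin\<close>

text \<open>A germ at \<open>0\<close> is given by a total representative; every notion below only depends on
  its values near \<open>0\<close>.\<close>

definition regular_germ :: "regularity \<Rightarrow> (real^'d \<Rightarrow> 'b::real_normed_vector) \<Rightarrow> bool" where
  "regular_germ r f \<longleftrightarrow> (\<exists>U. open U \<and> 0 \<in> U \<and> regular_on r U f)"

definition set_germ_eq :: "(real^'d) set \<Rightarrow> (real^'d) set \<Rightarrow> bool" where
  "set_germ_eq S T \<longleftrightarrow> (\<forall>\<^sub>F p in nhds 0. p \<in> S \<longleftrightarrow> p \<in> T)"

definition diffeo_germ :: "regularity \<Rightarrow> (real^'d \<Rightarrow> real^'d) \<Rightarrow> bool" where
  "diffeo_germ r F \<longleftrightarrow> F 0 = 0 \<and>
     (\<exists>U V G. open U \<and> open V \<and> 0 \<in> U \<and> 0 \<in> V \<and> homeomorphism U V F G \<and>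
        regular_on r U F \<and> regular_on r V G)"

section \<open>Exterior algebra\<close>

text \<open>A \<open>k\<close>-form on a vector space acts on lists of \<open>k\<close> vectors and, by convention, is \<open>0\<close>
  on lists of any other length. A differential form assigns such a form to each point.\<close>

type_synonym 'a mform = "'a list \<Rightarrow> real"
type_synonym 'a dform = "'a \<Rightarrow> 'a mform"

definition alternating_form :: "nat \<Rightarrow> 'a::real_vector mform \<Rightarrow> bool" where
  "alternating_form k \<alpha> \<longleftrightarrow>
     (\<forall>vs. length vs \<noteq> k \<longrightarrow> \<alpha> vs = 0) \<and>
     (\<forall>vs i. length vs = k \<longrightarrow> i < k \<longrightarrow> linear (\<lambda>v. \<alpha> (vs[i := v]))) \<and>
     (\<forall>vs i j. length vs = k \<longrightarrow> i < j \<longrightarrow> j < k \<longrightarrow> vs ! i = vs ! j \<longrightarrow> \<alpha> vs = 0)"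

definition wedge :: "nat \<Rightarrow> nat \<Rightarrow> 'a mform \<Rightarrow> 'a mform \<Rightarrow> 'a mform" where
  "wedge k l \<alpha> \<beta> vs =
     (if length vs = k + l then
        (\<Sum>\<sigma> | \<sigma> permutes {..<k + l}. of_int (sign \<sigma>) *
           \<alpha> (map (\<lambda>i. vs ! \<sigma> i) [0..<k]) * \<beta> (map (\<lambda>i. vs ! \<sigma> i) [k..<k + l]))
        / (fact k * fact l)
      else 0)"

text \<open>\<open>wedge_power k \<alpha> m\<close> is \<open>\<alpha> \<and> \<dots> \<and> \<alpha>\<close> (\<open>m\<close> factors) for a \<open>k\<close>-form \<open>\<alpha>\<close>.\<close>

primrec wedge_power :: "nat \<Rightarrow> 'a mform \<Rightarrow> nat \<Rightarrow> 'a mform" where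
  "wedge_power k \<alpha> 0 = (\<lambda>vs. if vs = [] then 1 else 0)"
| "wedge_power k \<alpha> (Suc m) = wedge k (k * m) \<alpha> (wedge_power k \<alpha> m)"

definition interior_product :: "'a \<Rightarrow> 'a mform \<Rightarrow> 'a mform" where
  "interior_product v \<alpha> = (\<lambda>vs. \<alpha> (v # vs))"

definition form_kernel :: "'a mform \<Rightarrow> 'a set" where
  "form_kernel \<alpha> = {v. interior_product v \<alpha> = (\<lambda>_. 0)}"

definition restrict_form :: "'a set \<Rightarrow> 'a mform \<Rightarrow> 'a mform" where
  "restrict_form T \<alpha> = (\<lambda>vs. if set vs \<subseteq> T then \<alpha> vs else 0)"

text \<open>Rank of the skew-symmetric bilinear form \<open>\<alpha>\<close> on the subspace \<open>T\<close>, i.e.\ the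
  codimension in \<open>T\<close> of its radical, which is the kernel of the induced map from \<open>T\<close> to its dual.\<close>

definition form_rank_on :: "'a::euclidean_space set \<Rightarrow> 'a mform \<Rightarrow> nat" where
  "form_rank_on T \<alpha> = dim T - dim {v \<in> T. \<forall>w\<in>T. \<alpha> [v, w] = 0}"

section \<open>Differential forms\<close>

definition form_germ :: "regularity \<Rightarrow> nat \<Rightarrow> (real^'d) dform \<Rightarrow> bool" where
  "form_germ r k \<omega> \<longleftrightarrow> (\<exists>U. open U \<and> 0 \<in> U \<and> (\<forall>p\<in>U. alternating_form k (\<omega> p)) \<and>
     (\<forall>vs. length vs = k \<longrightarrow> regular_on r U (\<lambda>p. \<omega> p vs)))"

definition differential :: "('a::real_normed_vector \<Rightarrow> real) \<Rightarrow> 'a dform" where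
  "differential f p vs = (case vs of [v] \<Rightarrow> frechet_derivative f (at p) v | _ \<Rightarrow> 0)"

text \<open>The usual formula for the exterior derivative, evaluated on constant vector fields
  (so that the Lie bracket terms vanish).\<close>

definition ext_deriv :: "'a::real_normed_vector dform \<Rightarrow> 'a dform" where
  "ext_deriv \<omega> p vs = (\<Sum>i<length vs. (- 1) ^ i *
     frechet_derivative (\<lambda>x. \<omega> x (take i vs @ drop (Suc i) vs)) (at p) (vs ! i))"

definition closed_form_germ :: "nat \<Rightarrow> (real^'d) dform \<Rightarrow> bool" where
  "closed_form_germ k \<omega> \<longleftrightarrow> (\<forall>\<^sub>F p in nhds 0. \<forall>vs. length vs = Suc k \<longrightarrow> ext_deriv \<omega> p vs = 0)"

definition pullback :: "('a::real_normed_vector \<Rightarrow> 'b::real_normed_vector) \<Rightarrow> 'b dform \<Rightarrow> 'a dform" where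
  "pullback F \<omega> p = (\<lambda>vs. \<omega> (F p) (map (frechet_derivative F (at p)) vs))"

definition volume_form_germ :: "regularity \<Rightarrow> (real^'d) dform \<Rightarrow> bool" where
  "volume_form_germ r \<Omega> \<longleftrightarrow> form_germ r CARD('d) \<Omega> \<and> (\<forall>\<^sub>F p in nhds 0. \<Omega> p \<noteq> (\<lambda>_. 0))"

section \<open>Forms on a hypersurface\<close>

text \<open>Velocities of smooth curves in \<open>S\<close> through \<open>p\<close>; for an embedded submanifold this is
  the tangent space.\<close>

definition tangent_space :: "'a::real_normed_vector set \<Rightarrow> 'a \<Rightarrow> 'a set" where
  "tangent_space S p = {v. \<exists>\<gamma> \<epsilon>. 0 < \<epsilon> \<and> smooth_on {-\<epsilon><..<\<epsilon>} \<gamma> \<and> \<gamma> ` {-\<epsilon><..<\<epsilon>} \<subseteq> S \<and>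
     \<gamma> (0::real) = p \<and> (\<gamma> has_vector_derivative v) (at 0)}"

text \<open>The pullback \<open>\<iota>\<^sup>*\<omega>\<close> along the inclusion \<open>\<iota>\<close> of \<open>S\<close>: at \<open>p \<in> S\<close> it is the restriction
  of \<open>\<omega> p\<close> to tangent vectors of \<open>S\<close>.\<close>

definition incl_pullback :: "'a::real_normed_vector set \<Rightarrow> 'a dform \<Rightarrow> 'a dform" where
  "incl_pullback S \<omega> p = restrict_form (tangent_space S p) (\<omega> p)"

definition eq_germ_along :: "(real^'d) set \<Rightarrow> (real^'d) dform \<Rightarrow> (real^'d) dform \<Rightarrow> bool" where
  "eq_germ_along S \<theta> \<eta> \<longleftrightarrow> (\<forall>\<^sub>F p in nhds 0. p \<in> S \<longrightarrow> \<theta> p = \<eta> p)"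

text \<open>Two nowhere vanishing top-degree forms on \<open>S\<close> determine the same orientation iff they
  differ by a positive factor. Forms on \<open>S\<close> are given here by ambient forms, restricted to \<open>S\<close>.\<close>

definition same_orientation :: "(real^'d) set \<Rightarrow> (real^'d) dform \<Rightarrow> (real^'d) dform \<Rightarrow> bool" where
  "same_orientation S \<Theta> \<Theta>' \<longleftrightarrow> (\<forall>\<^sub>F p in nhds 0. p \<in> S \<longrightarrow>
     (\<exists>c>0. \<forall>vs. incl_pullback S \<Theta>' p vs = c * incl_pullback S \<Theta> p vs))"

section \<open>Singular symplectic forms\<close>

definition martinet :: "nat \<Rightarrow> 'a dform \<Rightarrow> 'a set" where
  "martinet n \<omega> = {p. wedge_power 2 (\<omega> p) n = (\<lambda>_. 0)}"

definition singular_symplectic_germ :: "regularity \<Rightarrow> nat \<Rightarrow> (real^'d) dform \<Rightarrow> bool" where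
  "singular_symplectic_germ r n \<omega> \<longleftrightarrow> form_germ r 2 \<omega> \<and> closed_form_germ 2 \<omega> \<and>
     (\<exists>U. open U \<and> 0 \<in> U \<and> interior (closure (martinet n \<omega> \<inter> U)) = {})"

text \<open>\<open>\<omega>\<^sup>n = f \<Omega>\<close> near \<open>0\<close> with \<open>\<Omega>\<close> a volume form, \<open>f 0 = 0\<close> and \<open>df \<noteq> 0\<close> at \<open>0\<close>.
  Then \<open>{f = 0}\<close> is the Martinet hypersurface near \<open>0\<close> and \<open>\<Omega>\<close> is \<open>\<omega>\<^sup>n / f\<close>, extended
  by continuity across it.\<close>

definition martinet_presentation ::
    "regularity \<Rightarrow> nat \<Rightarrow> (real^'d) dform \<Rightarrow> (real^'d \<Rightarrow> real) \<Rightarrow> (real^'d) dform \<Rightarrow> bool" where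
  "martinet_presentation r n \<omega> f \<Omega> \<longleftrightarrow> regular_germ r f \<and> volume_form_germ r \<Omega> \<and>
     (\<forall>\<^sub>F p in nhds 0. wedge_power 2 (\<omega> p) n = (\<lambda>vs. f p * \<Omega> p vs)) \<and>
     f 0 = 0 \<and> differential f 0 \<noteq> (\<lambda>_. 0)"

definition structurally_smooth_martinet :: "regularity \<Rightarrow> nat \<Rightarrow> (real^'d) dform \<Rightarrow> bool" where
  "structurally_smooth_martinet r n \<omega> \<longleftrightarrow> (\<exists>f \<Omega>. martinet_presentation r n \<omega> f \<Omega>)"

text \<open>\<open>\<Theta>\<close> restricts to a volume form \<open>\<Omega>\<^bsub>\<Sigma>\<^esub>\<close> on the Martinet hypersurface with
  \<open>df \<and> \<Omega>\<^bsub>\<Sigma>\<^esub> = \<omega>\<^sup>n / f\<close> at its points, so it represents the canonical orientation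
  defined by \<open>\<omega>\<close>. The form \<open>df \<and> \<Theta>\<close> at \<open>p\<close> depends only on the restriction of \<open>\<Theta> p\<close> to
  \<open>ker df\<close>, and determines it.\<close>

definition canonical_volume_form ::
    "regularity \<Rightarrow> nat \<Rightarrow> (real^'d) dform \<Rightarrow> (real^'d) dform \<Rightarrow> bool" where
  "canonical_volume_form r n \<omega> \<Theta> \<longleftrightarrow> (\<exists>f \<Omega>. martinet_presentation r n \<omega> f \<Omega> \<and>
     (\<forall>\<^sub>F p in nhds 0. p \<in> martinet n \<omega> \<longrightarrow>
        alternating_form (2 * n - 1) (\<Theta> p) \<and>
        wedge 1 (2 * n - 1) (differential f p) (\<Theta> p) = \<Omega> p))"

definition same_canonical_orientation ::
    "regularity \<Rightarrow> nat \<Rightarrow> (real^'d) set \<Rightarrow> (real^'d) dform \<Rightarrow> (real^'d) dform \<Rightarrow> bool" where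
  "same_canonical_orientation r n S \<omega>\<^sub>0 \<omega>\<^sub>1 \<longleftrightarrow>
     (\<exists>\<Theta>\<^sub>0 \<Theta>\<^sub>1. canonical_volume_form r n \<omega>\<^sub>0 \<Theta>\<^sub>0 \<and> canonical_volume_form r n \<omega>\<^sub>1 \<Theta>\<^sub>1 \<and>
        same_orientation S \<Theta>\<^sub>0 \<Theta>\<^sub>1)"

end

theory Submission
  imports Defs "HOL-Complex_Analysis.Cauchy_Integral_Formula"
begin

text \<open>A map \<open>G\<close> with derivative \<open>id\<close> at \<open>0\<close> straightens the common Martinet hypersurface to a
  hyperplane \<open>T = ker q\<close>. There the two forms agree on \<open>T\<close>, so their difference is
  \<open>d (q \<cdot> \<beta>)\<close> by a Poincare lemma relative to \<open>T\<close>. All \<open>\<omega>\<^sub>t = (1 - t) \<omega>\<^sub>0 + t \<omega>\<^sub>1\<close> degenerate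
  along \<open>T\<close>; Moser's equation \<open>X \<rfloor> \<omega>\<^sub>t = - q \<beta>\<close> is nevertheless solvable
  with \<open>X = 0\<close> at \<open>0\<close> as soon as \<open>ker \<omega>\<^sub>t = K\<close> at \<open>0\<close> and the transversal
  derivative of \<open>\<omega>\<^sub>t\<close> on the plane \<open>K\<close> does not vanish for \<open>0 \<le> t \<le> 1\<close>. The orientation
  hypothesis says that the derivatives of \<open>\<omega>\<^sub>0\<^sup>n\<close> and \<open>\<omega>\<^sub>1\<^sup>n\<close> differ by a positive factor. If
  \<open>K\<close> is transversal to \<open>T\<close> this gives the sign condition directly; if \<open>K \<subseteq> T\<close> it gives it
  up to the reflection in \<open>T\<close>, which may be applied to \<open>\<omega>\<^sub>1\<close> first.\<close>

section \<open>Calculus of smooth maps\<close>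

text \<open>Along T the forms \<open>\<omega>\<^sub>t\<close> cannot be inverted, and near T their
  inverses grow like 1/q. An arbitrary primitive of
  \<open>\<omega>\<^sub>1 - \<omega>\<^sub>0\<close> would therefore give a singular field; the
  factor q of the relative primitive is what cancels the pole. For the flow to fix 0, \<beta> must
  vanish on K at 0, and it does because K is the kernel of both forms there. The regular field is
  obtained only near one point (t, 0) of time-space. Instead of controlling domains for 0 \<le> t
  \<le> 1, equivalence of two members of the family is treated as an equivalence relation on the
  unit interval with open classes, and connectedness gives the result. The reflection fixes T
  pointwise, so it keeps the restrictions to T, but it reverses the transversal derivative; it is
  admissible for K \<subseteq> T, since then it fixes K as well. The analytic case needs flows,
  quotients and parameter integrals that are again analytic. Each is produced by the smooth
  construction applied to a holomorphic extension, followed by a check that derivatives are complex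
  linear.\<close>

lemma Ck_on_cong:
  assumes "open S" "\<And>x. x \<in> S \<Longrightarrow> f x = g x"
  shows "Ck_on k S f \<longleftrightarrow> Ck_on k S g"
  using assms(2)
proof (induction k arbitrary: f g)
  case 0
  then show ?case using continuous_on_cong[OF refl, of S f g] by simp
next
  case (Suc k)
  have iff: "(f has_derivative D) (at x) \<longleftrightarrow> (g has_derivative D) (at x)" if "x \<in> S" for x D
    using has_derivative_transform_within_open[OF _ assms(1) that, of f D UNIV g]
      has_derivative_transform_within_open[OF _ assms(1) that, of g D UNIV f] Suc.prems by auto
  then have d: "frechet_derivative f (at x) = frechet_derivative g (at x)" if "x \<in> S" for x
    unfolding frechet_derivative_def using that by simp
  have "f differentiable (at x) \<longleftrightarrow> g differentiable (at x)" if "x \<in> S" for x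
    unfolding differentiable_def using iff that by simp
  moreover have "Ck_on k S (\<lambda>x. frechet_derivative f (at x) v) \<longleftrightarrow> Ck_on k S (\<lambda>x. frechet_derivative g (at x) v)" for v
    by (rule Suc.IH) (simp add: d)
  ultimately show ?case by simp
qed

lemma Ck_on_subset: "Ck_on k S f \<Longrightarrow> T \<subseteq> S \<Longrightarrow> Ck_on k T f"
  by (induction k arbitrary: f) (auto intro: continuous_on_subset)

text \<open>Only derivatives in a fixed direction enter \<open>Ck_on\<close>, so it suffices to
  exhibit some derivative \<open>f'\<close> and to control each \<open>f' x v\<close>. The closure
  proofs below are inductions on \<open>k\<close> in which the formula for the derivative is again
  built from functions of class \<open>k\<close>.\<close>

lemma Ck_on_SucI:
  assumes "open S" "\<And>x. x \<in> S \<Longrightarrow> (f has_derivative f' x) (at x)" "\<And>v. Ck_on k S (\<lambda>x. f' x v)"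
  shows "Ck_on (Suc k) S f"
proof -
  have "frechet_derivative f (at x) = f' x" if "x \<in> S" for x
    using assms(2)[OF that] frechet_derivative_at by metis
  then have "Ck_on k S (\<lambda>x. frechet_derivative f (at x) v)" for v
    using Ck_on_cong[OF assms(1), of "\<lambda>x. frechet_derivative f (at x) v" "\<lambda>x. f' x v"] assms(3) by simp
  then show ?thesis using assms(2) by (auto simp: differentiable_def)
qed

lemma Ck_on_SucD:
  assumes "Ck_on (Suc k) S f"
  shows "\<And>x. x \<in> S \<Longrightarrow> (f has_derivative frechet_derivative f (at x)) (at x)"
    and "\<And>v. Ck_on k S (\<lambda>x. frechet_derivative f (at x) v)"
  using assms by (auto simp: frechet_derivative_works)

lemma Ck_on_continuous: "Ck_on k S f \<Longrightarrow> continuous_on S f"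
  by (cases k) (auto intro!: continuous_at_imp_continuous_on differentiable_imp_continuous_within)

lemma Ck_on_Suc_imp: "Ck_on (Suc k) S f \<Longrightarrow> Ck_on k S f"
proof (induction k arbitrary: f)
  case 0
  then show ?case using Ck_on_continuous by (simp del: Ck_on.simps(2))
next
  case (Suc k)
  then show ?case by (simp del: Ck_on.simps(2) add: Ck_on.simps(2)[of "Suc k"] Ck_on.simps(2)[of k S f])
qed

lemma Ck_on_open_local:
  assumes "\<And>x. x \<in> S \<Longrightarrow> \<exists>T. open T \<and> x \<in> T \<and> Ck_on k T f" 
  shows "Ck_on k S f"
  using assms
proof (induction k arbitrary: f)
  case 0
  then show ?case
    by (auto intro!: continuous_at_imp_continuous_on simp: continuous_on_eq_continuous_at) (metis continuous_on_eq_continuous_at)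
next
  case (Suc k)
  show ?case
    unfolding Ck_on.simps
  proof (intro conjI ballI allI)
    show "f differentiable (at x)" if "x \<in> S" for x
      using Suc.prems[OF that] by auto
    show "Ck_on k S (\<lambda>x. frechet_derivative f (at x) v)" for v
    proof (rule Suc.IH)
      fix x assume "x \<in> S"
      from Suc.prems[OF this] obtain T where "open T" "x \<in> T" "Ck_on (Suc k) T f" by blast
      then show "\<exists>T. open T \<and> x \<in> T \<and> Ck_on k T (\<lambda>x. frechet_derivative f (at x) v)"
        by auto
    qed
  qed
qed

lemma Ck_on_const [simp]: "open S \<Longrightarrow> Ck_on k S (\<lambda>x. c)"
proof (induction k arbitrary: c)
  case (Suc k)
  show ?case
    by (rule Ck_on_SucI[where f'="\<lambda>x v. 0"]) (use Suc in \<open>auto intro: derivative_eq_intros\<close>)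
qed simp

lemma Ck_on_bounded_linear:
  assumes "open S" "bounded_linear h"
  shows "Ck_on k S h"
proof (cases k)
  case (Suc m)
  then show ?thesis
    using assms by (auto intro!: Ck_on_SucI[where f'="\<lambda>x. h"] bounded_linear_imp_has_derivative simp del: Ck_on.simps(2))
qed (use assms in \<open>auto intro: linear_continuous_on\<close>)

lemma Ck_on_bounded_linear_comp:
  assumes "open S" "bounded_linear h" "Ck_on k S f"
  shows "Ck_on k S (\<lambda>x. h (f x))"
  using assms(3)
proof (induction k arbitrary: f)
  case 0
  then show ?case
    by (simp add: bounded_linear.continuous_on[OF assms(2)])
next
  case (Suc k)
  note D = Ck_on_SucD[OF Suc.prems]
  show ?case
  proof (rule Ck_on_SucI[OF assms(1)])
    show "((\<lambda>x. h (f x)) has_derivative (\<lambda>v. h (frechet_derivative f (at x) v))) (at x)" if "x \<in> S" for x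
      using bounded_linear.has_derivative[OF assms(2) D(1)[OF that]] .
    show "Ck_on k S (\<lambda>x. h (frechet_derivative f (at x) v))" for v
      by (rule Suc.IH[OF D(2)])
  qed
qed

lemma Ck_on_add:
  assumes "open S" "Ck_on k S f" "Ck_on k S g"
  shows "Ck_on k S (\<lambda>x. f x + g x)"
  using assms(2,3)
proof (induction k arbitrary: f g)
  case 0
  then show ?case by (simp add: continuous_on_add)
next
  case (Suc k)
  note F = Ck_on_SucD[OF Suc.prems(1)] and G = Ck_on_SucD[OF Suc.prems(2)]
  show ?case
    by (rule Ck_on_SucI[OF assms(1)]) (auto intro!: derivative_intros F G Suc.IH)
qed

lemma Ck_on_sum:
  assumes "open S" "\<And>i. i \<in> I \<Longrightarrow> Ck_on k S (f i)"
  shows "Ck_on k S (\<lambda>x. \<Sum>i\<in>I. f i x)"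
  using assms(2)
proof (induction I rule: infinite_finite_induct)
  case (insert i I)
  then have "Ck_on k S (\<lambda>x. f i x + (\<Sum>i\<in>I. f i x))"
    by (intro Ck_on_add[OF assms(1)]) auto
  with insert show ?case by simp
qed (use assms(1) in simp_all)

lemma Ck_on_bilinear:
  assumes "open S" "bounded_bilinear h" "Ck_on k S f" "Ck_on k S g"
  shows "Ck_on k S (\<lambda>x. h (f x) (g x))"
  using assms(3,4)
proof (induction k arbitrary: f g)
  case 0
  then show ?case by (simp add: bounded_bilinear.continuous_on[OF assms(2)])
next
  case (Suc k)
  note F = Ck_on_SucD[OF Suc.prems(1)] and G = Ck_on_SucD[OF Suc.prems(2)]
  show ?case
  proof (rule Ck_on_SucI[OF assms(1)])
    show "((\<lambda>x. h (f x) (g x)) has_derivative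
        (\<lambda>v. h (f x) (frechet_derivative g (at x) v) + h (frechet_derivative f (at x) v) (g x))) (at x)" if "x \<in> S" for x
      using bounded_bilinear.FDERIV[OF assms(2) F(1)[OF that] G(1)[OF that]] .
    show "Ck_on k S (\<lambda>x. h (f x) (frechet_derivative g (at x) v) + h (frechet_derivative f (at x) v) (g x))" for v
      by (intro Ck_on_add assms(1) Suc.IH F(2) G(2) Ck_on_Suc_imp[OF Suc.prems(1)] Ck_on_Suc_imp[OF Suc.prems(2)])
  qed
qed

lemma Ck_on_inverse:
  fixes f :: "'a::real_normed_vector \<Rightarrow> 'b::real_normed_field"
  assumes "open S" "Ck_on k S f" "\<And>x. x \<in> S \<Longrightarrow> f x \<noteq> 0"
  shows "Ck_on k S (\<lambda>x. inverse (f x))"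
  using assms(2)
proof (induction k)
  case 0
  then show ?case using assms(3) by (simp add: continuous_on_inverse)
next
  case (Suc k)
  note F = Ck_on_SucD[OF Suc.prems] and IH = Suc.IH[OF Ck_on_Suc_imp[OF Suc.prems]]
  note M = Ck_on_bilinear[OF assms(1) bounded_bilinear_mult]
  show ?case
  proof (rule Ck_on_SucI[OF assms(1)])
    show "((\<lambda>x. inverse (f x)) has_derivative
       (\<lambda>v. (- 1) * (inverse (f x) * frechet_derivative f (at x) v * inverse (f x)))) (at x)" if "x \<in> S" for x
      using Deriv.has_derivative_inverse[OF assms(3) F(1)] that by simp
    show "Ck_on k S (\<lambda>x. (- 1) * (inverse (f x) * frechet_derivative f (at x) v * inverse (f x)))" for v
      by (intro M F(2) IH Ck_on_const assms(1))
  qed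
qed

lemma Ck_on_componentwise:
  fixes f :: "'a::real_normed_vector \<Rightarrow> 'b::euclidean_space"
  assumes "open S" "\<And>b. b \<in> Basis \<Longrightarrow> Ck_on k S (\<lambda>x. f x \<bullet> b)"
  shows "Ck_on k S f"
proof -
  have "Ck_on k S (\<lambda>x. \<Sum>b\<in>Basis. (f x \<bullet> b) *\<^sub>R b)"
    by (rule Ck_on_sum[OF assms(1)], rule Ck_on_bounded_linear_comp[OF assms(1) bounded_linear_scaleR_left], rule assms(2))
  then show ?thesis by (simp add: euclidean_representation)
qed

text \<open>\<open>Ck_on\<close> says nothing about a derivative evaluated in a direction that
  varies with the point. The expansion over \<open>Basis\<close> turns such a value into a finite
  sum of products involving fixed directions only; the chain rule and the superposition operators
  rest on it.\<close>

lemma frechet_derivative_sum_Basis: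
  fixes g :: "'b::euclidean_space \<Rightarrow> 'c::real_normed_vector"
  assumes "(g has_derivative g') F"
  shows "g' v = (\<Sum>b\<in>Basis. (v \<bullet> b) *\<^sub>R g' b)"
proof -
  interpret bounded_linear g' using assms by (rule has_derivative_bounded_linear)
  have "g' (\<Sum>b\<in>Basis. (v \<bullet> b) *\<^sub>R b) = (\<Sum>b\<in>Basis. (v \<bullet> b) *\<^sub>R g' b)"
    unfolding sum scaleR ..
  then show ?thesis unfolding euclidean_representation .
qed

text \<open>The intermediate space is Euclidean so that the chain rule becomes a finite sum over
  \<open>Basis\<close>. Each summand multiplies a coordinate of the derivative of \<open>f\<close>
  by a partial derivative of \<open>g\<close> along \<open>f\<close>, and the latter is covered by
  the induction hypothesis.\<close>

lemma Ck_on_compose: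
  fixes f :: "'a::real_normed_vector \<Rightarrow> 'b::euclidean_space" and g :: "'b \<Rightarrow> 'c::real_normed_vector"
  assumes "open S" "Ck_on k S f" "Ck_on k T g" "f ` S \<subseteq> T"
  shows "Ck_on k S (\<lambda>x. g (f x))"
  using assms(2,3)
proof (induction k arbitrary: g)
  case 0
  then show ?case using assms(4) by (auto intro: continuous_on_compose2)
next
  case (Suc k)
  note F = Ck_on_SucD[OF Suc.prems(1)] and G = Ck_on_SucD[OF Suc.prems(2)]
  let ?D = "\<lambda>x v. \<Sum>b\<in>Basis. (frechet_derivative f (at x) v \<bullet> b) *\<^sub>R frechet_derivative g (at (f x)) b"
  show ?case
  proof (rule Ck_on_SucI[OF assms(1)])
    show "((\<lambda>x. g (f x)) has_derivative ?D x) (at x)" if "x \<in> S" for x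
    proof -
      have g: "(g has_derivative frechet_derivative g (at (f x))) (at (f x))"
        using that assms(4) by (intro G) auto
      have "?D x = frechet_derivative g (at (f x)) \<circ> frechet_derivative f (at x)"
        unfolding o_def by (rule ext) (rule frechet_derivative_sum_Basis[OF g, symmetric])
      then show ?thesis
        using diff_chain_at[OF F(1)[OF that] g] by (simp add: o_def)
    qed
    show "Ck_on k S (\<lambda>x. ?D x v)" for v
    proof (intro Ck_on_sum assms(1) Ck_on_bilinear[OF _ bounded_bilinear_scaleR])
      fix b :: 'b
      show "Ck_on k S (\<lambda>x. frechet_derivative f (at x) v \<bullet> b)"
        by (rule Ck_on_bounded_linear_comp[OF assms(1) bounded_linear_inner_left F(2)])
      show "Ck_on k S (\<lambda>x. frechet_derivative g (at (f x)) b)"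
        by (rule Suc.IH[OF Ck_on_Suc_imp[OF Suc.prems(1)] G(2)])
    qed
  qed
qed

lemma smooth_on_cong: "open S \<Longrightarrow> (\<And>x. x \<in> S \<Longrightarrow> f x = g x) \<Longrightarrow> smooth_on S f \<longleftrightarrow> smooth_on S g"
  unfolding smooth_on_def using Ck_on_cong[of S f g] by simp

lemma smooth_on_subset: "smooth_on S f \<Longrightarrow> T \<subseteq> S \<Longrightarrow> smooth_on T f"
  unfolding smooth_on_def using Ck_on_subset by blast

lemma smooth_on_differentiable: "smooth_on S f \<Longrightarrow> x \<in> S \<Longrightarrow> f differentiable (at x)"
  unfolding smooth_on_def using Ck_on.simps(2)[of 0 S f] by blast

lemma smooth_on_has_derivative:
  "smooth_on S f \<Longrightarrow> x \<in> S \<Longrightarrow> (f has_derivative frechet_derivative f (at x)) (at x)"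
  using smooth_on_differentiable frechet_derivative_works by blast

lemma smooth_on_frechet_derivative: "smooth_on S f \<Longrightarrow> smooth_on S (\<lambda>x. frechet_derivative f (at x) v)"
  unfolding smooth_on_def using Ck_on_SucD(2) by blast

lemma smooth_on_continuous: "smooth_on S f \<Longrightarrow> continuous_on S f"
  unfolding smooth_on_def using Ck_on_continuous by blast

lemma smooth_on_const: "open S \<Longrightarrow> smooth_on S (\<lambda>x. c)"
  unfolding smooth_on_def by simp

lemma smooth_on_bounded_linear: "open S \<Longrightarrow> bounded_linear h \<Longrightarrow> smooth_on S h"
  unfolding smooth_on_def by (simp add: Ck_on_bounded_linear)

lemma smooth_on_bounded_linear_comp: "open S \<Longrightarrow> bounded_linear h \<Longrightarrow> smooth_on S f \<Longrightarrow> smooth_on S (\<lambda>x. h (f x))"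
  unfolding smooth_on_def by (simp add: Ck_on_bounded_linear_comp)

lemma smooth_on_add: "open S \<Longrightarrow> smooth_on S f \<Longrightarrow> smooth_on S g \<Longrightarrow> smooth_on S (\<lambda>x. f x + g x)"
  unfolding smooth_on_def by (simp add: Ck_on_add)

lemma smooth_on_bilinear:
  "open S \<Longrightarrow> bounded_bilinear h \<Longrightarrow> smooth_on S f \<Longrightarrow> smooth_on S g \<Longrightarrow> smooth_on S (\<lambda>x. h (f x) (g x))"
  unfolding smooth_on_def by (simp add: Ck_on_bilinear)

lemma smooth_on_inverse:
  fixes f :: "'a::real_normed_vector \<Rightarrow> 'b::real_normed_field"
  shows "open S \<Longrightarrow> smooth_on S f \<Longrightarrow> (\<And>x. x \<in> S \<Longrightarrow> f x \<noteq> 0) \<Longrightarrow> smooth_on S (\<lambda>x. inverse (f x))"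
  unfolding smooth_on_def by (simp add: Ck_on_inverse)

lemma smooth_on_componentwise:
  fixes f :: "'a::real_normed_vector \<Rightarrow> 'b::euclidean_space"
  shows "open S \<Longrightarrow> (\<And>b. b \<in> Basis \<Longrightarrow> smooth_on S (\<lambda>x. f x \<bullet> b)) \<Longrightarrow> smooth_on S f"
  unfolding smooth_on_def by (simp add: Ck_on_componentwise)

lemma smooth_on_compose:
  fixes f :: "'a::real_normed_vector \<Rightarrow> 'b::euclidean_space" and g :: "'b \<Rightarrow> 'c::real_normed_vector"
  shows "open S \<Longrightarrow> smooth_on S f \<Longrightarrow> smooth_on T g \<Longrightarrow> f ` S \<subseteq> T \<Longrightarrow> smooth_on S (\<lambda>x. g (f x))"
  unfolding smooth_on_def by (intro allI Ck_on_compose[of S _ f T g]) simp_all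

lemma smooth_on_open_local:
  assumes "\<And>x. x \<in> S \<Longrightarrow> \<exists>T. open T \<and> x \<in> T \<and> smooth_on T f"
  shows "smooth_on S f"
  unfolding smooth_on_def
proof
  fix k
  show "Ck_on k S f"
  proof (rule Ck_on_open_local)
    fix x assume "x \<in> S"
    from assms[OF this] show "\<exists>T. open T \<and> x \<in> T \<and> Ck_on k T f"
      unfolding smooth_on_def by blast
  qed
qed

section \<open>Flows of smooth vector fields\<close>

text \<open>The solution of \<open>y = T y + x\<close> is the fixed point of a contraction with
  constant 1/2, which also gives the norm bound 2. Uniqueness is part of the statement because it
  identifies any solution of a linearised equation with the resolvent.\<close>

lemma resolvent_exists:
  fixes T :: "'b::banach \<Rightarrow>\<^sub>L 'b"
  assumes "norm T \<le> 1/2"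
  shows "\<exists>R :: 'b \<Rightarrow>\<^sub>L 'b. norm R \<le> 2 \<and> (\<forall>x. blinfun_apply R x = T (blinfun_apply R x) + x) \<and> (\<forall>x y. y = T y + x \<longrightarrow> y = blinfun_apply R x)"
proof -
  have T: "norm (T x) \<le> norm x / 2" for x
    using norm_blinfun[of T x] mult_right_mono[OF assms norm_ge_zero[of x]] by simp
  have "\<exists>!y. T y + x = y" for x
    by (rule banach_fix_type[where c="1/2"]) (use T in \<open>auto simp: dist_norm simp flip: blinfun.diff_right\<close>)
  then obtain f where f: "T (f x) + x = f x" and uniq: "T y + x = y \<Longrightarrow> y = f x" for x y
    by metis
  have bound: "norm (f x) \<le> norm x * 2" for x
    using f[of x] T[of "f x"] norm_triangle_ineq[of "T (f x)" x] by simp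
  have "bounded_linear f"
  proof (rule bounded_linear_intro[OF _ _ bound])
    show "f (x + y) = f x + f y" for x y
    proof (rule uniq[symmetric])
      have "T (f x + f y) + (x + y) = (T (f x) + x) + (T (f y) + y)"
        by (simp add: blinfun.add_right)
      then show "T (f x + f y) + (x + y) = f x + f y" by (simp only: f)
    qed
    show "f (c *\<^sub>R x) = c *\<^sub>R f x" for c x
      by (rule uniq[symmetric]) (use f[of x] in \<open>simp add: blinfun.scaleR_right flip: scaleR_add_right\<close>)
  qed
  then have app: "blinfun_apply (Blinfun f) = f" by (rule bounded_linear_Blinfun_apply)
  show ?thesis
  proof (intro exI conjI allI impI)
    show "norm (Blinfun f) \<le> 2"
      by (rule norm_blinfun_bound) (use bound in \<open>simp_all add: app mult.commute\<close>)
    show "Blinfun f x = T (Blinfun f x) + x" for x using f[of x] by (simp add: app)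
    show "y = Blinfun f x" if "y = T y + x" for x y using uniq[of y x] that by (simp add: app)
  qed
qed

definition resolvent :: "('b::banach \<Rightarrow>\<^sub>L 'b) \<Rightarrow> ('b \<Rightarrow>\<^sub>L 'b)" where
  "resolvent T = (SOME R. norm R \<le> 2 \<and> (\<forall>x. blinfun_apply R x = T (blinfun_apply R x) + x) \<and> (\<forall>x y. y = T y + x \<longrightarrow> y = blinfun_apply R x))"

lemma resolvent:
  assumes "norm T \<le> 1/2"
  shows norm_resolvent: "norm (resolvent T) \<le> 2" 
    and resolvent_eq: "resolvent T x = T (resolvent T x) + x"
    and resolvent_unique: "y = T y + x \<Longrightarrow> y = resolvent T x"
  using someI_ex[OF resolvent_exists[OF assms]] unfolding resolvent_def[symmetric] by blast+

text \<open>The resolvent identity. It expresses a difference of inverses through the difference of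
  the operators and yields both the derivative and the estimate of the remainder.\<close>

lemma resolvent_diff:
  assumes "norm S \<le> 1/2" "norm T \<le> 1/2"
  shows "resolvent S - resolvent T = resolvent S o\<^sub>L (S - T) o\<^sub>L resolvent T"
proof (rule blinfun_eqI)
  fix x
  let ?y = "resolvent S x - resolvent T x"
  have "S (resolvent S x) = resolvent S x - x" "T (resolvent T x) = resolvent T x - x"
    using resolvent_eq[OF assms(1), of x] resolvent_eq[OF assms(2), of x] by (metis add_diff_cancel_right')+
  then have "?y = S ?y + (S - T) (resolvent T x)"
    by (simp add: blinfun.diff_left blinfun.diff_right)
  from resolvent_unique[OF assms(1) this]
  show "(resolvent S - resolvent T) x = (resolvent S o\<^sub>L (S - T) o\<^sub>L resolvent T) x"
    by (simp add: blinfun.diff_left)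
qed

lemma norm_blinfun_compose3: "norm (A o\<^sub>L B o\<^sub>L C) \<le> norm A * norm B * norm C"
  by (meson norm_blinfun_compose mult_right_mono norm_ge_zero order_trans)

text \<open>Using the resolvent identity twice leaves a remainder with \<open>S - T\<close>
  occurring twice as a factor, hence of second order; the constant 8 collects three norms bounded by
  2. The derivative is taken within the closed ball, where these bounds are available.\<close>

lemma has_derivative_resolvent:
  assumes "norm T \<le> 1/2"
  shows "(resolvent has_derivative (\<lambda>H. resolvent T o\<^sub>L H o\<^sub>L resolvent T)) (at T within {S. norm S \<le> 1/2})"
proof (rule has_derivativeI_sandwich[where e=1 and H="\<lambda>S. 8 * norm (S - T)"])
  show "bounded_linear (\<lambda>H. resolvent T o\<^sub>L H o\<^sub>L resolvent T)"
    by (auto intro!: bounded_linear_intros)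
  have "((\<lambda>S. 8 * norm (S - T)) \<longlongrightarrow> 8 * norm (T - T)) (at T within {S. norm S \<le> 1/2})"
    by (intro tendsto_intros)
  then show "((\<lambda>S. 8 * norm (S - T)) \<longlongrightarrow> 0) (at T within {S. norm S \<le> 1/2})" by simp
  fix S assume S: "S \<in> {S. norm S \<le> 1/2}" "S \<noteq> T"
  then have S2: "norm S \<le> 1/2" by simp
  let ?d = "S - T" and ?R = "resolvent T"
  note nS = norm_resolvent[OF S2] and nT = norm_resolvent[OF assms]
  have "resolvent S - ?R - (?R o\<^sub>L ?d o\<^sub>L ?R) = (resolvent S - ?R) o\<^sub>L ?d o\<^sub>L ?R"
  proof -
    have "resolvent S - ?R - (?R o\<^sub>L ?d o\<^sub>L ?R) = (resolvent S o\<^sub>L ?d o\<^sub>L ?R) - (?R o\<^sub>L ?d o\<^sub>L ?R)"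
      by (simp add: resolvent_diff[OF S2 assms])
    also have "\<dots> = (resolvent S - ?R) o\<^sub>L ?d o\<^sub>L ?R"
      by (rule blinfun_eqI) (simp add: blinfun.diff_left)
    finally show ?thesis .
  qed
  then have "norm (resolvent S - ?R - (?R o\<^sub>L ?d o\<^sub>L ?R)) \<le> norm (resolvent S - ?R) * norm ?d * norm ?R"
    by (simp add: norm_blinfun_compose3)
  also have "\<dots> \<le> (4 * norm ?d) * norm ?d * 2"
  proof -
    have "norm (resolvent S - ?R) \<le> norm (resolvent S) * norm ?d * norm ?R"
      unfolding resolvent_diff[OF S2 assms] by (rule norm_blinfun_compose3)
    also have "\<dots> \<le> 2 * norm ?d * 2"
      by (intro mult_mono nS nT) auto
    finally show ?thesis by (intro mult_mono nT) auto
  qed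
  finally show "norm (resolvent S - ?R - (?R o\<^sub>L ?d o\<^sub>L ?R)) / norm ?d \<le> 8 * norm ?d"
    using S by (simp add: divide_simps)
qed simp

text \<open>The derivative is a product of resolvents and the derivative of \<open>T\<close>, so
  each order of differentiability of \<open>T\<close> is inherited. Since \<open>S\<close> is open,
  the derivative within the ball becomes a full derivative in \<open>x\<close>.\<close>

lemma Ck_on_resolvent:
  fixes T :: "'a::real_normed_vector \<Rightarrow> ('b::banach \<Rightarrow>\<^sub>L 'b)"
  assumes "open S" "Ck_on k S T" "\<And>x. x \<in> S \<Longrightarrow> norm (T x) \<le> 1/2"
  shows "Ck_on k S (\<lambda>x. resolvent (T x))"
  using assms(2)
proof (induction k)
  case 0
  have "continuous_on {T :: 'b \<Rightarrow>\<^sub>L 'b. norm T \<le> 1/2} resolvent"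
    unfolding continuous_on_eq_continuous_within
    using has_derivative_continuous[OF has_derivative_resolvent] by blast
  then have "continuous_on S (\<lambda>x. resolvent (T x))"
    by (rule continuous_on_compose2) (use 0 assms(3) in auto)
  then show ?case by simp
next
  case (Suc k)
  note F = Ck_on_SucD[OF Suc.prems] and IH = Suc.IH[OF Ck_on_Suc_imp[OF Suc.prems]]
  note M = Ck_on_bilinear[OF assms(1) bounded_bilinear_blinfun_compose]
  show ?case
  proof (rule Ck_on_SucI[OF assms(1)])
    fix x assume x: "x \<in> S"
    have "((\<lambda>x. resolvent (T x)) has_derivative
       (\<lambda>v. resolvent (T x) o\<^sub>L frechet_derivative T (at x) v o\<^sub>L resolvent (T x))) (at x within S)"
      by (rule has_derivative_in_compose2[OF has_derivative_resolvent _ x has_derivative_at_withinI[OF F(1)[OF x]]])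
        (use assms(3) in auto)
    then show "((\<lambda>x. resolvent (T x)) has_derivative
       (\<lambda>v. resolvent (T x) o\<^sub>L frechet_derivative T (at x) v o\<^sub>L resolvent (T x))) (at x)"
      using at_within_open[OF x assms(1)] by simp
  next
    show "Ck_on k S (\<lambda>x. resolvent (T x) o\<^sub>L frechet_derivative T (at x) v o\<^sub>L resolvent (T x))" for v
      by (intro M F(2) IH)
  qed
qed

section \<open>Antiderivatives as bounded operators on paths\<close>

text \<open>Paths are bounded continuous functions on all of \<open>real\<close>; they are made constant outside \<open>[-d, d]\<close>.\<close>

definition clamp1 :: "real \<Rightarrow> real \<Rightarrow> real" where "clamp1 d t = max (-d) (min d t)"

lemma clamp1_bounds: "0 \<le> d \<Longrightarrow> - d \<le> clamp1 d t" "0 \<le> d \<Longrightarrow> clamp1 d t \<le> d"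
  by (auto simp: clamp1_def)

text \<open>Both integrals start at \<open>-d\<close>; their difference is the antiderivative
  vanishing at \<open>0\<close> for either sign of \<open>t\<close>, whereas an integral over
  \<open>{0..t}\<close> would be \<open>0\<close> for negative \<open>t\<close>.\<close>

definition prim_fun :: "real \<Rightarrow> (real \<Rightarrow>\<^sub>C 'a::euclidean_space) \<Rightarrow> real \<Rightarrow> 'a" where
  "prim_fun d w t = integral {-d..clamp1 d t} w - integral {-d..0} w"

lemma norm_integral_bcontfun_le:
  fixes w :: "real \<Rightarrow>\<^sub>C 'a::euclidean_space"
  assumes "a \<le> b"
  shows "norm (integral {a..b} w) \<le> norm w * (b - a)"
  using integral_bound[of a b w "norm w"] assms norm_bounded[of w] by auto

text \<open>The factor 3 adds the lengths of the two intervals of integration, at most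
  \<open>2 * d\<close> and \<open>d\<close>. It returns in the smallness conditions imposed on
  \<open>d\<close> for flows.\<close>

lemma prim_fun_bound: "0 < d \<Longrightarrow> norm (prim_fun d w t) \<le> norm w * (3 * d)"
proof -
  assume d: "0 < d"
  have "norm (prim_fun d w t) \<le> norm (integral {-d..clamp1 d t} w) + norm (integral {-d..0} w)"
    unfolding prim_fun_def by (rule norm_triangle_ineq4)
  also have "\<dots> \<le> norm w * (clamp1 d t - (-d)) + norm w * (0 - (-d))"
    by (intro add_mono norm_integral_bcontfun_le clamp1_bounds) (use d in auto)
  also have "\<dots> \<le> norm w * (2 * d) + norm w * d"
    using clamp1_bounds[of d t] d by (intro add_mono mult_left_mono) auto
  finally show ?thesis by (simp add: algebra_simps)
qed

lemma prim_fun_bcontfun: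
  assumes d: "0 < d"
  shows "prim_fun d w \<in> bcontfun"
proof (rule bcontfun_normI)
  show "norm (prim_fun d w t) \<le> norm w * (3 * d)" for t by (rule prim_fun_bound[OF d])
  have "continuous_on {-d..d} (\<lambda>x. integral {-d..x} w)"
    by (intro indefinite_integral_continuous_1 integrable_continuous_real) auto
  then have "continuous_on UNIV (\<lambda>t. integral {-d..clamp1 d t} w)"
    by (rule continuous_on_compose2) (use d in \<open>auto simp: clamp1_def intro!: continuous_intros\<close>)
  then show "continuous_on UNIV (prim_fun d w)"
    unfolding prim_fun_def[abs_def] by (intro continuous_intros)
qed

definition prim :: "real \<Rightarrow> (real \<Rightarrow>\<^sub>C 'a::euclidean_space) \<Rightarrow> (real \<Rightarrow>\<^sub>C 'a)" where
  "prim d w = Bcontfun (prim_fun d w)"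

lemma prim_apply: "0 < d \<Longrightarrow> prim d w t = integral {-d..clamp1 d t} w - integral {-d..0} w"
  unfolding prim_def by (simp add: Bcontfun_inverse prim_fun_bcontfun) (simp add: prim_fun_def)

lemma norm_prim: "0 < d \<Longrightarrow> norm (prim d w) \<le> norm w * (3 * d)"
  by (rule norm_bound) (simp add: prim_def Bcontfun_inverse prim_fun_bcontfun prim_fun_bound)

lemma bounded_linear_prim:
  assumes d: "0 < d" shows "bounded_linear (prim d :: (real \<Rightarrow>\<^sub>C 'a::euclidean_space) \<Rightarrow> _)"
proof (rule bounded_linear_intro)
  have int: "(apply_bcontfun v) integrable_on {a..b}" for v :: "real \<Rightarrow>\<^sub>C 'a" and a b
    by (intro integrable_continuous_real) auto
  have add: "integral {a..b} (\<lambda>x. v x + w x) = integral {a..b} v + integral {a..b} w" for v w :: "real \<Rightarrow>\<^sub>C 'a" and a b :: real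
    by (rule Henstock_Kurzweil_Integration.integral_add[OF int int])
  show "prim d (v + w) = prim d v + prim d w" for v w :: "real \<Rightarrow>\<^sub>C 'a"
    by (rule bcontfun_eqI) (simp add: prim_apply[OF d] add)
  show "prim d (c *\<^sub>R v) = c *\<^sub>R prim d v" for c and v :: "real \<Rightarrow>\<^sub>C 'a"
    by (rule bcontfun_eqI) (simp add: prim_apply[OF d] algebra_simps)
qed (rule norm_prim[OF d])

lemma prim_0: "0 < d \<Longrightarrow> prim d w 0 = 0"
  by (simp add: prim_apply clamp1_def)

lemma prim_has_vector_derivative:
  assumes d: "\<bar>t\<bar> < d"
  shows "((prim d w) has_vector_derivative w t) (at t)"
proof -
  have d0: "0 < d" using d by simp
  have "((\<lambda>u. integral {-d..u} w) has_vector_derivative w t) (at t within {-d..d})"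
    by (rule integral_has_vector_derivative) (use d in auto)
  then have "((\<lambda>u. integral {-d..u} w) has_vector_derivative w t) (at t within {-d<..<d})"
    by (rule has_vector_derivative_within_subset) auto
  then have "((\<lambda>u. integral {-d..u} w) has_vector_derivative w t) (at t)"
    using d by (subst (asm) at_within_open) auto
  then have "((\<lambda>u. integral {-d..u} w - integral {-d..0} w) has_vector_derivative w t - 0) (at t)"
    by (intro derivative_intros)
  then show ?thesis
    unfolding diff_0_right
    by (rule has_vector_derivative_transform_within_open[OF _ open_greaterThanLessThan[of "-d" d]])
      (use d in \<open>auto simp: prim_apply clamp1_def\<close>)
qed

section \<open>Superposition operators on the space of paths\<close>

definition ptscale :: "'a \<Rightarrow> (real \<Rightarrow>\<^sub>C 'a::euclidean_space) \<Rightarrow> (real \<Rightarrow>\<^sub>C 'a) \<Rightarrow> (real \<Rightarrow>\<^sub>C 'a)" where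
  "ptscale e w h = Bcontfun (\<lambda>t. (h t \<bullet> e) *\<^sub>R w t)"

lemma ptscale_bcontfun:
  fixes h w :: "real \<Rightarrow>\<^sub>C 'a::euclidean_space"
  shows "(\<lambda>t. (apply_bcontfun h t \<bullet> e) *\<^sub>R apply_bcontfun w t) \<in> bcontfun"
proof (rule bcontfun_normI)
  show "continuous_on UNIV (\<lambda>t. (apply_bcontfun h t \<bullet> e) *\<^sub>R apply_bcontfun w t)"
    by (intro continuous_intros) auto
  show "norm ((h t \<bullet> e) *\<^sub>R w t) \<le> (norm h * norm e) * norm w" for t
    using norm_bounded[of h t] norm_bounded[of w t] Cauchy_Schwarz_ineq2[of "h t" e]
    by (auto intro!: mult_mono intro: order_trans mult_right_mono)
qed

lemma ptscale_apply: "ptscale e w h t = (h t \<bullet> e) *\<^sub>R w t"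
  unfolding ptscale_def by (simp add: Bcontfun_inverse ptscale_bcontfun)

lemma bounded_bilinear_ptscale: "bounded_bilinear (ptscale e)"
proof
  show "\<exists>K. \<forall>a b. norm (ptscale e a b) \<le> norm a * norm b * K"
  proof (intro exI allI)
    fix a b :: "real \<Rightarrow>\<^sub>C 'a"
    show "norm (ptscale e a b) \<le> norm a * norm b * norm e"
    proof (rule norm_bound)
      fix t
      have "norm (ptscale e a b t) \<le> (norm (b t) * norm e) * norm (a t)"
        using Cauchy_Schwarz_ineq2[of "b t" e] by (auto simp: ptscale_apply intro!: mult_right_mono)
      also have "\<dots> \<le> (norm b * norm e) * norm a"
        by (intro mult_mono norm_bounded) auto
      finally show "norm (ptscale e a b t) \<le> norm a * norm b * norm e" by (simp add: ac_simps)
    qed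
  qed
qed (rule bcontfun_eqI; simp add: ptscale_apply algebra_simps)+

text \<open>Multiplication by \<open>w\<close>, as an operator, is itself bounded linear in
  \<open>w\<close>. This transfers smooth dependence from the path of a partial derivative to the
  operator built from it.\<close>

lemma bounded_linear_Blinfun_ptscale: "bounded_linear (\<lambda>w. Blinfun (ptscale e w))"
  and blinfun_apply_ptscale: "blinfun_apply (Blinfun (ptscale e w)) = ptscale e w"
proof -
  interpret bounded_bilinear "ptscale e" by (rule bounded_bilinear_ptscale)
  have app: "blinfun_apply (Blinfun (ptscale e w)) = ptscale e w" for w
    by (rule bounded_linear_Blinfun_apply[OF bounded_linear_right])
  then show "blinfun_apply (Blinfun (ptscale e w)) = ptscale e w" .
  obtain K where K: "norm (ptscale e a b) \<le> norm a * norm b * K" "0 < K" for a b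
    using pos_bounded by blast
  show "bounded_linear (\<lambda>w. Blinfun (ptscale e w))"
  proof (rule bounded_linear_intro)
    show "norm (Blinfun (ptscale e w)) \<le> norm w * K" for w
      by (rule norm_blinfun_bound) (use K(1)[of w] K(2) in \<open>auto simp: app ac_simps\<close>)
  qed (rule blinfun_eqI; simp add: app add_left scaleR_left blinfun.add_left blinfun.scaleR_left)+
qed

text \<open>The projection onto the ball makes the superposition operator total without changing it on paths
  that stay in the ball.\<close>

definition nem :: "'a \<Rightarrow> real \<Rightarrow> ('a \<Rightarrow> 'a) \<Rightarrow> (real \<Rightarrow>\<^sub>C 'a) \<Rightarrow> (real \<Rightarrow>\<^sub>C 'a::euclidean_space)" where
  "nem p R g \<gamma> = Bcontfun (\<lambda>t. g (closest_point (cball p R) (\<gamma> t)))"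

lemma nem_apply:
  assumes "continuous_on (cball p R) g" "0 \<le> R"
  shows "nem p R g \<gamma> t = g (closest_point (cball p R) (\<gamma> t))"
proof -
  have ne: "cball p R \<noteq> {}" using assms(2) by auto
  have "continuous_on UNIV (\<lambda>t. closest_point (cball p R) (\<gamma> t))"
    by (rule continuous_on_compose2[OF continuous_on_closest_point[OF convex_cball closed_cball ne]]) auto
  then have "continuous_on UNIV (\<lambda>t. g (closest_point (cball p R) (\<gamma> t)))"
    by (rule continuous_on_compose2[OF assms(1)]) (use closest_point_in_set[OF closed_cball ne] in auto)
  moreover obtain B where "\<And>y. y \<in> cball p R \<Longrightarrow> norm (g y) \<le> B"
    using compact_imp_bounded[OF compact_continuous_image[OF assms(1) compact_cball]]
    unfolding bounded_iff by (meson imageI)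
  ultimately have "(\<lambda>t. g (closest_point (cball p R) (\<gamma> t))) \<in> bcontfun"
    using closest_point_in_set[OF closed_cball ne] by (auto intro!: bcontfun_normI)
  then show ?thesis unfolding nem_def by (simp add: Bcontfun_inverse)
qed

text \<open>The derivative of superposition with \<open>g\<close> at a path multiplies pointwise by
  the derivative of \<open>g\<close>. Written as a sum over partial derivatives, it is assembled
  from superposition operators again, so that regularity can be proved by induction over all
  \<open>g\<close>.\<close>

definition dnem :: "'a \<Rightarrow> real \<Rightarrow> ('a \<Rightarrow> 'a) \<Rightarrow> (real \<Rightarrow>\<^sub>C 'a) \<Rightarrow> ((real \<Rightarrow>\<^sub>C 'a::euclidean_space) \<Rightarrow>\<^sub>L (real \<Rightarrow>\<^sub>C 'a))" where
  "dnem p R g \<gamma> = (\<Sum>e\<in>Basis. Blinfun (ptscale e (nem p R (\<lambda>x. frechet_derivative g (at x) e) \<gamma>)))"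

lemma apply_bcontfun_sum: "apply_bcontfun (\<Sum>i\<in>I. f i) t = (\<Sum>i\<in>I. apply_bcontfun (f i) t)"
  by (induction I rule: infinite_finite_induct) auto

lemma dnem_apply:
  fixes g :: "'a::euclidean_space \<Rightarrow> 'a"
  assumes "smooth_on S g" "cball p R \<subseteq> S" "0 \<le> R"
  shows "dnem p R g \<gamma> h t = frechet_derivative g (at (closest_point (cball p R) (\<gamma> t))) (h t)"
proof -
  let ?c = "closest_point (cball p R) (\<gamma> t)"
  have c: "?c \<in> S" using closest_point_in_set[OF closed_cball, of p R "\<gamma> t"] assms(2,3) by auto
  have cont: "continuous_on (cball p R) (\<lambda>x. frechet_derivative g (at x) e)" for e
    using smooth_on_continuous[OF smooth_on_frechet_derivative[OF assms(1)]] assms(2) continuous_on_subset by blast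
  have "dnem p R g \<gamma> h t = (\<Sum>e\<in>Basis. (h t \<bullet> e) *\<^sub>R frechet_derivative g (at ?c) e)"
    unfolding dnem_def
    by (simp add: blinfun.sum_left apply_bcontfun_sum blinfun_apply_ptscale ptscale_apply nem_apply[OF cont assms(3)])
  also have "\<dots> = frechet_derivative g (at ?c) (h t)"
    by (rule frechet_derivative_sum_Basis[OF smooth_on_has_derivative[OF assms(1) c], symmetric])
  finally show ?thesis .
qed

text \<open>All values of \<open>\<gamma>\<close> keep a distance of at least \<open>R - R'\<close>
  from the boundary, so nearby paths stay in the ball and the projection does not act on them. The
  derivative of \<open>g\<close> is uniformly continuous on the compact ball, and the mean value
  inequality gives a remainder estimate uniform in time, as the supremum norm requires.\<close>

lemma nem_has_derivative:
  fixes g :: "'a::euclidean_space \<Rightarrow> 'a" and \<gamma> :: "real \<Rightarrow>\<^sub>C 'a"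
  assumes g: "smooth_on S g" and S: "cball p R \<subseteq> S" and R': "R' < R" "\<And>t. \<gamma> t \<in> cball p R'"
  shows "(nem p R g has_derivative blinfun_apply (dnem p R g \<gamma>)) (at \<gamma>)"
  unfolding has_derivative_at_alt
proof (intro conjI allI impI)
  show "bounded_linear (blinfun_apply (dnem p R g \<gamma>))" by (rule blinfun.bounded_linear_right)
  fix e :: real assume e: "0 < e"
  have R: "0 < R" using R'(2)[of 0] R'(1) zero_le_dist[of p "\<gamma> 0"] unfolding mem_cball by linarith
  have gc: "continuous_on (cball p R) g" using smooth_on_continuous[OF g] S continuous_on_subset by blast
  let ?D = "\<lambda>x v. frechet_derivative g (at x) v"
  have Dcont: "continuous_on (cball p R) (\<lambda>x. ?D x b)" for b
    using smooth_on_continuous[OF smooth_on_frechet_derivative[OF g]] S continuous_on_subset by blast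
  \<comment> \<open>One share of the error for each basis direction in the estimate
    \<open>Dle\<close> of the full derivative.\<close>
  let ?e = "e / DIM('a)"
  have "\<exists>d>0. \<forall>b\<in>Basis. \<forall>y\<in>cball p R. \<forall>y'\<in>cball p R. dist y' y < d \<longrightarrow> dist (?D y' b) (?D y b) < ?e"
  proof -
    have "\<forall>b. \<exists>d>0. \<forall>y\<in>cball p R. \<forall>y'\<in>cball p R. dist y' y < d \<longrightarrow> dist (?D y' b) (?D y b) < ?e"
      using compact_uniformly_continuous[OF Dcont compact_cball] e unfolding uniformly_continuous_on_def
      by (metis DIM_positive divide_pos_pos of_nat_0_less_iff)
    then obtain d where d: "\<And>b. d b > 0" "\<And>b y y'. y \<in> cball p R \<Longrightarrow> y' \<in> cball p R \<Longrightarrow> dist y' y < d b \<Longrightarrow> dist (?D y' b) (?D y b) < ?e"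
      by metis
    show ?thesis
    proof (intro exI conjI ballI impI)
      show "0 < Min (d ` Basis)" using d(1) by simp
      show "dist (?D y' b) (?D y b) < ?e" if "b \<in> Basis" "y \<in> cball p R" "y' \<in> cball p R" "dist y' y < Min (d ` Basis)" for b y y'
        using that by (intro d(2)) auto
    qed
  qed
  then obtain d where d: "d > 0" "\<And>b y y'. b \<in> Basis \<Longrightarrow> y \<in> cball p R \<Longrightarrow> y' \<in> cball p R \<Longrightarrow> dist y' y < d \<Longrightarrow> dist (?D y' b) (?D y b) < ?e"
    by blast
  have Dlin: "(g has_derivative ?D y) (at y)" if "y \<in> cball p R" for y
    using smooth_on_has_derivative[OF g] that S by blast
  have Dle: "norm (?D y' k - ?D y k) \<le> e * norm k" if y: "y \<in> cball p R" "y' \<in> cball p R" "dist y' y < d" for y y' k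
  proof -
    have "?D y' k - ?D y k = (\<Sum>b\<in>Basis. (k \<bullet> b) *\<^sub>R (?D y' b - ?D y b))"
      unfolding frechet_derivative_sum_Basis[OF Dlin[OF y(1)], of k] frechet_derivative_sum_Basis[OF Dlin[OF y(2)], of k]
      by (simp add: sum_subtractf scaleR_diff_right)
    also have "norm \<dots> \<le> (\<Sum>b\<in>(Basis::'a set). norm k * ?e)"
    proof (rule sum_norm_le)
      fix b :: 'a assume b: "b \<in> Basis"
      show "norm ((k \<bullet> b) *\<^sub>R (?D y' b - ?D y b)) \<le> norm k * ?e"
        unfolding norm_scaleR
        using d(2)[OF b y] Basis_le_norm[OF b, of k] by (intro mult_mono) (auto simp: dist_norm)
    qed
    also have "\<dots> = e * norm k" by simp
    finally show ?thesis .
  qed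
  show "\<exists>d>0. \<forall>y. norm (y - \<gamma>) < d \<longrightarrow> norm (nem p R g y - nem p R g \<gamma> - dnem p R g \<gamma> (y - \<gamma>)) \<le> e * norm (y - \<gamma>)"
  proof (intro exI conjI allI impI)
    show "0 < min d (R - R')" using d(1) R'(1) by simp
    fix \<eta> :: "real \<Rightarrow>\<^sub>C 'a" assume \<eta>: "norm (\<eta> - \<gamma>) < min d (R - R')"
    show "norm (nem p R g \<eta> - nem p R g \<gamma> - dnem p R g \<gamma> (\<eta> - \<gamma>)) \<le> e * norm (\<eta> - \<gamma>)"
    proof (rule norm_bound)
      fix t
      have le: "norm (\<eta> t - \<gamma> t) \<le> norm (\<eta> - \<gamma>)" using norm_bounded[of "\<eta> - \<gamma>" t] by simp
      \<comment> \<open>Convexity keeps the segment between the two values inside the region where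
        the derivative differs by at most \<open>e\<close> from its value at
        \<open>\<gamma> t\<close>.\<close>
      let ?C = "ball (\<gamma> t) d \<inter> cball p R"
      have \<gamma>C: "\<gamma> t \<in> ?C" using R'(2)[of t] R'(1) d(1) by auto
      have "dist p (\<eta> t) \<le> R"
        using dist_triangle[of p "\<eta> t" "\<gamma> t"] R'(2)[of t] le \<eta> by (simp add: dist_norm norm_minus_commute)
      then have \<eta>C: "\<eta> t \<in> ?C" using le \<eta> by (auto simp: dist_norm norm_minus_commute)
      have cp: "closest_point (cball p R) (\<gamma> t) = \<gamma> t" "closest_point (cball p R) (\<eta> t) = \<eta> t"
        using \<gamma>C \<eta>C by (auto intro: closest_point_self)
      have "norm (g (\<eta> t) - g (\<gamma> t) - ?D (\<gamma> t) (\<eta> t - \<gamma> t)) \<le> norm (\<eta> t - \<gamma> t) * e"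
      proof (rule differentiable_bound_linearization[where S="?C" and f'="?D"])
        have "closed_segment (\<gamma> t) (\<eta> t) \<subseteq> ?C"
          using \<gamma>C \<eta>C by (intro closed_segment_subset convex_Int convex_ball convex_cball)
        then show "\<gamma> t + s *\<^sub>R (\<eta> t - \<gamma> t) \<in> ?C" if "s \<in> {0..1}" for s
          using that subsetD[of "closed_segment (\<gamma> t) (\<eta> t)" ?C "\<gamma> t + s *\<^sub>R (\<eta> t - \<gamma> t)"]
          unfolding in_segment by (force simp: algebra_simps)
        show "(g has_derivative ?D x) (at x within ?C)" if "x \<in> ?C" for x
          using Dlin that has_derivative_at_withinI by blast
        show "onorm (?D x - ?D (\<gamma> t)) \<le> e" if "x \<in> ?C" for x
          unfolding fun_diff_def by (rule onorm_le) (use that \<gamma>C Dle[of "\<gamma> t" x] in \<open>auto simp: dist_commute\<close>)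
        show "\<gamma> t \<in> ?C" by (rule \<gamma>C)
      qed
      also have "\<dots> \<le> e * norm (\<eta> - \<gamma>)" using le e by (simp add: mult.commute)
      finally show "norm ((nem p R g \<eta> - nem p R g \<gamma> - dnem p R g \<gamma> (\<eta> - \<gamma>)) t) \<le> e * norm (\<eta> - \<gamma>)"
        using R by (simp add: nem_apply[OF gc] dnem_apply[OF g S] cp)
    qed
  qed
qed

text \<open>The derivative of \<open>nem p R g\<close> consists of \<open>nem p R\<close> applied to
  the partial derivatives of \<open>g\<close>; as \<open>g\<close> is arbitrary in the induction,
  each step gains one order of differentiability.\<close>

lemma Ck_on_nem:
  fixes g :: "'a::euclidean_space \<Rightarrow> 'a" and \<gamma> :: "'z::real_normed_vector \<Rightarrow> (real \<Rightarrow>\<^sub>C 'a)"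
  assumes S: "cball p R \<subseteq> S" and W: "open W" and R': "R' < R" "\<And>x t. x \<in> W \<Longrightarrow> \<gamma> x t \<in> cball p R'"
    and g: "smooth_on S g" and \<gamma>: "Ck_on k W \<gamma>"
  shows "Ck_on k W (\<lambda>x. nem p R g (\<gamma> x))"
  using g \<gamma>
proof (induction k arbitrary: g)
  case 0
  have "continuous_on (\<gamma> ` W) (nem p R g)"
    by (intro continuous_at_imp_continuous_on ballI has_derivative_continuous[OF nem_has_derivative[OF 0(1) S R'(1)]])
      (use R'(2) in auto)
  then show ?case using 0 by (auto intro: continuous_on_compose2)
next
  case (Suc k)
  note F = Ck_on_SucD[OF Suc.prems(2)]
  show ?case
  proof (rule Ck_on_SucI[OF W])
    show "((\<lambda>x. nem p R g (\<gamma> x)) has_derivative (\<lambda>v. dnem p R g (\<gamma> x) (frechet_derivative \<gamma> (at x) v))) (at x)" if "x \<in> W" for x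
      using diff_chain_at[OF F(1)[OF that] nem_has_derivative[OF Suc.prems(1) S R'(1) R'(2)[OF that]]]
      by (simp add: o_def)
    show "Ck_on k W (\<lambda>x. dnem p R g (\<gamma> x) (frechet_derivative \<gamma> (at x) v))" for v
      unfolding dnem_def
      by (intro Ck_on_bilinear[OF W bounded_bilinear_blinfun_apply] Ck_on_sum W F
          Ck_on_bounded_linear_comp[OF W bounded_linear_Blinfun_ptscale] Suc.IH smooth_on_frechet_derivative Suc.prems
          Ck_on_Suc_imp[OF Suc.prems(2)])
  qed
qed

lemma Ck_on_dnem:
  fixes g :: "'a::euclidean_space \<Rightarrow> 'a" and \<gamma> :: "'z::real_normed_vector \<Rightarrow> (real \<Rightarrow>\<^sub>C 'a)"
  assumes S: "cball p R \<subseteq> S" and W: "open W" and R': "R' < R" "\<And>x t. x \<in> W \<Longrightarrow> \<gamma> x t \<in> cball p R'"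
    and g: "smooth_on S g" and \<gamma>: "Ck_on k W \<gamma>"
  shows "Ck_on k W (\<lambda>x. dnem p R g (\<gamma> x))"
  unfolding dnem_def
  by (intro Ck_on_sum W Ck_on_bounded_linear_comp[OF W bounded_linear_Blinfun_ptscale] 
      Ck_on_nem[OF S W R'] smooth_on_frechet_derivative g \<gamma>)

section \<open>The flow of a smooth vector field near a point\<close>

instance bcontfun :: (metric_space, banach) banach ..

lemma bounded_linear_const_bcontfun:
  "bounded_linear (const_bcontfun :: 'a::real_normed_vector \<Rightarrow> (real \<Rightarrow>\<^sub>C 'a))"
  by (rule bounded_linear_intro[where K=1])
    (auto intro: bcontfun_eqI norm_bound simp: const_bcontfun.rep_eq)

lemma norm_const_bcontfun_le: "norm (const_bcontfun x :: real \<Rightarrow>\<^sub>C 'a::real_normed_vector) \<le> norm x"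
  by (rule norm_bound) (simp add: const_bcontfun.rep_eq)

lemma bounded_linear_eval_bcontfun:
  "bounded_linear (\<lambda>w :: real \<Rightarrow>\<^sub>C 'a::real_normed_vector. apply_bcontfun w t)"
  by (rule bounded_linear_intro[where K=1]) (auto simp: norm_bounded)

text \<open>The path of \<open>x\<close> is the fixed point of a contraction of the Banach space of paths. Its derivative in
  \<open>x\<close> solves a linear equation whose resolvent depends on the path as smoothly as the path depends on
  \<open>x\<close>, so smoothness bootstraps without an implicit function theorem.\<close>

locale flow_box =
  fixes V :: "'a::euclidean_space \<Rightarrow> 'a" and S :: "'a set" and p :: 'a and R L d :: real
  assumes S: "cball p R \<subseteq> S" and V: "smooth_on S V" and R: "0 < R"
    and L: "0 < L" "\<And>x. x \<in> cball p R \<Longrightarrow> (\<Sum>e\<in>Basis. norm (frechet_derivative V (at x) e)) \<le> L"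
      "\<And>x. x \<in> cball p R \<Longrightarrow> norm (V x) \<le> L"
    and d: "0 < d" "3 * d * L \<le> 1/2" "3 * d * L \<le> R/4"
begin

lemma V_cont: "continuous_on (cball p R) V"
  using smooth_on_continuous[OF V] S continuous_on_subset by blast

lemma V_deriv: "x \<in> cball p R \<Longrightarrow> (V has_derivative frechet_derivative V (at x)) (at x)"
  using smooth_on_has_derivative[OF V] S by blast

lemma DV_bound:
  assumes "x \<in> cball p R"
  shows "norm (frechet_derivative V (at x) v) \<le> L * norm v"
proof -
  have "norm (frechet_derivative V (at x) v) \<le> (\<Sum>e\<in>Basis. norm ((v \<bullet> e) *\<^sub>R frechet_derivative V (at x) e))"
    unfolding frechet_derivative_sum_Basis[OF V_deriv[OF assms], of v] by (rule norm_sum)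
  also have "\<dots> \<le> (\<Sum>e\<in>Basis. norm v * norm (frechet_derivative V (at x) e))"
    unfolding norm_scaleR by (intro sum_mono mult_right_mono) (auto simp: Basis_le_norm)
  also have "\<dots> \<le> L * norm v"
    using mult_right_mono[OF L(2)[OF assms] norm_ge_zero[of v]] by (simp add: sum_distrib_left mult.commute)
  finally show ?thesis .
qed

lemma V_lip: "x \<in> cball p R \<Longrightarrow> y \<in> cball p R \<Longrightarrow> norm (V x - V y) \<le> L * norm (x - y)"
  by (rule differentiable_bound[OF convex_cball has_derivative_at_withinI[OF V_deriv]])
    (auto intro!: onorm_le DV_bound)

lemma cp: "closest_point (cball p R) y \<in> cball p R"
  by (rule closest_point_in_set) (use R in auto)

lemma nem_V: "nem p R V \<gamma> t = V (closest_point (cball p R) (\<gamma> t))"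
  by (rule nem_apply[OF V_cont]) (use R in auto)

lemma N_lip: "norm (nem p R V \<gamma> - nem p R V \<eta>) \<le> L * norm (\<gamma> - \<eta>)"
proof (rule norm_bound)
  fix t
  have "norm ((nem p R V \<gamma> - nem p R V \<eta>) t) \<le> L * dist (closest_point (cball p R) (\<gamma> t)) (closest_point (cball p R) (\<eta> t))"
    using V_lip[OF cp cp] by (simp add: nem_V dist_norm)
  also have "\<dots> \<le> L * dist (\<gamma> t) (\<eta> t)"
    using L(1) R by (intro mult_left_mono closest_point_lipschitz) auto
  also have "\<dots> \<le> L * norm (\<gamma> - \<eta>)"
    using L(1) norm_bounded[of "\<gamma> - \<eta>" t] by (intro mult_left_mono) (auto simp: dist_norm)
  finally show "norm ((nem p R V \<gamma> - nem p R V \<eta>) t) \<le> L * norm (\<gamma> - \<eta>)" .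
qed

lemma N_bound: "norm (nem p R V \<gamma>) \<le> L"
  by (rule norm_bound) (use L(3)[OF cp] in \<open>simp add: nem_V\<close>)

lemma dnem_V: "dnem p R V \<gamma> h t = frechet_derivative V (at (closest_point (cball p R) (\<gamma> t))) (h t)"
  by (rule dnem_apply[OF V S]) (use R in auto)

lemma dN_bound: "norm (dnem p R V \<gamma> h) \<le> L * norm h"
proof (rule norm_bound)
  fix t
  have "norm (dnem p R V \<gamma> h t) \<le> L * norm (h t)" unfolding dnem_V by (rule DV_bound[OF cp])
  also have "\<dots> \<le> L * norm h" using L(1) norm_bounded[of h t] by simp
  finally show "norm (dnem p R V \<gamma> h t) \<le> L * norm h" .
qed

text \<open>The norm of \<open>prim\<close> is at most \<open>3 * d\<close> and \<open>L\<close> is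
  a Lipschitz constant of superposition with \<open>V\<close>. This is the contraction factor 1/2
  shared by the fixed point, its Lipschitz estimate and the linearised equation.\<close>

lemma half: "0 \<le> x \<Longrightarrow> L * x * (3 * d) \<le> x / 2"
  using mult_right_mono[OF d(2), of x] by (simp add: ac_simps)

text \<open>The unknown is the deviation \<open>w\<close> from the constant path at
  \<open>x\<close>, so all starting points share one Banach space and \<open>x\<close> enters only
  as a parameter.\<close>

lemma fixpoint: "\<exists>!w. prim d (nem p R V (const_bcontfun x + w)) = w"
proof (rule banach_fix_type[where c="1/2"])
  interpret P: bounded_linear "prim d :: (real \<Rightarrow>\<^sub>C 'a) \<Rightarrow> _" by (rule bounded_linear_prim[OF d(1)])
  show "\<forall>w v. dist (prim d (nem p R V (const_bcontfun x + w))) (prim d (nem p R V (const_bcontfun x + v))) \<le> 1/2 * dist w v"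
  proof (intro allI)
    fix w v :: "real \<Rightarrow>\<^sub>C 'a"
    have "dist (prim d (nem p R V (const_bcontfun x + w))) (prim d (nem p R V (const_bcontfun x + v)))
      \<le> norm (nem p R V (const_bcontfun x + w) - nem p R V (const_bcontfun x + v)) * (3 * d)"
      unfolding dist_norm P.diff[symmetric] by (rule norm_prim[OF d(1)])
    also have "\<dots> \<le> (L * norm (w - v)) * (3 * d)"
      using N_lip[of "const_bcontfun x + w" "const_bcontfun x + v"] d(1) by (intro mult_right_mono) auto
    also have "\<dots> \<le> 1/2 * dist w v"
      using half[of "norm (w - v)"] by (simp add: dist_norm)
    finally show "dist (prim d (nem p R V (const_bcontfun x + w))) (prim d (nem p R V (const_bcontfun x + v))) \<le> 1/2 * dist w v" .
  qed
qed auto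

definition u :: "'a \<Rightarrow> (real \<Rightarrow>\<^sub>C 'a)" where
  "u x = (THE w. prim d (nem p R V (const_bcontfun x + w)) = w)"

definition path :: "'a \<Rightarrow> (real \<Rightarrow>\<^sub>C 'a)" where "path x = const_bcontfun x + u x"

lemma u_eq: "u x = prim d (nem p R V (path x))"
  using theI'[OF fixpoint[of x]] unfolding u_def[symmetric] path_def by simp

lemma u_bound: "norm (u x) \<le> R / 4"
proof -
  have "norm (u x) \<le> norm (nem p R V (path x)) * (3 * d)"
    by (subst u_eq) (rule norm_prim[OF d(1)])
  also have "\<dots> \<le> L * (3 * d)" using N_bound d(1) by (intro mult_right_mono) auto
  finally show ?thesis using d(3) by (simp add: ac_simps)
qed

lemma path_apply: "path x t = x + u x t"
  by (simp add: path_def const_bcontfun.rep_eq)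

text \<open>A path starts within \<open>R/4\<close> of the centre and moves by at most
  \<open>R/4\<close>. The remaining gap up to \<open>R\<close> is what differentiability of the
  superposition operator requires.\<close>

lemma path_in: "x \<in> ball p (R/4) \<Longrightarrow> path x t \<in> cball p (R/2)"
proof -
  assume x: "x \<in> ball p (R/4)"
  have "dist p (path x t) \<le> dist p x + dist x (path x t)" by (rule dist_triangle)
  also have "dist x (path x t) \<le> R/4"
    using u_bound[of x] norm_bounded[of "u x" t] by (simp add: dist_norm path_apply)
  finally show ?thesis using x by simp
qed

lemma path_cp: "x \<in> ball p (R/4) \<Longrightarrow> closest_point (cball p R) (path x t) = path x t"
  using path_in[of x t] R by (intro closest_point_self) auto

lemma path_diff: "path y - path x = const_bcontfun (y - x) + (u y - u x)"
  by (rule bcontfun_eqI) (simp add: path_apply const_bcontfun.rep_eq)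

interpretation P: bounded_linear "prim d :: (real \<Rightarrow>\<^sub>C 'a) \<Rightarrow> _" by (rule bounded_linear_prim[OF d(1)])

text \<open>The estimated quantity reappears on the right with factor 1/2 and is absorbed into the
  left hand side.\<close>

lemma u_lip: "norm (u y - u x) \<le> norm (y - x)"
proof -
  have "norm (u y - u x) = norm (prim d (nem p R V (path y) - nem p R V (path x)))"
    by (simp add: P.diff flip: u_eq)
  also have "\<dots> \<le> norm (nem p R V (path y) - nem p R V (path x)) * (3 * d)"
    by (rule norm_prim[OF d(1)])
  also have "\<dots> \<le> (L * norm (path y - path x)) * (3 * d)"
    using N_lip d(1) by (intro mult_right_mono) auto
  also have "\<dots> \<le> norm (path y - path x) / 2" by (rule half) simp
  also have "\<dots> \<le> (norm (y - x) + norm (u y - u x)) / 2"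
    using norm_triangle_ineq[of "const_bcontfun (y - x)" "u y - u x"] norm_const_bcontfun_le[of "y - x"]
    unfolding path_diff by simp
  finally show ?thesis by simp
qed

definition T :: "'a \<Rightarrow> ((real \<Rightarrow>\<^sub>C 'a) \<Rightarrow>\<^sub>L (real \<Rightarrow>\<^sub>C 'a))" where
  "T x = Blinfun (prim d) o\<^sub>L dnem p R V (path x)"

lemma T_apply: "T x h = prim d (dnem p R V (path x) h)"
  by (simp add: T_def bounded_linear_Blinfun_apply[OF bounded_linear_prim[OF d(1)]])

lemma T_bound: "norm (T x) \<le> 1/2"
proof (rule norm_blinfun_bound)
  fix h
  have "norm (T x h) \<le> norm (dnem p R V (path x) h) * (3 * d)"
    unfolding T_apply by (rule norm_prim[OF d(1)])
  also have "\<dots> \<le> L * norm h * (3 * d)" using dN_bound d(1) by (intro mult_right_mono) auto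
  also have "\<dots> \<le> norm h / 2" by (rule half) simp
  finally show "norm (T x h) \<le> 1/2 * norm h" by simp
qed simp

text \<open>Formal differentiation of the fixed point equation in direction \<open>v\<close> gives
  \<open>du = T (v + du)\<close> with \<open>v\<close> as a constant path; this is the solution by
  the resolvent.\<close>

definition du :: "'a \<Rightarrow> 'a \<Rightarrow> (real \<Rightarrow>\<^sub>C 'a)" where
  "du x v = resolvent (T x) (T x (const_bcontfun v))"

lemma du_eq: "du x v = prim d (dnem p R V (path x) (const_bcontfun v + du x v))"
proof -
  have "du x v = T x (du x v) + T x (const_bcontfun v)"
    unfolding du_def by (rule resolvent_eq[OF T_bound])
  then show ?thesis by (simp only: T_apply blinfun.add_right P.add add.commute)
qed

text \<open>The increment of \<open>u\<close> satisfies the linearised equation up to an error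
  \<open>\<rho>\<close>. By uniqueness of its solutions, the deviation from \<open>du\<close> is the
  resolvent of \<open>\<rho>\<close>, which is of smaller order than \<open>y - x\<close>.\<close>

lemma u_has_derivative:
  assumes x: "x \<in> ball p (R/4)"
  shows "(u has_derivative du x) (at x)"
  unfolding has_derivative_at_alt
proof (intro conjI allI impI)
  show "bounded_linear (du x)"
    unfolding du_def
    by (intro bounded_linear_compose[OF blinfun.bounded_linear_right] bounded_linear_const_bcontfun)
  fix e :: real assume e: "0 < e"
  \<comment> \<open>The remainder is multiplied by \<open>3 * d\<close> in \<open>prim\<close>, by 2
    for the increment of the path and by 2 in the resolvent, which makes \<open>e\<close> in
    total.\<close>
  let ?e = "e / (12 * d)"
  have e': "0 < ?e" using e d(1) by simp
  have "(nem p R V has_derivative blinfun_apply (dnem p R V (path x))) (at (path x))"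
    by (rule nem_has_derivative[OF V S _ path_in[OF x]]) (use R in auto)
  then obtain \<delta> where \<delta>: "\<delta> > 0" and N: "\<And>\<eta>. norm (\<eta> - path x) < \<delta> \<Longrightarrow> 
    norm (nem p R V \<eta> - nem p R V (path x) - dnem p R V (path x) (\<eta> - path x)) \<le> ?e * norm (\<eta> - path x)"
    using e' unfolding has_derivative_at_alt by blast
  show "\<exists>\<delta>>0. \<forall>y. norm (y - x) < \<delta> \<longrightarrow> norm (u y - u x - du x (y - x)) \<le> e * norm (y - x)"
  proof (intro exI conjI allI impI)
    show "0 < \<delta> / 2" using \<delta> by simp
    fix y assume y: "norm (y - x) < \<delta> / 2"
    have le: "norm (path y - path x) \<le> 2 * norm (y - x)"
      using norm_triangle_ineq[of "const_bcontfun (y - x)" "u y - u x"] norm_const_bcontfun_le[of "y - x"] u_lip[of y x]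
      unfolding path_diff by simp
    define \<rho> where "\<rho> = prim d (nem p R V (path y) - nem p R V (path x) - dnem p R V (path x) (path y - path x))"
    have "norm \<rho> \<le> norm (nem p R V (path y) - nem p R V (path x) - dnem p R V (path x) (path y - path x)) * (3 * d)"
      unfolding \<rho>_def by (rule norm_prim[OF d(1)])
    also have "\<dots> \<le> (?e * norm (path y - path x)) * (3 * d)"
      using N[of "path y"] le y d(1) by (intro mult_right_mono) auto
    also have "\<dots> \<le> (?e * (2 * norm (y - x))) * (3 * d)"
      using le e' d(1) by (intro mult_right_mono mult_left_mono) auto
    also have "\<dots> = e / 2 * norm (y - x)" using d(1) by simp
    finally have \<rho>: "norm \<rho> \<le> e / 2 * norm (y - x)" .
    have "u y - u x = prim d (nem p R V (path y)) - prim d (nem p R V (path x))"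
      by (simp flip: u_eq)
    also have "\<dots> = T x (path y - path x) + \<rho>"
      unfolding T_apply \<rho>_def by (simp add: P.diff P.add)
    also have "\<dots> = T x (u y - u x) + (T x (const_bcontfun (y - x)) + \<rho>)"
      unfolding path_diff by (simp add: blinfun.add_right blinfun.diff_right)
    finally have "u y - u x = resolvent (T x) (T x (const_bcontfun (y - x)) + \<rho>)"
      by (rule resolvent_unique[OF T_bound])
    then have "u y - u x - du x (y - x) = resolvent (T x) \<rho>"
      unfolding du_def by (simp add: blinfun.add_right)
    also have "norm \<dots> \<le> 2 * norm \<rho>"
      using norm_blinfun[of "resolvent (T x)" \<rho>] mult_right_mono[OF norm_resolvent[OF T_bound] norm_ge_zero[of \<rho>]]
      by (rule order_trans)
    finally show "norm (u y - u x - du x (y - x)) \<le> e * norm (y - x)" using \<rho> by simp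
  qed
qed

lemma Ck_u: "Ck_on k (ball p (R/4)) u"
proof (induction k)
  case 0
  show ?case
    unfolding Ck_on.simps
    by (intro continuous_at_imp_continuous_on ballI has_derivative_continuous[OF u_has_derivative])
next
  case (Suc k)
  show ?case
  proof (rule Ck_on_SucI[OF open_ball u_has_derivative])
    fix v
    have path: "Ck_on k (ball p (R/4)) path"
      unfolding path_def[abs_def]
      by (intro Ck_on_add Ck_on_bounded_linear bounded_linear_const_bcontfun Suc.IH open_ball)
    have T: "Ck_on k (ball p (R/4)) T"
      unfolding T_def[abs_def]
      by (intro Ck_on_bilinear[OF open_ball bounded_bilinear_blinfun_compose] Ck_on_const open_ball
          Ck_on_dnem[OF S open_ball, where R'="R/2"] path_in V path) (use R in auto)
    show "Ck_on k (ball p (R/4)) (\<lambda>x. du x v)"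
      unfolding du_def
      by (intro Ck_on_bilinear[OF open_ball bounded_bilinear_blinfun_apply] Ck_on_const open_ball T
          Ck_on_resolvent T_bound)
  qed
qed

definition \<Phi> :: "real \<Rightarrow> 'a \<Rightarrow> 'a" where "\<Phi> t x = x + u x t"

lemma flow_smooth: "smooth_on (ball p (R/4)) (\<Phi> t)"
proof -
  have "smooth_on (ball p (R/4)) u" by (simp add: smooth_on_def Ck_u)
  then show ?thesis
    unfolding \<Phi>_def[abs_def]
    by (intro smooth_on_add[OF open_ball smooth_on_bounded_linear[OF open_ball bounded_linear_ident]]
        smooth_on_bounded_linear_comp[OF open_ball bounded_linear_eval_bcontfun])
qed

lemma flow_0: "\<Phi> 0 x = x"
  unfolding \<Phi>_def by (subst u_eq) (simp add: prim_0[OF d(1)])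

lemma flow_path: "\<Phi> t x = path x t"
  by (simp add: \<Phi>_def path_apply)

lemma flow_in: "x \<in> ball p (R/4) \<Longrightarrow> \<Phi> t x \<in> cball p (R/2)"
  unfolding flow_path by (rule path_in)

lemma flow_ode:
  assumes x: "x \<in> ball p (R/4)" and t: "\<bar>t\<bar> < d"
  shows "((\<lambda>s. \<Phi> s x) has_vector_derivative V (\<Phi> t x)) (at t)"
proof -
  have "(apply_bcontfun (u x) has_vector_derivative nem p R V (path x) t) (at t)"
    by (subst u_eq) (rule prim_has_vector_derivative[OF t])
  then have "((\<lambda>s. x + u x s) has_vector_derivative 0 + nem p R V (path x) t) (at t)"
    by (intro derivative_intros)
  then show ?thesis
    unfolding nem_V path_cp[OF x] unfolding flow_path[symmetric] unfolding \<Phi>_def by simp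
qed

lemma flow_has_derivative:
  assumes x: "x \<in> ball p (R/4)"
  shows "(\<Phi> t has_derivative (\<lambda>v. v + du x v t)) (at x)"
  unfolding \<Phi>_def[abs_def]
  by (intro derivative_intros bounded_linear.has_derivative[OF bounded_linear_eval_bcontfun u_has_derivative[OF x]])

text \<open>\<open>du\<close> solves an integral equation in time by construction; differentiating
  it in time gives the variational equation along the flow.\<close>

lemma flow_variation:
  assumes x: "x \<in> ball p (R/4)" and t: "\<bar>t\<bar> < d"
  shows "((\<lambda>s. frechet_derivative (\<Phi> s) (at x) v) has_vector_derivative
    frechet_derivative V (at (\<Phi> t x)) (frechet_derivative (\<Phi> t) (at x) v)) (at t)"
proof -
  have D: "frechet_derivative (\<Phi> s) (at x) v = v + du x v s" for s
    using frechet_derivative_at[OF flow_has_derivative[OF x]] by metis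
  have "(apply_bcontfun (du x v) has_vector_derivative dnem p R V (path x) (const_bcontfun v + du x v) t) (at t)"
    by (subst du_eq) (rule prim_has_vector_derivative[OF t])
  then have "((\<lambda>s. v + du x v s) has_vector_derivative 0 + dnem p R V (path x) (const_bcontfun v + du x v) t) (at t)"
    by (intro derivative_intros)
  then show ?thesis
    by (simp add: D dnem_V path_cp[OF x] flow_path const_bcontfun.rep_eq)
qed

end

lemma flow_box_exists:
  fixes V :: "'a::euclidean_space \<Rightarrow> 'a"
  assumes "open S" "smooth_on S V" "p \<in> S"
  shows "\<exists>R L d. flow_box V S p R L d"
proof -
  obtain R where R: "0 < R" "cball p R \<subseteq> S" using assms(1,3) open_contains_cball by blast
  have c1: "continuous_on (cball p R) (\<lambda>x. \<Sum>e\<in>Basis. norm (frechet_derivative V (at x) e))"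
    using smooth_on_continuous[OF smooth_on_frechet_derivative[OF assms(2)]] R(2)
    by (intro continuous_on_sum continuous_on_norm) (blast intro: continuous_on_subset)
  have c2: "continuous_on (cball p R) V"
    using smooth_on_continuous[OF assms(2)] R(2) continuous_on_subset by blast
  obtain B1 where B1: "\<And>x. x \<in> cball p R \<Longrightarrow> norm (\<Sum>e\<in>Basis. norm (frechet_derivative V (at x) e)) \<le> B1"
    using compact_imp_bounded[OF compact_continuous_image[OF c1 compact_cball]] unfolding bounded_iff by (meson imageI)
  obtain B2 where B2: "\<And>x. x \<in> cball p R \<Longrightarrow> norm (V x) \<le> B2"
    using compact_imp_bounded[OF compact_continuous_image[OF c2 compact_cball]] unfolding bounded_iff by (meson imageI)
  define L where "L = max 1 (max B1 B2)"
  \<comment> \<open>Chosen so that \<open>3 * d * L\<close> equals the minimum of the two bounds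
    demanded of it.\<close>
  define d where "d = min (1/2) (R/4) / (3 * L)"
  have L: "L > 0" by (simp add: L_def)
  have eq: "3 * d * L = min (1/2) (R/4)" using L by (simp add: d_def)
  have "flow_box V S p R L d"
  proof
    show "0 < d" unfolding d_def using R(1) L by (intro divide_pos_pos) auto
    show "3 * d * L \<le> 1/2" "3 * d * L \<le> R/4" unfolding eq by auto
    show "(\<Sum>e\<in>Basis. norm (frechet_derivative V (at x) e)) \<le> L" if "x \<in> cball p R" for x
      using B1[OF that] unfolding L_def by simp
    show "norm (V x) \<le> L" if "x \<in> cball p R" for x
      using B2[OF that] unfolding L_def by simp
  qed (use R L assms in auto)
  then show ?thesis by blast
qed

text \<open>With the weight \<open>exp (- (2 * L * s))\<close> the squared norm is nonincreasing, so
  it cannot leave zero. Besides uniqueness of integral curves, this transports linear identities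
  such as complex linearity along a flow.\<close>

lemma gronwall_zero_forward:
  fixes e :: "real \<Rightarrow> 'a::real_inner"
  assumes e: "\<And>s. 0 \<le> s \<Longrightarrow> s \<le> t \<Longrightarrow> (e has_vector_derivative e' s) (at s)"
    and le: "\<And>s. 0 \<le> s \<Longrightarrow> s \<le> t \<Longrightarrow> norm (e' s) \<le> L * norm (e s)" and e0: "e 0 = 0" and t: "0 \<le> t"
  shows "e t = 0"
proof -
  define f where "f s = exp (- (2 * L * s)) * (e s \<bullet> e s)" for s
  have "f t \<le> f 0"
  proof (rule DERIV_nonpos_imp_nonincreasing[OF t])
    fix s assume s: "0 \<le> s" "s \<le> t"
    have "((\<lambda>s. e s \<bullet> e s) has_real_derivative 2 * (e s \<bullet> e' s)) (at s)"
      using has_derivative_inner[OF e[OF s, unfolded has_vector_derivative_def] e[OF s, unfolded has_vector_derivative_def]]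
      unfolding has_field_derivative_def by (rule has_derivative_eq_rhs) (auto simp: inner_commute algebra_simps)
    then have "(f has_real_derivative
        exp (- (2 * L * s)) * (2 * (e s \<bullet> e' s)) + exp (- (2 * L * s)) * (- (2 * L)) * (e s \<bullet> e s)) (at s)"
      unfolding f_def[abs_def] by (auto intro!: derivative_eq_intros simp: algebra_simps)
    moreover have "e s \<bullet> e' s \<le> L * (e s \<bullet> e s)"
    proof -
      have "e s \<bullet> e' s \<le> norm (e s) * norm (e' s)" by (rule norm_cauchy_schwarz)
      also have "\<dots> \<le> norm (e s) * (L * norm (e s))" by (intro mult_left_mono le s) simp
      finally show ?thesis by (simp add: dot_square_norm power2_eq_square algebra_simps)
    qed
    then have "exp (- (2 * L * s)) * (2 * (e s \<bullet> e' s)) + exp (- (2 * L * s)) * (- (2 * L)) * (e s \<bullet> e s) \<le> 0"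
      using mult_left_mono[of "e s \<bullet> e' s" "L * (e s \<bullet> e s)" "2 * exp (- (2 * L * s))"] by (simp add: algebra_simps)
    ultimately show "\<exists>y. (f has_real_derivative y) (at s) \<and> y \<le> 0" by blast
  qed
  then have "e t \<bullet> e t \<le> 0" by (simp add: f_def e0 mult_le_0_iff)
  then show ?thesis by (metis inner_eq_zero_iff inner_ge_zero order_antisym)
qed

lemma gronwall_zero:
  fixes e :: "real \<Rightarrow> 'a::real_inner"
  assumes e: "\<And>s. \<bar>s\<bar> \<le> \<bar>t\<bar> \<Longrightarrow> (e has_vector_derivative e' s) (at s)"
    and le: "\<And>s. \<bar>s\<bar> \<le> \<bar>t\<bar> \<Longrightarrow> norm (e' s) \<le> L * norm (e s)" and e0: "e 0 = 0"
  shows "e t = 0"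
proof (cases "0 \<le> t")
  case True
  show ?thesis by (rule gronwall_zero_forward[where e=e and e'=e' and L=L]) (use assms True in auto)
next
  case False
  have "e (- (- t)) = 0"
  proof (rule gronwall_zero_forward[where e="\<lambda>s. e (- s)" and e'="\<lambda>s. - e' (- s)" and L=L])
    fix s assume s: "0 \<le> s" "s \<le> - t"
    have "((e \<circ> uminus) has_vector_derivative (- 1) *\<^sub>R e' (- s)) (at s)"
      by (rule vector_diff_chain_at) (use s e[of "- s"] in \<open>auto intro!: derivative_eq_intros\<close>)
    then show "((\<lambda>s. e (- s)) has_vector_derivative - e' (- s)) (at s)" by (simp add: o_def)
    show "norm (- e' (- s)) \<le> L * norm (e (- s))" using le[of "- s"] s by simp
  qed (use False e0 in auto)
  then show ?thesis by simp
qed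

section \<open>Second derivatives and parameter integrals\<close>

lemma frechet_derivative_eqI: "(f has_derivative f') (at x) \<Longrightarrow> frechet_derivative f (at x) = f'"
  using frechet_derivative_at by metis

lemma has_derivative_along_line:
  assumes "(f has_derivative f') (at (x + s *\<^sub>R v))"
  shows "((\<lambda>s. f (x + s *\<^sub>R v)) has_vector_derivative f' v) (at s)"
proof -
  interpret bounded_linear f' using assms by (rule has_derivative_bounded_linear)
  have "((\<lambda>s. x + s *\<^sub>R v) has_derivative (\<lambda>h. h *\<^sub>R v)) (at s)"
    by (auto intro!: derivative_eq_intros)
  from diff_chain_at[OF this assms] show ?thesis
    by (simp add: o_def has_vector_derivative_def scaleR)
qed

text \<open>The second difference is the increment over \<open>s\<close> of a first difference in
  direction \<open>w\<close>; the mean value theorem in \<open>s\<close> and then in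
  \<open>t\<close> evaluates it. The left hand side is symmetric in \<open>v\<close> and
  \<open>w\<close>, while the right hand side singles out one order of differentiation.\<close>

lemma second_difference_mean_value:
  fixes f :: "'a::real_normed_vector \<Rightarrow> real"
  assumes S: "open S" "smooth_on S f" and d: "0 < d"
    and sub: "\<And>s t. 0 \<le> s \<Longrightarrow> s \<le> d \<Longrightarrow> 0 \<le> t \<Longrightarrow> t \<le> d \<Longrightarrow> x + s *\<^sub>R v + t *\<^sub>R w \<in> S"
  obtains s t where "0 \<le> s" "s \<le> d" "0 \<le> t" "t \<le> d"
    "f (x + d *\<^sub>R v + d *\<^sub>R w) - f (x + d *\<^sub>R v) - f (x + d *\<^sub>R w) + f x
      = d\<^sup>2 * frechet_derivative (\<lambda>y. frechet_derivative f (at y) v) (at (x + s *\<^sub>R v + t *\<^sub>R w)) w"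
proof -
  note F = smooth_on_has_derivative[OF S(2)] and G = smooth_on_has_derivative[OF smooth_on_frechet_derivative[OF S(2)]]
  let ?D = "\<lambda>y. frechet_derivative f (at y) v"
  have 1: "((\<lambda>s. f (x + d *\<^sub>R w + s *\<^sub>R v) - f (x + s *\<^sub>R v)) has_real_derivative
      ?D (x + d *\<^sub>R w + s *\<^sub>R v) - ?D (x + s *\<^sub>R v)) (at s)" if "0 \<le> s" "s \<le> d" for s
    using has_derivative_along_line[OF F, of "x + d *\<^sub>R w" s v] has_derivative_along_line[OF F, of x s v]
      sub[of s d] sub[of s 0] that d
    by (intro DERIV_diff) (auto simp: has_real_derivative_iff_has_vector_derivative ac_simps)
  obtain s where s: "0 < s" "s < d" "(f (x + d *\<^sub>R w + d *\<^sub>R v) - f (x + d *\<^sub>R v)) - (f (x + d *\<^sub>R w + 0 *\<^sub>R v) - f (x + 0 *\<^sub>R v))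
      = (d - 0) * (?D (x + d *\<^sub>R w + s *\<^sub>R v) - ?D (x + s *\<^sub>R v))"
    using MVT2[OF d 1] by blast
  have 2: "((\<lambda>t. ?D (x + s *\<^sub>R v + t *\<^sub>R w)) has_real_derivative
      frechet_derivative ?D (at (x + s *\<^sub>R v + t *\<^sub>R w)) w) (at t)" if "0 \<le> t" "t \<le> d" for t
    using has_derivative_along_line[OF G, of "x + s *\<^sub>R v" t w] sub[of s t] that s
    by (simp add: has_real_derivative_iff_has_vector_derivative)
  obtain t where t: "0 < t" "t < d" "?D (x + s *\<^sub>R v + d *\<^sub>R w) - ?D (x + s *\<^sub>R v + 0 *\<^sub>R w) 
      = (d - 0) * frechet_derivative ?D (at (x + s *\<^sub>R v + t *\<^sub>R w)) w"
    using MVT2[OF d 2] by blast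
  show ?thesis
    by (rule that[of s t]) (use s t in \<open>auto simp: power2_eq_square ac_simps\<close>)
qed

text \<open>Both mixed derivatives, taken at points close to \<open>x\<close>, equal the same second
  difference divided by \<open>d\<^sup>2\<close>; continuity at \<open>x\<close> excludes different
  values.\<close>

lemma frechet_derivative_symmetric_real:
  fixes f :: "'a::real_normed_vector \<Rightarrow> real"
  assumes S: "open S" "smooth_on S f" "x \<in> S"
  shows "frechet_derivative (\<lambda>y. frechet_derivative f (at y) v) (at x) w
       = frechet_derivative (\<lambda>y. frechet_derivative f (at y) w) (at x) v"
    (is "?A x = ?B x")
proof (rule ccontr)
  assume ne: "?A x \<noteq> ?B x"
  define e where "e = \<bar>?A x - ?B x\<bar> / 2"
  have e: "e > 0" using ne by (simp add: e_def)
  have cont: "isCont ?A x" "isCont ?B x"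
    using smooth_on_continuous[OF smooth_on_frechet_derivative[OF smooth_on_frechet_derivative[OF S(2)]]] S(1,3)
    by (auto simp: continuous_on_eq_continuous_at)
  have "\<forall>\<^sub>F y in at x. dist (?A y) (?A x) < e" "\<forall>\<^sub>F y in at x. dist (?B y) (?B x) < e" 
    using cont e by (auto simp: isCont_def intro: tendstoD)
  moreover have "\<forall>\<^sub>F y in at x. y \<in> S" using S by (simp add: eventually_at_in_open')
  ultimately have "\<forall>\<^sub>F y in at x. dist (?A y) (?A x) < e \<and> dist (?B y) (?B x) < e \<and> y \<in> S"
    by eventually_elim auto
  then obtain \<delta> where \<delta>: "\<delta> > 0" "\<And>y. y \<noteq> x \<Longrightarrow> dist y x < \<delta> \<Longrightarrow> dist (?A y) (?A x) < e \<and> dist (?B y) (?B x) < e \<and> y \<in> S"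
    unfolding eventually_at by auto
  \<comment> \<open>The whole parallelogram then stays within \<open>\<delta> / 2\<close> of
    \<open>x\<close>; the summand 1 covers the case in which \<open>v\<close> and \<open>w\<close>
    both vanish.\<close>
  define d where "d = \<delta> / (2 * (norm v + norm w + 1))"
  have pos: "0 < norm v + norm w + 1" by (simp add: add_nonneg_pos)
  have d: "d > 0" unfolding d_def using \<delta>(1) pos by simp
  have near: "dist (x + s *\<^sub>R v + t *\<^sub>R w) x < \<delta>" if "0 \<le> s" "s \<le> d" "0 \<le> t" "t \<le> d" for s t
  proof -
    have "dist (x + s *\<^sub>R v + t *\<^sub>R w) x \<le> s * norm v + t * norm w"
      using norm_triangle_ineq[of "s *\<^sub>R v" "t *\<^sub>R w"] that by (simp add: dist_norm)
    also have "\<dots> \<le> d * norm v + d * norm w" using that by (intro add_mono mult_right_mono) auto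
    also have "\<dots> \<le> d * (norm v + norm w + 1)" using d by (simp add: algebra_simps)
    also have "\<dots> = \<delta> / 2" unfolding d_def times_divide_eq_left using pos by (subst frac_eq_eq) auto
    finally show ?thesis using \<delta>(1) by simp
  qed
  have near': "dist (x + s *\<^sub>R w + t *\<^sub>R v) x < \<delta>" if "0 \<le> s" "s \<le> d" "0 \<le> t" "t \<le> d" for s t
    using near[of t s] that by (simp add: ac_simps)
  have \<delta>': "dist (?A y) (?A x) < e \<and> dist (?B y) (?B x) < e \<and> y \<in> S" if "dist y x < \<delta>" for y
    using \<delta>(2)[of y] that e S(3) by (cases "y = x") auto
  obtain y1 where y1: "dist y1 x < \<delta>" "f (x + d *\<^sub>R v + d *\<^sub>R w) - f (x + d *\<^sub>R v) - f (x + d *\<^sub>R w) + f x = d\<^sup>2 * ?A y1"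
    by (rule second_difference_mean_value[OF S(1,2) d, of x v w]) (use near \<delta>' in blast)+
  obtain y2 where y2: "dist y2 x < \<delta>" "f (x + d *\<^sub>R w + d *\<^sub>R v) - f (x + d *\<^sub>R w) - f (x + d *\<^sub>R v) + f x = d\<^sup>2 * ?B y2"
    by (rule second_difference_mean_value[OF S(1,2) d, of x w v]) (use near' \<delta>' in blast)+
  have "d\<^sup>2 * ?A y1 = d\<^sup>2 * ?B y2" using y1(2) y2(2) by (simp add: algebra_simps)
  then have "?A y1 = ?B y2" using d by simp
  then have "\<bar>?A x - ?B x\<bar> < 2 * e" using \<delta>'[OF y1(1)] \<delta>'[OF y2(1)] by (auto simp: dist_real_def)
  then show False by (simp add: e_def)
qed

lemma frechet_derivative_symmetric:
  fixes f :: "'a::real_normed_vector \<Rightarrow> 'b::euclidean_space"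
  assumes S: "open S" "smooth_on S f" "x \<in> S"
  shows "frechet_derivative (\<lambda>y. frechet_derivative f (at y) v) (at x) w
       = frechet_derivative (\<lambda>y. frechet_derivative f (at y) w) (at x) v"
proof (rule euclidean_eqI)
  fix b :: 'b assume "b \<in> Basis"
  let ?g = "\<lambda>y. f y \<bullet> b"
  have g: "smooth_on S ?g" by (rule smooth_on_bounded_linear_comp[OF S(1) bounded_linear_inner_left S(2)])
  have 1: "frechet_derivative ?g (at y) u = frechet_derivative f (at y) u \<bullet> b" if "y \<in> S" for y u
    by (simp add: frechet_derivative_eqI[OF bounded_linear.has_derivative[OF bounded_linear_inner_left smooth_on_has_derivative[OF S(2) that]]])
  have 2: "frechet_derivative (\<lambda>y. frechet_derivative ?g (at y) u) (at x) u' = frechet_derivative (\<lambda>y. frechet_derivative f (at y) u) (at x) u' \<bullet> b" for u u'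
  proof -
    have "((\<lambda>y. frechet_derivative f (at y) u \<bullet> b) has_derivative (\<lambda>u'. frechet_derivative (\<lambda>y. frechet_derivative f (at y) u) (at x) u' \<bullet> b)) (at x)"
      by (rule bounded_linear.has_derivative[OF bounded_linear_inner_left smooth_on_has_derivative[OF smooth_on_frechet_derivative[OF S(2)] S(3)]])
    then have "((\<lambda>y. frechet_derivative ?g (at y) u) has_derivative (\<lambda>u'. frechet_derivative (\<lambda>y. frechet_derivative f (at y) u) (at x) u' \<bullet> b)) (at x)"
      by (rule has_derivative_transform_within_open[OF _ S(1,3)]) (simp add: 1)
    then show ?thesis by (simp add: frechet_derivative_eqI)
  qed
  show "frechet_derivative (\<lambda>y. frechet_derivative f (at y) v) (at x) w \<bullet> b
       = frechet_derivative (\<lambda>y. frechet_derivative f (at y) w) (at x) v \<bullet> b"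
    using frechet_derivative_symmetric_real[OF S(1) g S(3), of v w] by (simp add: 2)
qed

section \<open>Parameter integrals along rays\<close>

lemma continuous_on_ray:
  fixes \<pi> :: "'a::real_normed_vector \<Rightarrow> 'a"
  assumes "bounded_linear \<pi>" "continuous_on S g" "\<And>x \<tau>. x \<in> S \<Longrightarrow> \<tau> \<in> {0..1} \<Longrightarrow> x - (1 - \<tau>) *\<^sub>R \<pi> x \<in> S"
  shows "continuous_on (S \<times> {0..1::real}) (\<lambda>(x,\<tau>). g (x - (1 - \<tau>) *\<^sub>R \<pi> x))"
proof -
  have "continuous_on (S \<times> {0..1}) (\<lambda>p. fst p - (1 - snd p) *\<^sub>R \<pi> (fst p))"
    by (intro continuous_intros bounded_linear.continuous_on[OF assms(1)])
  then have "continuous_on (S \<times> {0..1}) (\<lambda>p. g (fst p - (1 - snd p) *\<^sub>R \<pi> (fst p)))"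
    by (rule continuous_on_compose2[OF assms(2)]) (use assms(3) in auto)
  then show ?thesis by (simp add: split_beta')
qed

context
  fixes \<pi> :: "'a::euclidean_space \<Rightarrow> 'a" and S :: "'a set"
  assumes \<pi>: "bounded_linear \<pi>" and S: "open S" "convex S"
    and ray: "\<And>x \<tau>. x \<in> S \<Longrightarrow> \<tau> \<in> {0..1} \<Longrightarrow> x - (1 - \<tau>) *\<^sub>R \<pi> x \<in> S"
begin

lemma integrable_ray:
  fixes g :: "'a \<Rightarrow> 'b::euclidean_space"
  assumes "continuous_on S g" "x \<in> S"
  shows "(\<lambda>\<tau>::real. \<tau> ^ m *\<^sub>R g (x - (1 - \<tau>) *\<^sub>R \<pi> x)) integrable_on {0..1}"
proof (intro integrable_continuous_real continuous_intros)
  show "continuous_on {0..1} (\<lambda>\<tau>. g (x - (1 - \<tau>) *\<^sub>R \<pi> x))"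
    by (rule continuous_on_compose2[OF assms(1)]) (use ray assms(2) in \<open>auto intro!: continuous_intros\<close>)
qed

lemma has_derivative_integral_ray:
  fixes f :: "'a \<Rightarrow> 'b::euclidean_space"
  assumes f: "Ck_on (Suc k) S f" and x: "x \<in> S"
  shows "((\<lambda>x. integral {0..1} (\<lambda>\<tau>. \<tau> ^ m *\<^sub>R f (x - (1 - \<tau>) *\<^sub>R \<pi> x))) has_derivative
    (\<lambda>v. integral {0..1} (\<lambda>\<tau>. \<tau> ^ m *\<^sub>R frechet_derivative f (at (x - (1 - \<tau>) *\<^sub>R \<pi> x)) (v - \<pi> v))
       + integral {0..1} (\<lambda>\<tau>. \<tau> ^ Suc m *\<^sub>R frechet_derivative f (at (x - (1 - \<tau>) *\<^sub>R \<pi> x)) (\<pi> v)))) (at x)"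
proof -
  interpret \<pi>: bounded_linear \<pi> by (rule \<pi>)
  let ?r = "\<lambda>x \<tau>. x - (1 - \<tau>) *\<^sub>R \<pi> x"
  let ?D = "\<lambda>x. frechet_derivative f (at x)"
  note F = Ck_on_SucD[OF f]
  have Dcont: "continuous_on S (\<lambda>x. ?D x v)" for v using F(2) Ck_on_continuous by blast
  define G where "G x \<tau> = Blinfun (\<lambda>v. \<tau> ^ m *\<^sub>R ?D (?r x \<tau>) (?r v \<tau>))" for x \<tau>
  have r: "((\<lambda>x. ?r x \<tau>) has_derivative (\<lambda>v. ?r v \<tau>)) (at x)" for x \<tau>
    by (intro derivative_intros \<pi>.has_derivative)
  have hd: "((\<lambda>x. \<tau> ^ m *\<^sub>R f (?r x \<tau>)) has_derivative (\<lambda>v. \<tau> ^ m *\<^sub>R ?D (?r x \<tau>) (?r v \<tau>))) (at x)"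
    if "x \<in> S" "\<tau> \<in> {0..1}" for x \<tau>
    using has_derivative_scaleR_right[OF diff_chain_at[OF r F(1)[OF ray[OF that]]], of "\<tau> ^ m"] by (simp add: o_def)
  have G: "blinfun_apply (G x \<tau>) = (\<lambda>v. \<tau> ^ m *\<^sub>R ?D (?r x \<tau>) (?r v \<tau>))" if "x \<in> S" "\<tau> \<in> {0..1}" for x \<tau>
    unfolding G_def using has_derivative_bounded_linear[OF hd[OF that]] by (rule bounded_linear_Blinfun_apply)
  have split: "\<tau> ^ m *\<^sub>R ?D (?r x \<tau>) (?r v \<tau>) = \<tau> ^ m *\<^sub>R ?D (?r x \<tau>) (v - \<pi> v) + \<tau> ^ Suc m *\<^sub>R ?D (?r x \<tau>) (\<pi> v)"
    if "x \<in> S" "\<tau> \<in> {0..1}" for x \<tau> v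
  proof -
    interpret D: bounded_linear "?D (?r x \<tau>)" using F(1)[OF ray[OF that]] by (rule has_derivative_bounded_linear)
    have "?r v \<tau> = (v - \<pi> v) + \<tau> *\<^sub>R \<pi> v" by (simp add: algebra_simps)
    then show ?thesis by (simp only: D.add D.scaleR) (simp add: scaleR_add_right mult.commute)
  qed
  have Gcont: "continuous_on (S \<times> cbox 0 1) (\<lambda>(x, \<tau>). G x \<tau>)"
    unfolding split_beta'
  proof (rule continuous_on_blinfun_componentwise)
    fix i :: 'a
    have c: "continuous_on (S \<times> {0..1}) (\<lambda>p. ?D (?r (fst p) (snd p)) v)" for v
      using continuous_on_ray[OF \<pi> Dcont ray, of v] by (simp add: split_beta')
    have "continuous_on (S \<times> {0..1}) (\<lambda>p. snd p ^ m *\<^sub>R ?D (?r (fst p) (snd p)) (i - \<pi> i) + snd p ^ Suc m *\<^sub>R ?D (?r (fst p) (snd p)) (\<pi> i))"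
      by (intro continuous_intros c)
    then show "continuous_on (S \<times> cbox 0 1) (\<lambda>p. blinfun_apply (G (fst p) (snd p)) i)"
      unfolding cbox_interval
      by (rule continuous_on_eq) (auto simp: G split)
  qed
  have "((\<lambda>x. integral (cbox 0 1) (\<lambda>\<tau>. \<tau> ^ m *\<^sub>R f (?r x \<tau>))) has_derivative integral (cbox 0 1) (G x)) (at x within S)"
  proof (rule leibniz_rule[OF _ _ Gcont x S(2)])
    show "((\<lambda>x. \<tau> ^ m *\<^sub>R f (?r x \<tau>)) has_derivative blinfun_apply (G x \<tau>)) (at x within S)" if "x \<in> S" "\<tau> \<in> cbox 0 1" for x \<tau>
      using hd[of x \<tau>] G[of x \<tau>] that by (auto intro: has_derivative_at_withinI)
    show "(\<lambda>\<tau>. \<tau> ^ m *\<^sub>R f (?r x \<tau>)) integrable_on cbox 0 1" if "x \<in> S" for x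
      using integrable_ray[OF Ck_on_continuous[OF f] that] by simp
  qed
  then have hd: "((\<lambda>x. integral {0..1} (\<lambda>\<tau>. \<tau> ^ m *\<^sub>R f (?r x \<tau>))) has_derivative integral {0..1} (G x)) (at x)"
    using at_within_open[OF x S(1)] by (simp add: cbox_interval)
  have "continuous_on {0..1} (G x)"
  proof -
    have "continuous_on {0..1} (\<lambda>\<tau>::real. (x, \<tau>))" by (intro continuous_intros)
    from continuous_on_compose2[OF Gcont this] x show ?thesis by auto
  qed
  then have int: "G x integrable_on {0..1}" by (rule integrable_continuous_real)
  have "blinfun_apply (integral {0..1} (G x)) v = integral {0..1} (\<lambda>\<tau>. \<tau> ^ m *\<^sub>R ?D (?r x \<tau>) (v - \<pi> v))
       + integral {0..1} (\<lambda>\<tau>. \<tau> ^ Suc m *\<^sub>R ?D (?r x \<tau>) (\<pi> v))" for v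
  proof -
    have "blinfun_apply (integral {0..1} (G x)) v = integral {0..1} (\<lambda>\<tau>. blinfun_apply (G x \<tau>) v)"
      by (rule blinfun_apply_integral[OF int])
    also have "\<dots> = integral {0..1} (\<lambda>\<tau>. \<tau> ^ m *\<^sub>R ?D (?r x \<tau>) (v - \<pi> v) + \<tau> ^ Suc m *\<^sub>R ?D (?r x \<tau>) (\<pi> v))"
      by (intro Henstock_Kurzweil_Integration.integral_cong) (use x in \<open>simp add: G split\<close>)
    also have "\<dots> = integral {0..1} (\<lambda>\<tau>. \<tau> ^ m *\<^sub>R ?D (?r x \<tau>) (v - \<pi> v))
       + integral {0..1} (\<lambda>\<tau>. \<tau> ^ Suc m *\<^sub>R ?D (?r x \<tau>) (\<pi> v))"
      by (intro Henstock_Kurzweil_Integration.integral_add integrable_ray Dcont x)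
    finally show ?thesis .
  qed
  then have "blinfun_apply (integral {0..1} (G x)) = (\<lambda>v. integral {0..1} (\<lambda>\<tau>. \<tau> ^ m *\<^sub>R ?D (?r x \<tau>) (v - \<pi> v))
       + integral {0..1} (\<lambda>\<tau>. \<tau> ^ Suc m *\<^sub>R ?D (?r x \<tau>) (\<pi> v)))" by (rule ext)
  then show ?thesis using hd by metis
qed

lemma Ck_on_integral_ray:
  fixes f :: "'a \<Rightarrow> 'b::euclidean_space"
  assumes f: "Ck_on k S f"
  shows "Ck_on k S (\<lambda>x. integral {0..1} (\<lambda>\<tau>. \<tau> ^ m *\<^sub>R f (x - (1 - \<tau>) *\<^sub>R \<pi> x)))"
  using f
proof (induction k arbitrary: f m)
  case 0
  have "continuous_on (S \<times> cbox 0 1) (\<lambda>(x, \<tau>::real). \<tau> ^ m *\<^sub>R f (x - (1 - \<tau>) *\<^sub>R \<pi> x))"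
    using continuous_on_ray[OF \<pi> _ ray, of f] 0 unfolding split_beta'
    by (auto intro!: continuous_intros)
  from integral_continuous_on_param[OF this] show ?case by simp
next
  case (Suc k)
  note F = Ck_on_SucD[OF Suc.prems]
  show ?case
    by (rule Ck_on_SucI[OF S(1) has_derivative_integral_ray[OF Suc.prems]])
      (assumption, intro Ck_on_add S(1) Suc.IH F(2))
qed

lemma smooth_on_integral_ray:
  fixes f :: "'a \<Rightarrow> 'b::euclidean_space"
  assumes "smooth_on S f"
  shows "smooth_on S (\<lambda>x. integral {0..1} (\<lambda>\<tau>. f (x - (1 - \<tau>) *\<^sub>R \<pi> x)))"
  using assms Ck_on_integral_ray[of _ f 0] unfolding smooth_on_def by simp

end

section \<open>Holomorphic functions of several variables\<close>

definition cvec :: "real^'d \<Rightarrow> complex^'d" where "cvec x = (\<chi> i. of_real (x $ i))"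

lemma cvec_nth [simp]: "cvec x $ i = of_real (x $ i)"
  by (simp add: cvec_def)

lemma norm_cvec [simp]: "norm (cvec x) = norm x"
  by (simp add: norm_vec_def)

lemma cvec_diff: "cvec (x - y) = cvec x - cvec y"
  by (simp add: vec_eq_iff)

lemma dist_cvec [simp]: "dist (cvec x) (cvec y) = dist x y"
  by (simp add: dist_norm flip: cvec_diff)

lemma bounded_linear_cvec: "bounded_linear cvec"
  by (rule bounded_linear_intro[where K=1]) (auto simp: vec_eq_iff scaleR_conv_of_real[where 'a=complex])

text \<open>Holomorphic maps are treated as smooth maps with complex linear derivative, so that smooth and
  analytic germs obey the same closure properties for the same reasons.\<close>

definition holo :: "(complex^'d) set \<Rightarrow> (complex^'d \<Rightarrow> complex) \<Rightarrow> bool" where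
  "holo S F \<longleftrightarrow> smooth_on S F \<and>
     (\<forall>z\<in>S. \<forall>v. frechet_derivative F (at z) (\<i> *s v) = \<i> * frechet_derivative F (at z) v)"

lemma holoI:
  assumes "smooth_on S F" "\<And>z. z \<in> S \<Longrightarrow> (F has_derivative D z) (at z)" "\<And>z v. z \<in> S \<Longrightarrow> D z (\<i> *s v) = \<i> * D z v"
  shows "holo S F"
  unfolding holo_def using assms(1,3) frechet_derivative_eqI[OF assms(2)] by simp

lemma holoD:
  assumes "holo S F"
  shows holo_smooth: "smooth_on S F"
    and holo_has_derivative: "z \<in> S \<Longrightarrow> (F has_derivative frechet_derivative F (at z)) (at z)"
    and holo_i: "z \<in> S \<Longrightarrow> frechet_derivative F (at z) (\<i> *s v) = \<i> * frechet_derivative F (at z) v"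
  using assms smooth_on_has_derivative unfolding holo_def by auto

lemma holo_subset: "holo S F \<Longrightarrow> T \<subseteq> S \<Longrightarrow> holo T F"
  unfolding holo_def using smooth_on_subset by blast

lemma vector_scalar_eq: "c *s v = Re c *\<^sub>R v + Im c *\<^sub>R (\<i> *s v)" for v :: "complex^'d"
  by (auto simp: vec_eq_iff complex_eq_iff)

lemma holo_scale:
  assumes "holo S F" "z \<in> S"
  shows "frechet_derivative F (at z) (c *s v) = c * frechet_derivative F (at z) v"
proof -
  interpret bounded_linear "frechet_derivative F (at z)"
    using holo_has_derivative[OF assms] by (rule has_derivative_bounded_linear)
  show ?thesis
    unfolding vector_scalar_eq[of c] add scaleR holo_i[OF assms]
    by (simp add: scaleR_conv_of_real complex_eq_iff)
qed

lemma holo_const: "open S \<Longrightarrow> holo S (\<lambda>z. c)"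
  by (rule holoI[where D="\<lambda>z v. 0"]) (auto intro: smooth_on_const)

lemma holo_nth: "open S \<Longrightarrow> holo S (\<lambda>z. z $ i)"
  by (rule holoI[where D="\<lambda>z v. v $ i"])
    (auto intro: smooth_on_bounded_linear bounded_linear_vec_nth bounded_linear_imp_has_derivative)

lemma holo_add:
  assumes "open S" "holo S F" "holo S G"
  shows "holo S (\<lambda>z. F z + G z)"
  by (rule holoI[OF smooth_on_add[OF assms(1) holo_smooth[OF assms(2)] holo_smooth[OF assms(3)]]])
    (auto intro!: derivative_eq_intros holo_has_derivative assms simp: holo_i[OF assms(2)] holo_i[OF assms(3)] algebra_simps)

lemma holo_mult:
  assumes "open S" "holo S F" "holo S G"
  shows "holo S (\<lambda>z. F z * G z)"
  by (rule holoI[OF smooth_on_bilinear[OF assms(1) bounded_bilinear_mult holo_smooth[OF assms(2)] holo_smooth[OF assms(3)]]])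
    (rule has_derivative_mult[OF holo_has_derivative[OF assms(2)] holo_has_derivative[OF assms(3)]],
      auto simp: holo_i[OF assms(2)] holo_i[OF assms(3)] algebra_simps)

lemma holo_inverse:
  assumes "open S" "holo S F" "\<And>z. z \<in> S \<Longrightarrow> F z \<noteq> 0"
  shows "holo S (\<lambda>z. inverse (F z))"
  by (rule holoI[OF smooth_on_inverse[OF assms(1) holo_smooth[OF assms(2)] assms(3)]])
    (assumption, rule Deriv.has_derivative_inverse[OF assms(3) holo_has_derivative[OF assms(2)]],
      auto simp: holo_i[OF assms(2)] algebra_simps)

lemma smooth_on_vec:
  fixes G :: "'a::real_normed_vector \<Rightarrow> 'b::euclidean_space^'m"
  assumes "open S" "\<And>j. smooth_on S (\<lambda>z. G z $ j)"
  shows "smooth_on S G"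
proof (rule smooth_on_componentwise[OF assms(1)])
  fix b :: "'b^'m" assume bB: "b \<in> Basis"
  obtain j c where b: "b = axis j c" "c \<in> Basis" using bB unfolding Basis_vec_def by blast
  show "smooth_on S (\<lambda>x. G x \<bullet> b)"
    unfolding b inner_axis
    by (rule smooth_on_bounded_linear_comp[OF assms(1) bounded_linear_inner_left assms(2)])
qed

lemma has_derivative_vecI:
  fixes G :: "'a::real_normed_vector \<Rightarrow> 'b::euclidean_space^'m"
  assumes "\<And>j. ((\<lambda>z. G z $ j) has_derivative (\<lambda>v. G' v $ j)) (at z)"
  shows "(G has_derivative G') (at z)"
proof -
  have "((\<lambda>x. G x \<bullet> b) has_derivative (\<lambda>v. G' v \<bullet> b)) (at z)" if bB: "b \<in> Basis" for b :: "'b^'m"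
  proof -
    obtain j c where b: "b = axis j c" "c \<in> Basis" using bB unfolding Basis_vec_def by blast
    show ?thesis
      unfolding b inner_axis by (rule bounded_linear.has_derivative[OF bounded_linear_inner_left assms])
  qed
  then show ?thesis by (subst has_derivative_componentwise_within) simp
qed

lemma holo_map:
  assumes "open S" "\<And>j. holo S (\<lambda>z. G z $ j)"
  shows holo_map_smooth: "smooth_on S G"
    and holo_map_i: "z \<in> S \<Longrightarrow> frechet_derivative G (at z) (\<i> *s v) = \<i> *s frechet_derivative G (at z) v"
proof -
  show "smooth_on S G" by (rule smooth_on_vec[OF assms(1) holo_smooth[OF assms(2)]])
  assume z: "z \<in> S"
  have "(G has_derivative (\<lambda>v. \<chi> j. frechet_derivative (\<lambda>z. G z $ j) (at z) v)) (at z)"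
    by (rule has_derivative_vecI) (use holo_has_derivative[OF assms(2) z] in simp)
  then have "frechet_derivative G (at z) = (\<lambda>v. \<chi> j. frechet_derivative (\<lambda>z. G z $ j) (at z) v)"
    by (rule frechet_derivative_eqI)
  then show "frechet_derivative G (at z) (\<i> *s v) = \<i> *s frechet_derivative G (at z) v"
    by (simp add: vec_eq_iff holo_i[OF assms(2) z])
qed

lemma holo_mapI:
  assumes S: "open S" "smooth_on S G"
    and i: "\<And>z v. z \<in> S \<Longrightarrow> frechet_derivative G (at z) (\<i> *s v) = \<i> *s frechet_derivative G (at z) v"
  shows "holo S (\<lambda>z. G z $ j)"
  by (rule holoI[OF smooth_on_bounded_linear_comp[OF S(1) bounded_linear_vec_nth S(2)]])
   (rule bounded_linear.has_derivative[OF bounded_linear_vec_nth smooth_on_has_derivative[OF S(2)]], auto simp: i)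

lemma holo_compose:
  assumes S: "open S" "\<And>j. holo S (\<lambda>z. G z $ j)" and F: "holo T F" and sub: "G ` S \<subseteq> T"
  shows "holo S (\<lambda>z. F (G z))"
proof (rule holoI[OF smooth_on_compose[OF S(1) holo_map_smooth[OF S] holo_smooth[OF F] sub]])
  fix z assume z: "z \<in> S"
  then have Gz: "G z \<in> T" using sub by auto
  show "((\<lambda>z. F (G z)) has_derivative (\<lambda>v. frechet_derivative F (at (G z)) (frechet_derivative G (at z) v))) (at z)"
    using diff_chain_at[OF smooth_on_has_derivative[OF holo_map_smooth[OF S] z] holo_has_derivative[OF F Gz]]
    by (simp add: o_def)
  show "frechet_derivative F (at (G z)) (frechet_derivative G (at z) (\<i> *s v))
      = \<i> * frechet_derivative F (at (G z)) (frechet_derivative G (at z) v)" for v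
    by (simp add: holo_map_i[OF S z] holo_i[OF F Gz])
qed

text \<open>Second derivatives commute: after exchanging the two directions, the factor i is pulled
  out of the inner derivative.\<close>

lemma holo_frechet_derivative:
  assumes S: "open S" and F: "holo S F"
  shows "holo S (\<lambda>z. frechet_derivative F (at z) v)"
proof (rule holoI[OF smooth_on_frechet_derivative[OF holo_smooth[OF F]]
      smooth_on_has_derivative[OF smooth_on_frechet_derivative[OF holo_smooth[OF F]]]])
  fix z w assume z: "z \<in> S"
  note sym = frechet_derivative_symmetric[OF S holo_smooth[OF F] z, of v]
  have "((\<lambda>y. \<i> * frechet_derivative F (at y) w) has_derivative (\<lambda>u. \<i> * frechet_derivative (\<lambda>y. frechet_derivative F (at y) w) (at z) u)) (at z)"
    by (intro derivative_intros smooth_on_has_derivative[OF smooth_on_frechet_derivative[OF holo_smooth[OF F]] z])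
  then have "((\<lambda>y. frechet_derivative F (at y) (\<i> *s w)) has_derivative (\<lambda>u. \<i> * frechet_derivative (\<lambda>y. frechet_derivative F (at y) w) (at z) u)) (at z)"
    by (rule has_derivative_transform_within_open[OF _ S z]) (simp add: holo_i[OF F])
  then show "frechet_derivative (\<lambda>z. frechet_derivative F (at z) v) (at z) (\<i> *s w) =
     \<i> * frechet_derivative (\<lambda>z. frechet_derivative F (at z) v) (at z) w"
    unfolding sym by (simp add: frechet_derivative_eqI)
qed

text \<open>As \<open>\<pi>\<close> is complex linear, so is the splitting of a direction into its
  two parts, and both integrals in the derivative commute with multiplication by i.\<close>

lemma holo_integral_ray:
  fixes F :: "complex^'d \<Rightarrow> complex"
  assumes \<pi>: "bounded_linear \<pi>" "\<And>v. \<pi> (\<i> *s v) = \<i> *s \<pi> v" and S: "open S" "convex S"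
    and ray: "\<And>x \<tau>. x \<in> S \<Longrightarrow> \<tau> \<in> {0..1::real} \<Longrightarrow> x - (1 - \<tau>) *\<^sub>R \<pi> x \<in> S" and F: "holo S F"
  shows "holo S (\<lambda>x. integral {0..1} (\<lambda>\<tau>. F (x - (1 - \<tau>) *\<^sub>R \<pi> x)))"
proof -
  have F1: "Ck_on (Suc 0) S F" using holo_smooth[OF F] unfolding smooth_on_def by blast
  have h: "((\<lambda>x. integral {0..1} (\<lambda>\<tau>. F (x - (1 - \<tau>) *\<^sub>R \<pi> x))) has_derivative
    (\<lambda>v. integral {0..1} (\<lambda>\<tau>. \<tau> ^ 0 *\<^sub>R frechet_derivative F (at (x - (1 - \<tau>) *\<^sub>R \<pi> x)) (v - \<pi> v))
       + integral {0..1} (\<lambda>\<tau>. \<tau> ^ Suc 0 *\<^sub>R frechet_derivative F (at (x - (1 - \<tau>) *\<^sub>R \<pi> x)) (\<pi> v)))) (at x)" if "x \<in> S" for x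
    using has_derivative_integral_ray[OF \<pi>(1) S ray F1 that, of 0] by simp
  have I: "integral {0..1} (\<lambda>\<tau>::real. \<tau> ^ m *\<^sub>R frechet_derivative F (at (x - (1 - \<tau>) *\<^sub>R \<pi> x)) (\<i> *s w))
    = \<i> * integral {0..1} (\<lambda>\<tau>. \<tau> ^ m *\<^sub>R frechet_derivative F (at (x - (1 - \<tau>) *\<^sub>R \<pi> x)) w)" if "x \<in> S" for x w m
  proof -
    have "integral {0..1} (\<lambda>\<tau>::real. \<tau> ^ m *\<^sub>R frechet_derivative F (at (x - (1 - \<tau>) *\<^sub>R \<pi> x)) (\<i> *s w))
      = integral {0..1} (\<lambda>\<tau>. \<i> * (\<tau> ^ m *\<^sub>R frechet_derivative F (at (x - (1 - \<tau>) *\<^sub>R \<pi> x)) w))"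
      by (intro Henstock_Kurzweil_Integration.integral_cong) (use that ray in \<open>simp add: holo_i[OF F]\<close>)
    then show ?thesis unfolding Henstock_Kurzweil_Integration.integral_mult_right .
  qed
  show ?thesis
  proof (rule holoI[OF smooth_on_integral_ray[OF \<pi>(1) S ray holo_smooth[OF F]] h])
    fix z v assume z: "z \<in> S"
    have e: "\<i> *s v - \<pi> (\<i> *s v) = \<i> *s (v - \<pi> v)" by (simp add: \<pi>(2) vec_eq_iff algebra_simps)
    show "integral {0..1} (\<lambda>\<tau>. \<tau> ^ 0 *\<^sub>R frechet_derivative F (at (z - (1 - \<tau>) *\<^sub>R \<pi> z)) (\<i> *s v - \<pi> (\<i> *s v)))
       + integral {0..1} (\<lambda>\<tau>. \<tau> ^ Suc 0 *\<^sub>R frechet_derivative F (at (z - (1 - \<tau>) *\<^sub>R \<pi> z)) (\<pi> (\<i> *s v))) =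
      \<i> * (integral {0..1} (\<lambda>\<tau>. \<tau> ^ 0 *\<^sub>R frechet_derivative F (at (z - (1 - \<tau>) *\<^sub>R \<pi> z)) (v - \<pi> v))
       + integral {0..1} (\<lambda>\<tau>. \<tau> ^ Suc 0 *\<^sub>R frechet_derivative F (at (z - (1 - \<tau>) *\<^sub>R \<pi> z)) (\<pi> v)))"
      unfolding e unfolding \<pi>(2)[of v] I[OF z] by (simp only: distrib_left)
  qed
qed

lemma holo_affine:
  assumes "open S" "holo T F" "\<And>z. z \<in> S \<Longrightarrow> z + c \<in> T"
  shows "holo S (\<lambda>z. F (z + c))"
  by (rule holo_compose[OF assms(1) _ assms(2)])
    (use assms in \<open>auto intro!: holo_add holo_nth holo_const\<close>)

section \<open>Power series expansion of holomorphic functions\<close>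

definition polydisc :: "real \<Rightarrow> (complex^'d) set" where "polydisc R = {z. \<forall>i. norm (z $ i) < R}"

lemma open_polydisc: "open (polydisc R)"
proof -
  have "polydisc R = (\<Inter>i\<in>UNIV. {z. norm (z $ i) < R})" by (auto simp: polydisc_def)
  moreover have "open {z::complex^'d. norm (z $ i) < R}" for i
    by (intro open_Collect_less continuous_intros)
  ultimately show ?thesis by (metis (no_types, lifting) finite open_INT)
qed

definition vupd :: "complex^'d \<Rightarrow> 'd \<Rightarrow> complex \<Rightarrow> complex^'d" where
  "vupd z j w = (\<chi> k. if k = j then w else z $ k)"

lemma vupd_nth: "vupd z j w $ k = (if k = j then w else z $ k)"
  by (simp add: vupd_def)

lemma vupd_polydisc: "z \<in> polydisc R \<Longrightarrow> norm w < R \<Longrightarrow> vupd z j w \<in> polydisc R"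
  by (auto simp: polydisc_def vupd_nth)

text \<open>The multi-indices supported in \<open>I\<close>: power series are built up one variable at a time.\<close>

definition midx :: "'d set \<Rightarrow> ('d \<Rightarrow> nat) set" where "midx I = {\<alpha>. \<forall>i. i \<notin> I \<longrightarrow> \<alpha> i = 0}"

text \<open>A multi-index on \<open>insert j I\<close> is one on \<open>I\<close> together with the
  exponent of \<open>j\<close>. This reindexing underlies every expansion in one further
  variable.\<close>

lemma has_sum_midx_insert:
  assumes "j \<notin> I"
  shows "((\<lambda>(\<alpha>,k). f (\<alpha>(j := k))) has_sum s) (midx I \<times> UNIV) \<longleftrightarrow> (f has_sum s) (midx (insert j I))"
  by (rule has_sum_reindex_bij_witness[where i="\<lambda>\<beta>. (\<beta>(j := 0), \<beta> j)" and j="\<lambda>(\<alpha>,k). \<alpha>(j := k)"])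
    (use assms in \<open>auto simp: midx_def fun_eq_iff\<close>)

lemma summable_on_geometric_midx:
  fixes q :: "'d \<Rightarrow> real"
  assumes "finite I" "\<And>i. i \<in> I \<Longrightarrow> 0 \<le> q i" "\<And>i. i \<in> I \<Longrightarrow> q i < 1"
  shows "(\<lambda>\<alpha>. \<Prod>i\<in>I. q i ^ \<alpha> i) summable_on midx I"
  using assms
proof (induction I rule: finite_induct)
  case empty
  have "midx {} = {\<lambda>i::'d. 0}" by (auto simp: midx_def)
  then show ?case by simp
next
  case (insert j I)
  let ?g = "\<lambda>\<alpha>. \<Prod>i\<in>I. q i ^ \<alpha> i"
  have "(\<lambda>(\<alpha>,k). ?g \<alpha> * q j ^ k) summable_on midx I \<times> UNIV"
  proof (rule summable_on_SigmaI)
    show "((\<lambda>k. (case (\<alpha>, k) of (\<alpha>, k) \<Rightarrow> ?g \<alpha> * q j ^ k)) has_sum ?g \<alpha> * (1 / (1 - q j))) UNIV" for \<alpha>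
    proof -
      have "((\<lambda>k. q j ^ k) has_sum (1 / (1 - q j))) UNIV"
        by (rule sums_nonneg_imp_has_sum[OF geometric_sums]) (use insert.prems in auto)
      then have "((\<lambda>k. ?g \<alpha> * q j ^ k) has_sum ?g \<alpha> * (1 / (1 - q j))) UNIV" by (rule has_sum_cmult_right)
      then show ?thesis by simp
    qed
    show "(\<lambda>\<alpha>. ?g \<alpha> * (1 / (1 - q j))) summable_on midx I"
      by (rule summable_on_cmult_left) (use insert in auto)
    show "0 \<le> (case (\<alpha>, k) of (\<alpha>, k) \<Rightarrow> ?g \<alpha> * q j ^ k)" for \<alpha> k
      using insert.prems by (auto intro!: mult_nonneg_nonneg prod_nonneg)
  qed
  then obtain s where s: "((\<lambda>(\<alpha>,k). ?g \<alpha> * q j ^ k) has_sum s) (midx I \<times> UNIV)"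
    by (auto simp: summable_on_def)
  have e: "(\<Prod>i\<in>I. q i ^ ((\<alpha>(j := k)) i)) = ?g \<alpha>" for \<alpha> k
    using insert.hyps by (intro prod.cong) auto
  have "(\<lambda>(\<alpha>,k). ?g \<alpha> * q j ^ k) = (\<lambda>(\<alpha>,k). \<Prod>i\<in>insert j I. q i ^ ((\<alpha>(j := k)) i))"
    by (simp only: prod.insert[OF insert.hyps] e fun_upd_same mult.commute)
  with s show ?case
    using has_sum_midx_insert[OF insert.hyps(2), of "\<lambda>\<alpha>. \<Prod>i\<in>insert j I. q i ^ \<alpha> i" s] by (auto simp: summable_on_def)
qed

definition pd :: "'d \<Rightarrow> (complex^'d \<Rightarrow> complex) \<Rightarrow> complex^'d \<Rightarrow> complex" where
  "pd j F z = frechet_derivative F (at z) (axis j 1)"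

lemma holo_pd: "open S \<Longrightarrow> holo S F \<Longrightarrow> holo S ((pd j ^^ k) F)"
  by (induction k) (auto simp: pd_def[abs_def] intro: holo_frechet_derivative)

text \<open>Freezing all coordinates but one reduces to Cauchy's theory in one variable; complex
  linearity turns the real derivative into a complex one.\<close>

lemma slice_derivative:
  fixes F :: "complex^'d \<Rightarrow> complex"
  assumes F: "holo (polydisc R) F" and z: "z \<in> polydisc R" and w: "norm w < R"
  shows "((\<lambda>\<zeta>. F (vupd z j \<zeta>)) has_field_derivative pd j F (vupd z j w)) (at w)"
proof -
  have v: "vupd z j = (\<lambda>\<zeta>. vupd z j 0 + \<zeta> *s axis j 1)"
    by (auto simp: fun_eq_iff vec_eq_iff vupd_nth axis_def)
  have "((\<lambda>\<zeta>::complex. \<zeta> *s (axis j 1 :: complex^'d)) has_derivative (\<lambda>h. h *s axis j 1)) (at w)"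
    by (rule has_derivative_vecI) (auto simp: axis_def intro!: derivative_eq_intros)
  then have "((\<lambda>\<zeta>. vupd z j 0 + \<zeta> *s axis j 1) has_derivative (\<lambda>h. 0 + h *s axis j 1)) (at w)"
    by (rule has_derivative_add[OF has_derivative_const])
  then have "(vupd z j has_derivative (\<lambda>h. h *s axis j 1)) (at w)"
    by (simp flip: v)
  from diff_chain_at[OF this holo_has_derivative[OF F vupd_polydisc[OF z w]]]
  show ?thesis
    unfolding has_field_derivative_def pd_def
    by (simp add: o_def holo_scale[OF F vupd_polydisc[OF z w]] mult_commute_abs)
qed

lemma slice_higher_deriv:
  assumes F: "holo (polydisc R) F" and z: "z \<in> polydisc R" and w: "norm w < R"
  shows "(deriv ^^ k) (\<lambda>\<zeta>. F (vupd z j \<zeta>)) w = (pd j ^^ k) F (vupd z j w)"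
  using w
proof (induction k arbitrary: w)
  case (Suc k)
  have "((\<lambda>\<zeta>. (pd j ^^ k) F (vupd z j \<zeta>)) has_field_derivative pd j ((pd j ^^ k) F) (vupd z j w)) (at w)"
    by (rule slice_derivative[OF holo_pd[OF open_polydisc F] z Suc.prems])
  then have "((deriv ^^ k) (\<lambda>\<zeta>. F (vupd z j \<zeta>)) has_field_derivative pd j ((pd j ^^ k) F) (vupd z j w)) (at w)"
    by (rule has_field_derivative_transform_within_open[OF _ open_ball[of 0 R]])
      (use Suc in auto)
  then show ?case by (simp add: DERIV_imp_deriv)
qed simp

lemma slice_holomorphic:
  assumes F: "holo (polydisc R) F" and z: "z \<in> polydisc R"
  shows "(\<lambda>\<zeta>. F (vupd z j \<zeta>)) holomorphic_on ball 0 R"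
  unfolding holomorphic_on_open[OF open_ball] by (auto intro!: exI slice_derivative[OF F z])

lemma holo_vupd0:
  assumes F: "holo (polydisc R) F" and R: "0 < R"
  shows "holo (polydisc R) (\<lambda>z. F (vupd z j 0))"
proof (rule holo_compose[OF open_polydisc _ F])
  show "holo (polydisc R) (\<lambda>z. vupd z j 0 $ k)" for k
    by (cases "k = j") (auto simp: vupd_nth intro: holo_nth holo_const open_polydisc)
qed (use R vupd_polydisc[of _ R 0 j] in auto)

text \<open>Cauchy's estimate on the circle of radius \<open>r\<close> in the variable
  \<open>j\<close>. It is uniform in the other coordinates, so the coefficient is again a bounded
  function and the estimate can be iterated.\<close>

lemma slice_coeff_bound:
  assumes F: "holo (polydisc R) F" and r: "0 < r" "r < R" and z: "z \<in> polydisc R"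
    and M: "\<And>z. z \<in> polydisc R \<Longrightarrow> norm (F z) \<le> M"
  shows "norm ((pd j ^^ k) F (vupd z j 0) / fact k) \<le> M / r ^ k"
proof -
  let ?g = "\<lambda>\<zeta>. F (vupd z j \<zeta>)"
  note h = slice_holomorphic[OF F z, of j]
  have "norm ((deriv ^^ k) ?g 0) \<le> fact k * M / r ^ k"
  proof (rule Cauchy_inequality)
    show "?g holomorphic_on ball 0 r" by (rule holomorphic_on_subset[OF h]) (use r in auto)
    show "continuous_on (cball 0 r) ?g"
      by (rule continuous_on_subset[OF holomorphic_on_imp_continuous_on[OF h]]) (use r in auto)
    show "norm (?g x) \<le> M" if "norm (0 - x) = r" for x
      using that r by (intro M vupd_polydisc[OF z]) auto
  qed (use r in auto)
  then have "norm ((pd j ^^ k) F (vupd z j 0)) \<le> fact k * M / r ^ k"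
    using slice_higher_deriv[OF F z, of 0 k j] r by simp
  from divide_right_mono[OF this, of "fact k"] show ?thesis by (simp add: norm_divide)
qed

lemma slice_expansion:
  assumes F: "holo (polydisc R) F" and r: "0 < r" "r < R" and z: "z \<in> polydisc r"
    and M: "\<And>z. z \<in> polydisc R \<Longrightarrow> norm (F z) \<le> M"
  shows "((\<lambda>k. (pd j ^^ k) F (vupd z j 0) / fact k * (z $ j) ^ k) has_sum F z) UNIV"
proof -
  have zR: "z \<in> polydisc R" using z r unfolding polydisc_def by (auto intro: less_trans)
  have zj: "norm (z $ j) < r" using z by (simp add: polydisc_def)
  have M0: "0 \<le> M" using M[OF zR] norm_ge_zero order_trans by blast
  have v: "vupd z j (z $ j) = z" by (simp add: vec_eq_iff vupd_nth)
  have "(\<lambda>k. (deriv ^^ k) (\<lambda>\<zeta>. F (vupd z j \<zeta>)) 0 / fact k * (z $ j - 0) ^ k) sums F (vupd z j (z $ j))"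
    by (rule holomorphic_power_series[OF slice_holomorphic[OF F zR]]) (use zj r in simp)
  then have s: "(\<lambda>k. (pd j ^^ k) F (vupd z j 0) / fact k * (z $ j) ^ k) sums F z"
    using slice_higher_deriv[OF F zR, of 0 _ j] r by (simp add: v)
  show ?thesis
  proof (rule norm_summable_imp_has_sum[OF _ s])
    show "summable (\<lambda>k. norm ((pd j ^^ k) F (vupd z j 0) / fact k * (z $ j) ^ k))"
    proof (rule summable_comparison_test)
      show "summable (\<lambda>k. M * (norm (z $ j) / r) ^ k)"
        using zj r by (intro summable_mult summable_geometric) simp
      have "norm ((pd j ^^ k) F (vupd z j 0) / fact k * (z $ j) ^ k) \<le> M / r ^ k * norm (z $ j) ^ k" for k
        unfolding norm_mult norm_power by (intro mult_right_mono slice_coeff_bound[OF F r zR M]) auto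
      then show "\<exists>N. \<forall>n\<ge>N. norm (norm ((pd j ^^ n) F (vupd z j 0) / fact n * (z $ j) ^ n)) \<le> M * (norm (z $ j) / r) ^ n"
        by (simp add: power_divide)
    qed
  qed
qed

text \<open>One variable is expanded at a time. The coefficients stay holomorphic on the full
  polydisc, do not depend on the variables already expanded and obey Cauchy's bound. The bound
  allows comparison with a product of geometric series, so the sum over all multi-indices converges
  absolutely and iterated sums may be merged.\<close>

lemma polydisc_expansion:
  fixes F :: "complex^'d \<Rightarrow> complex"
  assumes I: "finite I" and F: "holo (polydisc R) F" and r: "0 < r" "r < R"
    and M: "\<And>z. z \<in> polydisc R \<Longrightarrow> norm (F z) \<le> M"
  shows "\<exists>c :: ('d \<Rightarrow> nat) \<Rightarrow> complex^'d \<Rightarrow> complex. (\<forall>\<alpha>. holo (polydisc R) (c \<alpha>)) \<and>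
    (\<forall>\<alpha>. \<forall>z\<in>polydisc R. norm (c \<alpha> z) \<le> M / (\<Prod>i\<in>I. r ^ \<alpha> i)) \<and>
    (\<forall>\<alpha> z z'. (\<forall>i. i \<notin> I \<longrightarrow> z $ i = z' $ i) \<longrightarrow> z \<in> polydisc R \<longrightarrow> z' \<in> polydisc R \<longrightarrow> c \<alpha> z = c \<alpha> z') \<and>
    (\<forall>z\<in>polydisc r. ((\<lambda>\<alpha>. c \<alpha> z * (\<Prod>i\<in>I. z $ i ^ \<alpha> i)) has_sum F z) (midx I))"
  using I
proof (induction I rule: finite_induct)
  case empty
  have "midx {} = {\<lambda>i::'d. 0}" by (auto simp: midx_def)
  then show ?case using F M has_sum_finite[of "{\<lambda>i::'d. 0::nat}"]
    by (intro exI[of _ "\<lambda>\<alpha>. F"]) (auto simp: vec_eq_iff[symmetric])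
next
  case (insert j I)
  then obtain c where c: "\<And>\<alpha>. holo (polydisc R) (c \<alpha>)"
    and cM: "\<And>\<alpha> z. z \<in> polydisc R \<Longrightarrow> norm (c \<alpha> z) \<le> M / (\<Prod>i\<in>I. r ^ \<alpha> i)"
    and cI: "\<And>\<alpha> z z'. (\<And>i. i \<notin> I \<Longrightarrow> z $ i = z' $ i) \<Longrightarrow> z \<in> polydisc R \<Longrightarrow> z' \<in> polydisc R \<Longrightarrow> c \<alpha> z = c \<alpha> z'"
    and cs: "\<And>z. z \<in> polydisc r \<Longrightarrow> ((\<lambda>\<alpha>. c \<alpha> z * (\<Prod>i\<in>I. z $ i ^ \<alpha> i)) has_sum F z) (midx I)"
    by blast
  have R: "0 < R" using r by simp
  \<comment> \<open>The Taylor coefficient of order \<open>\<alpha> j\<close> in the new variable,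
    taken of the coefficient that belongs to the other exponents; \<open>\<alpha>(j := 0)\<close>
    strips the new exponent.\<close>
  define c' where "c' \<alpha> z = (pd j ^^ \<alpha> j) (c (\<alpha>(j := 0))) (vupd z j 0) / fact (\<alpha> j)" for \<alpha> z
  have prodI: "(\<Prod>i\<in>I. f i ((\<alpha>(j := k)) i)) = (\<Prod>i\<in>I. f i (\<alpha> i))" for f :: "'d \<Rightarrow> nat \<Rightarrow> 'b::comm_monoid_mult" and \<alpha> k
    using insert.hyps by (auto intro!: prod.cong)
  have 1: "holo (polydisc R) (c' \<alpha>)" for \<alpha>
    unfolding c'_def[abs_def] divide_inverse
    by (intro holo_mult open_polydisc holo_const holo_vupd0 holo_pd c R)
  have 2: "norm (c' \<alpha> z) \<le> M / (\<Prod>i\<in>insert j I. r ^ \<alpha> i)" if z: "z \<in> polydisc R" for \<alpha> z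
  proof -
    have "norm (c' \<alpha> z) \<le> (M / (\<Prod>i\<in>I. r ^ (\<alpha>(j := 0)) i)) / r ^ \<alpha> j"
      unfolding c'_def by (rule slice_coeff_bound[OF c r z cM])
    also have "\<dots> = M / (\<Prod>i\<in>insert j I. r ^ \<alpha> i)"
      using insert.hyps prodI[of "\<lambda>i k. r ^ k" \<alpha> 0] by (simp add: mult.commute)
    finally show ?thesis .
  qed
  have 3: "c' \<alpha> z = c' \<alpha> z'" if "\<And>i. i \<notin> insert j I \<Longrightarrow> z $ i = z' $ i" and z: "z \<in> polydisc R" "z' \<in> polydisc R" for \<alpha> z z'
  proof -
    have eq: "c \<beta> (vupd z j w) = c \<beta> (vupd z' j w)" if "norm w < R" for \<beta> w
      by (rule cI) (use \<open>\<And>i. i \<notin> insert j I \<Longrightarrow> z $ i = z' $ i\<close> that z in \<open>auto simp: vupd_nth intro: vupd_polydisc\<close>)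
    have "(deriv ^^ k) (\<lambda>\<zeta>. c \<beta> (vupd z j \<zeta>)) 0 = (deriv ^^ k) (\<lambda>\<zeta>. c \<beta> (vupd z' j \<zeta>)) 0" for k \<beta>
      by (rule higher_deriv_cong_ev) (use R eq in \<open>auto simp: eventually_nhds_metric\<close>)
    then have "(pd j ^^ k) (c \<beta>) (vupd z j 0) = (pd j ^^ k) (c \<beta>) (vupd z' j 0)" for k \<beta>
      using slice_higher_deriv[OF c z(1), where w=0 and k=k and j=j, of \<beta>]
        slice_higher_deriv[OF c z(2), where w=0 and k=k and j=j, of \<beta>] R by simp
    then show ?thesis by (simp add: c'_def)
  qed
  have 4: "((\<lambda>\<alpha>. c' \<alpha> z * (\<Prod>i\<in>insert j I. z $ i ^ \<alpha> i)) has_sum F z) (midx (insert j I))" if z: "z \<in> polydisc r" for z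
  proof -
    have zR: "z \<in> polydisc R" using z r unfolding polydisc_def by (auto intro: less_trans)
    have M0: "0 \<le> M" using M[OF zR] norm_ge_zero order_trans by blast
    have zi: "norm (z $ i) < r" for i using z by (simp add: polydisc_def)
    let ?f = "\<lambda>\<alpha>. c' \<alpha> z * (\<Prod>i\<in>insert j I. z $ i ^ \<alpha> i)"
    have "((\<lambda>(\<alpha>,k). ?f (\<alpha>(j := k))) has_sum F z) (midx I \<times> UNIV)"
    proof (rule has_sum_SigmaI)
      show "((\<lambda>\<alpha>. c \<alpha> z * (\<Prod>i\<in>I. z $ i ^ \<alpha> i)) has_sum F z) (midx I)" by (rule cs[OF z])
      show "((\<lambda>k. (case (\<alpha>, k) of (\<alpha>, k) \<Rightarrow> ?f (\<alpha>(j := k)))) has_sum c \<alpha> z * (\<Prod>i\<in>I. z $ i ^ \<alpha> i)) UNIV"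
        if \<alpha>: "\<alpha> \<in> midx I" for \<alpha>
      proof -
        have \<alpha>j: "\<alpha>(j := 0) = \<alpha>" using \<alpha> insert.hyps by (auto simp: midx_def)
        have "((\<lambda>k. (pd j ^^ k) (c \<alpha>) (vupd z j 0) / fact k * z $ j ^ k * (\<Prod>i\<in>I. z $ i ^ \<alpha> i)) has_sum c \<alpha> z * (\<Prod>i\<in>I. z $ i ^ \<alpha> i)) UNIV"
          by (rule has_sum_cmult_left[OF slice_expansion[OF c r z cM]])
        moreover have "(case (\<alpha>, k) of (\<alpha>, k) \<Rightarrow> ?f (\<alpha>(j := k)))
          = (pd j ^^ k) (c \<alpha>) (vupd z j 0) / fact k * z $ j ^ k * (\<Prod>i\<in>I. z $ i ^ \<alpha> i)" for k
          by (simp only: c'_def case_prod_conv \<alpha>j fun_upd_upd fun_upd_same prod.insert[OF insert.hyps] prodI[of "\<lambda>i k. z $ i ^ k"] mult.assoc)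
        ultimately show ?thesis by simp
      qed
      \<comment> \<open>Absolute summability over the enlarged index set is what allows the inner
        sums over \<open>k\<close> to be combined with the outer sum.\<close>
      have "(\<lambda>\<alpha>. norm (?f \<alpha>)) summable_on midx (insert j I)"
      proof (rule Infinite_Sum.abs_summable_on_comparison_test)
        have "(\<lambda>\<alpha>. M * (\<Prod>i\<in>insert j I. (norm (z $ i) / r) ^ \<alpha> i)) summable_on midx (insert j I)"
          using zi r insert.hyps by (intro summable_on_cmult_right summable_on_geometric_midx) auto
        then show "(\<lambda>\<alpha>. norm (M * (\<Prod>i\<in>insert j I. (norm (z $ i) / r) ^ \<alpha> i))) summable_on midx (insert j I)"
          by (rule summable_on_iff_abs_summable_on_real[THEN iffD1])
        fix \<alpha>
        have "norm (?f \<alpha>) \<le> M / (\<Prod>i\<in>insert j I. r ^ \<alpha> i) * (\<Prod>i\<in>insert j I. norm (z $ i) ^ \<alpha> i)"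
          unfolding norm_mult prod_norm[symmetric] norm_power
          by (intro mult_right_mono 2[OF zR] prod_nonneg) auto
        also have "\<dots> = M * (\<Prod>i\<in>insert j I. (norm (z $ i) / r) ^ \<alpha> i)"
          by (simp only: power_divide prod_dividef) (simp add: field_simps)
        finally show "norm (?f \<alpha>) \<le> norm (M * (\<Prod>i\<in>insert j I. (norm (z $ i) / r) ^ \<alpha> i))" by simp
      qed
      then have "?f summable_on midx (insert j I)" by (rule Infinite_Sum.abs_summable_summable)
      then show "(\<lambda>(\<alpha>,k). ?f (\<alpha>(j := k))) summable_on midx I \<times> UNIV"
        unfolding summable_on_def using has_sum_midx_insert[OF insert.hyps(2), of ?f] by auto
    qed
    then show ?thesis using has_sum_midx_insert[OF insert.hyps(2), of ?f] by simp
  qed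
  show ?case
    by (rule exI[of _ c']) (use 1 2 3 4 in blast)
qed

lemma ball_polydisc: "0 < e \<Longrightarrow> z \<in> polydisc (e / (2 * CARD('d))) \<Longrightarrow> norm (z :: complex^'d) \<le> e / 2"
proof -
  assume e: "0 < e" and z: "z \<in> polydisc (e / (2 * CARD('d)))"
  have "norm z \<le> (\<Sum>i\<in>UNIV. norm (z $ i))" unfolding norm_vec_def by (rule L2_set_le_sum) simp
  also have "\<dots> \<le> (\<Sum>i\<in>(UNIV::'d set). e / (2 * CARD('d)))"
    using z by (intro sum_mono) (auto simp: polydisc_def intro: less_imp_le)
  finally show ?thesis by simp
qed

lemma polydisc_mono: "z \<in> polydisc a \<Longrightarrow> a \<le> b \<Longrightarrow> z \<in> polydisc b"
  unfolding polydisc_def by (auto intro: less_le_trans)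

lemma midx_UNIV: "midx UNIV = UNIV" by (simp add: midx_def)

lemma holo_power_series:
  fixes F :: "complex^'d \<Rightarrow> complex"
  assumes F: "holo (ball c e) F" and e: "0 < e"
  shows "\<exists>r>0. \<exists>a :: ('d \<Rightarrow> nat) \<Rightarrow> complex. \<forall>z. norm (z - c) < r \<longrightarrow>
    ((\<lambda>\<alpha>. (\<Prod>i\<in>UNIV. (z $ i - c $ i) ^ \<alpha> i) * a \<alpha>) has_sum F z) UNIV"
proof -
  define R where "R = e / (2 * CARD('d))"
  have R: "0 < R" using e by (simp add: R_def)
  have sub: "z + c \<in> cball c (e/2)" if "z \<in> polydisc R" for z
    using ball_polydisc[OF e that[unfolded R_def]] by (simp add: dist_norm)
  have sub': "z + c \<in> ball c e" if "z \<in> polydisc R" for z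
    using sub[OF that] e by simp
  have hF: "holo (polydisc R) (\<lambda>z. F (z + c))"
    by (rule holo_affine[OF open_polydisc F sub'])
  have "compact (F ` cball c (e/2))"
    using smooth_on_continuous[OF holo_smooth[OF F]] e
    by (intro compact_continuous_image compact_cball) (auto intro: continuous_on_subset)
  then obtain M where M: "\<And>z. z \<in> cball c (e/2) \<Longrightarrow> norm (F z) \<le> M"
    using compact_imp_bounded[of "F ` cball c (e/2)"] unfolding bounded_iff by (meson imageI)
  have M': "norm (F (z + c)) \<le> M" if "z \<in> polydisc R" for z using M sub[OF that] by blast
  have r: "0 < R/2" "R/2 < R" using R by auto
  from polydisc_expansion[OF finite[of UNIV] hF r M', simplified]
  obtain k :: "('d \<Rightarrow> nat) \<Rightarrow> complex^'d \<Rightarrow> complex" where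
    k: "\<forall>\<alpha> z z'. z \<in> polydisc R \<longrightarrow> z' \<in> polydisc R \<longrightarrow> k \<alpha> z = k \<alpha> z'"
    and s: "\<forall>z\<in>polydisc (R/2). ((\<lambda>\<alpha>. k \<alpha> z * (\<Prod>i\<in>UNIV. z $ i ^ \<alpha> i)) has_sum F (z + c)) (midx UNIV)"
    by blast
  show ?thesis
  proof (intro exI conjI allI impI)
    show "0 < R/2" using R by simp
    fix z assume z: "norm (z - c) < R/2"
    have zp: "z - c \<in> polydisc (R/2)"
      unfolding polydisc_def mem_Collect_eq using Finite_Cartesian_Product.norm_nth_le[of "z - c"] z by (metis le_less_trans)
    then have "z - c \<in> polydisc R" using R by (rule_tac polydisc_mono) auto
    \<comment> \<open>Once all variables are expanded, the coefficients depend on no coordinate and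
      may be evaluated at the origin.\<close>
    then have k0: "k \<alpha> (z - c) = k \<alpha> 0" for \<alpha> using k R by (simp add: polydisc_def)
    have "((\<lambda>\<alpha>. k \<alpha> (z - c) * (\<Prod>i\<in>UNIV. (z - c) $ i ^ \<alpha> i)) has_sum F (z - c + c)) (midx UNIV)"
      using s zp by blast
    then show "((\<lambda>\<alpha>. (\<Prod>i\<in>UNIV. (z $ i - c $ i) ^ \<alpha> i) * k \<alpha> 0) has_sum F z) UNIV"
      by (simp add: k0 midx_UNIV mult.commute)
  qed
qed

section \<open>Sums of power series are holomorphic\<close>

definition mon :: "('d \<Rightarrow> nat) \<Rightarrow> complex^'d \<Rightarrow> complex" where
  "mon \<alpha> z = (\<Prod>i\<in>UNIV. z $ i ^ \<alpha> i)"

text \<open>Absolute convergence at all diagonal points with coordinates \<sigma> < \<rho>; the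
  exponent is the total degree. The strict inequality leaves room for the loss in termwise
  differentiation.\<close>

definition conv :: "(('d::finite \<Rightarrow> nat) \<Rightarrow> complex) \<Rightarrow> real \<Rightarrow> bool" where
  "conv a \<rho> \<longleftrightarrow> (\<forall>\<sigma>. 0 < \<sigma> \<longrightarrow> \<sigma> < \<rho> \<longrightarrow> (\<lambda>\<alpha>. norm (a \<alpha>) * \<sigma> ^ sum \<alpha> UNIV) summable_on UNIV)"

definition ser :: "(('d \<Rightarrow> nat) \<Rightarrow> complex) \<Rightarrow> complex^'d \<Rightarrow> complex" where
  "ser a z = infsum (\<lambda>\<alpha>. a \<alpha> * mon \<alpha> z) UNIV"

definition dser :: "'d \<Rightarrow> (('d \<Rightarrow> nat) \<Rightarrow> complex) \<Rightarrow> ('d \<Rightarrow> nat) \<Rightarrow> complex" where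
  "dser i a \<alpha> = of_nat (Suc (\<alpha> i)) * a (\<alpha>(i := Suc (\<alpha> i)))"

text \<open>The partial derivative of \<open>mon \<beta>\<close> in the variable \<open>i\<close>.
  If \<open>\<beta> i\<close> is \<open>0\<close>, truncated subtraction leaves the exponent as it
  is, and the factor \<open>0\<close> makes the term vanish.\<close>

definition dmon :: "'d \<Rightarrow> ('d \<Rightarrow> nat) \<Rightarrow> complex^'d \<Rightarrow> complex" where
  "dmon i \<beta> z = of_nat (\<beta> i) * mon (\<beta>(i := \<beta> i - 1)) z"

lemma polydisc_shrink:
  fixes z :: "complex^'d"
  assumes "z \<in> polydisc \<rho>"
  shows "\<exists>\<sigma>. 0 < \<sigma> \<and> \<sigma> < \<rho> \<and> z \<in> polydisc \<sigma>"
proof -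
  define m where "m = Max (range (\<lambda>i. norm (z $ i)))"
  have le: "norm (z $ i) \<le> m" for i unfolding m_def by (rule Max_ge) auto
  have "m < \<rho>" unfolding m_def using assms by (subst Max_less_iff) (auto simp: polydisc_def)
  then obtain \<sigma> where \<sigma>: "m < \<sigma>" "\<sigma> < \<rho>" using dense by blast
  have "z \<in> polydisc \<sigma>" unfolding polydisc_def using le \<sigma>(1) by (auto intro: le_less_trans)
  moreover have "0 < \<sigma>" using order_trans[OF norm_ge_zero le] \<sigma>(1) by (rule le_less_trans)
  ultimately show ?thesis using \<sigma>(2) by blast
qed

lemma mon_bound:
  assumes "z \<in> polydisc \<sigma>" shows "norm (mon \<alpha> z) \<le> \<sigma> ^ sum \<alpha> UNIV"
proof -
  have "norm (z $ i) ^ \<alpha> i \<le> \<sigma> ^ \<alpha> i" for i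
    by (rule power_mono) (use assms in \<open>auto simp: polydisc_def intro: less_imp_le\<close>)
  then show ?thesis
    unfolding mon_def prod_norm[symmetric] power_sum norm_power by (intro prod_mono) simp
qed

lemma ser_has_sum:
  assumes "conv a \<rho>" "z \<in> polydisc \<rho>"
  shows "((\<lambda>\<alpha>. a \<alpha> * mon \<alpha> z) has_sum ser a z) UNIV"
proof -
  obtain \<sigma> where \<sigma>: "0 < \<sigma>" "\<sigma> < \<rho>" "z \<in> polydisc \<sigma>" using polydisc_shrink[OF assms(2)] by blast
  have "(\<lambda>\<alpha>. norm (a \<alpha>) * \<sigma> ^ sum \<alpha> UNIV) summable_on UNIV"
    by (rule assms(1)[unfolded conv_def, rule_format, OF \<sigma>(1,2)])
  then have "(\<lambda>\<alpha>. norm (a \<alpha> * mon \<alpha> z)) summable_on UNIV"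
  proof (rule summable_on_comparison_test)
    show "norm (a \<alpha> * mon \<alpha> z) \<le> norm (a \<alpha>) * \<sigma> ^ sum \<alpha> UNIV" for \<alpha>
      unfolding norm_mult by (intro mult_left_mono mon_bound \<sigma> norm_ge_zero)
  qed simp
  then show ?thesis unfolding ser_def by (rule has_sum_infsum[OF Infinite_Sum.abs_summable_summable])
qed

lemma sum_fun_upd_pred:
  fixes \<beta> :: "'d::finite \<Rightarrow> nat"
  assumes "0 < \<beta> i"
  shows "sum (\<beta>(i := \<beta> i - 1)) UNIV = sum \<beta> UNIV - 1"
proof -
  have "sum (\<beta>(i := \<beta> i - 1)) UNIV = (\<beta>(i := \<beta> i - 1)) i + sum (\<beta>(i := \<beta> i - 1)) (UNIV - {i})"
    by (rule sum.remove) auto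
  also have "sum (\<beta>(i := \<beta> i - 1)) (UNIV - {i}) = sum \<beta> (UNIV - {i})" by (rule sum.cong) auto
  finally have "sum (\<beta>(i := \<beta> i - 1)) UNIV = \<beta> i - 1 + sum \<beta> (UNIV - {i})" by simp
  moreover have "sum \<beta> UNIV = \<beta> i + sum \<beta> (UNIV - {i})" by (rule sum.remove) auto
  ultimately show ?thesis using assms by linarith
qed

text \<open>For \<sigma> < \<tau> < \<rho> the sequence
  \<open>real n * (\<sigma> / \<tau>) ^ n\<close> is bounded, so the differentiated terms at
  \<sigma> are at most a constant times the original terms at \<tau>.\<close>

lemma conv_dmon:
  fixes a :: "('d::finite \<Rightarrow> nat) \<Rightarrow> complex"
  assumes a: "conv a \<rho>" and \<sigma>: "0 < \<sigma>" "\<sigma> < \<rho>"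
  shows "(\<lambda>\<beta>. norm (a \<beta>) * (real (\<beta> i) * \<sigma> ^ (sum \<beta> UNIV - 1))) summable_on UNIV"
proof -
  obtain \<tau> where \<tau>: "\<sigma> < \<tau>" "\<tau> < \<rho>" using dense[OF \<sigma>(2)] by blast
  have "(\<lambda>n. real n * (\<sigma> / \<tau>) ^ n) \<longlonglongrightarrow> 0" using powser_times_n_limit_0[of "\<sigma> / \<tau>"] \<sigma> \<tau> by simp
  then have "Bseq (\<lambda>n. real n * (\<sigma> / \<tau>) ^ n)" by (rule convergent_imp_Bseq[OF convergentI])
  then obtain K where K: "\<And>n. norm (real n * (\<sigma> / \<tau>) ^ n) \<le> K" unfolding Bseq_def by blast
  have le: "real n * \<sigma> ^ (n - 1) \<le> K / \<sigma> * \<tau> ^ n" for n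
  proof (cases n)
    case 0 
    have "0 \<le> K" using K[of 0] by simp
    then show ?thesis using 0 \<sigma> by simp
  next
    case (Suc m)
    have "real n * \<sigma> ^ n / \<tau> ^ n \<le> K" using K[of n] \<sigma> \<tau> by (simp add: power_divide)
    then have "real n * \<sigma> ^ n \<le> K * \<tau> ^ n" using \<sigma> \<tau> by (simp add: pos_divide_le_eq)
    then have "real n * \<sigma> ^ n / \<sigma> \<le> K * \<tau> ^ n / \<sigma>" using \<sigma> by (intro divide_right_mono) auto
    moreover have "real n * \<sigma> ^ (n - 1) = real n * \<sigma> ^ n / \<sigma>" using Suc \<sigma> by simp
    ultimately show ?thesis by simp
  qed
  have "0 < \<tau>" using \<sigma> \<tau> by simp
  then have "(\<lambda>\<beta>. norm (a \<beta>) * \<tau> ^ sum \<beta> UNIV) summable_on UNIV"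
    using a[unfolded conv_def, rule_format, OF _ \<tau>(2)] by blast
  then have "(\<lambda>\<beta>. K / \<sigma> * (norm (a \<beta>) * \<tau> ^ sum \<beta> UNIV)) summable_on UNIV" by (rule summable_on_cmult_right)
  then show ?thesis
  proof (rule summable_on_comparison_test)
    fix \<beta> :: "'d \<Rightarrow> nat"
    have "\<beta> i \<le> sum \<beta> UNIV" by (rule member_le_sum) auto
    then have "real (\<beta> i) * \<sigma> ^ (sum \<beta> UNIV - 1) \<le> real (sum \<beta> UNIV) * \<sigma> ^ (sum \<beta> UNIV - 1)"
      using \<sigma>(1) by (intro mult_right_mono) (simp_all only: of_nat_le_iff zero_le_power less_imp_le)
    also have "\<dots> \<le> K / \<sigma> * \<tau> ^ sum \<beta> UNIV" by (rule le)
    finally have "norm (a \<beta>) * (real (\<beta> i) * \<sigma> ^ (sum \<beta> UNIV - 1)) \<le> norm (a \<beta>) * (K / \<sigma> * \<tau> ^ sum \<beta> UNIV)"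
      by (rule mult_left_mono) simp
    then show "norm (a \<beta>) * (real (\<beta> i) * \<sigma> ^ (sum \<beta> UNIV - 1)) \<le> K / \<sigma> * (norm (a \<beta>) * \<tau> ^ sum \<beta> UNIV)"
      by (simp only: mult.left_commute)
    show "0 \<le> norm (a \<beta>) * (real (\<beta> i) * \<sigma> ^ (sum \<beta> UNIV - 1))" using \<sigma>(1) by simp
  qed
qed

lemma inj_fun_upd_Suc: "inj (\<lambda>\<alpha>. \<alpha>(i := Suc (\<alpha> i)))"
proof (rule injI, rule ext)
  fix \<alpha> \<beta> :: "'a \<Rightarrow> nat" and j assume "\<alpha>(i := Suc (\<alpha> i)) = \<beta>(i := Suc (\<beta> i))"
  from fun_cong[OF this, of j] show "\<alpha> j = \<beta> j" by (auto split: if_splits)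
qed

lemma conv_dser:
  assumes a: "conv a \<rho>" shows "conv (dser i a) \<rho>"
  unfolding conv_def
proof (intro allI impI)
  fix \<sigma> assume \<sigma>: "0 < \<sigma>" "\<sigma> < \<rho>"
  let ?h = "\<lambda>\<alpha>. \<alpha>(i := Suc (\<alpha> i))"
  let ?g = "\<lambda>\<beta>. norm (a \<beta>) * (real (\<beta> i) * \<sigma> ^ (sum \<beta> UNIV - 1))"
  have "?g summable_on range ?h" using conv_dmon[OF a \<sigma>] by (rule summable_on_subset) auto
  then have "(?g \<circ> ?h) summable_on UNIV" by (rule summable_on_reindex[OF inj_fun_upd_Suc, THEN iffD1])
  moreover have "?g (?h \<alpha>) = norm (dser i a \<alpha>) * \<sigma> ^ sum \<alpha> UNIV" for \<alpha>
  proof -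
    have e: "(?h \<alpha>)(i := ?h \<alpha> i - 1) = \<alpha>" by (simp only: fun_upd_upd fun_upd_same diff_Suc_1 fun_upd_triv)
    have "0 < ?h \<alpha> i" by simp
    from sum_fun_upd_pred[of "?h \<alpha>" i, OF this] have e': "sum (?h \<alpha>) UNIV - 1 = sum \<alpha> UNIV" unfolding e by (rule sym)
    show ?thesis
      unfolding e' unfolding dser_def norm_mult norm_of_nat fun_upd_same by (simp only: mult.assoc mult.left_commute)
  qed
  ultimately show "(\<lambda>\<alpha>. norm (dser i a \<alpha>) * \<sigma> ^ sum \<alpha> UNIV) summable_on UNIV" unfolding o_def by (simp only:)
qed

text \<open>Raising the exponent of \<open>i\<close> by one identifies the differentiated series
  with the termwise derivatives. The multi-indices missed by this shift have exponent
  \<open>0\<close> at \<open>i\<close> and contribute nothing.\<close>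

lemma dmon_has_sum:
  assumes a: "conv a \<rho>" and z: "z \<in> polydisc \<rho>"
  shows "((\<lambda>\<beta>. a \<beta> * dmon i \<beta> z) has_sum ser (dser i a) z) UNIV"
proof -
  let ?h = "\<lambda>\<alpha>. \<alpha>(i := Suc (\<alpha> i))"
  have "((\<lambda>\<alpha>. dser i a \<alpha> * mon \<alpha> z) has_sum ser (dser i a) z) UNIV"
    by (rule ser_has_sum[OF conv_dser[OF a] z])
  moreover have "(\<lambda>\<alpha>. dser i a \<alpha> * mon \<alpha> z) = (\<lambda>\<beta>. a \<beta> * dmon i \<beta> z) \<circ> ?h"
  proof
    fix \<alpha>
    have e: "(?h \<alpha>)(i := ?h \<alpha> i - 1) = \<alpha>" by (simp only: fun_upd_upd fun_upd_same diff_Suc_1 fun_upd_triv)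
    show "dser i a \<alpha> * mon \<alpha> z = ((\<lambda>\<beta>. a \<beta> * dmon i \<beta> z) \<circ> ?h) \<alpha>"
      unfolding o_def dmon_def e unfolding dser_def fun_upd_same by (simp only: mult.assoc mult.left_commute)
  qed
  ultimately have "((\<lambda>\<beta>. a \<beta> * dmon i \<beta> z) \<circ> ?h has_sum ser (dser i a) z) UNIV" by (simp only:)
  then have hs: "((\<lambda>\<beta>. a \<beta> * dmon i \<beta> z) has_sum ser (dser i a) z) (range ?h)"
    by (rule has_sum_reindex[OF inj_fun_upd_Suc, THEN iffD2])
  have nz: "dmon i \<beta> z = 0" if "\<beta> \<notin> range ?h" for \<beta>
  proof -
    have "\<beta> i = 0"
    proof (rule ccontr)
      assume "\<beta> i \<noteq> 0"
      then have "\<beta> = ?h (\<beta>(i := \<beta> i - 1))" by (intro ext) simp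
      with that show False by blast
    qed
    then show ?thesis by (simp add: dmon_def)
  qed
  show ?thesis by (rule has_sum_cong_neutral[THEN iffD2, OF _ _ _ hs]) (use nz in \<open>simp_all only: mult_zero_right Diff_iff UNIV_I simp_thms\<close>)
qed

lemma dmon_bound:
  assumes "z \<in> polydisc \<sigma>"
  shows "norm (dmon i \<beta> z) \<le> real (\<beta> i) * \<sigma> ^ (sum \<beta> UNIV - 1)"
proof (cases "\<beta> i = 0")
  case False
  then show ?thesis
    using mult_left_mono[OF mon_bound[OF assms, of "\<beta>(i := \<beta> i - 1)"], of "real (\<beta> i)"] sum_fun_upd_pred[of \<beta> i]
    by (simp add: dmon_def norm_mult)
qed (simp add: dmon_def)

lemma mon_has_derivative:
  "(mon \<beta> has_derivative (\<lambda>v. \<Sum>i\<in>UNIV. v $ i * dmon i \<beta> z)) (at z)"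
proof -
  have "(mon \<beta> has_derivative (\<lambda>v. \<Sum>i\<in>UNIV. (of_nat (\<beta> i) * v $ i * z $ i ^ (\<beta> i - 1)) * (\<Prod>j\<in>UNIV - {i}. z $ j ^ \<beta> j))) (at z)"
    unfolding mon_def[abs_def]
    by (rule has_derivative_prod) (intro has_derivative_power bounded_linear.has_derivative[OF bounded_linear_vec_nth] has_derivative_ident)
  moreover have "(of_nat (\<beta> i) * v $ i * z $ i ^ (\<beta> i - 1)) * (\<Prod>j\<in>UNIV - {i}. z $ j ^ \<beta> j) = v $ i * dmon i \<beta> z" for i v
  proof -
    have "(\<Prod>j\<in>UNIV - {i}. z $ j ^ (\<beta>(i := \<beta> i - 1)) j) = (\<Prod>j\<in>UNIV - {i}. z $ j ^ \<beta> j)"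
      by (rule prod.cong) auto
    then show ?thesis by (simp add: dmon_def mon_def prod.remove[of UNIV i])
  qed
  ultimately show ?thesis by (simp only:)
qed

lemma convex_polydisc: "convex (polydisc \<sigma> :: (complex^'d) set)"
proof -
  have "polydisc \<sigma> = (\<Inter>i\<in>UNIV. (\<lambda>z::complex^'d. z $ i) -` ball 0 \<sigma>)"
    by (auto simp: polydisc_def dist_norm)
  moreover have "convex ((\<lambda>z::complex^'d. z $ i) -` ball 0 \<sigma>)" for i
    by (rule convex_linear_vimage) (auto intro: bounded_linear.linear bounded_linear_vec_nth)
  ultimately show ?thesis by (simp add: convex_INT)
qed

text \<open>Termwise differentiation on a slightly smaller polydisc. Multi-indices are enumerated by
  natural numbers so that theorems on uniformly convergent series apply; absolute convergence makes
  the chosen enumeration immaterial.\<close>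

lemma ser_has_derivative:
  fixes a :: "('d::finite \<Rightarrow> nat) \<Rightarrow> complex"
  assumes a: "conv a \<rho>" and z: "z \<in> polydisc \<rho>"
  shows "(ser a has_derivative (\<lambda>v. \<Sum>i\<in>UNIV. v $ i * ser (dser i a) z)) (at z)"
proof -
  obtain \<sigma> where \<sigma>: "0 < \<sigma>" "\<sigma> < \<rho>" "z \<in> polydisc \<sigma>" using polydisc_shrink[OF z] by blast
  let ?D = "polydisc \<sigma> :: (complex^'d) set"
  have sub: "w \<in> polydisc \<rho>" if "w \<in> ?D" for w using that \<sigma>(2) unfolding polydisc_def by (auto intro: less_trans)
  have inj: "inj (\<lambda>n. (\<lambda>_::'d. n::nat))" by (auto simp: inj_on_def fun_eq_iff)
  have inf: "infinite (UNIV :: ('d \<Rightarrow> nat) set)"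
    by (rule infinite_super[OF subset_UNIV range_inj_infinite[OF inj]])
  obtain e :: "nat \<Rightarrow> ('d \<Rightarrow> nat)" where e: "bij_betw e UNIV UNIV"
    using bij_betw_from_nat_into[OF countableI_type inf] by (rule that)
  have sums: "(\<lambda>n. f (e n)) sums s" if "(f has_sum s) UNIV" for f :: "('d \<Rightarrow> nat) \<Rightarrow> 'x::{comm_monoid_add, t2_space}" and s
    using that has_sum_reindex_bij_betw[OF e, of f s] by (simp add: has_sum_imp_sums)
  define f where "f n w = a (e n) * mon (e n) w" for n w
  define f' where "f' n w v = a (e n) * (\<Sum>i\<in>UNIV. v $ i * dmon i (e n) w)" for n w v
  have unif: "uniform_limit ?D (\<lambda>n w. \<Sum>m<n. a (e m) * dmon i (e m) w) (\<lambda>w. ser (dser i a) w) sequentially" for i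
  proof -
    have "uniform_limit ?D (\<lambda>n w. \<Sum>m<n. a (e m) * dmon i (e m) w) (\<lambda>w. suminf (\<lambda>m. a (e m) * dmon i (e m) w)) sequentially"
    proof (rule Weierstrass_m_test)
      show "norm (a (e n) * dmon i (e n) w) \<le> norm (a (e n)) * (real (e n i) * \<sigma> ^ (sum (e n) UNIV - 1))" if "w \<in> ?D" for n w
        using dmon_bound[OF that] by (simp add: norm_mult mult_left_mono)
      obtain s where "((\<lambda>\<beta>. norm (a \<beta>) * (real (\<beta> i) * \<sigma> ^ (sum \<beta> UNIV - 1))) has_sum s) UNIV"
        using conv_dmon[OF a \<sigma>(1,2), of i] by (auto simp: summable_on_def)
      from sums[OF this] show "summable (\<lambda>n. norm (a (e n)) * (real (e n i) * \<sigma> ^ (sum (e n) UNIV - 1)))"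
        by (rule sums_summable)
    qed
    moreover have "suminf (\<lambda>m. a (e m) * dmon i (e m) w) = ser (dser i a) w" if "w \<in> ?D" for w
      by (rule sums_unique[symmetric, OF sums[OF dmon_has_sum[OF a sub[OF that]]]])
    ultimately show ?thesis by (rule uniform_limit_cong'[OF refl, THEN iffD1, rotated])
  qed
  have "\<exists>g. \<forall>x\<in>?D. (\<lambda>n. f n x) sums g x \<and> (g has_derivative (\<lambda>v. \<Sum>i\<in>UNIV. v $ i * ser (dser i a) x)) (at x within ?D)"
  proof (rule has_derivative_series[OF convex_polydisc _ _ \<sigma>(3), where f'=f'])
    show "(f n has_derivative f' n w) (at w within ?D)" for n w
      unfolding f_def[abs_def] f'_def[abs_def]
      by (rule has_derivative_at_withinI, rule has_derivative_mult_right, rule mon_has_derivative)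
    show "(\<lambda>n. f n z) sums ser a z" unfolding f_def by (rule sums[OF ser_has_sum[OF a z]])
    fix \<epsilon> :: real assume \<epsilon>: "0 < \<epsilon>"
    \<comment> \<open>An error \<open>\<epsilon> / CARD('d)\<close> in each partial derivative adds
      up to an operator norm error of at most \<epsilon>; finitely many directions admit a common
      index.\<close>
    have "\<forall>\<^sub>F n in sequentially. \<forall>i. \<forall>w\<in>?D. dist (\<Sum>m<n. a (e m) * dmon i (e m) w) (ser (dser i a) w) < \<epsilon> / CARD('d)"
    proof (rule eventually_all_finite)
      have "0 < \<epsilon> / CARD('d)" using \<epsilon> by simp
      then show "\<forall>\<^sub>F n in sequentially. \<forall>w\<in>?D. dist (\<Sum>m<n. a (e m) * dmon i (e m) w) (ser (dser i a) w) < \<epsilon> / CARD('d)" for i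
        using unif[of i, unfolded uniform_limit_iff] by blast
    qed
    then show "\<forall>\<^sub>F n in sequentially. \<forall>w\<in>?D. \<forall>h. norm ((\<Sum>i<n. f' i w h) - (\<Sum>i\<in>UNIV. h $ i * ser (dser i a) w)) \<le> \<epsilon> * norm h"
    proof eventually_elim
      case (elim n)
      show ?case
      proof (intro ballI allI)
        fix w and h :: "complex^'d" assume w: "w \<in> ?D"
        have "(\<Sum>i<n. f' i w h) = (\<Sum>i\<in>UNIV. h $ i * (\<Sum>m<n. a (e m) * dmon i (e m) w))"
          unfolding f'_def sum_distrib_left by (subst sum.swap) (simp add: ac_simps)
        then have "norm ((\<Sum>i<n. f' i w h) - (\<Sum>i\<in>UNIV. h $ i * ser (dser i a) w))
           = norm (\<Sum>i\<in>UNIV. h $ i * ((\<Sum>m<n. a (e m) * dmon i (e m) w) - ser (dser i a) w))"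
          by (simp add: sum_subtractf right_diff_distrib)
        also have "\<dots> \<le> (\<Sum>i\<in>(UNIV::'d set). norm h * (\<epsilon> / CARD('d)))"
        proof (rule sum_norm_le)
          fix i
          show "norm (h $ i * ((\<Sum>m<n. a (e m) * dmon i (e m) w) - ser (dser i a) w)) \<le> norm h * (\<epsilon> / CARD('d))"
            unfolding norm_mult using elim[rule_format, OF w, of i, unfolded dist_norm]
            by (intro mult_mono Finite_Cartesian_Product.norm_nth_le) (auto intro: less_imp_le)
        qed
        also have "\<dots> = \<epsilon> * norm h" by simp
        finally show "norm ((\<Sum>i<n. f' i w h) - (\<Sum>i\<in>UNIV. h $ i * ser (dser i a) w)) \<le> \<epsilon> * norm h" .
      qed
    qed
  qed
  then obtain g where g: "\<And>x. x \<in> ?D \<Longrightarrow> (\<lambda>n. f n x) sums g x"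
    "(g has_derivative (\<lambda>v. \<Sum>i\<in>UNIV. v $ i * ser (dser i a) z)) (at z within ?D)"
    using \<sigma>(3) by (elim exE) (rule that, auto)
  have "g x = ser a x" if "x \<in> ?D" for x
    using g(1)[OF that] sums[OF ser_has_sum[OF a sub[OF that]]] unfolding f_def by (rule sums_unique2)
  moreover have "(g has_derivative (\<lambda>v. \<Sum>i\<in>UNIV. v $ i * ser (dser i a) z)) (at z)"
    using g(2) at_within_open[OF \<sigma>(3) open_polydisc] by simp
  ultimately show ?thesis by (rule has_derivative_transform_within_open[OF _ open_polydisc \<sigma>(3), rotated])
qed

lemma holo_ser:
  assumes a: "conv a \<rho>" 
  shows "holo (polydisc \<rho>) (ser a)"
proof (rule holoI[OF _ ser_has_derivative[OF a]])
  have "Ck_on k (polydisc \<rho>) (ser b)" if "conv b \<rho>" for k b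
    using that
  proof (induction k arbitrary: b)
    case 0
    then show ?case
      unfolding Ck_on.simps
      by (intro continuous_at_imp_continuous_on ballI has_derivative_continuous[OF ser_has_derivative])
  next
    case (Suc k)
    show ?case
      by (rule Ck_on_SucI[OF open_polydisc ser_has_derivative[OF Suc.prems]], assumption)
        (intro Ck_on_sum open_polydisc Ck_on_bilinear[OF open_polydisc bounded_bilinear_mult] Ck_on_const Suc.IH conv_dser Suc.prems)
  qed
  then show "smooth_on (polydisc \<rho>) (ser a)" unfolding smooth_on_def using a by blast
qed (auto simp: sum_distrib_left mult.assoc)

text \<open>For real series unconditional summability is absolute. Convergence at real points of the
  form \<open>p + (\<chi> i. \<sigma>)\<close> therefore already gives convergence on a complex
  polydisc, and the sum there is the holomorphic extension.\<close>

lemma power_series_holo: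
  fixes f :: "real^'d \<Rightarrow> real"
  assumes r: "0 < r" and s: "\<And>x. x \<in> ball p r \<Longrightarrow> ((\<lambda>\<alpha>. (\<Prod>i\<in>UNIV. (x $ i - p $ i) ^ \<alpha> i) *\<^sub>R a \<alpha>) has_sum f x) UNIV"
  shows "\<exists>e>0. \<exists>F. holo (ball (cvec p) e) F \<and> (\<forall>x\<in>ball p e. F (cvec x) = of_real (f x))"
proof -
  \<comment> \<open>A displacement by \<sigma> < \<rho> in every coordinate has norm below
    \<open>r / 2\<close>, so the real series converges there; also \<rho> \<le> r.\<close>
  define \<rho> where "\<rho> = r / (2 * CARD('d))"
  have "1 \<le> 2 * real CARD('d)" using zero_less_card_finite[where 'a='d] by linarith
  then have \<rho>: "0 < \<rho>" "\<rho> \<le> r" using r unfolding \<rho>_def by (auto simp: field_simps)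
  define A where "A \<alpha> = complex_of_real (a \<alpha>)" for \<alpha>
  have A: "conv A \<rho>"
    unfolding conv_def
  proof (intro allI impI)
    fix \<sigma> assume \<sigma>: "0 < \<sigma>" "\<sigma> < \<rho>"
    let ?x = "p + (\<chi> i. \<sigma>)"
    have "norm (\<chi> i::'d. \<sigma>) \<le> (\<Sum>i\<in>(UNIV::'d set). \<bar>\<sigma>\<bar>)"
      using norm_le_l1_cart[of "\<chi> i::'d. \<sigma>"] by simp
    also have "\<dots> < CARD('d) * \<rho>" using \<sigma> by simp
    also have "\<dots> = r / 2" by (simp add: \<rho>_def)
    finally have "?x \<in> ball p r" using r by (simp add: dist_norm)
    from s[OF this] have "(\<lambda>\<alpha>. \<sigma> ^ sum \<alpha> UNIV * a \<alpha>) summable_on UNIV"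
      by (auto simp: summable_on_def power_sum)
    then have "(\<lambda>\<alpha>. norm (\<sigma> ^ sum \<alpha> UNIV * a \<alpha>)) summable_on UNIV"
      by (rule summable_on_iff_abs_summable_on_real[THEN iffD1])
    then show "(\<lambda>\<alpha>. norm (A \<alpha>) * \<sigma> ^ sum \<alpha> UNIV) summable_on UNIV"
      using \<sigma> by (simp add: A_def abs_mult mult.commute)
  qed
  have sub: "z - cvec p \<in> polydisc \<rho>" if "z \<in> ball (cvec p) \<rho>" for z
    using that Finite_Cartesian_Product.norm_nth_le[of "z - cvec p"]
    by (auto simp: polydisc_def dist_norm norm_minus_commute intro: le_less_trans)
  have "holo (ball (cvec p) \<rho>) (\<lambda>z. ser A (z + (- cvec p)))"
    by (rule holo_affine[OF open_ball holo_ser[OF A]]) (use sub in simp)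
  moreover have "ser A (cvec x + (- cvec p)) = of_real (f x)" if x: "x \<in> ball p \<rho>" for x
  proof -
    have "((\<lambda>\<alpha>. A \<alpha> * mon \<alpha> (cvec x - cvec p)) has_sum ser A (cvec x - cvec p)) UNIV"
      by (rule ser_has_sum[OF A sub]) (use x in simp)
    moreover have "((\<lambda>\<alpha>. of_real ((\<Prod>i\<in>UNIV. (x $ i - p $ i) ^ \<alpha> i) *\<^sub>R a \<alpha>)) has_sum complex_of_real (f x)) UNIV"
      by (rule has_sum_bounded_linear[OF bounded_linear_of_real s]) (use x \<rho> in auto)
    moreover have "of_real ((\<Prod>i\<in>UNIV. (x $ i - p $ i) ^ \<alpha> i) *\<^sub>R a \<alpha>) = A \<alpha> * mon \<alpha> (cvec x - cvec p)" for \<alpha>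
      by (simp add: A_def mon_def)
    ultimately show ?thesis using has_sum_unique by simp
  qed
  ultimately show ?thesis using \<rho>(1) by blast
qed

text \<open>Reduces real analyticity to the existence of a holomorphic extension to a complex ball.
  Composition, differentiation, integration and flows are then carried out on the extension, where
  only complex linearity has to be added to the smooth statements.\<close>

lemma real_analytic_germ_iff:
  fixes f :: "real^'d \<Rightarrow> real"
  shows "(\<exists>U. open U \<and> p \<in> U \<and> real_analytic_on U f) \<longleftrightarrow>
    (\<exists>e>0. \<exists>F. holo (ball (cvec p) e) F \<and> (\<forall>x\<in>ball p e. F (cvec x) = of_real (f x)))"
proof
  assume "\<exists>U. open U \<and> p \<in> U \<and> real_analytic_on U f"
  then show "\<exists>e>0. \<exists>F. holo (ball (cvec p) e) F \<and> (\<forall>x\<in>ball p e. F (cvec x) = of_real (f x))"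
    unfolding real_analytic_on_def using power_series_holo by blast
next
  assume "\<exists>e>0. \<exists>F. holo (ball (cvec p) e) F \<and> (\<forall>x\<in>ball p e. F (cvec x) = of_real (f x))"
  then obtain e F where e: "0 < e" and F: "holo (ball (cvec p) e) F" and ext: "\<And>x. x \<in> ball p e \<Longrightarrow> F (cvec x) = of_real (f x)"
    by blast
  have "real_analytic_on (ball p e) f"
    unfolding real_analytic_on_def
  proof
    fix q assume q: "q \<in> ball p e"
    define \<delta> where "\<delta> = e - dist p q"
    have \<delta>: "0 < \<delta>" "ball q \<delta> \<subseteq> ball p e" "ball (cvec q) \<delta> \<subseteq> ball (cvec p) e"
      using q by (simp_all add: \<delta>_def ball_subset_ball_iff dist_commute)
    obtain r a where r: "0 < r" and a: "\<And>z. norm (z - cvec q) < r \<Longrightarrow>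
      ((\<lambda>\<alpha>. (\<Prod>i\<in>UNIV. (z $ i - cvec q $ i) ^ \<alpha> i) * a \<alpha>) has_sum F z) UNIV"
      using holo_power_series[OF holo_subset[OF F \<delta>(3)] \<delta>(1)] by blast
    show "\<exists>r>0. \<exists>a. \<forall>x\<in>ball q r. ((\<lambda>\<alpha>. (\<Prod>i\<in>UNIV. (x $ i - q $ i) ^ \<alpha> i) *\<^sub>R a \<alpha>) has_sum f x) UNIV"
    proof (intro exI conjI ballI)
      show "0 < min r \<delta>" using r \<delta> by simp
      fix x assume x: "x \<in> ball q (min r \<delta>)"
      have "norm (cvec x - cvec q) < r" using x by (simp add: dist_norm norm_minus_commute flip: cvec_diff)
      from has_sum_Re[OF a[OF this]]
      have "((\<lambda>\<alpha>. Re ((\<Prod>i\<in>UNIV. (cvec x $ i - cvec q $ i) ^ \<alpha> i) * a \<alpha>)) has_sum f x) UNIV"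
        using ext[of x] x \<delta>(2) by auto
      moreover have "Re ((\<Prod>i\<in>UNIV. (cvec x $ i - cvec q $ i) ^ \<alpha> i) * a \<alpha>) = (\<Prod>i\<in>UNIV. (x $ i - q $ i) ^ \<alpha> i) *\<^sub>R Re (a \<alpha>)" for \<alpha>
      proof -
        have "(\<Prod>i\<in>UNIV. (cvec x $ i - cvec q $ i) ^ \<alpha> i) = of_real (\<Prod>i\<in>UNIV. (x $ i - q $ i) ^ \<alpha> i)" by simp
        then show ?thesis by (simp only: Re_complex_of_real times_complex.sel Im_complex_of_real) simp
      qed
      ultimately show "((\<lambda>\<alpha>. (\<Prod>i\<in>UNIV. (x $ i - q $ i) ^ \<alpha> i) *\<^sub>R Re (a \<alpha>)) has_sum f x) UNIV" by simp
    qed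
  qed
  then show "\<exists>U. open U \<and> p \<in> U \<and> real_analytic_on U f" using e by (intro exI[of _ "ball p e"]) auto
qed

section \<open>Regular germs\<close>

text \<open>Germs at arbitrary points and of either regularity; maps between Euclidean spaces are treated
  componentwise.\<close>

definition rg :: "regularity \<Rightarrow> real^'d \<Rightarrow> (real^'d \<Rightarrow> real) \<Rightarrow> bool" where
  "rg r p f \<longleftrightarrow> (\<exists>U. open U \<and> p \<in> U \<and> regular_on r U f)"

lemma rg_Smooth: "rg Smooth p f \<longleftrightarrow> (\<exists>e>0. smooth_on (ball p e) f)"
  unfolding rg_def regular_on_def regularity.case
  by (meson open_contains_ball smooth_on_subset open_ball centre_in_ball)

lemma rg_Analytic: "rg Analytic p f \<longleftrightarrow> (\<exists>e>0. \<exists>F. holo (ball (cvec p) e) F \<and> (\<forall>x\<in>ball p e. F (cvec x) = of_real (f x)))"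
  unfolding rg_def regular_on_def regularity.case by (rule real_analytic_germ_iff)

lemma rg_AnalyticE:
  assumes "rg Analytic p f"
  obtains e F where "0 < e" "holo (ball (cvec p) e) F" "\<And>x. x \<in> ball p e \<Longrightarrow> F (cvec x) = of_real (f x)"
  using assms unfolding rg_Analytic by blast

lemma rg_AnalyticI:
  assumes "open S" "cvec p \<in> S" "holo S F" "open T" "p \<in> T" "\<And>x. x \<in> T \<Longrightarrow> F (cvec x) = of_real (f x)"
  shows "rg Analytic p f"
proof -
  obtain e1 where e1: "0 < e1" "ball (cvec p) e1 \<subseteq> S" using assms(1,2) open_contains_ball by blast
  obtain e2 where e2: "0 < e2" "ball p e2 \<subseteq> T" using assms(4,5) open_contains_ball by blast
  have "holo (ball (cvec p) (min e1 e2)) F"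
    by (rule holo_subset[OF assms(3)]) (use e1 in auto)
  moreover have "F (cvec x) = of_real (f x)" if "x \<in> ball p (min e1 e2)" for x
    using assms(6) e2 that by auto
  ultimately show ?thesis unfolding rg_Analytic using e1(1) e2(1)
    by (intro exI[of _ "min e1 e2"] conjI exI[of _ F]) auto
qed

lemma rg_SmoothI: "open S \<Longrightarrow> p \<in> S \<Longrightarrow> smooth_on S f \<Longrightarrow> rg Smooth p f"
  unfolding rg_def regular_on_def by auto

lemma rg_cong:
  assumes "open S" "p \<in> S" "\<And>x. x \<in> S \<Longrightarrow> f x = g x" "rg r p f"
  shows "rg r p g"
proof (cases r)
  case Smooth
  obtain e where e: "0 < e" "smooth_on (ball p e) f" using assms(4) unfolding rg_Smooth Smooth by blast
  have o: "open (ball p e \<inter> S)" using assms(1) by auto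
  have "smooth_on (ball p e \<inter> S) f" using e(2) by (rule smooth_on_subset) auto
  then have "smooth_on (ball p e \<inter> S) g"
    using smooth_on_cong[OF o, of f g] assms(3) by simp
  then show ?thesis unfolding Smooth by (rule rg_SmoothI[OF o, rotated]) (use e assms(2) in auto)
next
  case Analytic
  obtain e F where F: "0 < e" "holo (ball (cvec p) e) F" "\<And>x. x \<in> ball p e \<Longrightarrow> F (cvec x) = of_real (f x)"
    using assms(4)[unfolded Analytic] by (rule rg_AnalyticE) (rule that)
  show ?thesis unfolding Analytic
    by (rule rg_AnalyticI[OF open_ball _ F(2), where T="ball p e \<inter> S"]) (use F assms in auto)
qed

lemma smooth_on_cvec:
  fixes F :: "complex^'d \<Rightarrow> complex"
  assumes "holo (ball (cvec p) e) F" "\<And>x. x \<in> ball p e \<Longrightarrow> F (cvec x) = of_real (f x)"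
  shows "smooth_on (ball p e) f"
proof -
  have sub: "cvec ` ball p e \<subseteq> ball (cvec p) e" by auto
  have "smooth_on (ball p e) (\<lambda>x. F (cvec x))"
    by (rule smooth_on_compose[OF open_ball smooth_on_bounded_linear[OF open_ball bounded_linear_cvec] holo_smooth[OF assms(1)] sub])
  then have "smooth_on (ball p e) (\<lambda>x. Re (F (cvec x)))"
    by (rule smooth_on_bounded_linear_comp[OF open_ball bounded_linear_Re])
  then show ?thesis
    using smooth_on_cong[OF open_ball, of p e "\<lambda>x. Re (F (cvec x))" f] assms(2) by simp
qed

lemma rg_imp_smooth:
  assumes "rg r p f" obtains e where "0 < e" "smooth_on (ball p e) f"
proof (cases r)
  case Smooth
  with assms show ?thesis using that by (simp only: rg_Smooth) blast
next
  case Analytic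
  obtain e F where "0 < e" "holo (ball (cvec p) e) F" "\<And>x. x \<in> ball p e \<Longrightarrow> F (cvec x) = of_real (f x)"
    using assms[unfolded Analytic] by (rule rg_AnalyticE) (rule that)
  then show ?thesis using that smooth_on_cvec by blast
qed

lemma rg_const: "rg r p (\<lambda>x. c)"
  by (cases r) (auto intro: rg_SmoothI[OF open_UNIV] smooth_on_const 
      rg_AnalyticI[OF open_UNIV _ holo_const[OF open_UNIV, of "of_real c"] open_UNIV])

lemma rg_nth: "rg r p (\<lambda>x. x $ i)"
  by (cases r) (auto intro: rg_SmoothI[OF open_UNIV] smooth_on_bounded_linear bounded_linear_vec_nth
      rg_AnalyticI[OF open_UNIV _ holo_nth[OF open_UNIV] open_UNIV])

lemma rg_common_ball:
  fixes e e' :: real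
  assumes "0 < e" "0 < e'"
  obtains d where "0 < d" "d \<le> e" "d \<le> e'"
  by (rule that[of "min e e'"]) (use assms in simp_all)

lemma rg_add:
  assumes "rg r p f" "rg r p g"
  shows "rg r p (\<lambda>x. f x + g x)"
proof (cases r)
  case Smooth
  from assms obtain e e' where e: "0 < e" "smooth_on (ball p e) f" "0 < e'" "smooth_on (ball p e') g"
    unfolding rg_Smooth Smooth by blast
  obtain d where d: "0 < d" "d \<le> e" "d \<le> e'" using rg_common_ball[OF e(1,3)] .
  have "smooth_on (ball p d) (\<lambda>x. f x + g x)"
    by (intro smooth_on_add open_ball smooth_on_subset[OF e(2)] smooth_on_subset[OF e(4)] subset_ball d)
  then show ?thesis unfolding Smooth rg_Smooth using d(1) by blast
next
  case Analytic
  obtain e F where e: "0 < e" "holo (ball (cvec p) e) F" "\<And>x. x \<in> ball p e \<Longrightarrow> F (cvec x) = of_real (f x)"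
    using assms(1)[unfolded Analytic] by (rule rg_AnalyticE) (rule that)
  obtain e' G where e': "0 < e'" "holo (ball (cvec p) e') G" "\<And>x. x \<in> ball p e' \<Longrightarrow> G (cvec x) = of_real (g x)"
    using assms(2)[unfolded Analytic] by (rule rg_AnalyticE) (rule that)
  obtain d where d: "0 < d" "d \<le> e" "d \<le> e'" using rg_common_ball[OF e(1) e'(1)] .
  have "holo (ball (cvec p) d) (\<lambda>x. F x + G x)"
    by (intro holo_add open_ball holo_subset[OF e(2)] holo_subset[OF e'(2)] subset_ball d)
  then show ?thesis unfolding Analytic
    by (rule rg_AnalyticI[OF open_ball _ _ open_ball[of p d], rotated]) (use e e' d in auto)
qed

lemma rg_mult:
  assumes "rg r p f" "rg r p g"
  shows "rg r p (\<lambda>x. f x * g x)"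
proof (cases r)
  case Smooth
  from assms obtain e e' where e: "0 < e" "smooth_on (ball p e) f" "0 < e'" "smooth_on (ball p e') g"
    unfolding rg_Smooth Smooth by blast
  obtain d where d: "0 < d" "d \<le> e" "d \<le> e'" using rg_common_ball[OF e(1,3)] .
  have "smooth_on (ball p d) (\<lambda>x. f x * g x)"
    by (intro smooth_on_bilinear[OF _ bounded_bilinear_mult] open_ball smooth_on_subset[OF e(2)] smooth_on_subset[OF e(4)] subset_ball d)
  then show ?thesis unfolding Smooth rg_Smooth using d(1) by blast
next
  case Analytic
  obtain e F where e: "0 < e" "holo (ball (cvec p) e) F" "\<And>x. x \<in> ball p e \<Longrightarrow> F (cvec x) = of_real (f x)"
    using assms(1)[unfolded Analytic] by (rule rg_AnalyticE) (rule that)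
  obtain e' G where e': "0 < e'" "holo (ball (cvec p) e') G" "\<And>x. x \<in> ball p e' \<Longrightarrow> G (cvec x) = of_real (g x)"
    using assms(2)[unfolded Analytic] by (rule rg_AnalyticE) (rule that)
  obtain d where d: "0 < d" "d \<le> e" "d \<le> e'" using rg_common_ball[OF e(1) e'(1)] .
  have "holo (ball (cvec p) d) (\<lambda>x. F x * G x)"
    by (intro holo_mult open_ball holo_subset[OF e(2)] holo_subset[OF e'(2)] subset_ball d)
  then show ?thesis unfolding Analytic
    by (rule rg_AnalyticI[OF open_ball _ _ open_ball[of p d], rotated]) (use e e' d in auto)
qed

lemma rg_inverse:
  assumes "rg r p f" "f p \<noteq> 0"
  shows "rg r p (\<lambda>x. inverse (f x))"
proof (cases r)
  case Smooth
  from assms obtain e where e: "0 < e" "smooth_on (ball p e) f"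
    unfolding rg_Smooth Smooth by blast
  let ?S = "{x \<in> ball p e. f x \<noteq> 0}"
  have "?S = ball p e \<inter> f -` (- {0})" by auto
  then have o: "open ?S"
    using continuous_open_preimage[OF smooth_on_continuous[OF e(2)] open_ball, of "- {0}"] by auto
  have "smooth_on ?S (\<lambda>x. inverse (f x))"
    by (intro smooth_on_inverse o smooth_on_subset[OF e(2)]) auto
  then show ?thesis unfolding Smooth using e assms(2) by (intro rg_SmoothI[OF o]) auto
next
  case Analytic
  obtain e F where e: "0 < e" "holo (ball (cvec p) e) F" "\<And>x. x \<in> ball p e \<Longrightarrow> F (cvec x) = of_real (f x)"
    using assms(1)[unfolded Analytic] by (rule rg_AnalyticE) (rule that)
  let ?S = "{x \<in> ball (cvec p) e. F x \<noteq> 0}"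
  have "?S = ball (cvec p) e \<inter> F -` (- {0})" by auto
  then have o: "open ?S"
    using continuous_open_preimage[OF smooth_on_continuous[OF holo_smooth[OF e(2)]] open_ball, of "- {0}"] by auto
  have h: "holo ?S (\<lambda>x. inverse (F x))"
    by (intro holo_inverse o holo_subset[OF e(2)]) auto
  show ?thesis unfolding Analytic
    by (rule rg_AnalyticI[OF o _ h open_ball[of p e]]) (use e assms(2) in auto)
qed

lemma finite_min_pos:
  fixes e :: "'d::finite \<Rightarrow> real"
  assumes "\<And>j. 0 < e j" obtains d where "0 < d" "\<And>j. d \<le> e j"
  by (rule that[of "Min (range e)"]) (use assms in auto)

lemma rg_map_smooth:
  fixes G :: "real^'d \<Rightarrow> real^'m"
  assumes "\<And>j. rg r p (\<lambda>x. G x $ j)"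
  obtains e where "0 < e" "smooth_on (ball p e) G"
proof -
  have "\<forall>j. \<exists>e>0. smooth_on (ball p e) (\<lambda>x. G x $ j)"
    using rg_imp_smooth[OF assms] by metis
  then obtain e where e: "\<And>j. 0 < e j" "\<And>j. smooth_on (ball p (e j)) (\<lambda>x. G x $ j)" by metis
  obtain d where d: "0 < d" "\<And>j. d \<le> e j" using finite_min_pos[of e] e(1) by blast
  have "smooth_on (ball p d) G"
    by (rule smooth_on_vec[OF open_ball smooth_on_subset[OF e(2) subset_ball[OF d(2)]]])
  then show ?thesis using that d(1) by blast
qed

lemma rg_map_holo:
  fixes G :: "real^'d \<Rightarrow> real^'m"
  assumes "\<And>j. rg Analytic p (\<lambda>x. G x $ j)"
  obtains e H where "0 < e" "\<And>j. holo (ball (cvec p) e) (\<lambda>z. H z $ j)" "\<And>x. x \<in> ball p e \<Longrightarrow> H (cvec x) = cvec (G x)"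
proof -
  have "\<forall>j. \<exists>e F. 0 < e \<and> holo (ball (cvec p) e) F \<and> (\<forall>x\<in>ball p e. F (cvec x) = of_real (G x $ j))"
    using assms unfolding rg_Analytic by blast
  then obtain e F where e: "\<And>j. 0 < e j" "\<And>j. holo (ball (cvec p) (e j)) (F j)" "\<And>j x. x \<in> ball p (e j) \<Longrightarrow> F j (cvec x) = of_real (G x $ j)"
    by metis
  obtain d where d: "0 < d" "\<And>j. d \<le> e j" using finite_min_pos[of e] e(1) by blast
  show ?thesis
  proof (rule that[OF d(1), of "\<lambda>z. \<chi> j. F j z"])
    show "holo (ball (cvec p) d) (\<lambda>z. (\<chi> j. F j z) $ j)" for j
      using holo_subset[OF e(2)[of j] subset_ball[OF d(2)[of j]]] by simp
    show "(\<chi> j. F j (cvec x)) = cvec (G x)" if "x \<in> ball p d" for x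
    proof -
      have "x \<in> ball p (e j)" for j using that subset_ball[OF d(2)[of j]] by blast
      then show ?thesis using e(3) by (simp add: vec_eq_iff)
    qed
  qed
qed

lemma rg_compose:
  fixes G :: "real^'d \<Rightarrow> real^'m"
  assumes G: "\<And>j. rg r p (\<lambda>x. G x $ j)" and f: "rg r (G p) f"
  shows "rg r p (\<lambda>x. f (G x))"
proof (cases r)
  case Smooth
  obtain e where e: "0 < e" "smooth_on (ball p e) G" using rg_map_smooth[OF G] .
  obtain e' where e': "0 < e'" "smooth_on (ball (G p) e') f" using f unfolding Smooth rg_Smooth by blast
  let ?S = "ball p e \<inter> G -` ball (G p) e'"
  have o: "open ?S" by (intro continuous_open_preimage smooth_on_continuous[OF e(2)] open_ball)
  have "smooth_on ?S (\<lambda>x. f (G x))"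
    by (rule smooth_on_compose[OF o smooth_on_subset[OF e(2)] e'(2)]) auto
  then show ?thesis unfolding Smooth using e e' by (intro rg_SmoothI[OF o]) auto
next
  case Analytic
  obtain e H where e: "0 < e" "\<And>j. holo (ball (cvec p) e) (\<lambda>z. H z $ j)" "\<And>x. x \<in> ball p e \<Longrightarrow> H (cvec x) = cvec (G x)"
    by (rule rg_map_holo[OF G[unfolded Analytic]]) (rule that)
  obtain e' F where e': "0 < e'" "holo (ball (cvec (G p)) e') F" "\<And>x. x \<in> ball (G p) e' \<Longrightarrow> F (cvec x) = of_real (f x)"
    using f[unfolded Analytic] by (rule rg_AnalyticE) (rule that)
  obtain e'' where e'': "0 < e''" "smooth_on (ball p e'') G" using rg_map_smooth[OF G] .
  let ?S = "ball (cvec p) e \<inter> H -` ball (cvec (G p)) e'"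
  let ?T = "(ball p e'' \<inter> G -` ball (G p) e') \<inter> ball p e"
  have o: "open ?S"
    by (intro continuous_open_preimage smooth_on_continuous[OF holo_map_smooth[OF open_ball e(2)]] open_ball)
  have oT: "open ?T" by (intro continuous_open_preimage open_Int smooth_on_continuous[OF e''(2)] open_ball)
  have h: "holo ?S (\<lambda>z. F (H z))"
    by (rule holo_compose[OF o holo_subset[OF e(2)] e'(2)]) auto
  show ?thesis unfolding Analytic
    by (rule rg_AnalyticI[OF o _ h oT]) (use e e' e'' in auto)
qed

text \<open>In the analytic case the extension is differentiated in the direction
  \<open>cvec v\<close>; on real points this is the real derivative, by uniqueness of
  derivatives.\<close>

lemma rg_frechet_derivative:
  assumes "rg r p f"
  shows "rg r p (\<lambda>x. frechet_derivative f (at x) v)"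
proof (cases r)
  case Smooth
  then show ?thesis using assms smooth_on_frechet_derivative unfolding rg_Smooth Smooth by blast
next
  case Analytic
  obtain e F where e: "0 < e" "holo (ball (cvec p) e) F" "\<And>x. x \<in> ball p e \<Longrightarrow> F (cvec x) = of_real (f x)"
    using assms[unfolded Analytic] by (rule rg_AnalyticE) (rule that)
  have f: "smooth_on (ball p e) f" by (rule smooth_on_cvec[OF e(2,3)])
  show ?thesis unfolding Analytic
  proof (rule rg_AnalyticI[OF open_ball _ holo_frechet_derivative[OF open_ball e(2), of "cvec v"] open_ball])
    fix x assume x: "x \<in> ball p e"
    then have cx: "cvec x \<in> ball (cvec p) e" by simp
    have "((\<lambda>x. F (cvec x)) has_derivative (\<lambda>v. frechet_derivative F (at (cvec x)) (cvec v))) (at x)"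
      using diff_chain_at[OF bounded_linear_imp_has_derivative[OF bounded_linear_cvec] holo_has_derivative[OF e(2) cx]]
      by (simp add: o_def)
    then have "((\<lambda>x. of_real (f x)) has_derivative (\<lambda>v. frechet_derivative F (at (cvec x)) (cvec v))) (at x)"
      by (rule has_derivative_transform_within_open[OF _ open_ball x e(3)])
    moreover have "((\<lambda>x. complex_of_real (f x)) has_derivative (\<lambda>v. of_real (frechet_derivative f (at x) v))) (at x)"
      by (rule bounded_linear.has_derivative[OF bounded_linear_of_real smooth_on_has_derivative[OF f x]])
    ultimately show "frechet_derivative F (at (cvec x)) (cvec v) = of_real (frechet_derivative f (at x) v)"
      by (rule fun_cong[OF has_derivative_unique])
  qed (use e in auto)
qed

text \<open>A ray point is a convex combination of \<open>x\<close> and \<open>x - \<pi> x\<close>,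
  and subtracting its own projection gives \<open>x - \<pi> x\<close> again. Requiring both points
  to lie in the ball gives an invariant convex open set even for an oblique projection, which may
  enlarge norms.\<close>

lemma ray_invariant_nbhd:
  fixes \<pi> :: "'a::euclidean_space \<Rightarrow> 'a"
  assumes \<pi>: "bounded_linear \<pi>" "\<And>v. \<pi> (\<pi> v) = \<pi> v" "\<pi> p = 0" and e: "0 < e"
  defines "S \<equiv> {x. x \<in> ball p e \<and> x - \<pi> x \<in> ball p e}"
  shows "open S" "convex S" "p \<in> S" "S \<subseteq> ball p e"
    "\<And>x \<tau>. x \<in> S \<Longrightarrow> \<tau> \<in> {0..1} \<Longrightarrow> x - (1 - \<tau>) *\<^sub>R \<pi> x \<in> S"
proof -
  interpret \<pi>: bounded_linear \<pi> by (rule \<pi>(1))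
  have S: "S = ball p e \<inter> (\<lambda>x. x - \<pi> x) -` ball p e" by (auto simp: S_def)
  have "open ((\<lambda>x. x - \<pi> x) -` ball p e)"
    by (rule open_vimage) (auto intro!: continuous_intros \<pi>.continuous_on)
  then show "open S" unfolding S by auto
  have "linear (\<lambda>x. x - \<pi> x)" by (auto intro!: linear_compose_sub \<pi>.linear linear_ident)
  then show "convex S" unfolding S by (intro convex_Int convex_ball convex_linear_vimage)
  show "p \<in> S" using e \<pi>(3) by (simp add: S_def)
  show "S \<subseteq> ball p e" by (auto simp: S_def)
  fix x \<tau> assume x: "x \<in> S" and \<tau>: "\<tau> \<in> {0..1::real}"
  let ?y = "x - (1 - \<tau>) *\<^sub>R \<pi> x"
  have "?y = (1 - \<tau>) *\<^sub>R (x - \<pi> x) + \<tau> *\<^sub>R x" by (simp add: algebra_simps)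
  moreover have "(1 - \<tau>) *\<^sub>R (x - \<pi> x) + \<tau> *\<^sub>R x \<in> ball p e"
    using x \<tau> convex_ball[of p e] unfolding convex_alt S_def by auto
  moreover have "?y - \<pi> ?y = x - \<pi> x" by (simp add: \<pi>.diff \<pi>.scaleR \<pi>(2))
  ultimately show "?y \<in> S" using x by (simp add: S_def)
qed

text \<open>In the analytic case the holomorphic version is applied to the complexified projection
  on an invariant neighbourhood in complex space. On real points the whole ray is real, so the
  complex integral restricts to the real one.\<close>

lemma rg_integral_ray:
  fixes \<phi> u :: "real^'d"
  assumes \<phi>: "\<phi> \<bullet> u = 1" "\<phi> \<bullet> p = 0" and f: "rg r p f"
  shows "rg r p (\<lambda>x. integral {0..1} (\<lambda>\<tau>. f (x - (1 - \<tau>) *\<^sub>R ((\<phi> \<bullet> x) *\<^sub>R u))))"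
proof -
  let ?\<pi> = "\<lambda>x. (\<phi> \<bullet> x) *\<^sub>R u"
  have \<pi>: "bounded_linear ?\<pi>" "\<And>v. ?\<pi> (?\<pi> v) = ?\<pi> v" "?\<pi> p = 0"
    using \<phi> by (auto intro!: bounded_linear_intros)
  show ?thesis
  proof (cases r)
    case Smooth
    obtain e where e: "0 < e" "smooth_on (ball p e) f"
      using f unfolding rg_Smooth Smooth by blast
    note S = ray_invariant_nbhd[OF \<pi> e(1)]
    show ?thesis unfolding Smooth
      by (rule rg_SmoothI[OF S(1,3) smooth_on_integral_ray[OF \<pi>(1) S(1,2,5) smooth_on_subset[OF e(2) S(4)]]])
  next
    case Analytic
    obtain e F where e: "0 < e" "holo (ball (cvec p) e) F" "\<And>x. x \<in> ball p e \<Longrightarrow> F (cvec x) = of_real (f x)"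
      using f[unfolded Analytic] by (rule rg_AnalyticE) (rule that)
    let ?\<Pi> = "\<lambda>z::complex^'d. (\<Sum>i\<in>UNIV. of_real (\<phi> $ i) * z $ i) *s cvec u"
    have "linear ?\<Pi>"
      by (rule linearI) (auto simp: vec_eq_iff sum.distrib distrib_left distrib_right sum_distrib_left scaleR_conv_of_real[where 'a=complex] ac_simps)
    then have bl: "bounded_linear ?\<Pi>" by (rule linear_conv_bounded_linear[THEN iffD1])
    have cv: "?\<Pi> (cvec x) = cvec (?\<pi> x)" for x
      by (simp add: vec_eq_iff inner_vec_def flip: of_real_mult of_real_sum)
    have one: "(\<Sum>i\<in>UNIV. complex_of_real (\<phi> $ i) * of_real (u $ i)) = 1"
      using \<phi>(1) by (simp add: inner_vec_def flip: of_real_mult of_real_sum)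
    have \<Pi>: "?\<Pi> (\<i> *s v) = \<i> *s ?\<Pi> v" "?\<Pi> (?\<Pi> v) = ?\<Pi> v" for v
    proof -
      show "?\<Pi> (\<i> *s v) = \<i> *s ?\<Pi> v"
        by (simp add: vec_eq_iff sum_distrib_left sum_distrib_right ac_simps)
      have "(\<Sum>i\<in>UNIV. of_real (\<phi> $ i) * (c *s cvec u) $ i) = c" for c
      proof -
        have "(\<Sum>i\<in>UNIV. of_real (\<phi> $ i) * (c *s cvec u) $ i) = c * (\<Sum>i\<in>UNIV. complex_of_real (\<phi> $ i) * of_real (u $ i))"
          by (simp add: sum_distrib_left ac_simps)
        then show ?thesis by (simp add: one)
      qed
      then show "?\<Pi> (?\<Pi> v) = ?\<Pi> v" by simp
    qed
    have \<Pi>0: "?\<Pi> (cvec p) = 0" unfolding cv using \<phi> by (simp add: vec_eq_iff)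
    note S = ray_invariant_nbhd[OF bl \<Pi>(2) \<Pi>0 e(1)] and T = ray_invariant_nbhd[OF \<pi> e(1)]
    show ?thesis unfolding Analytic
    proof (rule rg_AnalyticI[OF S(1,3) holo_integral_ray[OF bl \<Pi>(1) S(1,2,5) holo_subset[OF e(2) S(4)]] T(1,3)])
      fix x assume x: "x \<in> {x. x \<in> ball p e \<and> x - ?\<pi> x \<in> ball p e}"
      have xb: "x - (1 - \<tau>) *\<^sub>R ?\<pi> x \<in> ball p e" if "\<tau> \<in> {0..1}" for \<tau>
        using T(5)[OF x that] T(4) by blast
      have "cvec x - (1 - \<tau>) *\<^sub>R ?\<Pi> (cvec x) = cvec (x - (1 - \<tau>) *\<^sub>R ?\<pi> x)" for \<tau>
        unfolding cv by (simp add: vec_eq_iff scaleR_conv_of_real[where 'a=complex])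
      then have "integral {0..1} (\<lambda>\<tau>. F (cvec x - (1 - \<tau>) *\<^sub>R ?\<Pi> (cvec x)))
        = integral {0..1} (\<lambda>\<tau>. complex_of_real (f (x - (1 - \<tau>) *\<^sub>R ?\<pi> x)))"
        by (intro Henstock_Kurzweil_Integration.integral_cong) (use e(3) xb in simp)
      also have "\<dots> = of_real (integral {0..1} (\<lambda>\<tau>. f (x - (1 - \<tau>) *\<^sub>R ?\<pi> x)))"
      proof -
        have fc: "continuous_on {x. x \<in> ball p e \<and> x - ?\<pi> x \<in> ball p e} f"
          using smooth_on_continuous[OF smooth_on_cvec[OF e(2,3)]] T(4) by (rule continuous_on_subset)
        have "(\<lambda>\<tau>. f (x - (1 - \<tau>) *\<^sub>R ?\<pi> x)) integrable_on {0..1}"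
          using integrable_ray[OF \<pi>(1) T(1,2,5) fc x, of 0] by simp
        from integral_linear[OF this bounded_linear_of_real] show ?thesis by (simp add: o_def)
      qed
      finally show "integral {0..1} (\<lambda>\<tau>. F (cvec x - (1 - \<tau>) *\<^sub>R ?\<Pi> (cvec x))) = of_real (integral {0..1} (\<lambda>\<tau>. f (x - (1 - \<tau>) *\<^sub>R ?\<pi> x)))" .
    qed
  qed
qed

section \<open>Regularity of vector-valued maps and of flows\<close>

lemma has_sum_vec:
  fixes f :: "'i \<Rightarrow> real^'m"
  assumes "\<And>j. ((\<lambda>i. f i $ j) has_sum s $ j) A"
  shows "(f has_sum s) A"
  using assms unfolding has_sum_def by (intro vec_tendstoI) simp

text \<open>Analyticity of a map asks for one series with vector coefficients, so the scalar
  expansions are brought to a common radius.\<close>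

lemma regular_on_vecI:
  fixes G :: "real^'d \<Rightarrow> real^'m"
  assumes U: "open U" and G: "\<And>q j. q \<in> U \<Longrightarrow> rg r q (\<lambda>x. G x $ j)"
  shows "regular_on r U G"
proof (cases r)
  case Smooth
  have "smooth_on U G"
  proof (rule smooth_on_open_local)
    fix x assume "x \<in> U"
    obtain e where "0 < e" "smooth_on (ball x e) G"
      using rg_map_smooth[OF G[OF \<open>x \<in> U\<close>]] .
    then show "\<exists>T. open T \<and> x \<in> T \<and> smooth_on T G" by (intro exI[of _ "ball x e"]) auto
  qed
  then show ?thesis by (simp add: regular_on_def Smooth)
next
  case Analytic
  have "real_analytic_on U G"
    unfolding real_analytic_on_def
  proof
    fix p assume p: "p \<in> U"
    define P where "P j r a \<longleftrightarrow> (\<forall>x\<in>ball p r. ((\<lambda>\<alpha>. (\<Prod>i\<in>UNIV. (x $ i - p $ i) ^ \<alpha> i) *\<^sub>R a \<alpha>) has_sum G x $ j) UNIV)"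
      for j r and a :: "('d \<Rightarrow> nat) \<Rightarrow> real"
    have "\<exists>r a. 0 < r \<and> P j r a" for j
    proof -
      obtain T where "p \<in> T" "real_analytic_on T (\<lambda>x. G x $ j)"
        using G[OF p, of j] unfolding rg_def regular_on_def Analytic regularity.case by auto
      from this(2)[unfolded real_analytic_on_def, rule_format, OF this(1)] show ?thesis
        unfolding P_def by (elim exE conjE) (intro exI conjI)
    qed
    then obtain e a where e: "\<And>j. 0 < e j" and P: "\<And>j. P j (e j) (a j)" by metis
    have a: "((\<lambda>\<alpha>. (\<Prod>i\<in>UNIV. (x $ i - p $ i) ^ \<alpha> i) *\<^sub>R a j \<alpha>) has_sum G x $ j) UNIV" if "x \<in> ball p (e j)" for x j
      using P[of j, unfolded P_def] that by (rule bspec)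
    obtain d where d: "0 < d" "\<And>j. d \<le> e j" by (rule finite_min_pos[of e, OF e]) (rule that)
    show "\<exists>r>0. \<exists>a. \<forall>x\<in>ball p r. ((\<lambda>\<alpha>. (\<Prod>i\<in>UNIV. (x $ i - p $ i) ^ \<alpha> i) *\<^sub>R a \<alpha>) has_sum G x) UNIV"
    proof (intro exI conjI ballI)
      fix x assume x: "x \<in> ball p d"
      show "((\<lambda>\<alpha>. (\<Prod>i\<in>UNIV. (x $ i - p $ i) ^ \<alpha> i) *\<^sub>R (\<chi> j. a j \<alpha>)) has_sum G x) UNIV"
      proof (rule has_sum_vec)
        fix j
        have "x \<in> ball p (e j)" using x subset_ball[OF d(2)[of j]] by blast
        from a[OF this] show "((\<lambda>\<alpha>. ((\<Prod>i\<in>UNIV. (x $ i - p $ i) ^ \<alpha> i) *\<^sub>R (\<chi> j. a j \<alpha>)) $ j) has_sum G x $ j) UNIV" by simp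
      qed
    qed (rule d(1))
  qed
  then show ?thesis by (simp add: regular_on_def Analytic)
qed

lemma regular_on_nth:
  fixes G :: "real^'d \<Rightarrow> real^'m"
  assumes U: "open U" "q \<in> U" and G: "regular_on r U G"
  shows "rg r q (\<lambda>x. G x $ j)"
proof (cases r)
  case Smooth
  then have "smooth_on U (\<lambda>x. G x $ j)"
    using G smooth_on_bounded_linear_comp[OF U(1) bounded_linear_vec_nth, of G j] by (simp add: regular_on_def)
  then show ?thesis unfolding Smooth by (rule rg_SmoothI[OF U])
next
  case Analytic
  have "real_analytic_on U (\<lambda>x. G x $ j)"
    unfolding real_analytic_on_def
  proof
    fix p assume p: "p \<in> U"
    have "real_analytic_on U G" using G by (simp add: regular_on_def Analytic)
    from this[unfolded real_analytic_on_def, rule_format, OF p] obtain r a where r: "0 < r"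
      and a': "\<forall>x\<in>ball p r. ((\<lambda>\<alpha>. (\<Prod>i\<in>UNIV. (x $ i - p $ i) ^ \<alpha> i) *\<^sub>R a \<alpha>) has_sum G x) UNIV"
      by (elim exE conjE) (rule that)
    note a = a'[rule_format]
    show "\<exists>r>0. \<exists>a. \<forall>x\<in>ball p r. ((\<lambda>\<alpha>. (\<Prod>i\<in>UNIV. (x $ i - p $ i) ^ \<alpha> i) *\<^sub>R a \<alpha>) has_sum G x $ j) UNIV"
    proof (intro exI conjI ballI)
      fix x assume "x \<in> ball p r"
      from has_sum_bounded_linear[OF bounded_linear_vec_nth a[OF this], of j]
      show "((\<lambda>\<alpha>. (\<Prod>i\<in>UNIV. (x $ i - p $ i) ^ \<alpha> i) *\<^sub>R (a \<alpha> $ j)) has_sum G x $ j) UNIV" by simp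
    qed (rule r)
  qed
  then show ?thesis unfolding rg_def regular_on_def Analytic regularity.case by (intro exI[of _ U] conjI U)
qed

lemma (in flow_box) flow_unique:
  assumes t: "\<bar>t\<bar> < d" and x: "\<gamma> 0 \<in> ball p (R/4)"
    and \<gamma>: "\<And>s. \<bar>s\<bar> \<le> \<bar>t\<bar> \<Longrightarrow> \<gamma> s \<in> cball p R" "\<And>s. \<bar>s\<bar> \<le> \<bar>t\<bar> \<Longrightarrow> (\<gamma> has_vector_derivative V (\<gamma> s)) (at s)"
  shows "\<gamma> t = \<Phi> t (\<gamma> 0)"
proof -
  have "\<gamma> t - \<Phi> t (\<gamma> 0) = 0"
  proof (rule gronwall_zero[where e="\<lambda>s. \<gamma> s - \<Phi> s (\<gamma> 0)"])
    fix s assume s: "\<bar>s\<bar> \<le> \<bar>t\<bar>"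
    show "((\<lambda>s. \<gamma> s - \<Phi> s (\<gamma> 0)) has_vector_derivative V (\<gamma> s) - V (\<Phi> s (\<gamma> 0))) (at s)"
      by (intro has_vector_derivative_diff \<gamma>(2) flow_ode x s) (use s t in linarith)
    have "\<Phi> s (\<gamma> 0) \<in> cball p R" using flow_in[OF x, of s] R by auto
    then show "norm (V (\<gamma> s) - V (\<Phi> s (\<gamma> 0))) \<le> L * norm (\<gamma> s - \<Phi> s (\<gamma> 0))"
      using V_lip \<gamma>(1)[OF s] by blast
  qed (simp add: flow_0)
  then show ?thesis by simp
qed

text \<open>\<open>\<Phi> (t + s) x\<close> solves the equation in \<open>s\<close> with initial
  value \<open>\<Phi> t x\<close>, so by uniqueness it is the flow from that point; at
  \<open>s = - t\<close> it is \<open>x\<close>. The bound \<open>d/2\<close> keeps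
  \<open>t + s\<close> in the interval of existence.\<close>

lemma (in flow_box) flow_inverse:
  assumes x: "x \<in> ball p (R/4)" and t: "\<bar>t\<bar> < d/2" and \<Phi>x: "\<Phi> t x \<in> ball p (R/4)"
  shows "\<Phi> (- t) (\<Phi> t x) = x"
proof -
  have "(\<lambda>s. \<Phi> (t + s) x) (- t) = \<Phi> (- t) ((\<lambda>s. \<Phi> (t + s) x) 0)"
  proof (rule flow_unique)
    fix s assume s: "\<bar>s\<bar> \<le> \<bar>- t\<bar>"
    show "\<Phi> (t + s) x \<in> cball p R" using flow_in[OF x, of "t + s"] R by auto
    have "((\<lambda>s. \<Phi> s x) \<circ> (+) t has_vector_derivative 1 *\<^sub>R V (\<Phi> (t + s) x)) (at s)"
      by (rule vector_diff_chain_at) (use s t in \<open>auto intro!: derivative_eq_intros flow_ode x\<close>)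
    then show "((\<lambda>s. \<Phi> (t + s) x) has_vector_derivative V (\<Phi> (t + s) x)) (at s)" by (simp add: o_def)
  qed (use t \<Phi>x d in auto)
  then show ?thesis by (simp add: flow_0)
qed

text \<open>The derivative of \<open>V\<close> is complex linear, so the defect of complex linearity
  of the derivative of the flow solves the linear variational equation. It vanishes at time
  \<open>0\<close>, and Gronwall's estimate keeps it zero.\<close>

lemma flow_box_complex_linear:
  fixes V :: "complex^'d \<Rightarrow> complex^'d"
  assumes "flow_box V S p R L d" and oS: "open S" and hV: "\<And>j. holo S (\<lambda>z. V z $ j)" and t: "\<bar>t\<bar> < d"
  shows "holo (ball p (R/4)) (\<lambda>z. flow_box.\<Phi> V p R d t z $ j)"
proof -
  interpret flow_box V S p R L d by (rule assms(1))
  show ?thesis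
  proof (rule holo_mapI[OF open_ball flow_smooth])
    fix z v assume z: "z \<in> ball p (R/4)"
    let ?D = "\<lambda>s. frechet_derivative (\<Phi> s) (at z)"
    have bl: "bounded_linear (\<lambda>v::complex^'d. \<i> *s v)"
      by (rule bounded_linear_intro[where K=1]) (auto simp: vec_eq_iff norm_vec_def norm_mult algebra_simps)
    have \<Phi>S: "\<Phi> s z \<in> cball p R" for s using flow_in[OF z, of s] R by auto
    have "?D t (\<i> *s v) - \<i> *s ?D t v = 0"
    proof (rule gronwall_zero[where e="\<lambda>s. ?D s (\<i> *s v) - \<i> *s ?D s v" and L=L])
      fix s assume "\<bar>s\<bar> \<le> \<bar>t\<bar>"
      then have s: "\<bar>s\<bar> < d" using t by simp
      let ?A = "frechet_derivative V (at (\<Phi> s z))"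
      interpret A: bounded_linear ?A using V_deriv[OF \<Phi>S] by (rule has_derivative_bounded_linear)
      have "((\<lambda>s. ?D s (\<i> *s v) - \<i> *s ?D s v) has_vector_derivative ?A (?D s (\<i> *s v)) - \<i> *s ?A (?D s v)) (at s)"
        by (intro has_vector_derivative_diff flow_variation[OF z s] bounded_linear.has_vector_derivative[OF bl])
      moreover have "?A (?D s (\<i> *s v)) - \<i> *s ?A (?D s v) = ?A (?D s (\<i> *s v) - \<i> *s ?D s v)"
        using holo_map_i[OF oS hV, of "\<Phi> s z" "?D s v"] \<Phi>S[of s] flow_box.S[OF assms(1)] by (auto simp: A.diff)
      ultimately show "((\<lambda>s. ?D s (\<i> *s v) - \<i> *s ?D s v) has_vector_derivative ?A (?D s (\<i> *s v) - \<i> *s ?D s v)) (at s)" by simp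
      show "norm (?A (?D s (\<i> *s v) - \<i> *s ?D s v)) \<le> L * norm (?D s (\<i> *s v) - \<i> *s ?D s v)"
        by (rule DV_bound[OF \<Phi>S])
    next
      have "\<Phi> 0 = (\<lambda>x. x)" by (rule ext) (rule flow_0)
      then show "?D 0 (\<i> *s v) - \<i> *s ?D 0 v = 0" by (simp add: frechet_derivative_eqI[OF has_derivative_ident])
    qed
    then show "?D t (\<i> *s v) = \<i> *s ?D t v" by simp
  qed
qed

text \<open>Analytic dependence on the initial point comes from the flow of the holomorphic
  extension: on real points it agrees with the real flow by uniqueness and so extends it. The real
  box is chosen inside the complex one so that the real curves are admissible for that
  comparison.\<close>

lemma regular_flow_box:
  fixes V :: "real^'e \<Rightarrow> real^'e"
  assumes V: "\<And>j. rg r p (\<lambda>x. V x $ j)" and N: "open N" "p \<in> N"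
  shows "\<exists>S R L d d1. flow_box V S p R L d \<and> S \<subseteq> N \<and> 0 < d1 \<and> d1 \<le> d/2 \<and>
    (\<forall>t x j. \<bar>t\<bar> < d1 \<longrightarrow> x \<in> ball p (R/4) \<longrightarrow> rg r x (\<lambda>x. flow_box.\<Phi> V p R d t x $ j))"
proof (cases r)
  case Smooth
  obtain e where e: "0 < e" "smooth_on (ball p e) V" using rg_map_smooth[OF V] .
  have o: "open (ball p e \<inter> N)" "p \<in> ball p e \<inter> N" using e N by auto
  obtain R L d where fb: "flow_box V (ball p e \<inter> N) p R L d"
    using flow_box_exists[OF o(1) smooth_on_subset[OF e(2)] o(2)] by blast
  interpret flow_box V "ball p e \<inter> N" p R L d by (rule fb)
  have "rg r x (\<lambda>x. \<Phi> t x $ j)" if "x \<in> ball p (R/4)" for x t j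
    unfolding Smooth by (rule rg_SmoothI[OF open_ball that smooth_on_bounded_linear_comp[OF open_ball bounded_linear_vec_nth flow_smooth]])
  then show ?thesis using fb d(1) by (intro exI[of _ "ball p e \<inter> N"] exI[of _ R] exI[of _ L] exI[of _ d] exI[of _ "d/2"]) auto
next
  case Analytic
  obtain e where e: "0 < e" "smooth_on (ball p e) V" using rg_map_smooth[OF V] .
  obtain e' H where H: "0 < e'" "\<And>j. holo (ball (cvec p) e') (\<lambda>z. H z $ j)" "\<And>x. x \<in> ball p e' \<Longrightarrow> H (cvec x) = cvec (V x)"
    by (rule rg_map_holo[OF V[unfolded Analytic]]) (rule that)
  have "cvec p \<in> ball (cvec p) e'" using H(1) by simp
  from flow_box_exists[OF open_ball holo_map_smooth[OF open_ball H(2)] this]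
  obtain R' L' d' where fbc: "flow_box H (ball (cvec p) e') (cvec p) R' L' d'" by blast
  interpret C: flow_box H "ball (cvec p) e'" "cvec p" R' L' d' by (rule fbc)
  let ?S = "ball p e \<inter> N \<inter> (ball p e' \<inter> ball p R')"
  have o: "open ?S" "p \<in> ?S" using e N H(1) C.R by auto
  have sm: "smooth_on ?S V" by (rule smooth_on_subset[OF e(2)]) auto
  obtain R L d where fb: "flow_box V ?S p R L d"
    using flow_box_exists[OF o(1) sm o(2)] by blast
  interpret F: flow_box V ?S p R L d by (rule fb)
  have RR: "R < R'"
  proof -
    have "cball p R \<subseteq> ball p R'" using F.S by auto
    then show ?thesis using F.R by (auto simp: cball_subset_ball_iff)
  qed
  have eq: "C.\<Phi> t (cvec x) = cvec (F.\<Phi> t x)" if x: "x \<in> ball p (R/4)" and t: "\<bar>t\<bar> < min d d'" for x t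
  proof -
    have "(\<lambda>s. cvec (F.\<Phi> s x)) t = C.\<Phi> t ((\<lambda>s. cvec (F.\<Phi> s x)) 0)"
    proof (rule C.flow_unique)
      show "\<bar>t\<bar> < d'" using t by simp
      show "cvec (F.\<Phi> 0 x) \<in> ball (cvec p) (R'/4)" using x RR by (simp add: F.flow_0)
      fix s assume "\<bar>s\<bar> \<le> \<bar>t\<bar>"
      then have s: "\<bar>s\<bar> < d" using t by simp
      have \<Phi>: "F.\<Phi> s x \<in> cball p (R/2)" by (rule F.flow_in[OF x])
      then show "cvec (F.\<Phi> s x) \<in> cball (cvec p) R'" using RR F.R by simp
      have "F.\<Phi> s x \<in> cball p R" using \<Phi> F.R by simp
      then have "F.\<Phi> s x \<in> ball p e'" using F.S by blast
      then have "H (cvec (F.\<Phi> s x)) = cvec (V (F.\<Phi> s x))" by (rule H(3))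
      then show "((\<lambda>s. cvec (F.\<Phi> s x)) has_vector_derivative H (cvec (F.\<Phi> s x))) (at s)"
        using bounded_linear.has_vector_derivative[OF bounded_linear_cvec F.flow_ode[OF x s]] by simp
    qed
    then show ?thesis by (simp add: F.flow_0)
  qed
  have "rg r x (\<lambda>x. F.\<Phi> t x $ j)" if x: "x \<in> ball p (R/4)" and t: "\<bar>t\<bar> < min (d/2) d'" for x t j
    unfolding Analytic
  proof (rule rg_AnalyticI[OF open_ball _ _ open_ball x])
    show "holo (ball (cvec p) (R'/4)) (\<lambda>z. C.\<Phi> t z $ j)"
      by (rule flow_box_complex_linear[OF fbc open_ball H(2)]) (use t in simp)
    show "cvec x \<in> ball (cvec p) (R'/4)" using x RR by simp
    have t': "\<bar>t\<bar> < min d d'" using t F.d(1) by auto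
    show "C.\<Phi> t (cvec y) $ j = of_real (F.\<Phi> t y $ j)" if "y \<in> ball p (R/4)" for y
      using eq[OF that t'] by simp
  qed
  then show ?thesis using fb F.d(1) C.d(1)
    by (intro exI[of _ ?S] exI[of _ R] exI[of _ L] exI[of _ d] exI[of _ "min (d/2) d'"]) auto
qed

text \<open>Packages the local flow without the constants of its construction. Inversion by reversed
  time and uniqueness are the clauses that turn the time maps into diffeomorphism germs fixing the
  origin.\<close>

lemma regular_flow:
  fixes V :: "real^'e \<Rightarrow> real^'e"
  assumes V: "\<And>j. rg r p (\<lambda>x. V x $ j)" and N: "open N" "p \<in> N"
  obtains d W \<Phi> where "0 < d" "open W" "p \<in> W" "W \<subseteq> N"
    "\<And>t x j. \<bar>t\<bar> < d \<Longrightarrow> x \<in> W \<Longrightarrow> rg r x (\<lambda>x. \<Phi> t x $ j)"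
    "\<And>x. \<Phi> 0 x = x" "\<And>t x. \<bar>t\<bar> < d \<Longrightarrow> x \<in> W \<Longrightarrow> \<Phi> t x \<in> N"
    "\<And>t x. \<bar>t\<bar> < d \<Longrightarrow> x \<in> W \<Longrightarrow> ((\<lambda>s. \<Phi> s x) has_vector_derivative V (\<Phi> t x)) (at t)"
    "\<And>t x v. \<bar>t\<bar> < d \<Longrightarrow> x \<in> W \<Longrightarrow> ((\<lambda>s. frechet_derivative (\<Phi> s) (at x) v) has_vector_derivative
          frechet_derivative V (at (\<Phi> t x)) (frechet_derivative (\<Phi> t) (at x) v)) (at t)"
    "\<And>t x. \<bar>t\<bar> < d \<Longrightarrow> x \<in> W \<Longrightarrow> \<Phi> t x \<in> W \<Longrightarrow> \<Phi> (- t) (\<Phi> t x) = x"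
    "\<forall>\<gamma> t. \<bar>t\<bar> < d \<longrightarrow> (\<forall>s. \<bar>s\<bar> \<le> \<bar>t\<bar> \<longrightarrow> \<gamma> s \<in> W \<and> (\<gamma> has_vector_derivative V (\<gamma> s)) (at s)) \<longrightarrow> \<gamma> t = \<Phi> t (\<gamma> 0)"
proof -
  obtain S R L d d1 where fb: "flow_box V S p R L d" and SN: "S \<subseteq> N" and d1: "0 < d1" "d1 \<le> d/2"
    and rg': "\<forall>t x j. \<bar>t\<bar> < d1 \<longrightarrow> x \<in> ball p (R/4) \<longrightarrow> rg r x (\<lambda>x. flow_box.\<Phi> V p R d t x $ j)"
    using regular_flow_box[OF V N] by (elim exE conjE) (rule that)
  note rg = rg'[rule_format]
  interpret flow_box V S p R L d by (rule fb)
  have cN: "cball p R \<subseteq> N" using flow_box.S[OF fb] SN by (rule subset_trans)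
  have "ball p (R/4) \<subseteq> cball p R" using R by auto
  then have h4: "ball p (R/4) \<subseteq> N" using cN by blast
  have h7: "\<Phi> t x \<in> N" if "x \<in> ball p (R/4)" for t x
  proof -
    have "\<Phi> t x \<in> cball p R" using flow_in[OF that, of t] R by simp
    then show ?thesis using cN by blast
  qed
  have h11: "\<forall>\<gamma> t. \<bar>t\<bar> < d1 \<longrightarrow> (\<forall>s. \<bar>s\<bar> \<le> \<bar>t\<bar> \<longrightarrow> \<gamma> s \<in> ball p (R/4) \<and> (\<gamma> has_vector_derivative V (\<gamma> s)) (at s)) \<longrightarrow> \<gamma> t = \<Phi> t (\<gamma> 0)"
  proof (intro allI impI)
    fix \<gamma> t assume t: "\<bar>t\<bar> < d1"
      and \<gamma>: "\<forall>s. \<bar>s\<bar> \<le> \<bar>t\<bar> \<longrightarrow> \<gamma> s \<in> ball p (R/4) \<and> (\<gamma> has_vector_derivative V (\<gamma> s)) (at s)"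
    show "\<gamma> t = \<Phi> t (\<gamma> 0)"
    proof (rule flow_unique[of t \<gamma>])
      show "\<gamma> s \<in> cball p R" if "\<bar>s\<bar> \<le> \<bar>t\<bar>" for s
      proof -
        have "\<gamma> s \<in> ball p (R/4)" using \<gamma> that by blast
        then show ?thesis using R by simp
      qed
      show "\<bar>t\<bar> < d" using t d1 by linarith
      show "\<gamma> 0 \<in> ball p (R/4)" using \<gamma> by simp
      show "(\<gamma> has_vector_derivative V (\<gamma> s)) (at s)" if "\<bar>s\<bar> \<le> \<bar>t\<bar>" for s using \<gamma> that by blast
    qed
  qed
  have h8: "((\<lambda>s. \<Phi> s x) has_vector_derivative V (\<Phi> t x)) (at t)" if "\<bar>t\<bar> < d1" "x \<in> ball p (R/4)" for t x
    by (rule flow_ode[OF that(2)]) (use that(1) d1 in linarith)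
  have h9: "((\<lambda>s. frechet_derivative (\<Phi> s) (at x) v) has_vector_derivative
        frechet_derivative V (at (\<Phi> t x)) (frechet_derivative (\<Phi> t) (at x) v)) (at t)"
    if "\<bar>t\<bar> < d1" "x \<in> ball p (R/4)" for t x v
    by (rule flow_variation[OF that(2)]) (use that(1) d1 in linarith)
  have h10: "\<Phi> (- t) (\<Phi> t x) = x" if "\<bar>t\<bar> < d1" "x \<in> ball p (R/4)" "\<Phi> t x \<in> ball p (R/4)" for t x
    by (rule flow_inverse[OF that(2) _ that(3)]) (use that(1) d1 in linarith)
  have h3: "p \<in> ball p (R/4)" using R by simp
  have h5: "rg r x (\<lambda>x. \<Phi> t x $ j)" if "\<bar>t\<bar> < d1" "x \<in> ball p (R/4)" for t x j
    by (rule rg[OF that])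
  have h1: "0 < d1" by (rule d1(1))
  have h2: "open (ball p (R/4))" by (rule open_ball)
  have h6: "\<Phi> 0 x = x" for x by (rule flow_0)
  show ?thesis by (rule that[OF h1 h2 h3 h4 h5 h6 h7 h8 h9 h10 h11])
qed

section \<open>Germs of diffeomorphisms and time-dependent flows\<close>

lemma rg_map_continuous:
  fixes F :: "real^'d \<Rightarrow> real^'m"
  assumes "\<And>x j. x \<in> U \<Longrightarrow> rg r x (\<lambda>x. F x $ j)"
  shows "continuous_on U F"
proof (intro continuous_at_imp_continuous_on ballI)
  fix x assume "x \<in> U"
  obtain e where e: "0 < e" "smooth_on (ball x e) F" using rg_map_smooth[OF assms[OF \<open>x \<in> U\<close>]] .
  show "isCont F x"
    using continuous_on_interior[OF smooth_on_continuous[OF e(2)], of x] e(1) by simp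
qed

text \<open>\<open>F\<close> and \<open>G\<close> need to be mutually inverse only where the
  compositions land in the given domains; intersecting each domain with the preimage of the other
  yields the homeomorphism.\<close>

lemma diffeo_germI:
  fixes F G :: "real^'d \<Rightarrow> real^'d"
  assumes o: "open U" "open V" "0 \<in> U" "0 \<in> V" and F0: "F 0 = 0"
    and F: "\<And>x j. x \<in> U \<Longrightarrow> rg r x (\<lambda>x. F x $ j)" and G: "\<And>y j. y \<in> V \<Longrightarrow> rg r y (\<lambda>y. G y $ j)"
    and GF: "\<And>x. x \<in> U \<Longrightarrow> F x \<in> V \<Longrightarrow> G (F x) = x" and FG: "\<And>y. y \<in> V \<Longrightarrow> G y \<in> U \<Longrightarrow> F (G y) = y"
  shows "diffeo_germ r F"
proof -
  note cF = rg_map_continuous[OF F] and cG = rg_map_continuous[OF G]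
  let ?U = "U \<inter> F -` V" and ?V = "V \<inter> G -` U"
  have oU: "open ?U" using cF o by (intro continuous_open_preimage) auto
  have oV: "open ?V" using cG o by (intro continuous_open_preimage) auto
  have G0: "G 0 = 0" using GF[OF o(3)] F0 o(4) by simp
  have hom: "homeomorphism ?U ?V F G"
    unfolding homeomorphism_def
  proof (intro conjI ballI)
    show "continuous_on ?U F" by (rule continuous_on_subset[OF cF]) auto
    show "continuous_on ?V G" by (rule continuous_on_subset[OF cG]) auto
    show "F ` ?U = ?V"
    proof
      show "F ` ?U \<subseteq> ?V" using GF by auto
      show "?V \<subseteq> F ` ?U"
      proof
        fix y assume y: "y \<in> ?V"
        then have "F (G y) = y" using FG by auto
        then show "y \<in> F ` ?U" using y by (intro image_eqI[of y F "G y"]) auto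
      qed
    qed
    show "G ` ?V = ?U"
    proof
      show "G ` ?V \<subseteq> ?U" using FG by auto
      show "?U \<subseteq> G ` ?V"
      proof
        fix y assume y: "y \<in> ?U"
        then have "G (F y) = y" using GF by auto
        then show "y \<in> G ` ?V" using y by (intro image_eqI[of y G "F y"]) auto
      qed
    qed
  qed (use GF FG in auto)
  have "regular_on r ?U F" by (rule regular_on_vecI[OF oU F]) auto
  moreover have "regular_on r ?V G" by (rule regular_on_vecI[OF oV G]) auto
  moreover have "0 \<in> ?U" "0 \<in> ?V" using o F0 G0 by auto
  ultimately show ?thesis
    unfolding diffeo_germ_def using F0 oU oV hom
    by (intro conjI[OF F0] exI[of _ ?U] exI[of _ ?V] exI[of _ G] conjI)
qed

lemma diffeo_germE:
  fixes F :: "real^'d \<Rightarrow> real^'d"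
  assumes "diffeo_germ r F"
  obtains U V G where "open U" "open V" "0 \<in> U" "0 \<in> V" "F 0 = 0" "G 0 = 0"
    "\<And>x j. x \<in> U \<Longrightarrow> rg r x (\<lambda>x. F x $ j)" "\<And>y j. y \<in> V \<Longrightarrow> rg r y (\<lambda>y. G y $ j)"
    "\<And>x. x \<in> U \<Longrightarrow> F x \<in> V" "\<And>y. y \<in> V \<Longrightarrow> G y \<in> U"
    "\<And>x. x \<in> U \<Longrightarrow> G (F x) = x" "\<And>y. y \<in> V \<Longrightarrow> F (G y) = y"
proof -
  from assms obtain U V G where F0: "F 0 = 0" and o: "open U" "open V" "0 \<in> U" "0 \<in> V"
    and h: "homeomorphism U V F G" and rF: "regular_on r U F" and rG: "regular_on r V G"
    unfolding diffeo_germ_def by (elim exE conjE) (rule that)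
  have 1: "F x \<in> V" if "x \<in> U" for x using h that unfolding homeomorphism_def by blast
  have 2: "G x \<in> U" if "x \<in> V" for x using h that unfolding homeomorphism_def by blast
  have 3: "G (F x) = x" if "x \<in> U" for x using h that unfolding homeomorphism_def by blast
  have 4: "F (G x) = x" if "x \<in> V" for x using h that unfolding homeomorphism_def by blast
  have G0: "G 0 = 0" using 3[OF o(3)] F0 by simp
  show ?thesis
    by (rule that[OF o F0 G0 regular_on_nth[OF o(1) _ rF] regular_on_nth[OF o(2) _ rG] 1 2 3 4])
qed

lemma diffeo_germ_inverse:
  fixes F :: "real^'d \<Rightarrow> real^'d"
  assumes "diffeo_germ r F"
  obtains G where "diffeo_germ r G" "\<forall>\<^sub>F x in nhds 0. G (F x) = x" "\<forall>\<^sub>F y in nhds 0. F (G y) = y"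
proof -
  obtain U V G where *: "open U" "open V" "0 \<in> U" "0 \<in> V" "F 0 = 0" "G 0 = 0"
    "\<And>x j. x \<in> U \<Longrightarrow> rg r x (\<lambda>x. F x $ j)" "\<And>y j. y \<in> V \<Longrightarrow> rg r y (\<lambda>y. G y $ j)"
    "\<And>x. x \<in> U \<Longrightarrow> F x \<in> V" "\<And>y. y \<in> V \<Longrightarrow> G y \<in> U"
    "\<And>x. x \<in> U \<Longrightarrow> G (F x) = x" "\<And>y. y \<in> V \<Longrightarrow> F (G y) = y"
    by (rule diffeo_germE[OF assms]) (rule that)
  have "diffeo_germ r G"
    by (rule diffeo_germI[OF *(2,1,4,3,6,8,7) *(12,11)])
  moreover have "\<forall>\<^sub>F x in nhds 0. G (F x) = x" "\<forall>\<^sub>F y in nhds 0. F (G y) = y"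
    using * unfolding eventually_nhds by metis+
  ultimately show ?thesis by (rule that)
qed

lemma diffeo_germ_smooth:
  fixes F :: "real^'d \<Rightarrow> real^'d"
  assumes "diffeo_germ r F"
  obtains e where "0 < e" "smooth_on (ball 0 e) F"
proof -
  obtain U V G where U: "(0::real^'d) \<in> U" and F: "\<And>x j. x \<in> U \<Longrightarrow> rg r x (\<lambda>x. F x $ j)"
    by (rule diffeo_germE[OF assms]) (rule that)
  show ?thesis using rg_map_smooth[OF F[OF U]] that by blast
qed

lemma diffeo_germ_0: "diffeo_germ r F \<Longrightarrow> F 0 = 0"
  by (simp add: diffeo_germ_def)

lemma diffeo_germ_has_derivative:
  assumes "diffeo_germ r F"
  shows "\<forall>\<^sub>F x in nhds 0. (F has_derivative frechet_derivative F (at x)) (at x)"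
proof -
  obtain e where e: "0 < e" "smooth_on (ball 0 e) F" using diffeo_germ_smooth[OF assms] .
  then show ?thesis
    unfolding eventually_nhds by (intro exI[of _ "ball 0 e"]) (auto intro: smooth_on_has_derivative)
qed

lemma diffeo_germ_tendsto:
  assumes "diffeo_germ r F"
  shows "(F \<longlongrightarrow> 0) (nhds 0)"
proof -
  have "(F has_derivative frechet_derivative F (at 0)) (at 0)"
    using diffeo_germ_has_derivative[OF assms] by (rule eventually_nhds_x_imp_x)
  then have "isCont F 0" by (rule has_derivative_continuous)
  then have "(F \<longlongrightarrow> F 0) (nhds 0)" unfolding isCont_def tendsto_at_iff_tendsto_nhds .
  then show ?thesis by (simp add: diffeo_germ_0[OF assms])
qed

lemma diffeo_germ_eventually:
  assumes "diffeo_germ r F" "\<forall>\<^sub>F x in nhds 0. P x"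
  shows "\<forall>\<^sub>F x in nhds 0. P (F x)"
  using diffeo_germ_tendsto[OF assms(1)] assms(2) by (simp add: filterlim_iff)

lemma diffeo_germ_compose:
  fixes F G :: "real^'d \<Rightarrow> real^'d"
  assumes "diffeo_germ r F" "diffeo_germ r G"
  shows "diffeo_germ r (G \<circ> F)"
proof -
  obtain U V F' where F: "open U" "open V" "0 \<in> U" "0 \<in> V" "F 0 = 0" "F' 0 = 0"
    "\<And>x j. x \<in> U \<Longrightarrow> rg r x (\<lambda>x. F x $ j)" "\<And>y j. y \<in> V \<Longrightarrow> rg r y (\<lambda>y. F' y $ j)"
    "\<And>x. x \<in> U \<Longrightarrow> F x \<in> V" "\<And>y. y \<in> V \<Longrightarrow> F' y \<in> U"
    "\<And>x. x \<in> U \<Longrightarrow> F' (F x) = x" "\<And>y. y \<in> V \<Longrightarrow> F (F' y) = y"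
    by (rule diffeo_germE[OF assms(1)]) (rule that)
  obtain U' V' G' where G: "open U'" "open V'" "0 \<in> U'" "0 \<in> V'" "G 0 = 0" "G' 0 = 0"
    "\<And>x j. x \<in> U' \<Longrightarrow> rg r x (\<lambda>x. G x $ j)" "\<And>y j. y \<in> V' \<Longrightarrow> rg r y (\<lambda>y. G' y $ j)"
    "\<And>x. x \<in> U' \<Longrightarrow> G x \<in> V'" "\<And>y. y \<in> V' \<Longrightarrow> G' y \<in> U'"
    "\<And>x. x \<in> U' \<Longrightarrow> G' (G x) = x" "\<And>y. y \<in> V' \<Longrightarrow> G (G' y) = y"
    by (rule diffeo_germE[OF assms(2)]) (rule that)
  let ?U = "U \<inter> F -` U'" and ?V = "V' \<inter> G' -` V"
  have o: "open ?U" "open ?V"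
    using F(1,2) G(1,2) rg_map_continuous[OF F(7)] rg_map_continuous[OF G(8)] by (auto intro!: continuous_open_preimage)
  show ?thesis
  proof (rule diffeo_germI[OF o])
    show "0 \<in> ?U" "0 \<in> ?V" "(G \<circ> F) 0 = 0" using F G by auto
    show "rg r x (\<lambda>x. (G \<circ> F) x $ j)" if "x \<in> ?U" for x j
      unfolding o_def by (rule rg_compose[of r x F "\<lambda>y. G y $ j"]) (use that F(7) G(7) in auto)
    show "rg r x (\<lambda>x. (F' \<circ> G') x $ j)" if "x \<in> ?V" for x j
      unfolding o_def by (rule rg_compose[of r x G' "\<lambda>y. F' y $ j"]) (use that G(8) F(8) in auto)
    show "(F' \<circ> G') ((G \<circ> F) x) = x" if "x \<in> ?U" for x using that F(11) G(11) by simp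
    show "(G \<circ> F) ((F' \<circ> G') x) = x" if "x \<in> ?V" for x using that F(12) G(12) by simp
  qed
qed

lemma rg_linear:
  fixes A :: "real^'d \<Rightarrow> real"
  assumes "linear A" shows "rg r p A"
proof (cases r)
  case Smooth
  then show ?thesis
    using assms by (auto intro!: rg_SmoothI[OF open_UNIV] smooth_on_bounded_linear simp: linear_conv_bounded_linear)
next
  case Analytic
  have "A x = (\<Sum>i\<in>UNIV. x $ i * A (axis i 1))" for x
    by (subst basis_expansion[of x, symmetric]) (simp add: linear_sum[OF assms] linear_cmul[OF assms] scalar_mult_eq_scaleR)
  moreover have "rg Analytic p (\<lambda>x. \<Sum>i\<in>I. x $ i * A (axis i 1))" if "finite I" for I
    using that by (induction I) (auto intro!: rg_const rg_add rg_mult rg_nth)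
  ultimately show ?thesis unfolding Analytic by (metis (no_types, lifting) ext finite)
qed

section \<open>Flows of time-dependent fields\<close>

text \<open>Time is carried as the additional coordinate \<open>None\<close>.\<close>

definition emb :: "real \<Rightarrow> real^'d \<Rightarrow> real^('d option)" where
  "emb t x = (\<chi> i. case i of None \<Rightarrow> t | Some j \<Rightarrow> x $ j)"

definition prj :: "real^('d option) \<Rightarrow> real^'d" where "prj y = (\<chi> j. y $ Some j)"

lemma emb_nth [simp]: "emb t x $ None = t" "emb t x $ Some j = x $ j"
  by (simp_all add: emb_def)

lemma prj_nth [simp]: "prj y $ j = y $ Some j" by (simp add: prj_def)

lemma prj_emb [simp]: "prj (emb t x) = x" by (simp add: vec_eq_iff)

lemma emb_prj: "emb (y $ None) (prj y) = y"
  by (simp add: vec_eq_iff split: option.split) (metis emb_nth not_Some_eq prj_nth)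

lemma emb_eq: "emb t x = emb t 0 + emb 0 x"
  by (simp add: vec_eq_iff emb_def split: option.split)

lemma linear_emb0: "linear (emb 0)"
  by (rule linearI) (simp_all add: vec_eq_iff emb_def split: option.split)

lemma linear_emb1: "linear (\<lambda>t. emb t 0)"
  by (rule linearI) (simp_all add: vec_eq_iff emb_def split: option.split)

lemma linear_prj: "linear prj"
  by (rule linearI) (simp_all add: vec_eq_iff)

lemma emb_has_derivative: "(emb t has_derivative emb 0) (at x)"
proof -
  have "((\<lambda>x. emb t 0 + emb 0 x) has_derivative (\<lambda>v. 0 + emb 0 v)) (at x)"
    by (intro derivative_intros linear_imp_has_derivative linear_emb0)
  then show ?thesis by (simp flip: emb_eq)
qed

lemma continuous_emb: "continuous_on S (emb t)" "continuous_on T (\<lambda>t. emb t x)"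
proof -
  show "continuous_on S (emb t)"
    using emb_has_derivative by (intro continuous_at_imp_continuous_on ballI has_derivative_continuous)
  have "continuous_on T (\<lambda>t. emb t 0 + emb 0 x)"
    by (intro continuous_intros linear_continuous_on linear_emb1[unfolded linear_conv_bounded_linear])
  then show "continuous_on T (\<lambda>t. emb t x)" by (simp flip: emb_eq)
qed

lemma rg_emb: "rg r x (\<lambda>x. emb t x $ i)"
  by (cases i) (simp_all add: rg_const rg_nth)

lemma emb_has_vector_derivative: "((\<lambda>s. emb (t + s) x) has_vector_derivative emb 1 0) (at s)"
proof -
  have "((\<lambda>s. emb t x + s *\<^sub>R emb 1 0) has_vector_derivative 0 + 1 *\<^sub>R emb 1 0) (at s)"
    by (intro derivative_eq_intros) auto
  moreover have "emb t x + s *\<^sub>R emb 1 0 = emb (t + s) x" for s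
    by (simp add: vec_eq_iff emb_def split: option.split)
  ultimately show ?thesis by simp
qed

text \<open>The field becomes autonomous when the time coordinate moves with speed 1. Regularity at
  the single point \<open>emb t0 0\<close> yields maps for times near \<open>t0\<close>, and
  vanishing of \<open>X\<close> on the time axis makes them fix the origin. The variational equation
  is included because pullbacks of forms involve the derivative of the flow.\<close>

lemma time_flow:
  fixes X :: "real^('d option) \<Rightarrow> real^'d"
  assumes X: "\<And>j. rg r (emb t0 0) (\<lambda>y. X y $ j)" and X0: "\<forall>\<^sub>F t in nhds t0. X (emb t 0) = 0"
    and N: "open N" "emb t0 0 \<in> N"
  obtains d U \<phi> where "0 < d" "open U" "0 \<in> U" "\<And>s. \<bar>s\<bar> < d \<Longrightarrow> diffeo_germ r (\<phi> s)" "\<And>x. \<phi> 0 x = x"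
    "\<And>s x. \<bar>s\<bar> < d \<Longrightarrow> x \<in> U \<Longrightarrow> emb (t0 + s) (\<phi> s x) \<in> N"
    "\<And>s x. \<bar>s\<bar> < d \<Longrightarrow> x \<in> U \<Longrightarrow> ((\<lambda>s. \<phi> s x) has_vector_derivative X (emb (t0 + s) (\<phi> s x))) (at s)"
    "\<And>s x. \<bar>s\<bar> < d \<Longrightarrow> x \<in> U \<Longrightarrow> (\<phi> s has_derivative frechet_derivative (\<phi> s) (at x)) (at x)"
    "\<And>s x v. \<bar>s\<bar> < d \<Longrightarrow> x \<in> U \<Longrightarrow> ((\<lambda>s. frechet_derivative (\<phi> s) (at x) v) has_vector_derivative
        frechet_derivative X (at (emb (t0 + s) (\<phi> s x))) (emb 0 (frechet_derivative (\<phi> s) (at x) v))) (at s)"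
proof -
  obtain e1 where e1: "0 < e1" "smooth_on (ball (emb t0 0) e1) X" using rg_map_smooth[OF X] .
  define V where "V y = emb 1 (X y)" for y
  have V: "rg r (emb t0 0) (\<lambda>y. V y $ i)" for i
    unfolding V_def using X by (cases i) (simp_all add: rg_const)
  have N': "open (N \<inter> ball (emb t0 0) e1)" "emb t0 0 \<in> N \<inter> ball (emb t0 0) e1" using N e1 by auto
  obtain d W \<Phi> where d: "0 < d" and W: "open W" "emb t0 0 \<in> W" "W \<subseteq> N \<inter> ball (emb t0 0) e1"
    and rgF: "\<And>t x j. \<bar>t\<bar> < d \<Longrightarrow> x \<in> W \<Longrightarrow> rg r x (\<lambda>x. \<Phi> t x $ j)"
    and F0: "\<And>x. \<Phi> 0 x = x" and FN: "\<And>t x. \<bar>t\<bar> < d \<Longrightarrow> x \<in> W \<Longrightarrow> \<Phi> t x \<in> N \<inter> ball (emb t0 0) e1"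
    and ode: "\<And>t x. \<bar>t\<bar> < d \<Longrightarrow> x \<in> W \<Longrightarrow> ((\<lambda>s. \<Phi> s x) has_vector_derivative V (\<Phi> t x)) (at t)"
    and var: "\<And>t x v. \<bar>t\<bar> < d \<Longrightarrow> x \<in> W \<Longrightarrow> ((\<lambda>s. frechet_derivative (\<Phi> s) (at x) v) has_vector_derivative
          frechet_derivative V (at (\<Phi> t x)) (frechet_derivative (\<Phi> t) (at x) v)) (at t)"
    and inv: "\<And>t x. \<bar>t\<bar> < d \<Longrightarrow> x \<in> W \<Longrightarrow> \<Phi> t x \<in> W \<Longrightarrow> \<Phi> (- t) (\<Phi> t x) = x"
    and uniq: "\<forall>\<gamma> t. \<bar>t\<bar> < d \<longrightarrow> (\<forall>s. \<bar>s\<bar> \<le> \<bar>t\<bar> \<longrightarrow> \<gamma> s \<in> W \<and> (\<gamma> has_vector_derivative V (\<gamma> s)) (at s)) \<longrightarrow> \<gamma> t = \<Phi> t (\<gamma> 0)"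
    by (rule regular_flow[OF V N']) (rule that)
  have None: "\<Phi> s y $ None = y $ None + s" if y: "y \<in> W" and s: "\<bar>s\<bar> < d" for s y
  proof -
    have "((\<lambda>s. \<Phi> s y $ None - s) has_vector_derivative 0) (at s within {-d<..<d})" if "s \<in> {-d<..<d}" for s
    proof -
      have "\<bar>s\<bar> < d" using that by auto
      from bounded_linear.has_vector_derivative[OF bounded_linear_vec_nth ode[OF this y], of None]
      have "((\<lambda>s. \<Phi> s y $ None - s) has_vector_derivative 1 - 1) (at s)"
        unfolding V_def emb_nth by (intro has_vector_derivative_diff has_vector_derivative_id)
      then show ?thesis by (auto intro: has_vector_derivative_at_within)
    qed
    from has_vector_derivative_zero_constant[OF _ this]
    obtain c where c: "\<And>s. s \<in> {-d<..<d} \<Longrightarrow> \<Phi> s y $ None - s = c" by auto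
    have "s \<in> {-d<..<d}" "0 \<in> {-d<..<d}" using s d by auto
    from c[OF this(1)] c[OF this(2)] show ?thesis unfolding F0 by linarith
  qed
  define \<phi> where "\<phi> s x = prj (\<Phi> s (emb t0 x))" for s x
  have \<Phi>: "\<Phi> s (emb t0 x) = emb (t0 + s) (\<phi> s x)" if "emb t0 x \<in> W" "\<bar>s\<bar> < d" for s x
    using None[OF that] emb_prj[of "\<Phi> s (emb t0 x)"] by (simp add: \<phi>_def)
  have "\<forall>\<^sub>F t in nhds t0. emb t 0 \<in> W"
  proof -
    have "open ((\<lambda>t. emb t 0) -` W)" by (rule open_vimage[OF W(1) continuous_emb(2)])
    then show ?thesis unfolding eventually_nhds using W(2) by (intro exI[of _ "(\<lambda>t. emb t 0) -` W"]) auto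
  qed
  with X0 have "\<forall>\<^sub>F t in nhds t0. emb t 0 \<in> W \<and> X (emb t 0) = 0" by eventually_elim auto
  then obtain d2 where d2: "0 < d2" "\<And>t. dist t t0 < d2 \<Longrightarrow> emb t 0 \<in> W \<and> X (emb t 0) = 0"
    unfolding eventually_nhds_metric by blast
  have d2': "emb (t0 + s) 0 \<in> W" "X (emb (t0 + s) 0) = 0" if "\<bar>s\<bar> < d2" for s
    using d2(2)[of "t0 + s"] that by (auto simp: dist_real_def)
  \<comment> \<open>Where \<open>X\<close> vanishes the time axis is itself an integral curve;
    uniqueness makes it the flow line through the origin.\<close>
  have \<phi>0: "\<phi> s 0 = 0" if s: "\<bar>s\<bar> < min d d2" for s
  proof -
    have sd: "\<bar>s\<bar> < d" using s by simp
    have h: "\<forall>\<sigma>. \<bar>\<sigma>\<bar> \<le> \<bar>s\<bar> \<longrightarrow> emb (t0 + \<sigma>) 0 \<in> W \<and> ((\<lambda>s. emb (t0 + s) 0) has_vector_derivative V (emb (t0 + \<sigma>) 0)) (at \<sigma>)"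
    proof (intro allI impI)
      fix \<sigma> assume "\<bar>\<sigma>\<bar> \<le> \<bar>s\<bar>"
      then have "\<bar>\<sigma>\<bar> < d2" using s by simp
      from d2'[OF this] show "emb (t0 + \<sigma>) 0 \<in> W \<and> ((\<lambda>s. emb (t0 + s) 0) has_vector_derivative V (emb (t0 + \<sigma>) 0)) (at \<sigma>)"
        using emb_has_vector_derivative by (simp add: V_def)
    qed
    have e: "emb (t0 + s) 0 = \<Phi> s (emb (t0 + 0) 0)"
      by (rule uniq[THEN spec, of "\<lambda>s. emb (t0 + s) 0", THEN spec, THEN mp, THEN mp, OF sd h])
    have "\<phi> s 0 = prj (emb (t0 + s) 0)" unfolding e by (simp add: \<phi>_def)
    then show ?thesis by simp
  qed
  define U where "U = emb t0 -` W"
  have U: "open U" "0 \<in> U" unfolding U_def using W by (auto intro: open_vimage continuous_emb)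
  have rg\<Phi>: "rg r x (\<lambda>x. prj (\<Phi> s (emb t x)) $ j)" if "emb t x \<in> W" "\<bar>s\<bar> < d" for s t x j
    using rg_compose[OF rg_emb rgF[OF that(2,1)], of "Some j"] by simp
  have \<phi>d: "(\<phi> s has_derivative (\<lambda>v. prj (frechet_derivative (\<Phi> s) (at (emb t0 x)) (emb 0 v)))) (at x)"
    if x: "x \<in> U" and s: "\<bar>s\<bar> < d" for s x
  proof -
    obtain e where e: "0 < e" "smooth_on (ball (emb t0 x) e) (\<Phi> s)"
      using rg_map_smooth[OF rgF[OF s]] x unfolding U_def by blast
    have "(\<Phi> s has_derivative frechet_derivative (\<Phi> s) (at (emb t0 x))) (at (emb t0 x))"
      using smooth_on_has_derivative[OF e(2)] e(1) by simp
    from diff_chain_at[OF diff_chain_at[OF emb_has_derivative this] linear_imp_has_derivative[OF linear_prj]]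
    show ?thesis by (simp add: o_def \<phi>_def[abs_def])
  qed
  show ?thesis
  proof (rule that[of "min d d2" U \<phi>])
    show "0 < min d d2" using d d2 by simp
    show "open U" "0 \<in> U" by (rule U)+
    show "\<phi> 0 x = x" for x by (simp add: \<phi>_def F0)
    show "emb (t0 + s) (\<phi> s x) \<in> N" if "\<bar>s\<bar> < min d d2" "x \<in> U" for s x
      using FN[of s "emb t0 x"] \<Phi>[of x s] that by (auto simp: U_def)
    show "((\<lambda>s. \<phi> s x) has_vector_derivative X (emb (t0 + s) (\<phi> s x))) (at s)" if "\<bar>s\<bar> < min d d2" "x \<in> U" for s x
    proof -
      have x: "emb t0 x \<in> W" and s: "\<bar>s\<bar> < d" using that by (auto simp: U_def)
      from bounded_linear.has_vector_derivative[OF linear_prj[unfolded linear_conv_bounded_linear] ode[OF s x]]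
      have h: "((\<lambda>s. \<phi> s x) has_vector_derivative prj (V (\<Phi> s (emb t0 x)))) (at s)" unfolding \<phi>_def .
      have "prj (V (\<Phi> s (emb t0 x))) = X (emb (t0 + s) (\<phi> s x))" by (simp add: V_def \<Phi>[OF x s])
      with h show ?thesis by (simp only:)
    qed
    show "(\<phi> s has_derivative frechet_derivative (\<phi> s) (at x)) (at x)" if "\<bar>s\<bar> < min d d2" "x \<in> U" for s x
    proof -
      have "\<bar>s\<bar> < d" using that(1) by simp
      from \<phi>d[OF that(2) this] show ?thesis unfolding frechet_derivative_eqI[OF \<phi>d[OF that(2) \<open>\<bar>s\<bar> < d\<close>]] .
    qed
    show "((\<lambda>s. frechet_derivative (\<phi> s) (at x) v) has_vector_derivative
        frechet_derivative X (at (emb (t0 + s) (\<phi> s x))) (emb 0 (frechet_derivative (\<phi> s) (at x) v))) (at s)"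
      if "\<bar>s\<bar> < min d d2" "x \<in> U" for s x v
    proof -
      have x: "emb t0 x \<in> W" and s: "\<bar>s\<bar> < d" using that by (auto simp: U_def)
      let ?y = "\<Phi> s (emb t0 x)"
      have "?y \<in> ball (emb t0 0) e1" using FN[OF s x] by auto
      from smooth_on_has_derivative[OF e1(2) this]
      have dX: "(X has_derivative frechet_derivative X (at ?y)) (at ?y)" .
      have "(V has_derivative (\<lambda>w. emb 0 (frechet_derivative X (at ?y) w))) (at ?y)"
        using diff_chain_at[OF dX emb_has_derivative] by (simp add: o_def V_def[abs_def])
      then have dV: "frechet_derivative V (at ?y) = (\<lambda>w. emb 0 (frechet_derivative X (at ?y) w))"
        by (rule frechet_derivative_eqI)
      let ?D = "\<lambda>s. frechet_derivative (\<Phi> s) (at (emb t0 x)) (emb 0 v)"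
      have D: "frechet_derivative (\<phi> \<sigma>) (at x) v = prj (?D \<sigma>)" if "\<bar>\<sigma>\<bar> < d" for \<sigma>
        using frechet_derivative_eqI[OF \<phi>d[OF \<open>x \<in> U\<close> that]] by simp
      have varD: "((\<lambda>s. ?D s) has_vector_derivative emb 0 (frechet_derivative X (at (\<Phi> \<sigma> (emb t0 x))) (?D \<sigma>))) (at \<sigma>)"
        if "\<sigma> = s" for \<sigma> using var[OF s x, of "emb 0 v"] that by (simp add: dV)
      \<comment> \<open>The time coordinate of the flow does not depend on \<open>x\<close>, so
        spatial derivatives have no time component and the variational equation closes in
        space.\<close>
      have DNone: "?D s $ None = 0"
      proof -
        have "((\<lambda>x. \<Phi> s (emb t0 x) $ None) has_derivative (\<lambda>v. frechet_derivative (\<Phi> s) (at (emb t0 x)) (emb 0 v) $ None)) (at x)"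
        proof -
          obtain e where e: "0 < e" "smooth_on (ball (emb t0 x) e) (\<Phi> s)"
            using rg_map_smooth[OF rgF[OF s x]] by blast
          have "(\<Phi> s has_derivative frechet_derivative (\<Phi> s) (at (emb t0 x))) (at (emb t0 x))"
            using smooth_on_has_derivative[OF e(2)] e(1) by simp
          from bounded_linear.has_derivative[OF bounded_linear_vec_nth diff_chain_at[OF emb_has_derivative this]]
          show ?thesis by (simp add: o_def)
        qed
        moreover have "((\<lambda>x. \<Phi> s (emb t0 x) $ None) has_derivative (\<lambda>v. 0)) (at x)"
          by (rule has_derivative_transform_within_open[OF has_derivative_const U(1) \<open>x \<in> U\<close>, of "t0 + s"])
            (use None s in \<open>simp add: U_def\<close>)
        ultimately show ?thesis using has_derivative_unique by metis
      qed
      have De: "?D s = emb 0 (prj (?D s))" using emb_prj[of "?D s"] by (simp add: DNone)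
      have "((\<lambda>s. prj (?D s)) has_vector_derivative prj (emb 0 (frechet_derivative X (at ?y) (?D s)))) (at s)"
        by (rule bounded_linear.has_vector_derivative[OF linear_prj[unfolded linear_conv_bounded_linear] varD[OF refl]])
      then have "((\<lambda>s. prj (?D s)) has_vector_derivative frechet_derivative X (at ?y) (emb 0 (prj (?D s)))) (at s)"
        using De by simp
      then have "((\<lambda>s. frechet_derivative (\<phi> s) (at x) v) has_vector_derivative frechet_derivative X (at ?y) (emb 0 (prj (?D s)))) (at s)"
        by (rule has_vector_derivative_transform_within_open[OF _ open_greaterThanLessThan[of "-d" d]])
          (use s D in auto)
      then show ?thesis by (simp add: D[OF s] \<Phi>[OF x s])
    qed
    show "diffeo_germ r (\<phi> s)" if s': "\<bar>s\<bar> < min d d2" for s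
    proof -
      have s: "\<bar>s\<bar> < d" "\<bar>- s\<bar> < d" using s' by auto
      \<comment> \<open>The inverse runs the flow backwards, starting at time
        \<open>t0 + s\<close>.\<close>
      let ?V = "emb (t0 + s) -` W" and ?G = "\<lambda>y. prj (\<Phi> (- s) (emb (t0 + s) y))"
      have V: "open ?V" "0 \<in> ?V" using W d2' s' by (auto intro: open_vimage continuous_emb)
      have h1: "rg r x (\<lambda>x. \<phi> s x $ j)" if "x \<in> U" for x j
        using rg\<Phi>[OF _ s(1)] that unfolding \<phi>_def U_def by simp
      have h2: "rg r y (\<lambda>y. ?G y $ j)" if "y \<in> ?V" for y j
        using rg\<Phi>[OF _ s(2)] that by simp
      have h3: "?G (\<phi> s x) = x" if "x \<in> U" "\<phi> s x \<in> ?V" for x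
      proof -
        have x: "emb t0 x \<in> W" using that by (simp add: U_def)
        have "\<Phi> (- s) (\<Phi> s (emb t0 x)) = emb t0 x"
          by (rule inv[OF s(1) x]) (use that \<Phi>[OF x s(1)] in simp)
        then show ?thesis by (simp add: \<Phi>[OF x s(1)])
      qed
      have h4: "\<phi> s (?G y) = y" if "y \<in> ?V" "?G y \<in> U" for y
      proof -
        have y: "emb (t0 + s) y \<in> W" using that by simp
        have e: "\<Phi> (- s) (emb (t0 + s) y) = emb t0 (?G y)"
          using emb_prj[of "\<Phi> (- s) (emb (t0 + s) y)"] None[OF y s(2)] by simp
        have "\<Phi> (- (- s)) (\<Phi> (- s) (emb (t0 + s) y)) = emb (t0 + s) y"
          by (rule inv[OF s(2) y]) (use that(2) e in \<open>simp add: U_def\<close>)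
        then show ?thesis unfolding \<phi>_def e[symmetric] by simp
      qed
      show ?thesis
        by (rule diffeo_germI[where F="\<phi> s" and G="?G", OF U(1) V(1) U(2) V(2) \<phi>0[OF s'] h1 h2 h3 h4])
    qed
  qed
qed

section \<open>Equivalence of germs of forms\<close>

lemma diffeo_germ_chain:
  fixes F G :: "real^'d \<Rightarrow> real^'d"
  assumes "diffeo_germ r F" "diffeo_germ r G"
  shows "\<forall>\<^sub>F x in nhds 0. frechet_derivative (G \<circ> F) (at x) = frechet_derivative G (at (F x)) \<circ> frechet_derivative F (at x)"
  using diffeo_germ_has_derivative[OF assms(1)] diffeo_germ_eventually[OF assms(1) diffeo_germ_has_derivative[OF assms(2)]]
proof eventually_elim
  case (elim x)
  from diff_chain_at[OF elim] show ?case by (rule frechet_derivative_eqI)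
qed

lemma diffeo_germ_left_inverse_derivative:
  fixes F G :: "real^'d \<Rightarrow> real^'d"
  assumes F: "diffeo_germ r F" and G: "diffeo_germ r G" and FG: "\<forall>\<^sub>F y in nhds 0. F (G y) = y"
  shows "\<forall>\<^sub>F y in nhds 0. \<forall>v. frechet_derivative F (at (G y)) (frechet_derivative G (at y) v) = v"
proof -
  have "\<forall>\<^sub>F y in nhds 0. \<forall>\<^sub>F y in nhds y. F (G y) = y" using FG by (simp add: eventually_eventually)
  with diffeo_germ_chain[OF G F] show ?thesis
  proof eventually_elim
    case (elim y)
    obtain S where S: "open S" "y \<in> S" "\<And>z. z \<in> S \<Longrightarrow> z = (F \<circ> G) z"
      using elim(2) unfolding eventually_nhds by auto
    have "(F \<circ> G has_derivative (\<lambda>v. v)) (at y)"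
      by (rule has_derivative_transform_within_open[OF has_derivative_ident S])
    from frechet_derivative_eqI[OF this] elim(1) show ?case by (metis comp_apply)
  qed
qed

text \<open>A relation, so that small steps in the parameter of a family can be chained without
  keeping track of the maps.\<close>

definition form_equiv :: "regularity \<Rightarrow> (real^'d) dform \<Rightarrow> (real^'d) dform \<Rightarrow> bool" where
  "form_equiv r \<omega> \<omega>' \<longleftrightarrow> (\<exists>\<Psi>. diffeo_germ r \<Psi> \<and> (\<forall>\<^sub>F p in nhds 0. pullback \<Psi> \<omega>' p = \<omega> p))"

lemma form_equiv_sym:
  assumes "form_equiv r \<omega> \<omega>'" shows "form_equiv r \<omega>' \<omega>"
proof -
  obtain \<Psi> where \<Psi>: "diffeo_germ r \<Psi>" "\<forall>\<^sub>F p in nhds 0. pullback \<Psi> \<omega>' p = \<omega> p"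
    using assms unfolding form_equiv_def by blast
  obtain G where G: "diffeo_germ r G" "\<forall>\<^sub>F x in nhds 0. G (\<Psi> x) = x" "\<forall>\<^sub>F y in nhds 0. \<Psi> (G y) = y"
    by (rule diffeo_germ_inverse[OF \<Psi>(1)]) (rule that)
  have "\<forall>\<^sub>F q in nhds 0. pullback G \<omega> q = \<omega>' q"
    using diffeo_germ_eventually[OF G(1) \<Psi>(2)] G(3) diffeo_germ_left_inverse_derivative[OF \<Psi>(1) G(1,3)]
  proof eventually_elim
    case (elim q)
    show ?case
      unfolding pullback_def elim(1)[symmetric] elim(2) by (simp add: o_def elim(3))
  qed
  then show ?thesis unfolding form_equiv_def using G(1) by blast
qed

lemma form_equiv_trans:
  assumes "form_equiv r \<omega> \<omega>'" "form_equiv r \<omega>' \<omega>''" shows "form_equiv r \<omega> \<omega>''"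
proof -
  obtain F where F: "diffeo_germ r F" "\<forall>\<^sub>F p in nhds 0. pullback F \<omega>' p = \<omega> p"
    using assms(1) unfolding form_equiv_def by blast
  obtain G where G: "diffeo_germ r G" "\<forall>\<^sub>F p in nhds 0. pullback G \<omega>'' p = \<omega>' p"
    using assms(2) unfolding form_equiv_def by blast
  have "\<forall>\<^sub>F p in nhds 0. pullback (G \<circ> F) \<omega>'' p = \<omega> p"
    using F(2) diffeo_germ_eventually[OF F(1) G(2)] diffeo_germ_chain[OF F(1) G(1)]
  proof eventually_elim
    case (elim p)
    show ?case
      unfolding elim(1)[symmetric] unfolding pullback_def elim(3) unfolding elim(2)[symmetric] unfolding pullback_def
      by (simp add: o_def)
  qed
  then show ?thesis unfolding form_equiv_def using diffeo_germ_compose[OF F(1) G(1)] by blast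
qed

lemma diffeo_germ_linear:
  fixes A B :: "real^'d \<Rightarrow> real^'d"
  assumes "linear A" "linear B" "\<And>x. B (A x) = x" "\<And>x. A (B x) = x"
  shows "diffeo_germ r A"
proof (rule diffeo_germI[where U=UNIV and V=UNIV and G=B])
  have "linear (\<lambda>x. A x $ j)" "linear (\<lambda>x. B x $ j)" for j
    using linear_compose[OF assms(1) bounded_linear.linear[OF bounded_linear_vec_nth]]
      linear_compose[OF assms(2) bounded_linear.linear[OF bounded_linear_vec_nth]] by (simp_all add: o_def)
  then show "rg r x (\<lambda>x. A x $ j)" "rg r x (\<lambda>x. B x $ j)" for x j by (simp_all add: rg_linear)
qed (use assms linear_0 in auto)

section \<open>Straightening a hypersurface\<close>

lemma rg_nonzero_nbhd:
  assumes "rg r p f" "f p \<noteq> 0"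
  obtains N where "open N" "p \<in> N" "\<And>x. x \<in> N \<Longrightarrow> f x \<noteq> 0"
proof -
  obtain e where e: "0 < e" "smooth_on (ball p e) f" using rg_imp_smooth[OF assms(1)] .
  have "open (ball p e \<inter> f -` (- {0}))"
    by (intro continuous_open_preimage smooth_on_continuous[OF e(2)] open_ball) auto
  then show ?thesis by (rule that) (use e assms(2) in auto)
qed

lemma rg_prj:
  fixes f :: "real^'d \<Rightarrow> real"
  assumes "rg r (prj p) f" shows "rg r p (\<lambda>y. f (prj y))"
  by (rule rg_compose[of r p prj f]) (simp_all add: rg_nth assms)

lemma rg_diff: "rg r p f \<Longrightarrow> rg r p g \<Longrightarrow> rg r p (\<lambda>x. f x - g x)"
  using rg_add[of r p f "\<lambda>x. (-1) * g x"] rg_mult[OF rg_const, of r p g "-1"] by simp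

lemma rg_has_derivative:
  assumes "rg r p f"
  obtains N where "open N" "p \<in> N" "\<And>x. x \<in> N \<Longrightarrow> (f has_derivative frechet_derivative f (at x)) (at x)"
proof -
  obtain e where e: "0 < e" "smooth_on (ball p e) f" using rg_imp_smooth[OF assms(1)] .
  show ?thesis by (rule that[OF open_ball _ smooth_on_has_derivative[OF e(2)]]) (use e(1) in auto)
qed

text \<open>Moser's argument for functions. The time derivative of \<open>F t\<close> is
  \<open>f - L\<close>, and the field with coefficient \<open>(L - f) / D\<close> along
  \<open>u\<close>, where \<open>D\<close> is the derivative of \<open>F t\<close> in direction
  \<open>u\<close>, compensates it. As \<open>f\<close> and \<open>L\<close> agree to first order at
  the origin, the field vanishes there to second order in space, so the derivative of the flow at
  the origin stays the identity.\<close>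

lemma straighten_step:
  fixes f L :: "real^'d \<Rightarrow> real"
  assumes f: "rg r 0 f" "f 0 = 0" and L: "L = frechet_derivative f (at 0)" and u: "L u = 1"
  defines "F \<equiv> \<lambda>t x. (1 - t) * L x + t * f x"
  shows "\<exists>d>0. \<forall>s. \<bar>s\<bar> < d \<longrightarrow> (\<exists>\<Psi>. diffeo_germ r \<Psi> \<and> frechet_derivative \<Psi> (at 0) = (\<lambda>v. v) \<and>
    (\<forall>\<^sub>F x in nhds 0. F (t0 + s) (\<Psi> x) = F t0 x))"
proof -
  obtain N0 where N0: "open N0" "0 \<in> N0" "\<And>x. x \<in> N0 \<Longrightarrow> (f has_derivative frechet_derivative f (at x)) (at x)"
    by (rule rg_has_derivative[OF f(1)]) (rule that)
  have blL: "bounded_linear L" unfolding L using N0(3)[OF N0(2)] by (rule has_derivative_bounded_linear)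
  then have linL: "linear L" by (rule bounded_linear.linear)
  have L0: "L 0 = 0" using linL by (rule linear_0)
  define D where "D y = (1 - y $ None) + y $ None * frechet_derivative f (at (prj y)) u" for y :: "real^('d option)"
  define g where "g y = L (prj y) - f (prj y)" for y :: "real^('d option)"
  define X where "X y = (g y * inverse (D y)) *\<^sub>R u" for y
  have p0: "prj (emb t0 0 :: real^('d option)) = 0" by simp
  have rgf: "rg r (emb t0 0) (\<lambda>y. f (prj y))" by (rule rg_prj) (simp add: f)
  have rgL: "rg r (emb t0 0) (\<lambda>y. L (prj y))" by (rule rg_prj) (simp add: rg_linear linL)
  have rgD: "rg r (emb t0 0) D"
    unfolding D_def[abs_def]
    by (intro rg_add rg_diff rg_mult rg_const rg_nth rg_prj) (simp add: rg_frechet_derivative f)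
  have D0: "D (emb t 0) = 1" for t using u by (simp add: D_def L[symmetric])
  have rgg: "rg r (emb t0 0) g" unfolding g_def[abs_def] by (intro rg_diff rgf rgL)
  have rgDi: "rg r (emb t0 0) (\<lambda>y. inverse (D y))" by (rule rg_inverse[OF rgD]) (simp add: D0)
  have rgX: "rg r (emb t0 0) (\<lambda>y. X y $ j)" for j
    unfolding X_def by (simp, intro rg_mult rgg rgDi rg_const)
  have g0: "g (emb t 0) = 0" for t by (simp add: g_def f L0)
  have X0: "X (emb t 0) = 0" for t by (simp add: X_def g0)
  obtain N1 where N1: "open N1" "emb t0 0 \<in> N1" "\<And>y. y \<in> N1 \<Longrightarrow> D y \<noteq> 0"
    by (rule rg_nonzero_nbhd[OF rgD]) (simp add: D0, rule that)
  obtain N2 where N2: "open N2" "emb t0 0 \<in> N2" "\<And>y. y \<in> N2 \<Longrightarrow> ((\<lambda>y. inverse (D y)) has_derivative frechet_derivative (\<lambda>y. inverse (D y)) (at y)) (at y)"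
    by (rule rg_has_derivative[OF rgDi]) (rule that)
  define N where "N = N1 \<inter> N2 \<inter> prj -` N0"
  have "open (prj -` N0 :: (real^('d option)) set)"
    by (rule open_vimage[OF N0(1)]) (intro linear_continuous_on linear_prj[unfolded linear_conv_bounded_linear])
  then have N: "open N" "emb t0 0 \<in> N" unfolding N_def using N0 N1 N2 by auto
  obtain d U \<phi> where d: "0 < d" and U: "open U" "0 \<in> U" and dg: "\<And>s. \<bar>s\<bar> < d \<Longrightarrow> diffeo_germ r (\<phi> s)" and \<phi>0: "\<And>x. \<phi> 0 x = x"
    and \<phi>N: "\<And>s x. \<bar>s\<bar> < d \<Longrightarrow> x \<in> U \<Longrightarrow> emb (t0 + s) (\<phi> s x) \<in> N"
    and ode: "\<And>s x. \<bar>s\<bar> < d \<Longrightarrow> x \<in> U \<Longrightarrow> ((\<lambda>s. \<phi> s x) has_vector_derivative X (emb (t0 + s) (\<phi> s x))) (at s)"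
    and dif: "\<And>s x. \<bar>s\<bar> < d \<Longrightarrow> x \<in> U \<Longrightarrow> (\<phi> s has_derivative frechet_derivative (\<phi> s) (at x)) (at x)"
    and var: "\<And>s x v. \<bar>s\<bar> < d \<Longrightarrow> x \<in> U \<Longrightarrow> ((\<lambda>s. frechet_derivative (\<phi> s) (at x) v) has_vector_derivative
        frechet_derivative X (at (emb (t0 + s) (\<phi> s x))) (emb 0 (frechet_derivative (\<phi> s) (at x) v))) (at s)"
    by (rule time_flow[OF rgX _ N]) (simp add: X0, rule that)
  have I: "convex {-d<..<d}" "0 \<in> {-d<..<d}" using d by auto
  show ?thesis
  proof (intro exI[of _ d] conjI allI impI d)
    fix s assume s: "\<bar>s\<bar> < d"
    have sI: "s \<in> {-d<..<d}" using s by auto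
    show "\<exists>\<Psi>. diffeo_germ r \<Psi> \<and> frechet_derivative \<Psi> (at 0) = (\<lambda>v. v) \<and> (\<forall>\<^sub>F x in nhds 0. F (t0 + s) (\<Psi> x) = F t0 x)"
    proof (intro exI[of _ "\<phi> s"] conjI dg[OF s])
      show "frechet_derivative (\<phi> s) (at 0) = (\<lambda>v. v)"
      proof
        fix v
        have "((\<lambda>s. frechet_derivative (\<phi> s) (at 0) v) has_vector_derivative 0) (at \<sigma> within {-d<..<d})" if "\<sigma> \<in> {-d<..<d}" for \<sigma>
        proof -
          have \<sigma>: "\<bar>\<sigma>\<bar> < d" using that by auto
          let ?y = "emb (t0 + \<sigma>) 0 :: real^('d option)"
          have z: "\<phi> \<sigma> 0 = 0" by (rule diffeo_germ_0[OF dg[OF \<sigma>]])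
          have y: "?y \<in> N" using \<phi>N[OF \<sigma> U(2)] z by simp
          \<comment> \<open>The first order parts of \<open>f\<close> and \<open>L\<close> cancel,
            because \<open>L\<close> is the derivative of \<open>f\<close> at the origin.\<close>
          have dg: "(g has_derivative (\<lambda>w. L (prj w) - L (prj w))) (at ?y)"
          proof -
            have dprj: "(prj has_derivative prj) (at ?y)" by (rule linear_imp_has_derivative[OF linear_prj])
            have "(f has_derivative L) (at (prj ?y))" using N0(3)[OF N0(2)] by (simp add: L)
            from diff_chain_at[OF dprj this] have 1: "((\<lambda>y. f (prj y)) has_derivative (\<lambda>w. L (prj w))) (at ?y)" by (simp add: o_def)
            from diff_chain_at[OF dprj linear_imp_has_derivative[OF linL]] have 2: "((\<lambda>y. L (prj y)) has_derivative (\<lambda>w. L (prj w))) (at ?y)" by (simp add: o_def)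
            show ?thesis unfolding g_def[abs_def] by (rule has_derivative_diff[OF 2 1])
          qed
          have dD: "((\<lambda>y. inverse (D y)) has_derivative frechet_derivative (\<lambda>y. inverse (D y)) (at ?y)) (at ?y)"
            using N2(3) y by (simp add: N_def)
          from has_derivative_scaleR_left[OF has_derivative_mult[OF dg dD], of u]
          have "(X has_derivative (\<lambda>w. 0)) (at ?y)" unfolding X_def[abs_def] by (simp add: g0)
          from frechet_derivative_eqI[OF this] var[OF \<sigma> U(2), of v]
          have "((\<lambda>s. frechet_derivative (\<phi> s) (at 0) v) has_vector_derivative 0) (at \<sigma>)" by (simp add: z)
          then show ?thesis by (rule has_vector_derivative_at_within)
        qed
        from has_vector_derivative_zero_constant[OF I(1) this]
        obtain c where c: "\<And>\<sigma>. \<sigma> \<in> {-d<..<d} \<Longrightarrow> frechet_derivative (\<phi> \<sigma>) (at 0) v = c" by blast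
        have "\<phi> 0 = (\<lambda>x. x)" by (rule ext) (rule \<phi>0)
        then have "frechet_derivative (\<phi> 0) (at 0) v = v" by (simp add: frechet_derivative_eqI[OF has_derivative_ident])
        then show "frechet_derivative (\<phi> s) (at 0) v = v" using c[OF I(2)] c[OF sI] by simp
      qed
      have "F (t0 + s) (\<phi> s x) = F t0 x" if x: "x \<in> U" for x
      proof -
        have "((\<lambda>s. F (t0 + s) (\<phi> s x)) has_vector_derivative 0) (at \<sigma> within {-d<..<d})" if "\<sigma> \<in> {-d<..<d}" for \<sigma>
        proof -
          have \<sigma>: "\<bar>\<sigma>\<bar> < d" using that by auto
          let ?y = "emb (t0 + \<sigma>) (\<phi> \<sigma> x)" and ?z = "\<phi> \<sigma> x"
          have y: "?y \<in> N" by (rule \<phi>N[OF \<sigma> x])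
          have Dy: "D ?y \<noteq> 0" using N1(3) y by (simp add: N_def)
          have z: "?z \<in> N0" using y by (simp add: N_def)
          have f': "((\<lambda>s. f (\<phi> s x)) has_real_derivative frechet_derivative f (at ?z) (X ?y)) (at \<sigma>)"
            using vector_derivative_diff_chain_within[OF ode[OF \<sigma> x] has_derivative_at_withinI[OF N0(3)[OF z]]]
            by (simp add: o_def has_real_derivative_iff_has_vector_derivative)
          have L': "((\<lambda>s. L (\<phi> s x)) has_real_derivative L (X ?y)) (at \<sigma>)"
            using bounded_linear.has_vector_derivative[OF blL ode[OF \<sigma> x]]
            by (simp add: has_real_derivative_iff_has_vector_derivative)
          interpret Df: bounded_linear "frechet_derivative f (at ?z)" using N0(3)[OF z] by (rule has_derivative_bounded_linear)
          let ?c = "g ?y * inverse (D ?y)" and ?a = "frechet_derivative f (at ?z) u"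
          have fX: "frechet_derivative f (at ?z) (X ?y) = ?c * ?a" by (simp add: X_def Df.scaleR)
          have LX: "L (X ?y) = ?c" using linL u by (simp add: X_def linear_cmul)
          have "((\<lambda>s. F (t0 + s) (\<phi> s x)) has_real_derivative
              (1 - (t0 + \<sigma>)) * ?c + (-1) * L ?z + ((t0 + \<sigma>) * (?c * ?a) + 1 * f ?z)) (at \<sigma>)"
            unfolding F_def
            by (rule derivative_eq_intros f' L' refl | simp add: fX LX)+
          moreover have "(1 - (t0 + \<sigma>)) * ?c + (-1) * L ?z + ((t0 + \<sigma>) * (?c * ?a) + 1 * f ?z) = ?c * D ?y - g ?y"
            by (simp add: D_def g_def algebra_simps)
          moreover have "?c * D ?y - g ?y = 0" using Dy by simp
          ultimately show ?thesis
            by (simp add: has_real_derivative_iff_has_vector_derivative has_vector_derivative_at_within)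
        qed
        from has_vector_derivative_zero_constant[OF I(1) this]
        obtain c where c: "\<And>\<sigma>. \<sigma> \<in> {-d<..<d} \<Longrightarrow> F (t0 + \<sigma>) (\<phi> \<sigma> x) = c" by blast
        show ?thesis using c[OF I(2)] c[OF sI] by (simp add: \<phi>0)
      qed
      then show "\<forall>\<^sub>F x in nhds 0. F (t0 + s) (\<phi> s x) = F t0 x"
        unfolding eventually_nhds using U by blast
    qed
  qed
qed

text \<open>An equivalence relation that holds between each parameter and its neighbours has open
  classes, and the interval is connected. This replaces a flow over the whole unit interval, for
  which the domains would have to be controlled uniformly.\<close>

lemma connected_steps:
  fixes R :: "real \<Rightarrow> real \<Rightarrow> bool"
  assumes sym: "\<And>x y. R x y \<Longrightarrow> R y x" and trans: "\<And>x y z. R x y \<Longrightarrow> R y z \<Longrightarrow> R x z"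
    and step: "\<And>t. t \<in> {0..1} \<Longrightarrow> \<exists>d>0. \<forall>s. \<bar>s\<bar> < d \<longrightarrow> R t (t + s)"
  shows "R 0 1"
proof (rule connected_equivalence_relation[of "{0..1}" 0 1 R])
  show "R y x" if "R x y" for x y using that by (rule sym)
  show "R x z" if "R x y" "R y z" for x y z using that by (rule trans)
  fix t :: real assume "t \<in> {0..1}"
  from step[OF this] obtain d where d: "d > 0" "\<And>s. \<bar>s\<bar> < d \<Longrightarrow> R t (t + s)" by blast
  show "\<exists>T. openin (top_of_set {0..1}) T \<and> t \<in> T \<and> (\<forall>x\<in>T. R t x)"
  proof (intro exI[of _ "{0..1} \<inter> ball t d"] conjI ballI)
    show "openin (top_of_set {0..1}) ({0..1} \<inter> ball t d)" by (rule openin_open_Int) simp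
    show "t \<in> {0..1} \<inter> ball t d" using \<open>t \<in> {0..1}\<close> d by simp
    fix x assume "x \<in> {0..1} \<inter> ball t d"
    then have "\<bar>x - t\<bar> < d" by (simp add: dist_real_def abs_minus_commute)
    from d(2)[OF this] show "R t x" by simp
  qed
qed simp_all

text \<open>The relation also records that the derivative at the origin is the identity, so that
  straightening does not change the values of the forms there.\<close>

lemma straighten:
  fixes f L :: "real^'d \<Rightarrow> real"
  assumes f: "rg r 0 f" "f 0 = 0" and L: "L = frechet_derivative f (at 0)" and u: "L u = 1"
  obtains G where "diffeo_germ r G" "frechet_derivative G (at 0) = (\<lambda>v. v)" "\<forall>\<^sub>F x in nhds 0. f (G x) = L x"
proof -
  define F where "F t x = (1 - t) * L x + t * f x" for t x
  define R where "R t t' \<longleftrightarrow> (\<exists>\<Psi>. diffeo_germ r \<Psi> \<and> frechet_derivative \<Psi> (at 0) = (\<lambda>v. v) \<and>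
    (\<forall>\<^sub>F x in nhds 0. F t' (\<Psi> x) = F t x))" for t t'
  have "R 0 1"
  proof (rule connected_steps)
    fix t t' assume "R t t'"
    then obtain \<Psi> where \<Psi>: "diffeo_germ r \<Psi>" "frechet_derivative \<Psi> (at 0) = (\<lambda>v. v)" "\<forall>\<^sub>F x in nhds 0. F t' (\<Psi> x) = F t x"
      unfolding R_def by blast
    obtain G where G: "diffeo_germ r G" "\<forall>\<^sub>F x in nhds 0. G (\<Psi> x) = x" "\<forall>\<^sub>F y in nhds 0. \<Psi> (G y) = y"
      by (rule diffeo_germ_inverse[OF \<Psi>(1)]) (rule that)
    have "\<forall>v. frechet_derivative \<Psi> (at (G 0)) (frechet_derivative G (at 0) v) = v"
      using diffeo_germ_left_inverse_derivative[OF \<Psi>(1) G(1,3)] by (rule eventually_nhds_x_imp_x)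
    then have 1: "frechet_derivative G (at 0) = (\<lambda>v. v)" by (simp add: diffeo_germ_0[OF G(1)] \<Psi>(2) fun_eq_iff)
    have 2: "\<forall>\<^sub>F y in nhds 0. F t (G y) = F t' y"
      using diffeo_germ_eventually[OF G(1) \<Psi>(3)] G(3) by eventually_elim simp
    show "R t' t" unfolding R_def by (intro exI[of _ G] conjI G(1) 1 2)
  next
    fix t1 t2 t3 assume "R t1 t2" "R t2 t3"
    obtain F1 where F1: "diffeo_germ r F1" "frechet_derivative F1 (at 0) = (\<lambda>v. v)" "\<forall>\<^sub>F x in nhds 0. F t2 (F1 x) = F t1 x"
      using \<open>R t1 t2\<close> unfolding R_def by blast
    obtain F2 where F2: "diffeo_germ r F2" "frechet_derivative F2 (at 0) = (\<lambda>v. v)" "\<forall>\<^sub>F x in nhds 0. F t3 (F2 x) = F t2 x"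
      using \<open>R t2 t3\<close> unfolding R_def by blast
    have "frechet_derivative (F2 \<circ> F1) (at 0) = frechet_derivative F2 (at (F1 0)) \<circ> frechet_derivative F1 (at 0)"
      using diffeo_germ_chain[OF F1(1) F2(1)] by (rule eventually_nhds_x_imp_x)
    then have 1: "frechet_derivative (F2 \<circ> F1) (at 0) = (\<lambda>v. v)"
      by (simp add: diffeo_germ_0[OF F1(1)] F1(2) F2(2) o_def)
    have 2: "\<forall>\<^sub>F x in nhds 0. F t3 ((F2 \<circ> F1) x) = F t1 x"
      using diffeo_germ_eventually[OF F1(1) F2(3)] F1(3) by eventually_elim simp
    show "R t1 t3" unfolding R_def by (intro exI[of _ "F2 \<circ> F1"] conjI diffeo_germ_compose F1(1) F2(1) 1 2)
  next
    fix t :: real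
    show "\<exists>d>0. \<forall>s. \<bar>s\<bar> < d \<longrightarrow> R t (t + s)"
      unfolding R_def F_def by (rule straighten_step[OF f L u])
  qed
  then obtain G where "diffeo_germ r G" "frechet_derivative G (at 0) = (\<lambda>v. v)" "\<forall>\<^sub>F x in nhds 0. F 1 (G x) = F 0 x"
    unfolding R_def by blast
  then show ?thesis using that by (simp add: F_def)
qed

section \<open>Powers of a two-form\<close>

text \<open>For antisymmetric \<open>g\<close> this is \<open>2\<^sup>m m!\<close> times the Pfaffian of \<open>g\<close>.\<close>

definition pf :: "nat \<Rightarrow> (nat \<Rightarrow> nat \<Rightarrow> real) \<Rightarrow> real" where
  "pf m g = (\<Sum>\<sigma> | \<sigma> permutes {..<2*m}. of_int (sign \<sigma>) * (\<Prod>k<m. g (\<sigma> (2*k)) (\<sigma> (2*k+1))))"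

text \<open>Embeds the permutations of \<open>2 * m\<close> positions into those of
  \<open>2 * m + 2\<close> positions that fix \<open>0\<close> and \<open>1\<close>, with the same
  sign.\<close>

definition shift_perm :: "nat \<Rightarrow> (nat \<Rightarrow> nat) \<Rightarrow> nat \<Rightarrow> nat" where
  "shift_perm m = map_permutation {..<2*m} (\<lambda>i. i + 2)"

lemma shift_perm_permutes:
  assumes "\<tau> permutes {..<2*m}"
  shows "shift_perm m \<tau> permutes {..<2 * Suc m}" "shift_perm m \<tau> 0 = 0" "shift_perm m \<tau> (Suc 0) = 1"
    "i < 2*m \<Longrightarrow> shift_perm m \<tau> (i + 2) = \<tau> i + 2" "sign (shift_perm m \<tau>) = sign \<tau>"
proof -
  have "bij_betw (\<lambda>i. i + 2) {..<2*m} {2..<2*m+2}" 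
    by (rule bij_betwI[where g = "\<lambda>i. i - 2"]) auto
  from map_permutation_permutes[OF this assms] have *: "shift_perm m \<tau> permutes {2..<2*m+2}" unfolding shift_perm_def .
  show "shift_perm m \<tau> permutes {..<2 * Suc m}" by (rule permutes_subset[OF *]) auto
  show "shift_perm m \<tau> 0 = 0" "shift_perm m \<tau> (Suc 0) = 1" using permutes_not_in[OF *] by auto
  show "shift_perm m \<tau> (i + 2) = \<tau> i + 2" if "i < 2*m"
    unfolding shift_perm_def by (rule map_permutation_apply) (use that in \<open>auto simp: inj_on_def\<close>)
  show "sign (shift_perm m \<tau>) = sign \<tau>"
    unfolding shift_perm_def by (rule sign_map_permutation) (use assms in \<open>auto simp: inj_on_def\<close>)
qed

lemma permutes_lessThan_less: "\<sigma> permutes {..<n} \<Longrightarrow> i < n \<Longrightarrow> \<sigma> i < (n::nat)"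
  using permutes_in_image[of \<sigma> "{..<n}" i] by simp

lemma pf_cong:
  assumes "\<And>i j. i < 2*m \<Longrightarrow> j < 2*m \<Longrightarrow> g i j = h i j" shows "pf m g = pf m h"
  unfolding pf_def by (intro sum.cong refl arg_cong2[where f="(*)"] prod.cong assms) (auto intro: permutes_lessThan_less)

text \<open>Unfolding one wedge factor composes a permutation with a shifted one. For each fixed
  shifted permutation the composites run through all permutations, so the additional sum contributes
  only its number of terms \<open>fact (2 * m)\<close>, which cancels. Of the normalisation only
  \<open>fact 2\<close> remains for each of the factors.\<close>

lemma wedge_power_pf:
  assumes "length vs = 2 * m"
  shows "wedge_power 2 \<alpha> m vs = pf m (\<lambda>i j. \<alpha> [vs ! i, vs ! j]) / 2 ^ m"
  using assms
proof (induction m arbitrary: vs)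
  case 0
  then show ?case by (simp add: pf_def)
next
  case (Suc m)
  let ?P = "\<lambda>m. {\<sigma>. \<sigma> permutes {..<2 * m}}"
  define T where "T \<sigma> = of_int (sign \<sigma>) * (\<Prod>k<Suc m. \<alpha> [vs ! \<sigma> (2*k), vs ! \<sigma> (2*k+1)])" for \<sigma>
  have *: "of_int (sign \<sigma>) * \<alpha> (map (\<lambda>i. vs ! \<sigma> i) [0..<2]) * wedge_power 2 \<alpha> m (map (\<lambda>i. vs ! \<sigma> i) [2..<2 + 2*m])
      = (\<Sum>\<tau>\<in>?P m. T (\<sigma> \<circ> shift_perm m \<tau>)) / 2 ^ m" if \<sigma>: "\<sigma> \<in> ?P (Suc m)" for \<sigma>
  proof -
    have 1: "map (\<lambda>i. vs ! \<sigma> i) [0..<2] = [vs ! \<sigma> 0, vs ! \<sigma> 1]" by (simp add: upt_rec)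
    have "pf m (\<lambda>i j. \<alpha> [map (\<lambda>i. vs ! \<sigma> i) [2..<2 + 2*m] ! i, map (\<lambda>i. vs ! \<sigma> i) [2..<2 + 2*m] ! j])
        = pf m (\<lambda>i j. \<alpha> [vs ! \<sigma> (i+2), vs ! \<sigma> (j+2)])"
      by (rule pf_cong) (simp add: add.commute del: upt_Suc)
    then have 2: "wedge_power 2 \<alpha> m (map (\<lambda>i. vs ! \<sigma> i) [2..<2 + 2*m]) = pf m (\<lambda>i j. \<alpha> [vs ! \<sigma> (i+2), vs ! \<sigma> (j+2)]) / 2 ^ m"
      by (simp add: Suc.IH del: upt_Suc)
    have "of_int (sign \<sigma>) * \<alpha> [vs ! \<sigma> 0, vs ! \<sigma> 1] * (of_int (sign \<tau>) * (\<Prod>k<m. \<alpha> [vs ! \<sigma> (\<tau> (2*k) + 2), vs ! \<sigma> (\<tau> (2*k+1) + 2)]))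
        = T (\<sigma> \<circ> shift_perm m \<tau>)" if \<tau>: "\<tau> \<in> ?P m" for \<tau>
    proof -
      note sh = shift_perm_permutes[OF \<tau>[simplified]]
      have "sign (\<sigma> \<circ> shift_perm m \<tau>) = sign \<sigma> * sign \<tau>"
        using \<sigma> sh(1) by (subst sign_compose) (auto simp: sh(5) permutation_permutes)
      moreover have "\<sigma> (shift_perm m \<tau> (2 * Suc k)) = \<sigma> (\<tau> (2*k) + 2)" "\<sigma> (shift_perm m \<tau> (2 * Suc k + 1)) = \<sigma> (\<tau> (2*k+1) + 2)" if "k < m" for k
        using sh(4)[of "2*k"] sh(4)[of "2*k+1"] that by (simp_all add: numeral_2_eq_2)
      ultimately show ?thesis unfolding T_def
        by (simp add: prod.lessThan_Suc_shift sh(2,3) del: mult_Suc_right prod.lessThan_Suc)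
    qed
    then show ?thesis unfolding 1 2 pf_def by (simp add: sum_distrib_left)
  qed
  have "wedge_power 2 \<alpha> (Suc m) vs = (\<Sum>\<sigma>\<in>?P (Suc m). (\<Sum>\<tau>\<in>?P m. T (\<sigma> \<circ> shift_perm m \<tau>)) / 2 ^ m) / (fact 2 * fact (2 * m))"
    using Suc.prems sum.cong[OF refl *, of "?P (Suc m)"] by (simp add: wedge_def del: upt_Suc)
  also have "\<dots> = (\<Sum>\<tau>\<in>?P m. \<Sum>\<sigma>\<in>?P (Suc m). T (\<sigma> \<circ> shift_perm m \<tau>)) / 2 ^ m / (fact 2 * fact (2 * m))"
    by (subst sum.swap) (simp add: sum_divide_distrib)
  also have "(\<Sum>\<tau>\<in>?P m. \<Sum>\<sigma>\<in>?P (Suc m). T (\<sigma> \<circ> shift_perm m \<tau>)) = (\<Sum>\<tau>\<in>?P m. \<Sum>\<sigma>\<in>?P (Suc m). T \<sigma>)"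
    by (intro sum.cong refl sum_permutations_compose_right[symmetric] shift_perm_permutes) simp
  also have "\<dots> = fact (2 * m) * pf (Suc m) (\<lambda>i j. \<alpha> [vs ! i, vs ! j])"
    using card_permutations[of "{..<2*m}" "2*m"] by (simp add: pf_def T_def)
  finally show ?case by simp
qed

lemma sum_zero_outside:
  fixes f :: "'a \<Rightarrow> real"
  assumes "finite A" "B \<subseteq> A" "\<And>x. x \<in> A \<Longrightarrow> x \<notin> B \<Longrightarrow> f x = 0"
  shows "sum f A = sum f B"
  by (rule sum.mono_neutral_right) (use assms in auto)

lemma shift_perm_surj:
  assumes \<sigma>: "\<sigma> permutes {..<2 * Suc m}" "\<sigma> 0 = 0" "\<sigma> (Suc 0) = 1"
  obtains \<tau> where "\<tau> permutes {..<2*m}" "\<sigma> = shift_perm m \<tau>"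
proof -
  have b: "bij_betw (\<lambda>i. i - 2) {2..<2*m+2} {..<2*m}"
    by (rule bij_betwI[where g = "\<lambda>i. i + 2"]) (auto simp del: add_2_eq_Suc')
  have p: "\<sigma> permutes {2..<2*m+2}"
  proof (rule permutes_superset[OF \<sigma>(1)])
    fix x assume "x \<in> {..<2 * Suc m} - {2..<2*m+2}"
    then have "x = 0 \<or> x = 1" by auto
    then show "\<sigma> x = x" using \<sigma> by auto
  qed
  show ?thesis
  proof (rule that[OF map_permutation_permutes[OF b p]])
    show "\<sigma> = shift_perm m (map_permutation {2..<2*m+2} (\<lambda>i. i - 2) \<sigma>)"
      unfolding shift_perm_def by (rule map_permutation_compose_inv[OF b p, symmetric]) (simp del: add_2_eq_Suc')
  qed
qed

text \<open>Every nonzero term pairs \<open>1\<close> with \<open>0\<close>, and the pair can be moved to the front by an even permutation.\<close>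

lemma pf_first_pair:
  fixes g :: "nat \<Rightarrow> nat \<Rightarrow> real"
  assumes anti: "\<And>i j. g i j = - g j i" and 1: "\<And>j. 2 \<le> j \<Longrightarrow> j < 2 * Suc m \<Longrightarrow> g 1 j = 0"
  shows "pf (Suc m) g = 2 * Suc m * g 0 1 * pf m (\<lambda>i j. g (i + 2) (j + 2))"
proof -
  let ?P = "{\<sigma>. \<sigma> permutes {..<2 * Suc m}}"
  define T where "T \<sigma> = of_int (sign \<sigma>) * (\<Prod>k<Suc m. g (\<sigma> (2*k)) (\<sigma> (2*k+1)))" for \<sigma>
  have fin: "finite ?P" by (rule finite_permutations) simp
  \<comment> \<open>Permutations are grouped by the index \<open>k\<close> of the pair containing
    the value 1.\<close>
  define Q where "Q k = {\<sigma> \<in> ?P. inv \<sigma> (Suc 0) div 2 = k}" for k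
  have iff: "inv \<sigma> (Suc 0) = i \<longleftrightarrow> \<sigma> i = Suc 0" if "\<sigma> \<in> ?P" for \<sigma> i
    using permutes_inverses[of \<sigma> "{..<2 * Suc m}"] that by (metis mem_Collect_eq)
  have Qk: "sum T (Q k) = sum T (Q 0)" if k: "k < Suc m" for k
  proof -
    \<comment> \<open>Exchanges pair \<open>0\<close> with pair \<open>k\<close> entry by entry: a
      product of two transpositions, hence even, and the identity for \<open>k = 0\<close>.\<close>
    define \<rho> where "\<rho> = Transposition.transpose 0 (2*k) \<circ> Transposition.transpose 1 (2*k+1)"
    have \<rho>: "\<rho> permutes {..<2 * Suc m}" unfolding \<rho>_def
      by (intro permutes_compose permutes_swap_id) (use k in auto)
    have \<rho>i: "\<rho> (2*i) = 2 * Transposition.transpose 0 k i" "\<rho> (2*i+1) = 2 * Transposition.transpose 0 k i + 1" for i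
      by (auto simp: \<rho>_def Transposition.transpose_def) presburger+
    have \<rho>\<rho>: "\<rho> (\<rho> i) = i" for i
    proof -
      have "even i \<or> odd i" by simp
      then show ?thesis by (elim disjE evenE oddE) (simp_all only: \<rho>i transpose_involutory)
    qed
    have \<rho>div: "\<rho> i div 2 = Transposition.transpose 0 k (i div 2)" for i
    proof -
      have "even i \<or> odd i" by simp
      then show ?thesis by (elim disjE evenE oddE) (simp_all only: \<rho>i, simp_all)
    qed
    have sgn: "sign \<rho> = 1"
      unfolding \<rho>_def by (subst sign_compose) (auto simp: permutation_swap_id sign_swap_id)
    have inv: "inv (\<sigma> \<circ> \<rho>) (Suc 0) = \<rho> (inv \<sigma> (Suc 0))" if "\<sigma> \<in> ?P" for \<sigma>
    proof -
      have "\<sigma> \<circ> \<rho> \<in> ?P" using that permutes_compose[OF \<rho>] by simp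
      from iff[OF this] show ?thesis using iff[OF that, of "inv \<sigma> (Suc 0)"] by (simp add: \<rho>\<rho>)
    qed
    have T: "T (\<sigma> \<circ> \<rho>) = T \<sigma>" if "\<sigma> \<in> ?P" for \<sigma>
    proof -
      have "sign (\<sigma> \<circ> \<rho>) = sign \<sigma>"
        using that \<rho> by (subst sign_compose) (auto simp: sgn permutation_permutes)
      moreover have "(\<Prod>i<Suc m. g (\<sigma> (\<rho> (2*i))) (\<sigma> (\<rho> (2*i+1)))) = (\<Prod>i<Suc m. g (\<sigma> (2*i)) (\<sigma> (2*i+1)))"
        unfolding \<rho>i
        by (rule prod.permute[of "Transposition.transpose 0 k" "{..<Suc m}" "\<lambda>i. g (\<sigma> (2*i)) (\<sigma> (2*i+1))", unfolded o_def, symmetric])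
          (use k in \<open>auto intro: permutes_swap_id\<close>)
      ultimately show ?thesis by (simp add: T_def)
    qed
    show ?thesis
    proof (rule sum.reindex_bij_witness[where i = "\<lambda>\<sigma>. \<sigma> \<circ> \<rho>" and j = "\<lambda>\<sigma>. \<sigma> \<circ> \<rho>"])
      fix \<sigma> assume "\<sigma> \<in> Q k"
      then have \<sigma>: "\<sigma> \<in> ?P" "inv \<sigma> (Suc 0) div 2 = k" by (auto simp: Q_def)
      show "\<sigma> \<circ> \<rho> \<circ> \<rho> = \<sigma>" by (simp add: fun_eq_iff \<rho>\<rho>)
      show "T (\<sigma> \<circ> \<rho>) = T \<sigma>" by (rule T[OF \<sigma>(1)])
      show "\<sigma> \<circ> \<rho> \<in> Q 0" using \<sigma> permutes_compose[OF \<rho>] by (simp add: Q_def inv[OF \<sigma>(1)] \<rho>div)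
    next
      fix \<sigma> assume "\<sigma> \<in> Q 0"
      then have \<sigma>: "\<sigma> \<in> ?P" "inv \<sigma> (Suc 0) div 2 = 0" by (auto simp: Q_def)
      show "\<sigma> \<circ> \<rho> \<circ> \<rho> = \<sigma>" by (simp add: fun_eq_iff \<rho>\<rho>)
      show "\<sigma> \<circ> \<rho> \<in> Q k" using \<sigma>(1) permutes_compose[OF \<rho>] by (simp add: Q_def inv[OF \<sigma>(1)] \<rho>div \<sigma>(2))
    qed
  qed
  define R where "R = {\<sigma> \<in> ?P. \<sigma> 0 = 0 \<and> \<sigma> (Suc 0) = 1}"
  define R' where "R' = {\<sigma> \<in> ?P. \<sigma> 0 = 1 \<and> \<sigma> (Suc 0) = 0}"
  \<comment> \<open>Swapping the entries of the first pair reverses the sign of the permutation and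
    that of \<open>g\<close>, so \<open>R'\<close> contributes as much as \<open>R\<close>; this is
    the origin of the factor 2.\<close>
  define t where "t = Transposition.transpose 0 (Suc 0)"
  have tp: "t permutes {..<2 * Suc m}" unfolding t_def by (rule permutes_swap_id) auto
  have tt: "t (t i) = i" for i by (simp add: t_def)
  have "sum T (Q 0) = sum T (R \<union> R')"
  proof (rule sum_zero_outside)
    show "finite (Q 0)" using fin by (simp add: Q_def)
    show "R \<union> R' \<subseteq> Q 0"
    proof
      fix \<sigma> assume "\<sigma> \<in> R \<union> R'"
      then have "\<sigma> \<in> ?P" "\<sigma> 0 = Suc 0 \<or> \<sigma> (Suc 0) = Suc 0" by (auto simp: R_def R'_def)
      then show "\<sigma> \<in> Q 0" using iff[of \<sigma> 0] iff[of \<sigma> "Suc 0"] by (auto simp: Q_def)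
    qed
    fix \<sigma> assume \<sigma>: "\<sigma> \<in> Q 0" "\<sigma> \<notin> R \<union> R'"
    then have P: "\<sigma> \<in> ?P" and "inv \<sigma> (Suc 0) = 0 \<or> inv \<sigma> (Suc 0) = Suc 0" by (auto simp: Q_def)
    then have "\<sigma> 0 = 1 \<or> \<sigma> (Suc 0) = 1" using iff[OF P, of 0] iff[OF P, of "Suc 0"] by auto
    have inj: "\<sigma> 0 \<noteq> \<sigma> (Suc 0)" using permutes_inj[of \<sigma>] P by (metis inj_eq mem_Collect_eq zero_neq_one One_nat_def)
    have lt: "\<sigma> 0 < 2 * Suc m" "\<sigma> (Suc 0) < 2 * Suc m" using P permutes_lessThan_less by auto
    have "g (\<sigma> 0) (\<sigma> (Suc 0)) = 0"
    proof (cases "\<sigma> 0 = 1")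
      case True
      then have "\<sigma> (Suc 0) \<ge> 2" using \<sigma>(2) P inj by (auto simp: R'_def)
      then show ?thesis using True 1 lt by simp
    next
      case False
      then have "\<sigma> (Suc 0) = 1" "\<sigma> 0 \<ge> 2" using \<open>\<sigma> 0 = 1 \<or> _\<close> \<sigma>(2) P by (auto simp: R_def)
      then show ?thesis using 1 lt anti[of "\<sigma> 0"] by simp
    qed
    then show "T \<sigma> = 0" by (simp add: T_def prod.lessThan_Suc_shift del: prod.lessThan_Suc)
  qed
  also have "\<dots> = sum T R + sum T R'"
    by (rule sum.union_disjoint) (use fin in \<open>auto simp: R_def R'_def\<close>)
  also have "sum T R' = sum T R"
  proof (rule sum.reindex_bij_witness[where i = "\<lambda>\<sigma>. \<sigma> \<circ> t" and j = "\<lambda>\<sigma>. \<sigma> \<circ> t"])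
    fix \<sigma> :: "nat \<Rightarrow> nat"
    show "\<sigma> \<circ> t \<circ> t = \<sigma>" by (simp add: fun_eq_iff tt)
    then show "\<sigma> \<circ> t \<circ> t = \<sigma>" .
    show "\<sigma> \<circ> t \<in> R" if "\<sigma> \<in> R'" using that permutes_compose[OF tp] by (auto simp: R_def R'_def t_def)
    show "\<sigma> \<circ> t \<in> R'" if "\<sigma> \<in> R" using that permutes_compose[OF tp] by (auto simp: R_def R'_def t_def)
    assume "\<sigma> \<in> R'"
    then have P: "\<sigma> \<in> ?P" by (simp add: R'_def)
    have "sign (\<sigma> \<circ> t) = - sign \<sigma>"
      using P tp by (subst sign_compose) (auto simp: permutation_permutes t_def sign_swap_id)
    moreover have "t (Suc (Suc i)) = Suc (Suc i)" for i by (simp add: t_def Transposition.transpose_def)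
    ultimately show "T (\<sigma> \<circ> t) = T \<sigma>"
      using anti[of "\<sigma> 0" "\<sigma> (Suc 0)"] by (simp add: T_def prod.lessThan_Suc_shift t_def del: prod.lessThan_Suc)
  qed
  also have "sum T R = (\<Sum>\<tau> | \<tau> permutes {..<2*m}. g 0 1 * (of_int (sign \<tau>) * (\<Prod>k<m. g (\<tau> (2*k) + 2) (\<tau> (2*k+1) + 2))))"
  proof (rule sum.reindex_bij_betw[symmetric, THEN trans, rotated])
    show "bij_betw (shift_perm m) {\<tau>. \<tau> permutes {..<2*m}} R"
    proof (rule bij_betw_imageI)
      show "inj_on (shift_perm m) {\<tau>. \<tau> permutes {..<2*m}}"
      proof (rule inj_onI)
        fix \<tau> \<tau>' assume A: "\<tau> \<in> {\<tau>. \<tau> permutes {..<2*m}}" "\<tau>' \<in> {\<tau>. \<tau> permutes {..<2*m}}" "shift_perm m \<tau> = shift_perm m \<tau>'"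
        show "\<tau> = \<tau>'"
        proof
          fix i show "\<tau> i = \<tau>' i"
            using A shift_perm_permutes(4)[of \<tau> m i] shift_perm_permutes(4)[of \<tau>' m i] permutes_not_in[of \<tau> _ i] permutes_not_in[of \<tau>' _ i]
            by (cases "i < 2*m") auto
        qed
      qed
      show "shift_perm m ` {\<tau>. \<tau> permutes {..<2*m}} = R"
      proof
        show "R \<subseteq> shift_perm m ` {\<tau>. \<tau> permutes {..<2*m}}"
        proof
          fix \<sigma> assume "\<sigma> \<in> R"
          then have "\<sigma> permutes {..<2 * Suc m}" "\<sigma> 0 = 0" "\<sigma> (Suc 0) = 1" by (simp_all add: R_def)
          then obtain \<tau> where "\<tau> permutes {..<2*m}" "\<sigma> = shift_perm m \<tau>" by (rule shift_perm_surj)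
          then show "\<sigma> \<in> shift_perm m ` {\<tau>. \<tau> permutes {..<2*m}}" by blast
        qed
      qed (auto simp: R_def shift_perm_permutes simp del: mult_Suc_right)
    qed
    show "(\<Sum>\<tau>\<in>{\<tau>. \<tau> permutes {..<2*m}}. T (shift_perm m \<tau>)) = (\<Sum>\<tau> | \<tau> permutes {..<2*m}. g 0 1 * (of_int (sign \<tau>) * (\<Prod>k<m. g (\<tau> (2*k) + 2) (\<tau> (2*k+1) + 2))))"
    proof (rule sum.cong[OF refl])
      fix \<tau> assume "\<tau> \<in> {\<tau>. \<tau> permutes {..<2*m}}"
      note sh = shift_perm_permutes[OF this[simplified]]
      have "shift_perm m \<tau> (2 * Suc k) = \<tau> (2*k) + 2" "shift_perm m \<tau> (2 * Suc k + 1) = \<tau> (2*k+1) + 2" if "k < m" for k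
        using sh(4)[of "2*k"] sh(4)[of "2*k+1"] that by (simp_all add: numeral_2_eq_2)
      then show "T (shift_perm m \<tau>) = g 0 1 * (of_int (sign \<tau>) * (\<Prod>k<m. g (\<tau> (2*k) + 2) (\<tau> (2*k+1) + 2)))"
        by (simp add: T_def prod.lessThan_Suc_shift sh(2,3,5) del: mult_Suc_right prod.lessThan_Suc)
    qed
  qed
  also have "\<dots> = g 0 1 * pf m (\<lambda>i j. g (i + 2) (j + 2))"
    by (simp add: pf_def sum_distrib_left)
  finally have Q0: "sum T (Q 0) = 2 * g 0 1 * pf m (\<lambda>i j. g (i + 2) (j + 2))" by simp
  have "pf (Suc m) g = sum T ?P" by (simp add: pf_def T_def)
  also have "\<dots> = (\<Sum>k<Suc m. sum T (Q k))"
    unfolding Q_def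
  proof (rule sum.group[symmetric, OF fin])
    show "(\<lambda>\<sigma>. inv \<sigma> (Suc 0) div 2) ` ?P \<subseteq> {..<Suc m}"
    proof (rule image_subsetI)
      fix \<sigma> assume "\<sigma> \<in> ?P"
      then have "inv \<sigma> permutes {..<2 * Suc m}" using permutes_inv by blast
      from permutes_lessThan_less[OF this, of 1] show "inv \<sigma> (Suc 0) div 2 \<in> {..<Suc m}" by auto
    qed
  qed simp
  also have "\<dots> = (\<Sum>k<Suc m. sum T (Q 0))" by (rule sum.cong[OF refl]) (rule Qk, simp)
  also have "\<dots> = real (Suc m) * sum T (Q 0)" by simp
  finally show ?thesis using Q0 by simp
qed

lemma permutes_pair_iff:
  assumes "\<sigma> permutes S"
  shows "\<sigma> (2*k) = c \<or> \<sigma> (2*k+1) = c \<longleftrightarrow> inv \<sigma> c div 2 = (k::nat)"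
proof -
  have "\<sigma> i = c \<longleftrightarrow> inv \<sigma> c = i" for i using permutes_inverses[OF assms] by metis
  then show ?thesis by presburger
qed

lemma pf_zero:
  fixes g :: "nat \<Rightarrow> nat \<Rightarrow> real"
  assumes "i < 2*m" "\<And>j. g i j = 0" "\<And>j. g j i = 0"
  shows "pf m g = 0"
proof -
  have *: "(\<Prod>k<m. g (\<sigma> (2*k)) (\<sigma> (2*k+1))) = 0" if "\<sigma> permutes {..<2*m}" for \<sigma>
  proof (rule prod_zero)
    have "inv \<sigma> i < 2*m" by (rule permutes_lessThan_less[OF permutes_inv[OF that] assms(1)])
    moreover have "\<sigma> (2*(inv \<sigma> i div 2)) = i \<or> \<sigma> (2*(inv \<sigma> i div 2)+1) = i"
      by (simp only: permutes_pair_iff[OF that])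
    ultimately show "\<exists>k\<in>{..<m}. g (\<sigma> (2*k)) (\<sigma> (2*k+1)) = 0"
      using assms(2,3) by (intro bexI[of _ "inv \<sigma> i div 2"]) auto
  qed simp
  show ?thesis unfolding pf_def
  proof (rule sum.neutral, rule ballI)
    fix \<sigma> assume "\<sigma> \<in> {\<sigma>. \<sigma> permutes {..<2*m}}"
    then show "of_int (sign \<sigma>) * (\<Prod>k<m. g (\<sigma> (2*k)) (\<sigma> (2*k+1))) = 0"
      by (simp only: * mem_Collect_eq mult_zero_right)
  qed
qed

text \<open>Every summand has a factor whose pair contains \<open>0\<close> and one whose pair
  contains \<open>1\<close>, and both vanish at \<open>s = 0\<close>. If these factors are
  different, the product rule always leaves one of them. Hence only summands pairing
  \<open>0\<close> with \<open>1\<close> survive, with exactly that factor differentiated. Replacing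
  this entry by its derivative gives the array \<open>h\<close>, from which the first pair splits
  off.\<close>

lemma pf_derivative:
  fixes G :: "real \<Rightarrow> nat \<Rightarrow> nat \<Rightarrow> real" and G' :: "nat \<Rightarrow> nat \<Rightarrow> real"
  assumes G': "\<And>i j. ((\<lambda>s. G s i j) has_real_derivative G' i j) (at 0)"
    and anti: "\<And>s i j. G s i j = - G s j i"
    and zero: "\<And>j. G 0 0 j = 0" "\<And>j. G 0 1 j = 0"
  shows "((\<lambda>s. pf (Suc m) (G s)) has_real_derivative
    2 * Suc m * G' 0 1 * pf m (\<lambda>i j. G 0 (i + 2) (j + 2))) (at 0)"
proof -
  let ?P = "{\<sigma>. \<sigma> permutes {..<2 * Suc m}}"
  define h where "h i j = (if {i, j} = {0, 1} then G' i j else G 0 i j)" for i j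
  have zero': "G 0 j 0 = 0" "G 0 j 1 = 0" for j using zero anti[of 0 j] by simp_all
  have *: "(\<Sum>k<Suc m. G' (\<sigma> (2*k)) (\<sigma> (2*k+1)) * (\<Prod>j\<in>{..<Suc m}-{k}. G 0 (\<sigma> (2*j)) (\<sigma> (2*j+1))))
      = (\<Prod>k<Suc m. h (\<sigma> (2*k)) (\<sigma> (2*k+1)))" if \<sigma>: "\<sigma> \<in> ?P" for \<sigma>
  proof -
    define A where "A = inv \<sigma> 0 div 2"
    define B where "B = inv \<sigma> 1 div 2"
    have p: "\<sigma> permutes {..<2 * Suc m}" using \<sigma> by simp
    note iff = permutes_pair_iff[OF p]
    have iA: "\<sigma> (2*k) = 0 \<or> \<sigma> (2*k+1) = 0 \<longleftrightarrow> A = k" for k using iff[of k 0] by (simp add: A_def)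
    have iB: "\<sigma> (2*k) = 1 \<or> \<sigma> (2*k+1) = 1 \<longleftrightarrow> B = k" for k using iff[of k 1] by (simp add: B_def)
    have lt: "A < Suc m" "B < Suc m"
      unfolding A_def B_def using permutes_lessThan_less[OF permutes_inv[OF p], of 0] permutes_lessThan_less[OF permutes_inv[OF p], of 1] by auto
    have z: "G 0 (\<sigma> (2*A)) (\<sigma> (2*A+1)) = 0" "G 0 (\<sigma> (2*B)) (\<sigma> (2*B+1)) = 0"
      using iA[of A] iB[of B] zero zero' by auto
    show ?thesis
    proof (cases "A = B")
      case True
      have nz: "(\<Prod>j\<in>{..<Suc m}-{k}. G 0 (\<sigma> (2*j)) (\<sigma> (2*j+1))) = 0" if "k \<noteq> A" for k
        by (rule prod_zero) (use lt z that in auto)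
      have "(\<Sum>k<Suc m. G' (\<sigma> (2*k)) (\<sigma> (2*k+1)) * (\<Prod>j\<in>{..<Suc m}-{k}. G 0 (\<sigma> (2*j)) (\<sigma> (2*j+1))))
         = (\<Sum>k\<in>{A}. G' (\<sigma> (2*k)) (\<sigma> (2*k+1)) * (\<Prod>j\<in>{..<Suc m}-{k}. G 0 (\<sigma> (2*j)) (\<sigma> (2*j+1))))"
        by (rule sum_zero_outside) (use lt nz in auto)
      also have "\<dots> = G' (\<sigma> (2*A)) (\<sigma> (2*A+1)) * (\<Prod>j\<in>{..<Suc m}-{A}. G 0 (\<sigma> (2*j)) (\<sigma> (2*j+1)))"
        by simp
      also have "(\<Prod>j\<in>{..<Suc m}-{A}. G 0 (\<sigma> (2*j)) (\<sigma> (2*j+1))) = (\<Prod>j\<in>{..<Suc m}-{A}. h (\<sigma> (2*j)) (\<sigma> (2*j+1)))"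
      proof (rule prod.cong[OF refl])
        fix j assume "j \<in> {..<Suc m}-{A}"
        then have "\<sigma> (2*j) \<noteq> 0" "\<sigma> (2*j+1) \<noteq> 0" using iA[of j] by auto
        then show "G 0 (\<sigma> (2*j)) (\<sigma> (2*j+1)) = h (\<sigma> (2*j)) (\<sigma> (2*j+1))" by (auto simp: h_def doubleton_eq_iff)
      qed
      also have "{\<sigma> (2*A), \<sigma> (2*A+1)} = {0, 1}" using iA[of A] iB[of A] True by auto
      then have "G' (\<sigma> (2*A)) (\<sigma> (2*A+1)) = h (\<sigma> (2*A)) (\<sigma> (2*A+1))" by (simp add: h_def)
      also have "h (\<sigma> (2*A)) (\<sigma> (2*A+1)) * (\<Prod>j\<in>{..<Suc m}-{A}. h (\<sigma> (2*j)) (\<sigma> (2*j+1))) = (\<Prod>k<Suc m. h (\<sigma> (2*k)) (\<sigma> (2*k+1)))"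
        by (rule prod.remove[symmetric]) (use lt in auto)
      finally show ?thesis .
    next
      case False
      have "(\<Prod>j\<in>{..<Suc m}-{k}. G 0 (\<sigma> (2*j)) (\<sigma> (2*j+1))) = 0" for k
      proof (rule prod_zero)
        show "\<exists>j\<in>{..<Suc m}-{k}. G 0 (\<sigma> (2*j)) (\<sigma> (2*j+1)) = 0"
          by (rule bexI[where x = "if k = A then B else A"]) (use lt z False in auto)
      qed simp
      moreover have "(\<Prod>k<Suc m. h (\<sigma> (2*k)) (\<sigma> (2*k+1))) = 0"
      proof (rule prod_zero)
        have "\<sigma> (2*A) \<noteq> 1" "\<sigma> (2*A+1) \<noteq> 1" using iB[of A] False by auto
        then have "h (\<sigma> (2*A)) (\<sigma> (2*A+1)) = 0" using z by (auto simp: h_def doubleton_eq_iff)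
        then show "\<exists>k\<in>{..<Suc m}. h (\<sigma> (2*k)) (\<sigma> (2*k+1)) = 0" using lt by blast
      qed simp
      ultimately show ?thesis by (simp only: mult_zero_right sum.neutral_const)
    qed
  qed
  have "((\<lambda>s. \<Prod>k<Suc m. G s (\<sigma> (2*k)) (\<sigma> (2*k+1))) has_real_derivative (\<Prod>k<Suc m. h (\<sigma> (2*k)) (\<sigma> (2*k+1)))) (at 0)"
    if "\<sigma> \<in> ?P" for \<sigma>
    unfolding has_field_derivative_def
  proof (rule has_derivative_eq_rhs[OF has_derivative_prod[OF G'[unfolded has_field_derivative_def]]], rule ext)
    fix y
    show "(\<Sum>k<Suc m. G' (\<sigma> (2*k)) (\<sigma> (2*k+1)) * y * (\<Prod>j\<in>{..<Suc m}-{k}. G 0 (\<sigma> (2*j)) (\<sigma> (2*j+1))))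
        = (\<Prod>k<Suc m. h (\<sigma> (2*k)) (\<sigma> (2*k+1))) * y"
      unfolding *[OF that, symmetric] sum_distrib_right by (rule sum.cong[OF refl]) (simp only: mult_ac)
  qed
  then have "((\<lambda>s. pf (Suc m) (G s)) has_real_derivative pf (Suc m) h) (at 0)"
    unfolding pf_def by (intro DERIV_sum DERIV_cmult) auto
  moreover have "pf (Suc m) h = 2 * Suc m * h 0 1 * pf m (\<lambda>i j. h (i + 2) (j + 2))"
  proof (rule pf_first_pair)
    have anti': "G' i j = - G' j i" for i j
    proof (rule DERIV_unique[OF G'])
      show "((\<lambda>s. G s i j) has_real_derivative - G' j i) (at 0)"
        unfolding anti[of _ i j] by (rule DERIV_minus[OF G'])
    qed
    have "{i, j} = {0, 1} \<longleftrightarrow> {j, i} = {0, 1}" for i j :: nat by (simp add: insert_commute)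
    then show "h i j = - h j i" for i j using anti[of 0 i j] anti'[of i j] by (simp add: h_def)
    show "h 1 j = 0" if "2 \<le> j" for j using that zero by (auto simp: h_def doubleton_eq_iff)
  qed
  moreover have "h 0 1 = G' 0 1" "(\<lambda>i j. h (i + 2) (j + 2)) = (\<lambda>i j. G 0 (i + 2) (j + 2))"
    by (auto simp: h_def doubleton_eq_iff)
  ultimately show ?thesis by simp
qed

section \<open>Alternating forms\<close>

lemma alternating_form_two:
  assumes "alternating_form 2 \<alpha>"
  shows "bilinear (\<lambda>v w. \<alpha> [v, w])" "\<alpha> [v, v] = 0" "\<alpha> [v, w] = - \<alpha> [w, v]" "length vs \<noteq> 2 \<Longrightarrow> \<alpha> vs = 0"
proof -
  have l: "linear (\<lambda>v. \<alpha> (vs[i := v]))" if "length vs = 2" "i < 2" for vs i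
    using assms that unfolding alternating_form_def by blast
  have 1: "linear (\<lambda>v. \<alpha> [v, w])" for w using l[of "[0, w]" 0] by simp
  have 2: "linear (\<lambda>w. \<alpha> [v, w])" for v using l[of "[v, 0]" 1] by simp
  show "bilinear (\<lambda>v w. \<alpha> [v, w])" unfolding bilinear_def using 1 2 by blast
  have 3: "\<alpha> [v, v] = 0" for v
  proof -
    have "length [v, v] = 2 \<longrightarrow> 0 < (1::nat) \<longrightarrow> 1 < (2::nat) \<longrightarrow> [v, v] ! 0 = [v, v] ! 1 \<longrightarrow> \<alpha> [v, v] = 0"
      using assms unfolding alternating_form_def by blast
    then show ?thesis by simp
  qed
  then show "\<alpha> [v, v] = 0" .
  have "\<alpha> [v + w, v + w] = \<alpha> [v, v] + \<alpha> [w, v] + (\<alpha> [v, w] + \<alpha> [w, w])"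
    by (simp only: linear_add[OF 1] linear_add[OF 2])
  then show "\<alpha> [v, w] = - \<alpha> [w, v]" by (simp add: 3)
  show "length vs \<noteq> 2 \<Longrightarrow> \<alpha> vs = 0" using assms unfolding alternating_form_def by blast
qed

text \<open>Put the sum of the two entries into both slots and expand: the form vanishes there, and
  so do its two terms with equal entries.\<close>

lemma alternating_form_swap:
  assumes "alternating_form N \<alpha>" "length vs = N" "i < N" "j < N" "i \<noteq> j"
  shows "\<alpha> (vs[i := vs ! j, j := vs ! i]) = - \<alpha> vs"
proof -
  define f where "f v w = \<alpha> (vs[i := v, j := w])" for v w
  have lin: "linear (\<lambda>v. f v w)" "linear (\<lambda>w. f v w)" for v w
  proof -
    have "linear (\<lambda>v. \<alpha> ((vs[j := w])[i := v]))" "linear (\<lambda>w. \<alpha> ((vs[i := v])[j := w]))"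
      using assms unfolding alternating_form_def by auto
    then show "linear (\<lambda>v. f v w)" "linear (\<lambda>w. f v w)"
      using assms(5) by (simp_all add: f_def list_update_swap)
  qed
  have z: "f v v = 0" for v
  proof -
    have "\<alpha> ws = 0" if "length ws = N" "i < j \<longrightarrow> ws ! i = ws ! j" "j < i \<longrightarrow> ws ! j = ws ! i" for ws
    proof (cases "i < j")
      case True
      then show ?thesis
        using assms(1)[unfolded alternating_form_def, THEN conjunct2, THEN conjunct2, rule_format, of ws i j] that assms by simp
    next
      case False
      then show ?thesis
        using assms(1)[unfolded alternating_form_def, THEN conjunct2, THEN conjunct2, rule_format, of ws j i] that assms by simp
    qed
    then show ?thesis using assms by (simp add: f_def)
  qed
  have "f (vs!i + vs!j) (vs!i + vs!j) = f (vs!i) (vs!i) + f (vs!j) (vs!i) + (f (vs!i) (vs!j) + f (vs!j) (vs!j))"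
    by (simp only: linear_add[OF lin(1)] linear_add[OF lin(2)])
  then have "f (vs!j) (vs!i) = - f (vs!i) (vs!j)" by (simp add: z)
  then show ?thesis by (simp add: f_def)
qed

text \<open>A permutation is a product of transpositions, and each of them only changes the sign;
  since only vanishing is asserted, no signs have to be tracked.\<close>

lemma alternating_form_permute_zero:
  assumes \<alpha>: "alternating_form N \<alpha>" and "p permutes {..<N}"
  shows "length vs = N \<Longrightarrow> \<alpha> vs = 0 \<Longrightarrow> \<alpha> (map (\<lambda>i. vs ! p i) [0..<N]) = 0"
  using assms(2) finite_lessThan
proof (induction p arbitrary: vs rule: permutes_induct)
  case id
  then show ?case using map_nth[of vs] by simp
next
  case (swap a b p)
  let ?ws = "vs[a := vs ! b, b := vs ! a]"
  have 1: "map (\<lambda>i. vs ! (Transposition.transpose a b \<circ> p) i) [0..<N] = map (\<lambda>i. ?ws ! p i) [0..<N]"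
  proof (rule map_cong[OF refl])
    fix i assume "i \<in> set [0..<N]"
    then have "p i < N" using permutes_lessThan_less[OF \<open>p permutes {..<N}\<close>] by simp
    then show "vs ! (Transposition.transpose a b \<circ> p) i = ?ws ! p i"
      using swap by (auto simp: Transposition.transpose_def nth_list_update)
  qed
  have 2: "\<alpha> ?ws = 0" using alternating_form_swap[OF \<alpha>, of vs a b] swap by simp
  show ?case unfolding 1 by (rule swap.IH[OF _ 2]) (use swap in simp)
qed

text \<open>Induction on the number of leading entries that need not come from \<open>vs\<close>:
  such an entry is expanded along the spanning list by linearity. A list with all entries from
  \<open>vs\<close> is a rearrangement of it or has a repetition.\<close>

lemma alternating_form_zero:
  fixes \<alpha> :: "'a::euclidean_space mform"
  assumes \<alpha>: "alternating_form DIM('a) \<alpha>" and vs: "length vs = DIM('a)" "span (set vs) = UNIV" and z: "\<alpha> vs = 0"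
  shows "\<alpha> ws = 0"
proof (cases "length ws = DIM('a)")
  case True
  have "DIM('a) \<le> card (set vs)" using vs(2) dim_le_card'[of "set vs"] by (metis dim_UNIV dim_span finite_set)
  then have d: "distinct vs" using card_length[of vs] vs(1) by (intro card_distinct) simp
  have "\<alpha> ws = 0" if "k \<le> DIM('a)" "length ws = DIM('a)" "\<And>i. k \<le> i \<Longrightarrow> i < DIM('a) \<Longrightarrow> ws ! i \<in> set vs" for k ws
    using that
  proof (induction k arbitrary: ws)
    case 0
    have sub: "set ws \<subseteq> set vs" using 0 by (auto simp: in_set_conv_nth)
    show ?case
    proof (cases "distinct ws")
      case True
      have "set ws = set vs" by (rule card_subset_eq) (use sub True d vs 0 in \<open>auto simp: distinct_card\<close>)
      then have "mset ws = mset vs" using True d by (metis set_eq_iff_mset_eq_distinct)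
      then obtain p where p: "p permutes {..<length vs}" "permute_list p vs = ws" by (rule mset_eq_permutation)
      then have "map (\<lambda>i. vs ! p i) [0..<DIM('a)] = ws" by (simp add: permute_list_def vs(1))
      then show ?thesis using alternating_form_permute_zero[OF \<alpha> p(1)[unfolded vs(1)] vs(1) z] by simp
    next
      case False
      then obtain i j where "i < j" "j < length ws" "ws ! i = ws ! j"
        by (metis distinct_conv_nth linorder_neqE_nat)
      then show ?thesis using \<alpha>[unfolded alternating_form_def, THEN conjunct2, THEN conjunct2, rule_format, of ws i j] 0 by simp
    qed
  next
    case (Suc k)
    have l: "linear (\<lambda>v. \<alpha> (ws[k := v]))" using \<alpha> Suc.prems unfolding alternating_form_def by auto
    have "\<alpha> (ws[k := v]) = 0" if "v \<in> set vs" for v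
      by (rule Suc.IH) (use Suc.prems that in \<open>auto simp: nth_list_update\<close>)
    then have "\<alpha> (ws[k := ws ! k]) = 0"
      by (rule linear_eq_0_on_span[OF l]) (use vs(2) in auto)
    then show ?case by simp
  qed
  then show ?thesis using True by (metis order_refl linorder_not_le)
qed (use \<alpha> in \<open>auto simp: alternating_form_def\<close>)

section \<open>Radicals and symplectic bases\<close>

definition rad :: "('a \<Rightarrow> 'a \<Rightarrow> real) \<Rightarrow> 'a set \<Rightarrow> 'a set" where
  "rad b V = {v \<in> V. \<forall>w\<in>V. b v w = 0}"

lemma subspace_bilinear_zero:
  assumes "bilinear b" shows "subspace {x. b v x = 0}" "subspace {x. b x v = 0}"
  using assms linear_subspace_kernel unfolding bilinear_def by blast+

lemma subspace_rad:
  assumes "bilinear b" "subspace V" shows "subspace (rad b V)"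
proof -
  have "rad b V = V \<inter> (\<Inter>w\<in>V. {x. b x w = 0})" by (auto simp: rad_def)
  then show ?thesis using assms subspace_bilinear_zero(2)[OF assms(1)] by (auto intro!: subspace_inter subspace_Inter)
qed

lemma alternating_bilinear_anti:
  assumes b: "bilinear b" and alt: "\<And>v. b v v = (0::real)"
  shows "b v w = - b w v"
proof -
  have "b (v + w) (v + w) = b v v + b v w + (b w v + b w w)"
    by (simp only: bilinear_ladd[OF b] bilinear_radd[OF b])
  then show ?thesis by (simp add: alt)
qed

text \<open>\<open>v\<close> and \<open>w\<close> span a hyperbolic plane and \<open>V'\<close> is
  its complement with respect to \<open>b\<close>. The form is nondegenerate on the plane, so the
  plane splits off without touching the radical; this is the induction step for symplectic
  bases.\<close>

lemma symplectic_split: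
  fixes b :: "'a::euclidean_space \<Rightarrow> 'a \<Rightarrow> real"
  assumes b: "bilinear b" and alt: "\<And>v. b v v = 0" and V: "subspace V" "v \<in> V" "w \<in> V" and vw: "b v w = 1"
  defines "V' \<equiv> {x \<in> V. b v x = 0 \<and> b w x = 0}"
  shows "subspace V'" "dim V = dim V' + 2" "rad b V' = rad b V"
proof -
  note anti = alternating_bilinear_anti[OF b alt]
  have wv: "b w v = - 1" using anti[of w v] vw by simp
  note bl = bilinear_ladd[OF b] bilinear_radd[OF b] bilinear_lmul[OF b] bilinear_rmul[OF b] bilinear_lsub[OF b] bilinear_rsub[OF b]
  have "V' = V \<inter> {x. b v x = 0} \<inter> {x. b w x = 0}" by (auto simp: V'_def)
  then show V': "subspace V'" by (simp add: V subspace_inter subspace_bilinear_zero[OF b])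
  define P where "P = span {v, w}"
  have PE: "\<exists>\<alpha> \<beta>. x = \<alpha> *\<^sub>R v + \<beta> *\<^sub>R w" if "x \<in> P" for x
    using that unfolding P_def by (auto simp: span_insert span_empty algebra_simps)
  have dec: "\<exists>y\<in>V'. x = b x w *\<^sub>R v + b v x *\<^sub>R w + y" if "x \<in> V" for x
  proof (rule bexI)
    let ?y = "x - b x w *\<^sub>R v - b v x *\<^sub>R w"
    show "x = b x w *\<^sub>R v + b v x *\<^sub>R w + ?y" by simp
    show "?y \<in> V'" unfolding V'_def using that V
      by (auto simp: bl alt vw wv anti[of w x] intro!: subspace_diff subspace_scale)
  qed
  have "dim {x + y |x y. x \<in> P \<and> y \<in> V'} + dim (P \<inter> V') = dim P + dim V'"
    by (rule dim_sums_Int) (simp_all add: P_def V')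
  moreover have "{x + y |x y. x \<in> P \<and> y \<in> V'} = V"
  proof (intro equalityI subsetI)
    fix z assume "z \<in> {x + y |x y. x \<in> P \<and> y \<in> V'}"
    then obtain x y where z: "z = x + y" "x \<in> P" "y \<in> V'" by blast
    have "P \<subseteq> V" unfolding P_def using V by (intro span_minimal) auto
    then have "x \<in> V" "y \<in> V" using z by (auto simp: V'_def)
    then show "z \<in> V" using z V(1) by (simp add: subspace_add)
  next
    fix x assume "x \<in> V"
    from dec[OF this] obtain y where y: "y \<in> V'" "x = b x w *\<^sub>R v + b v x *\<^sub>R w + y" by blast
    have "b x w *\<^sub>R v + b v x *\<^sub>R w \<in> P" unfolding P_def by (intro span_add span_scale span_base) auto
    then show "x \<in> {x + y |x y. x \<in> P \<and> y \<in> V'}" using y by blast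
  qed
  moreover have "P \<inter> V' = {0}"
  proof -
    have "x = 0" if "x \<in> P" "x \<in> V'" for x
    proof -
      from PE[OF that(1)] obtain \<alpha> \<beta> where x: "x = \<alpha> *\<^sub>R v + \<beta> *\<^sub>R w" by blast
      have "\<beta> = 0" "\<alpha> = 0" using that(2) unfolding V'_def x by (auto simp: bl alt vw wv)
      then show ?thesis using x by simp
    qed
    moreover have "0 \<in> P" "0 \<in> V'" using V' by (auto simp: P_def span_zero subspace_0)
    ultimately show ?thesis by auto
  qed
  moreover have "dim P = 2"
  proof -
    have ne: "v \<noteq> w" using vw alt by auto
    have "independent {v, w}"
    proof (rule independent_insertI)
      show "v \<notin> span {w}"
      proof
        assume "v \<in> span {w}"
        then obtain c where "v = c *\<^sub>R w" by (auto simp: span_singleton)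
        then show False using vw alt by (simp add: bl)
      qed
      have "w \<noteq> 0" using vw bilinear_rzero[OF b, of v] by auto
      then show "independent {w}" by simp
    qed
    then show ?thesis unfolding P_def dim_span using dim_eq_card_independent ne by fastforce
  qed
  ultimately show "dim V = dim V' + 2" by simp
  show "rad b V' = rad b V"
  proof (intro equalityI subsetI)
    fix x assume x: "x \<in> rad b V'"
    then have "x \<in> V" "b v x = 0" "b w x = 0" and z: "\<And>y. y \<in> V' \<Longrightarrow> b x y = 0" by (auto simp: rad_def V'_def)
    moreover have "b x y = 0" if "y \<in> V" for y
    proof -
      from dec[OF that] obtain y' where y': "y' \<in> V'" "y = b y w *\<^sub>R v + b v y *\<^sub>R w + y'" by blast
      have "b x y = b y w * b x v + b v y * b x w + b x y'" by (subst y'(2)) (simp add: bl)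
      then show ?thesis using z[OF y'(1)] calculation(2,3) anti[of x] by simp
    qed
    ultimately show "x \<in> rad b V" by (simp add: rad_def)
  next
    fix x assume "x \<in> rad b V"
    then show "x \<in> rad b V'" using V anti[of _ x] by (simp add: rad_def V'_def)
  qed
qed

text \<open>Orthogonality of the list to \<open>w\<close> is enough: \<open>w\<close> can then only
  be paired with \<open>v\<close>, whatever the products of \<open>v\<close> with the other vectors.
  This freedom serves for a \<open>v\<close> that is merely transversal to a hyperplane.\<close>

lemma pf_symplectic_cons:
  fixes b :: "'a::real_vector \<Rightarrow> 'a \<Rightarrow> real"
  assumes b: "bilinear b" and alt: "\<And>v. b v v = 0" and "length vs = 2 * m" "\<And>x. x \<in> set vs \<Longrightarrow> b w x = 0"
  shows "pf (Suc m) (\<lambda>i j. b ((v # w # vs) ! i) ((v # w # vs) ! j)) = 2 * Suc m * b v w * pf m (\<lambda>i j. b (vs ! i) (vs ! j))"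
proof -
  have z: "b w ((v # w # vs) ! j) = 0" if "2 \<le> j" "j < 2 * Suc m" for j
  proof -
    have j: "(v # w # vs) ! j = vs ! (j - 2)" using that(1) by (cases j; cases "j - 1") auto
    have "j - 2 < length vs" using that assms(3) by simp
    then show ?thesis unfolding j by (intro assms(4) nth_mem)
  qed
  have "pf (Suc m) (\<lambda>i j. b ((v # w # vs) ! i) ((v # w # vs) ! j)) = 2 * Suc m * b ((v # w # vs) ! 0) ((v # w # vs) ! 1)
      * pf m (\<lambda>i j. b ((v # w # vs) ! (i + 2)) ((v # w # vs) ! (j + 2)))"
  proof (rule pf_first_pair)
    fix i j
    show "b ((v # w # vs) ! i) ((v # w # vs) ! j) = - b ((v # w # vs) ! j) ((v # w # vs) ! i)"
      by (rule alternating_bilinear_anti[OF b alt])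
  next
    fix j assume "2 \<le> j" "j < 2 * Suc m"
    from z[OF this] show "b ((v # w # vs) ! 1) ((v # w # vs) ! j) = 0" by (simp only: One_nat_def nth_Cons_Suc nth_Cons_0)
  qed
  then show ?thesis by simp
qed

text \<open>A nonzero \<open>pf\<close> stands for the explicit relations among basis vectors. Both
  parts come from one induction on the dimension; the second lets any vector outside the radical
  come first, which is how kernels of powers are detected. The dimension formula also shows that the
  radical has even codimension.\<close>

lemma symplectic_basis:
  fixes b :: "'a::euclidean_space \<Rightarrow> 'a \<Rightarrow> real"
  assumes b: "bilinear b" and alt: "\<And>v. b v v = 0"
  shows "subspace V \<Longrightarrow> \<exists>m vs. length vs = 2 * m \<and> set vs \<subseteq> V \<and> dim V = 2 * m + dim (rad b V) \<and>
    pf m (\<lambda>i j. b (vs ! i) (vs ! j)) \<noteq> 0"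
    and "subspace V \<Longrightarrow> v \<in> V \<Longrightarrow> v \<notin> rad b V \<Longrightarrow> \<exists>m w vs. length vs = 2 * m \<and> dim V = 2 * Suc m + dim (rad b V) \<and>
    pf (Suc m) (\<lambda>i j. b ((v # w # vs) ! i) ((v # w # vs) ! j)) \<noteq> 0 \<and> set (v # w # vs) \<subseteq> V"
proof -
  have "subspace V \<Longrightarrow> (\<exists>m vs. length vs = 2 * m \<and> set vs \<subseteq> V \<and> dim V = 2 * m + dim (rad b V) \<and>
    pf m (\<lambda>i j. b (vs ! i) (vs ! j)) \<noteq> 0) \<and> (\<forall>v\<in>V. v \<notin> rad b V \<longrightarrow> (\<exists>m w vs. length vs = 2 * m \<and> dim V = 2 * Suc m + dim (rad b V) \<and>
    pf (Suc m) (\<lambda>i j. b ((v # w # vs) ! i) ((v # w # vs) ! j)) \<noteq> 0 \<and> set (v # w # vs) \<subseteq> V))" for V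
  proof (induction "dim V" arbitrary: V rule: less_induct)
    case less
    have ext: "\<exists>m w vs. length vs = 2 * m \<and> dim V = 2 * Suc m + dim (rad b V) \<and>
      pf (Suc m) (\<lambda>i j. b ((v # w # vs) ! i) ((v # w # vs) ! j)) \<noteq> 0 \<and> set (v # w # vs) \<subseteq> V" if v: "v \<in> V" "v \<notin> rad b V" for v
    proof -
      obtain w' where w': "w' \<in> V" "b v w' \<noteq> 0" using v by (auto simp: rad_def)
      define w where "w = (1 / b v w') *\<^sub>R w'"
      have w: "w \<in> V" "b v w = 1" using w' less.prems by (simp_all add: w_def subspace_scale bilinear_rmul[OF b])
      let ?V = "{x \<in> V. b v x = 0 \<and> b w x = 0}"
      note sp = symplectic_split[OF b alt less.prems v(1) w]
      have "dim ?V < dim V" using sp(2) by simp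
      from less.hyps[OF this sp(1)] obtain m vs where *: "length vs = 2 * m" "set vs \<subseteq> ?V" "dim ?V = 2 * m + dim (rad b ?V)"
        "pf m (\<lambda>i j. b (vs ! i) (vs ! j)) \<noteq> 0" by blast
      have "pf (Suc m) (\<lambda>i j. b ((v # w # vs) ! i) ((v # w # vs) ! j)) = 2 * Suc m * b v w * pf m (\<lambda>i j. b (vs ! i) (vs ! j))"
        by (rule pf_symplectic_cons[OF b alt *(1)]) (use *(2) in auto)
      then have "pf (Suc m) (\<lambda>i j. b ((v # w # vs) ! i) ((v # w # vs) ! j)) \<noteq> 0" using w(2) *(4) by simp
      moreover have "set (v # w # vs) \<subseteq> V" using *(2) v w by auto
      moreover have "dim V = 2 * Suc m + dim (rad b V)" using sp(2,3) *(3) by simp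
      ultimately show ?thesis using *(1) by blast
    qed
    show ?case
    proof (intro conjI ballI impI)
      show "\<exists>m vs. length vs = 2 * m \<and> set vs \<subseteq> V \<and> dim V = 2 * m + dim (rad b V) \<and> pf m (\<lambda>i j. b (vs ! i) (vs ! j)) \<noteq> 0"
      proof (cases "V \<subseteq> rad b V")
        case True
        then have "rad b V = V" by (auto simp: rad_def)
        then show ?thesis by (intro exI[of _ 0] exI[of _ "[]"]) (simp add: pf_def)
      next
        case False
        then obtain v where "v \<in> V" "v \<notin> rad b V" by blast
        from ext[OF this] obtain m w vs where *: "length vs = 2 * m" "dim V = 2 * Suc m + dim (rad b V)"
          "pf (Suc m) (\<lambda>i j. b ((v # w # vs) ! i) ((v # w # vs) ! j)) \<noteq> 0" "set (v # w # vs) \<subseteq> V" by (elim exE conjE) (rule that)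
        then show ?thesis by (intro exI[of _ "Suc m"] exI[of _ "v # w # vs"] conjI) simp_all
      qed
    qed (rule ext)
  qed
  then show "subspace V \<Longrightarrow> \<exists>m vs. length vs = 2 * m \<and> set vs \<subseteq> V \<and> dim V = 2 * m + dim (rad b V) \<and>
    pf m (\<lambda>i j. b (vs ! i) (vs ! j)) \<noteq> 0"
    and "subspace V \<Longrightarrow> v \<in> V \<Longrightarrow> v \<notin> rad b V \<Longrightarrow> \<exists>m w vs. length vs = 2 * m \<and> dim V = 2 * Suc m + dim (rad b V) \<and>
    pf (Suc m) (\<lambda>i j. b ((v # w # vs) ! i) ((v # w # vs) ! j)) \<noteq> 0 \<and> set (v # w # vs) \<subseteq> V" by blast+
qed

text \<open>The radical has codimension \<open>2 * m\<close> for some \<open>m\<close> whose power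
  of the form is nonzero, and \<open>m = n\<close> would contradict the vanishing of the top
  power.\<close>

lemma wedge_power_zero_degenerate:
  fixes \<alpha> :: "'a::euclidean_space mform"
  assumes \<alpha>: "alternating_form 2 \<alpha>" and n: "DIM('a) = 2 * n" and z: "wedge_power 2 \<alpha> n = (\<lambda>_. 0)"
  shows "2 \<le> dim (rad (\<lambda>v w. \<alpha> [v, w]) UNIV)"
proof -
  obtain m vs where *: "length vs = 2 * m" "DIM('a) = 2 * m + dim (rad (\<lambda>v w. \<alpha> [v, w]) UNIV)"
    "pf m (\<lambda>i j. \<alpha> [vs ! i, vs ! j]) \<noteq> 0"
    using symplectic_basis(1)[OF alternating_form_two(1,2)[OF \<alpha>], of UNIV] by (auto simp: dim_UNIV)
  have "m \<noteq> n"
  proof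
    assume "m = n"
    with wedge_power_pf[OF *(1), of \<alpha>] z *(3) show False by simp
  qed
  then show ?thesis using *(2) n by simp
qed

text \<open>A vector outside the radical starts a symplectic list of \<open>n - 1\<close> pairs, on
  which the power does not vanish; a vector in the radical produces a zero row in every Pfaffian.
  This translates kernels of powers into radicals of the forms themselves.\<close>

lemma form_kernel_wedge_power:
  fixes \<alpha> :: "'a::euclidean_space mform"
  assumes \<alpha>: "alternating_form 2 \<alpha>" and n: "DIM('a) = 2 * n" "2 \<le> n" and d: "dim (rad (\<lambda>v w. \<alpha> [v, w]) UNIV) = 2"
  shows "form_kernel (wedge_power 2 \<alpha> (n - 1)) = rad (\<lambda>v w. \<alpha> [v, w]) UNIV"
proof (intro equalityI subsetI)
  fix v assume v: "v \<in> form_kernel (wedge_power 2 \<alpha> (n - 1))"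
  show "v \<in> rad (\<lambda>v w. \<alpha> [v, w]) UNIV"
  proof (rule ccontr)
    assume "v \<notin> rad (\<lambda>v w. \<alpha> [v, w]) UNIV"
    from symplectic_basis(2)[OF alternating_form_two(1,2)[OF \<alpha>] _ _ this]
    obtain m w vs where *: "length vs = 2 * m" "DIM('a) = 2 * Suc m + 2"
      "pf (Suc m) (\<lambda>i j. \<alpha> [(v # w # vs) ! i, (v # w # vs) ! j]) \<noteq> 0" by (auto simp: dim_UNIV d)
    then have "wedge_power 2 \<alpha> (Suc m) (v # w # vs) \<noteq> 0" using wedge_power_pf[of "v # w # vs" "Suc m" \<alpha>] by simp
    moreover have "n - 1 = Suc m" using *(2) n by simp
    moreover have "wedge_power 2 \<alpha> (n - 1) (v # w # vs) = 0"
      using fun_cong[OF v[unfolded form_kernel_def interior_product_def mem_Collect_eq], of "w # vs"] .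
    ultimately show False by simp
  qed
next
  fix v assume v: "v \<in> rad (\<lambda>v w. \<alpha> [v, w]) UNIV"
  have "wedge_power 2 \<alpha> (n - 1) (v # vs) = 0" for vs
  proof (cases "length (v # vs) = 2 * (n - 1)")
    case True
    have "pf (n - 1) (\<lambda>i j. \<alpha> [(v # vs) ! i, (v # vs) ! j]) = 0"
      by (rule pf_zero[of 0]) (use v n alternating_form_two(3)[OF \<alpha>, of _ v] in \<open>auto simp: rad_def\<close>)
    then show ?thesis using wedge_power_pf[OF True] by simp
  next
    case False
    obtain k where "n - 1 = Suc k" using n by (metis Suc_diff_Suc Suc_1 Suc_le_lessD diff_Suc_1)
    then show ?thesis using False by (simp add: wedge_def)
  qed
  then show "v \<in> form_kernel (wedge_power 2 \<alpha> (n - 1))" by (simp add: form_kernel_def interior_product_def)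
qed

section \<open>Moser's method for singular symplectic forms\<close>

lemma bilinear_expand:
  fixes b :: "real^'d \<Rightarrow> real^'d \<Rightarrow> real"
  assumes "bilinear b"
  shows "b v w = (\<Sum>i\<in>UNIV. \<Sum>j\<in>UNIV. v $ i * w $ j * b (axis i 1) (axis j 1))"
proof -
  have e: "x = (\<Sum>i\<in>UNIV. x $ i *\<^sub>R axis i 1)" for x :: "real^'d"
    using basis_expansion[of x] by (simp add: scalar_mult_eq_scaleR)
  have "b v w = b (\<Sum>i\<in>UNIV. v $ i *\<^sub>R axis i 1) (\<Sum>j\<in>UNIV. w $ j *\<^sub>R axis j 1)" using e[of v] e[of w] by simp
  also have "\<dots> = (\<Sum>(i, j)\<in>UNIV \<times> UNIV. b (v $ i *\<^sub>R axis i 1) (w $ j *\<^sub>R axis j 1))"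
    by (rule bilinear_sum[OF assms]) 
  finally show ?thesis by (simp add: sum.cartesian_product bilinear_lmul[OF assms] bilinear_rmul[OF assms] mult_ac)
qed

text \<open>The product rule for a form that varies together with its arguments, read off from the
  expansion in coordinates.\<close>

lemma bilinear_family_derivative:
  fixes B :: "'z::real_normed_vector \<Rightarrow> real^'d \<Rightarrow> real^'d \<Rightarrow> real"
  assumes N: "open N" "p \<in> N" "\<And>z. z \<in> N \<Longrightarrow> bilinear (B z)"
    and B': "\<And>v w. ((\<lambda>z. B z v w) has_derivative B' v w) (at p)"
    and v: "(v has_derivative v') (at p)" and w: "(w has_derivative w') (at p)"
  shows "((\<lambda>z. B z (v z) (w z)) has_derivative (\<lambda>h. B' (v p) (w p) h + B p (v' h) (w p) + B p (v p) (w' h))) (at p)"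
proof -
  let ?e = "\<lambda>i. axis i 1 :: real^'d"
  have D: "((\<lambda>z. B z (v z) (w z)) has_derivative
      (\<lambda>h. \<Sum>i\<in>UNIV. \<Sum>j\<in>UNIV. (v p $ i * w' h $ j + v' h $ i * w p $ j) * B p (?e i) (?e j) + v p $ i * w p $ j * B' (?e i) (?e j) h)) (at p)"
    if v: "(v has_derivative v') (at p)" and w: "(w has_derivative w') (at p)" for v w v' w'
  proof (rule has_derivative_transform_within_open[OF _ N(1,2)])
    show "(\<Sum>i\<in>UNIV. \<Sum>j\<in>UNIV. v z $ i * w z $ j * B z (?e i) (?e j)) = B z (v z) (w z)" if "z \<in> N" for z
      by (rule bilinear_expand[OF N(3)[OF that], symmetric])
    have v: "((\<lambda>z. v z $ i) has_derivative (\<lambda>h. v' h $ i)) (at p)" for i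
      by (rule bounded_linear.has_derivative[OF bounded_linear_vec_nth v])
    have w: "((\<lambda>z. w z $ i) has_derivative (\<lambda>h. w' h $ i)) (at p)" for i
      by (rule bounded_linear.has_derivative[OF bounded_linear_vec_nth w])
    show "((\<lambda>z. \<Sum>i\<in>UNIV. \<Sum>j\<in>UNIV. v z $ i * w z $ j * B z (?e i) (?e j)) has_derivative
      (\<lambda>h. \<Sum>i\<in>UNIV. \<Sum>j\<in>UNIV. (v p $ i * w' h $ j + v' h $ i * w p $ j) * B p (?e i) (?e j) + v p $ i * w p $ j * B' (?e i) (?e j) h)) (at p)"
    proof (intro has_derivative_sum)
      fix i j
      show "((\<lambda>z. v z $ i * w z $ j * B z (?e i) (?e j)) has_derivative
        (\<lambda>h. (v p $ i * w' h $ j + v' h $ i * w p $ j) * B p (?e i) (?e j) + v p $ i * w p $ j * B' (?e i) (?e j) h)) (at p)"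
        by (rule has_derivative_eq_rhs[OF has_derivative_mult[OF has_derivative_mult[OF v w] B']]) (simp add: fun_eq_iff)
    qed
  qed
  \<comment> \<open>Applied to constant arguments, the coordinate formula shows that
    \<open>B'\<close> is determined bilinearly by its values on basis vectors.\<close>
  have B'e: "B' x y h = (\<Sum>i\<in>UNIV. \<Sum>j\<in>UNIV. x $ i * y $ j * B' (?e i) (?e j) h)" for x y h
    using has_derivative_unique[OF B'[of x y] D[OF has_derivative_const has_derivative_const]] by (simp add: fun_eq_iff)
  show ?thesis
  proof (rule has_derivative_eq_rhs[OF D[OF v w]], rule ext)
    fix h
    show "(\<Sum>i\<in>UNIV. \<Sum>j\<in>UNIV. (v p $ i * w' h $ j + v' h $ i * w p $ j) * B p (?e i) (?e j) + v p $ i * w p $ j * B' (?e i) (?e j) h)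
      = B' (v p) (w p) h + B p (v' h) (w p) + B p (v p) (w' h)"
      unfolding B'e[of "v p"] bilinear_expand[OF N(3)[OF N(2)], of "v' h"] bilinear_expand[OF N(3)[OF N(2)], of "v p"]
      by (simp add: sum.distrib algebra_simps)
  qed
qed

lemma rg_sum: "(\<And>i. i \<in> I \<Longrightarrow> rg r p (f i)) \<Longrightarrow> rg r p (\<lambda>x. \<Sum>i\<in>I. f i x)"
  by (induction I rule: infinite_finite_induct) (simp_all add: rg_const rg_add)

lemma rg_prod: "(\<And>i. i \<in> I \<Longrightarrow> rg r p (f i)) \<Longrightarrow> rg r p (\<lambda>x. \<Prod>i\<in>I. f i x)"
  by (induction I rule: infinite_finite_induct) (simp_all add: rg_const rg_mult)

lemma rg_det:
  fixes A :: "real^'e \<Rightarrow> real^'d^'d"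
  assumes "\<And>i j. rg r p (\<lambda>x. A x $ i $ j)" shows "rg r p (\<lambda>x. det (A x))"
  unfolding det_def by (intro rg_sum rg_mult rg_const rg_prod assms)

text \<open>The components are Cramer's quotients of determinants, so either kind of regularity
  passes from the system to its solution.\<close>

lemma rg_linear_solve:
  fixes M :: "real^'e \<Rightarrow> real^'d^'d" and z :: "real^'e \<Rightarrow> real^'d"
  assumes M: "\<And>i j. rg r p (\<lambda>x. M x $ i $ j)" and z: "\<And>i. rg r p (\<lambda>x. z x $ i)" and "det (M p) \<noteq> 0"
  shows "rg r p (\<lambda>x. (\<chi> k. det (\<chi> i j. if j = k then z x $ i else M x $ i $ j) / det (M x)) $ k)"
proof -
  have "rg r p (\<lambda>x. det (\<chi> i j. if j = k then z x $ i else M x $ i $ j) * inverse (det (M x)))"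
  proof (intro rg_mult rg_inverse rg_det M assms(3))
    show "rg r p (\<lambda>x. (\<chi> i j. if j = k then z x $ i else M x $ i $ j) $ i $ j)" for i j
      by (cases "j = k") (simp_all add: M z)
  qed
  then show ?thesis by (simp add: divide_inverse)
qed

lemma rg_inner: "(\<And>i. rg r p (\<lambda>x. v x $ i)) \<Longrightarrow> (\<And>i. rg r p (\<lambda>x. w x $ i)) \<Longrightarrow> rg r p (\<lambda>x. v x \<bullet> w x)"
  unfolding inner_vec_def inner_real_def by (intro rg_sum rg_mult)

lemma regular_on_rg: "open U \<Longrightarrow> x \<in> U \<Longrightarrow> regular_on r U f \<Longrightarrow> rg r x f"
  unfolding rg_def by blast

section \<open>Closed two-forms and division along a hyperplane\<close>

definition closed_two_form :: "regularity \<Rightarrow> (real^'d) dform \<Rightarrow> bool" where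
  "closed_two_form r \<omega> \<longleftrightarrow> (\<exists>N. open N \<and> 0 \<in> N \<and> (\<forall>x\<in>N. alternating_form 2 (\<omega> x) \<and>
    (\<forall>v w. rg r x (\<lambda>x. \<omega> x [v, w])) \<and>
    (\<forall>u v w. frechet_derivative (\<lambda>x. \<omega> x [v, w]) (at x) u - frechet_derivative (\<lambda>x. \<omega> x [u, w]) (at x) v
      + frechet_derivative (\<lambda>x. \<omega> x [u, v]) (at x) w = 0)))"

lemma closed_two_formE:
  assumes "closed_two_form r \<omega>"
  obtains N where "open N" "0 \<in> N" "\<And>x. x \<in> N \<Longrightarrow> alternating_form 2 (\<omega> x)"
    "\<And>x v w. x \<in> N \<Longrightarrow> rg r x (\<lambda>x. \<omega> x [v, w])"
    "\<And>x u v w. x \<in> N \<Longrightarrow> frechet_derivative (\<lambda>x. \<omega> x [v, w]) (at x) u - frechet_derivative (\<lambda>x. \<omega> x [u, w]) (at x) v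
      + frechet_derivative (\<lambda>x. \<omega> x [u, v]) (at x) w = 0"
proof -
  obtain N where N: "open N" "0 \<in> N" and *: "\<forall>x\<in>N. alternating_form 2 (\<omega> x) \<and>
    (\<forall>v w. rg r x (\<lambda>x. \<omega> x [v, w])) \<and>
    (\<forall>u v w. frechet_derivative (\<lambda>x. \<omega> x [v, w]) (at x) u - frechet_derivative (\<lambda>x. \<omega> x [u, w]) (at x) v
      + frechet_derivative (\<lambda>x. \<omega> x [u, v]) (at x) w = 0)"
    using assms unfolding closed_two_form_def by (elim exE conjE) (rule that)
  show ?thesis
    by (rule that[OF N bspec[OF *, THEN conjunct1] bspec[OF *, THEN conjunct2, THEN conjunct1, rule_format]
      bspec[OF *, THEN conjunct2, THEN conjunct2, rule_format]])
qed

lemma closed_two_form_germ: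
  assumes "form_germ r 2 \<omega>" "closed_form_germ 2 \<omega>"
  shows "closed_two_form r \<omega>"
proof -
  obtain U where U: "open U" "0 \<in> U" "\<And>p. p \<in> U \<Longrightarrow> alternating_form 2 (\<omega> p)"
    "\<And>vs. length vs = 2 \<Longrightarrow> regular_on r U (\<lambda>p. \<omega> p vs)"
    using assms(1) unfolding form_germ_def by blast
  obtain V where V: "open V" "0 \<in> V" "\<And>p vs. p \<in> V \<Longrightarrow> length vs = Suc 2 \<Longrightarrow> ext_deriv \<omega> p vs = 0"
    using assms(2) unfolding closed_form_germ_def eventually_nhds by blast
  show ?thesis unfolding closed_two_form_def
  proof (intro exI[of _ "U \<inter> V"] conjI ballI allI)
    show "open (U \<inter> V)" "0 \<in> U \<inter> V" using U V by auto
    fix x assume x: "x \<in> U \<inter> V"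
    show "alternating_form 2 (\<omega> x)" using U(3) x by blast
    show "rg r x (\<lambda>x. \<omega> x [v, w])" for v w
      by (rule regular_on_rg[OF U(1) _ U(4)]) (use x in auto)
    show "frechet_derivative (\<lambda>x. \<omega> x [v, w]) (at x) u - frechet_derivative (\<lambda>x. \<omega> x [u, w]) (at x) v
      + frechet_derivative (\<lambda>x. \<omega> x [u, v]) (at x) w = 0" for u v w
      using V(3)[of x "[u, v, w]"] x by (simp add: ext_deriv_def numeral_3_eq_3 lessThan_Suc)
  qed
qed

lemma smooth_on_of_rg:
  assumes "open N" "\<And>x. x \<in> N \<Longrightarrow> rg r x f" shows "smooth_on N f"
proof (rule smooth_on_open_local)
  fix x assume x: "x \<in> N"
  obtain e where e: "0 < e" "smooth_on (ball x e) f" using rg_imp_smooth[OF assms(2)[OF x]] .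
  show "\<exists>S. open S \<and> x \<in> S \<and> smooth_on S f"
    by (intro exI[of _ "ball x e"] conjI e(2)) (use e(1) in auto)
qed

text \<open>The homotopy formula along rays that end on the hyperplane. The velocity of the ray
  through \<open>x\<close> is \<open>(q \<bullet> x) *\<^sub>R u\<close>, so the primitive acquires
  the factor \<open>q \<bullet> x\<close>, and \<beta> is the integral of \<eta> contracted with
  \<open>u\<close>. The boundary term on the hyperplane vanishes by \<open>zero\<close>. The value
  of \<beta> at the origin is recorded because it decides that the Moser field vanishes
  there.\<close>

lemma relative_poincare:
  fixes \<eta> :: "real^'d \<Rightarrow> real^'d \<Rightarrow> real^'d \<Rightarrow> real" and q u :: "real^'d"
  assumes qu: "q \<bullet> u = 1" and N: "open N" "0 \<in> N"
    and bil: "\<And>x. x \<in> N \<Longrightarrow> bilinear (\<eta> x)" and alt: "\<And>x v. x \<in> N \<Longrightarrow> \<eta> x v v = 0"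
    and reg: "\<And>x v w. x \<in> N \<Longrightarrow> rg r x (\<lambda>x. \<eta> x v w)"
    and cl: "\<And>x u v w. x \<in> N \<Longrightarrow> frechet_derivative (\<lambda>x. \<eta> x v w) (at x) u - frechet_derivative (\<lambda>x. \<eta> x u w) (at x) v
      + frechet_derivative (\<lambda>x. \<eta> x u v) (at x) w = 0"
    and zero: "\<And>x v w. x \<in> N \<Longrightarrow> q \<bullet> x = 0 \<Longrightarrow> q \<bullet> v = 0 \<Longrightarrow> q \<bullet> w = 0 \<Longrightarrow> \<eta> x v w = 0"
  obtains \<beta> :: "real^'d \<Rightarrow> real^'d" and S where "open S" "0 \<in> S" "\<And>j. rg r 0 (\<lambda>x. \<beta> x $ j)"
    "\<And>v. \<beta> 0 \<bullet> v = \<eta> 0 u v"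
    "\<And>x v w. x \<in> S \<Longrightarrow> frechet_derivative (\<lambda>x. (q \<bullet> x) * (\<beta> x \<bullet> w)) (at x) v - frechet_derivative (\<lambda>x. (q \<bullet> x) * (\<beta> x \<bullet> v)) (at x) w = \<eta> x v w"
proof -
  define \<pi> where "\<pi> x = (q \<bullet> x) *\<^sub>R u" for x
  have \<pi>: "bounded_linear \<pi>" "\<And>v. \<pi> (\<pi> v) = \<pi> v" "\<pi> 0 = 0"
    using qu by (auto simp: \<pi>_def[abs_def] intro!: bounded_linear_intros)
  obtain e where e: "0 < e" "ball 0 e \<subseteq> N" using N open_contains_ball by blast
  define S where "S = {x. x \<in> ball 0 e \<and> x - \<pi> x \<in> ball 0 e}"
  note S = ray_invariant_nbhd[OF \<pi> e(1), folded S_def]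
  have SN: "S \<subseteq> N" using S(4) e(2) by blast
  define R where "R x \<tau> = x - (1 - \<tau>) *\<^sub>R \<pi> x" for x \<tau>
  have RS: "R x \<tau> \<in> S" if "x \<in> S" "\<tau> \<in> {0..1}" for x \<tau> using S(5)[OF that] by (simp add: R_def)
  have sm: "smooth_on S (\<lambda>x. \<eta> x v w)" for v w
    by (rule smooth_on_subset[OF smooth_on_of_rg[OF N(1) reg] SN])
  define D where "D v w x = frechet_derivative (\<lambda>x. \<eta> x v w) (at x)" for v w x
  have dd: "((\<lambda>x. \<eta> x v w) has_derivative D v w x) (at x)" if "x \<in> S" for v w x
    unfolding D_def by (rule smooth_on_has_derivative[OF sm that])
  have smD: "continuous_on S (\<lambda>x. D v w x a)" for v w a
    unfolding D_def by (rule smooth_on_continuous[OF smooth_on_frechet_derivative[OF sm]])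
  define I where "I w x = integral {0..1} (\<lambda>\<tau>. \<eta> (R x \<tau>) u w)" for w x
  define A where "A w x v = integral {0..1} (\<lambda>\<tau>. D u w (R x \<tau>) (v - \<pi> v)) + integral {0..1} (\<lambda>\<tau>. \<tau> * D u w (R x \<tau>) (\<pi> v))" for w x v
  have II: "((\<lambda>\<tau>. \<eta> (R x \<tau>) v w) has_integral integral {0..1} (\<lambda>\<tau>. \<eta> (R x \<tau>) v w)) {0..1}" if "x \<in> S" for x v w
    using integrable_ray[OF \<pi>(1) S(1,2,5) smooth_on_continuous[OF sm] that, of 0] by (simp add: R_def has_integral_integrable_integral)
  have I1: "((\<lambda>\<tau>. D u w (R x \<tau>) a) has_integral integral {0..1} (\<lambda>\<tau>. D u w (R x \<tau>) a)) {0..1}" if "x \<in> S" for x w a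
    using integrable_ray[OF \<pi>(1) S(1,2,5) smD that, of 0] by (simp add: R_def has_integral_integrable_integral)
  have I2: "((\<lambda>\<tau>. \<tau> * D u w (R x \<tau>) a) has_integral integral {0..1} (\<lambda>\<tau>. \<tau> * D u w (R x \<tau>) a)) {0..1}" if "x \<in> S" for x w a
    using integrable_ray[OF \<pi>(1) S(1,2,5) smD that, of 1] by (simp add: R_def has_integral_integrable_integral)
  have dI: "(I w has_derivative A w x) (at x)" if "x \<in> S" for w x
  proof -
    have "Ck_on (Suc 0) S (\<lambda>x. \<eta> x u w)" using sm unfolding smooth_on_def by blast
    from has_derivative_integral_ray[OF \<pi>(1) S(1,2,5) this that, of 0]
    show ?thesis unfolding I_def[abs_def] A_def[abs_def] R_def D_def by simp
  qed
  define \<beta> where "\<beta> x = (\<chi> j. I (axis j 1) x)" for x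
  have \<beta>: "\<beta> x \<bullet> w = I w x" if x: "x \<in> S" for x w
  proof -
    have "((\<lambda>\<tau>. \<Sum>j\<in>UNIV. w $ j * \<eta> (R x \<tau>) u (axis j 1)) has_integral (\<Sum>j\<in>UNIV. w $ j * I (axis j 1) x)) {0..1}"
      unfolding I_def by (intro has_integral_sum has_integral_mult_right II x finite)
    moreover have "(\<Sum>j\<in>UNIV. w $ j * \<eta> (R x \<tau>) u (axis j 1)) = \<eta> (R x \<tau>) u w" if "\<tau> \<in> {0..1}" for \<tau>
    proof -
      have "linear (\<eta> (R x \<tau>) u)" using bil[of "R x \<tau>"] RS[OF x that] SN unfolding bilinear_def by blast
      then have "\<eta> (R x \<tau>) u (\<Sum>j\<in>UNIV. w $ j *\<^sub>R axis j 1) = (\<Sum>j\<in>UNIV. w $ j * \<eta> (R x \<tau>) u (axis j 1))"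
        by (simp add: linear_sum linear_cmul)
      then show ?thesis using basis_expansion[of w] by (simp add: scalar_mult_eq_scaleR)
    qed
    ultimately have "((\<lambda>\<tau>. \<eta> (R x \<tau>) u w) has_integral (\<Sum>j\<in>UNIV. w $ j * I (axis j 1) x)) {0..1}"
      by (rule has_integral_eq[rotated])
    then have "I w x = (\<Sum>j\<in>UNIV. w $ j * I (axis j 1) x)" unfolding I_def by (rule integral_unique)
    then show ?thesis by (simp add: \<beta>_def inner_vec_def mult.commute)
  qed
  show ?thesis
  proof (rule that[OF S(1,3)])
    show "rg r 0 (\<lambda>x. \<beta> x $ j)" for j
    proof -
      have "rg r 0 (\<lambda>x. integral {0..1} (\<lambda>\<tau>. \<eta> (x - (1 - \<tau>) *\<^sub>R ((q \<bullet> x) *\<^sub>R u)) u (axis j 1)))"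
        by (rule rg_integral_ray[OF qu _ reg[OF N(2)]]) simp
      then show ?thesis by (simp add: \<beta>_def I_def R_def \<pi>_def)
    qed
    show "\<beta> 0 \<bullet> v = \<eta> 0 u v" for v
      unfolding \<beta>[OF S(3)] by (simp add: I_def R_def \<pi>(3))
    fix x v w assume x: "x \<in> S"
    have dq: "((\<bullet>) q has_derivative (\<bullet>) q) (at x)" by (rule bounded_linear_imp_has_derivative[OF bounded_linear_inner_right])
    have d\<alpha>: "frechet_derivative (\<lambda>x. (q \<bullet> x) * (\<beta> x \<bullet> w)) (at x) v = (q \<bullet> x) * A w x v + (q \<bullet> v) * I w x" for v w
    proof -
      have "((\<lambda>x. (q \<bullet> x) * (\<beta> x \<bullet> w)) has_derivative (\<lambda>v. (q \<bullet> x) * A w x v + (q \<bullet> v) * I w x)) (at x)"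
        by (rule has_derivative_transform_within_open[OF has_derivative_mult[OF dq dI[OF x]] S(1) x]) (simp add: \<beta>)
      then show ?thesis by (simp add: frechet_derivative_eqI)
    qed
    \<comment> \<open>The pullback of \<eta> under the ray map, expanded with
      \<open>\<eta> (R x \<tau>) u u = 0\<close>. It runs from the restriction to the hyperplane at
      \<tau> = 0 to \<open>\<eta> x v w\<close> at \<tau> = 1. In \<open>?F'\<close> closedness has
      already replaced the derivative of \<open>\<eta>\<close> along \<open>u\<close>.\<close>
    let ?F = "\<lambda>\<tau>. \<eta> (R x \<tau>) v w - (1 - \<tau>) * ((q \<bullet> v) * \<eta> (R x \<tau>) u w) + (1 - \<tau>) * ((q \<bullet> w) * \<eta> (R x \<tau>) u v)"
    let ?F' = "\<lambda>\<tau>. (q \<bullet> x) * (D u w (R x \<tau>) (v - \<pi> v) + \<tau> * D u w (R x \<tau>) (\<pi> v) - (D u v (R x \<tau>) (w - \<pi> w) + \<tau> * D u v (R x \<tau>) (\<pi> w)))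
        + (q \<bullet> v) * \<eta> (R x \<tau>) u w - (q \<bullet> w) * \<eta> (R x \<tau>) u v"
    have "(?F' has_integral (?F 1 - ?F 0)) {0..1}"
    proof (rule fundamental_theorem_of_calculus)
      fix \<tau> :: real assume \<tau>: "\<tau> \<in> {0..1}"
      have y: "R x \<tau> \<in> S" by (rule RS[OF x \<tau>])
      have yN: "R x \<tau> \<in> N" using y SN by blast
      have lin: "linear (D a b (R x \<tau>))" for a b
        using dd[OF y] has_derivative_bounded_linear bounded_linear.linear by blast
      have R': "(R x has_vector_derivative (q \<bullet> x) *\<^sub>R u) (at \<tau> within {0..1})"
        unfolding R_def[abs_def] \<pi>_def by (auto intro!: derivative_eq_intros)
      have \<eta>': "((\<lambda>\<tau>. \<eta> (R x \<tau>) a b) has_real_derivative (q \<bullet> x) * D a b (R x \<tau>) u) (at \<tau> within {0..1})" for a b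
        using vector_derivative_diff_chain_within[OF R' has_derivative_at_withinI[OF dd[OF y]], of a b]
        by (simp add: o_def has_real_derivative_iff_has_vector_derivative linear_cmul[OF lin])
      have "(?F has_real_derivative ((q \<bullet> x) * D v w (R x \<tau>) u
          - ((1 - \<tau>) * ((q \<bullet> v) * ((q \<bullet> x) * D u w (R x \<tau>) u)) + (- 1) * ((q \<bullet> v) * \<eta> (R x \<tau>) u w))
          + ((1 - \<tau>) * ((q \<bullet> w) * ((q \<bullet> x) * D u v (R x \<tau>) u)) + (- 1) * ((q \<bullet> w) * \<eta> (R x \<tau>) u v)))) (at \<tau> within {0..1})"
        by (rule derivative_eq_intros \<eta>' refl | simp)+
      moreover have "D v w (R x \<tau>) u = D u w (R x \<tau>) v - D u v (R x \<tau>) w" using cl[OF yN, of v w u] by (simp add: D_def)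
      ultimately show "(?F has_vector_derivative ?F' \<tau>) (at \<tau> within {0..1})"
        by (simp add: has_real_derivative_iff_has_vector_derivative linear_diff[OF lin] linear_cmul[OF lin] \<pi>_def algebra_simps)
    qed simp
    moreover have "(?F' has_integral (q \<bullet> x) * (A w x v - A v x w) + (q \<bullet> v) * I w x - (q \<bullet> w) * I v x) {0..1}"
      unfolding A_def I_def by (intro has_integral_add has_integral_diff has_integral_mult_right II I1 I2 x)
    ultimately have "(q \<bullet> x) * (A w x v - A v x w) + (q \<bullet> v) * I w x - (q \<bullet> w) * I v x = ?F 1 - ?F 0"
      by (rule has_integral_unique[rotated])
    moreover have "?F 0 = 0"
    proof -
      have y: "R x 0 \<in> N" using RS[OF x, of 0] SN by auto
      note b = bil[OF y]
      have "\<eta> (R x 0) (v - \<pi> v) (w - \<pi> w) = 0"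
        by (rule zero[OF y]) (simp_all add: R_def \<pi>_def inner_diff_right qu)
      moreover have "\<eta> (R x 0) v u = - \<eta> (R x 0) u v" by (rule alternating_bilinear_anti[OF b alt[OF y]])
      ultimately show ?thesis
        by (simp add: \<pi>_def bilinear_lsub[OF b] bilinear_rsub[OF b] bilinear_lmul[OF b] bilinear_rmul[OF b] alt[OF y] algebra_simps)
    qed
    moreover have "R x 1 = x" by (simp add: R_def)
    ultimately show "frechet_derivative (\<lambda>x. (q \<bullet> x) * (\<beta> x \<bullet> w)) (at x) v - frechet_derivative (\<lambda>x. (q \<bullet> x) * (\<beta> x \<bullet> v)) (at x) w = \<eta> x v w"
      unfolding d\<alpha> by (simp add: algebra_simps)
  qed
qed

text \<open>Hadamard's lemma: the quotient is the integral of the derivative in direction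
  \<open>U\<close> along rays. Division by a defining function thus stays within either regularity
  class, with a known value at \<open>p\<close>.\<close>

lemma rg_divided_by_linear:
  fixes s :: "real^'e \<Rightarrow> real" and Q U p :: "real^'e"
  assumes QU: "Q \<bullet> U = 1" "Q \<bullet> p = 0" and s: "rg r p s" and N: "open N" "p \<in> N"
    and zero: "\<And>y. y \<in> N \<Longrightarrow> Q \<bullet> y = 0 \<Longrightarrow> s y = 0"
  obtains h S where "rg r p h" "open S" "p \<in> S" "\<And>y. y \<in> S \<Longrightarrow> s y = (Q \<bullet> y) * h y" "h p = frechet_derivative s (at p) U"
proof -
  define \<pi> where "\<pi> x = (Q \<bullet> x) *\<^sub>R U" for x
  have \<pi>: "bounded_linear \<pi>" "\<And>v. \<pi> (\<pi> v) = \<pi> v" "\<pi> p = 0"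
    using QU by (auto simp: \<pi>_def[abs_def] intro!: bounded_linear_intros)
  obtain V where V: "open V" "p \<in> V" "\<And>x. x \<in> V \<Longrightarrow> (s has_derivative frechet_derivative s (at x)) (at x)"
    by (rule rg_has_derivative[OF s]) (rule that)
  have "open (N \<inter> V)" "p \<in> N \<inter> V" using N V by auto
  then obtain e where e: "0 < e" "ball p e \<subseteq> N \<inter> V" using open_contains_ball by blast
  define S where "S = {x. x \<in> ball p e \<and> x - \<pi> x \<in> ball p e}"
  note S = ray_invariant_nbhd[OF \<pi> e(1), folded S_def]
  have SN: "S \<subseteq> N \<inter> V" using S(4) e(2) by blast
  define R where "R x \<tau> = x - (1 - \<tau>) *\<^sub>R \<pi> x" for x \<tau>
  have RS: "R x \<tau> \<in> N" "R x \<tau> \<in> V" if "x \<in> S" "\<tau> \<in> {0..1}" for x \<tau> using S(5)[OF that] SN by (auto simp: R_def)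
  define h where "h y = integral {0..1} (\<lambda>\<tau>. frechet_derivative s (at (R y \<tau>)) U)" for y
  show ?thesis
  proof (rule that[OF _ S(1,3)])
    show "rg r p h" unfolding h_def R_def \<pi>_def by (rule rg_integral_ray[OF QU rg_frechet_derivative[OF s]])
    show "h p = frechet_derivative s (at p) U" by (simp add: h_def R_def \<pi>(3))
    fix y assume y: "y \<in> S"
    have "((\<lambda>\<tau>. (Q \<bullet> y) * frechet_derivative s (at (R y \<tau>)) U) has_integral (s (R y 1) - s (R y 0))) {0..1}"
    proof (rule fundamental_theorem_of_calculus)
      fix \<tau> :: real assume \<tau>: "\<tau> \<in> {0..1}"
      have R': "(R y has_vector_derivative (Q \<bullet> y) *\<^sub>R U) (at \<tau> within {0..1})"
        unfolding R_def[abs_def] \<pi>_def by (auto intro!: derivative_eq_intros)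
      interpret D: bounded_linear "frechet_derivative s (at (R y \<tau>))"
        using V(3)[OF RS(2)[OF y \<tau>]] by (rule has_derivative_bounded_linear)
      show "((\<lambda>\<tau>. s (R y \<tau>)) has_vector_derivative (Q \<bullet> y) * frechet_derivative s (at (R y \<tau>)) U) (at \<tau> within {0..1})"
        using vector_derivative_diff_chain_within[OF R' has_derivative_at_withinI[OF V(3)[OF RS(2)[OF y \<tau>]]]]
        by (simp add: o_def D.scaleR)
    qed simp
    from integral_unique[OF this] have "s (R y 1) - s (R y 0) = (Q \<bullet> y) * h y" by (simp add: h_def)
    moreover have "s (R y 0) = 0" by (rule zero) (use RS(1)[OF y, of 0] QU in \<open>auto simp: R_def \<pi>_def inner_diff_right\<close>)
    ultimately show "s y = (Q \<bullet> y) * h y" by (simp add: R_def)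
  qed
qed

text \<open>The singular matrix \<open>A\<close> of \<open>W y\<close> is completed to the invertible \<open>M = A + k0 k1\<^sup>T - k1 k0\<^sup>T\<close>. Then
  \<open>s = 1 + k0 \<bullet> M\<^sup>-\<^sup>1 k1\<close> vanishes exactly where \<open>A\<close> is singular, so it is \<open>Q\<close> times a unit
  \<open>h\<close>, and dividing by \<open>h\<close> corrects \<open>Q M\<^sup>-\<^sup>1 b\<close> to a solution of \<open>A X = Q b\<close>.\<close>

lemma moser_field:
  fixes W :: "real^'e \<Rightarrow> real^'d \<Rightarrow> real^'d \<Rightarrow> real" and b :: "real^'e \<Rightarrow> real^'d" and p Q U :: "real^'e" and k0 k1 :: "real^'d"
  assumes N0: "open N0" "p \<in> N0" and bil: "\<And>y. y \<in> N0 \<Longrightarrow> bilinear (W y)" and alt: "\<And>y v. y \<in> N0 \<Longrightarrow> W y v v = 0"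
    and rgW: "\<And>v w. rg r p (\<lambda>y. W y v w)" and rgb: "\<And>j. rg r p (\<lambda>y. b y $ j)"
    and QU: "Q \<bullet> U = 1" "Q \<bullet> p = 0"
    and deg: "\<And>y. y \<in> N0 \<Longrightarrow> Q \<bullet> y = 0 \<Longrightarrow> \<exists>v. v \<noteq> 0 \<and> (\<forall>w. W y w v = 0)"
    and k: "k0 \<bullet> k0 = 1" "k1 \<bullet> k1 = 1" "k0 \<bullet> k1 = 0"
    and ker: "\<And>w. W p k0 w = 0" "\<And>w. W p k1 w = 0" and exact: "\<And>v. (\<forall>w. W p w v = 0) \<Longrightarrow> v \<in> span {k0, k1}"
    and a: "frechet_derivative (\<lambda>y. W y k0 k1) (at p) U \<noteq> 0"
  obtains X N where "open N" "p \<in> N" "N \<subseteq> N0" "\<And>j. rg r p (\<lambda>y. X y $ j)"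
    "\<And>y v. y \<in> N \<Longrightarrow> W y v (X y) = (Q \<bullet> y) * (b y \<bullet> v)"
    "\<And>y. y \<in> N \<Longrightarrow> (\<forall>w. W y k0 w = 0) \<Longrightarrow> (\<forall>w. W y k1 w = 0) \<Longrightarrow> b y \<bullet> k0 = 0 \<Longrightarrow> b y \<bullet> k1 = 0 \<Longrightarrow> Q \<bullet> y = 0 \<Longrightarrow> X y = 0"
proof -
  have k': "k1 \<bullet> k0 = 0" using k(3) by (simp add: inner_commute)
  define M where "M y = (\<chi> i j. W y (axis i 1) (axis j 1) + k0 $ i * k1 $ j - k1 $ i * k0 $ j)" for y
  have M: "v \<bullet> (M y *v w) = W y v w + (v \<bullet> k0) * (k1 \<bullet> w) - (v \<bullet> k1) * (k0 \<bullet> w)" if "y \<in> N0" for y v w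
  proof -
    have p: "(v \<bullet> a) * (b \<bullet> w) = (\<Sum>i\<in>UNIV. \<Sum>j\<in>UNIV. v $ i * (a $ i * b $ j) * w $ j)" for a b :: "real^'d"
      unfolding inner_vec_def sum_product by (simp add: mult_ac)
    have "v \<bullet> (M y *v w) = (\<Sum>i\<in>UNIV. \<Sum>j\<in>UNIV. v $ i * M y $ i $ j * w $ j)"
      by (simp add: inner_vec_def matrix_vector_mult_def sum_distrib_left mult_ac)
    then show ?thesis
      unfolding bilinear_expand[OF bil[OF that], of v w] p M_def
      by (simp add: sum.distrib sum_subtractf algebra_simps)
  qed
  have anti: "W y v w = - W y w v" if "y \<in> N0" for y v w by (rule alternating_bilinear_anti[OF bil[OF that] alt[OF that]])
  have skew: "v \<bullet> (M y *v w) = - (w \<bullet> (M y *v v))" if "y \<in> N0" for y v w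
    unfolding M[OF that] using anti[OF that, of v w] by (simp add: inner_commute)
  have rgM: "rg r p (\<lambda>y. M y $ i $ j)" for i j
    unfolding M_def by (simp, intro rg_diff rg_add rg_const rgW)
  \<comment> \<open>Testing with \<open>k0\<close> and \<open>k1\<close> shows that a kernel vector
    of \<open>M p\<close> is orthogonal to both. It therefore lies in the kernel of
    \<open>W p\<close>, which is their span, and must be zero.\<close>
  have detp: "det (M p) \<noteq> 0"
  proof -
    have "w = 0" if "M p *v w = 0" for w
    proof -
      have *: "W p v w + (v \<bullet> k0) * (k1 \<bullet> w) - (v \<bullet> k1) * (k0 \<bullet> w) = 0" for v using M[OF N0(2), of v w] that by simp
      have 1: "k1 \<bullet> w = 0" "k0 \<bullet> w = 0" using *[of k0] *[of k1] k k' ker by auto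
      then have "w \<in> span {k0, k1}" using * exact by simp
      then obtain \<alpha> \<beta> where w: "w = \<alpha> *\<^sub>R k0 + \<beta> *\<^sub>R k1" by (auto simp: span_insert span_empty algebra_simps)
      show ?thesis using 1 unfolding w by (simp add: inner_add_right k k')
    qed
    then have "\<exists>B. B ** M p = mat 1" using matrix_left_invertible_ker[of "M p"] by blast
    then have "invertible (M p)" by (simp only: invertible_left_inverse)
    then show ?thesis by (simp only: invertible_det_nz not_False_eq_True)
  qed
  obtain N1 where N1: "open N1" "p \<in> N1" "\<And>y. y \<in> N1 \<Longrightarrow> det (M y) \<noteq> 0"
    by (rule rg_nonzero_nbhd[OF rg_det[OF rgM] detp]) (rule that)
  define sol where "sol y z = (\<chi> k. det (\<chi> i j. if j = k then z $ i else M y $ i $ j) / det (M y))" for y z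
  have sol: "M y *v x = z \<longleftrightarrow> x = sol y z" if "y \<in> N1" for x y z
    unfolding sol_def by (rule cramer[OF N1(3)[OF that]])
  have Msol: "M y *v sol y z = z" if "y \<in> N1" for y z using sol[OF that] by blast
  have rgsol: "rg r p (\<lambda>y. sol y (z y) $ j)" if "\<And>i. rg r p (\<lambda>y. z y $ i)" for z j
    unfolding sol_def by (rule rg_linear_solve[OF rgM that detp])
  have ssk: "z \<bullet> sol y z' = - (z' \<bullet> sol y z)" if "y \<in> N0" "y \<in> N1" for y z z'
    using skew[OF that(1), of "sol y z'" "sol y z"] by (simp add: Msol[OF that(2)] inner_commute)
  define s where "s y = 1 + k0 \<bullet> sol y k1" for y
  have rgs: "rg r p s" unfolding s_def[abs_def] by (intro rg_add rg_const rg_inner rgsol)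
  \<comment> \<open>A kernel vector of \<open>W y\<close> is a combination of
    \<open>sol y k0\<close> and \<open>sol y k1\<close> whose coefficients are, up to sign, its
    products with \<open>k1\<close> and \<open>k0\<close>; pairing it with \<open>k0\<close> and
    \<open>k1\<close> again shows that these vanish unless \<open>s y = 0\<close>.\<close>
  have s0: "s y = 0" if y: "y \<in> N0 \<inter> N1" and Q: "Q \<bullet> y = 0" for y
  proof (rule ccontr)
    assume ns: "s y \<noteq> 0"
    have y0: "y \<in> N0" and y1: "y \<in> N1" using y by auto
    obtain v where v: "v \<noteq> 0" "\<And>w. W y w v = 0" using deg[OF y0 Q] by blast
    have "M y *v v = (k1 \<bullet> v) *\<^sub>R k0 - (k0 \<bullet> v) *\<^sub>R k1"
      by (rule vector_eq_ldot[THEN iffD1]) (simp add: M[OF y0] v(2) inner_diff_right mult.commute)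
    also have "\<dots> = M y *v ((k1 \<bullet> v) *\<^sub>R sol y k0 - (k0 \<bullet> v) *\<^sub>R sol y k1)"
      by (simp add: matrix_vector_mult_diff_distrib matrix_vector_mult_scaleR Msol[OF y1])
    finally have e: "v = (k1 \<bullet> v) *\<^sub>R sol y k0 - (k0 \<bullet> v) *\<^sub>R sol y k1"
      using sol[OF y1] by metis
    have z: "k0 \<bullet> sol y k0 = 0" "k1 \<bullet> sol y k1 = 0" "k1 \<bullet> sol y k0 = 1 - s y" "k0 \<bullet> sol y k1 = s y - 1"
      using ssk[OF y0 y1, of k0 k0] ssk[OF y0 y1, of k1 k1] ssk[OF y0 y1, of k1 k0] by (simp_all add: s_def)
    have "k0 \<bullet> v = - (k0 \<bullet> v) * (s y - 1)" using arg_cong[OF e, of "\<lambda>x. k0 \<bullet> x"] z by (simp add: inner_diff_right)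
    then have 0: "k0 \<bullet> v = 0" using ns by (simp add: algebra_simps)
    have "k1 \<bullet> v = (k1 \<bullet> v) * (1 - s y)" using arg_cong[OF e, of "\<lambda>x. k1 \<bullet> x"] z by (simp add: inner_diff_right)
    then have "k1 \<bullet> v = 0" using ns by (simp add: algebra_simps)
    then show False using e 0 v(1) by simp
  qed
  have o: "open (N0 \<inter> N1)" "p \<in> N0 \<inter> N1" using N0 N1 by auto
  obtain h S where h: "rg r p h" "open S" "p \<in> S" "\<And>y. y \<in> S \<Longrightarrow> s y = (Q \<bullet> y) * h y" "h p = frechet_derivative s (at p) U"
    by (rule rg_divided_by_linear[OF QU rgs o s0]) (assumption+, rule that)
  \<comment> \<open>\<open>h p\<close> is the derivative of \<open>s\<close> in direction
    \<open>U\<close>. Differentiating \<open>M y *v sol y k1 = k1\<close> at \<open>p\<close> and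
    pairing with \<open>k1\<close> identifies it with the transversal derivative of
    \<open>W y k0 k1\<close>.\<close>
  have hp: "h p \<noteq> 0"
  proof -
    obtain e where e: "0 < e" "smooth_on (ball p e) (\<lambda>y. sol y k1)"
      by (rule rg_map_smooth[of r p "\<lambda>y. sol y k1"]) (rule rgsol, rule rg_const, rule that)
    define B' where "B' = frechet_derivative (\<lambda>y. sol y k1) (at p)"
    have dB: "((\<lambda>y. sol y k1) has_derivative B') (at p)" unfolding B'_def using e by (intro smooth_on_has_derivative[OF e(2)]) simp
    have ds: "(s has_derivative (\<lambda>h. k0 \<bullet> B' h)) (at p)"
      unfolding s_def[abs_def] by (auto intro!: derivative_eq_intros dB)
    have dW: "((\<lambda>y. W y v w) has_derivative frechet_derivative (\<lambda>y. W y v w) (at p)) (at p)" for v w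
      by (rule rg_has_derivative[OF rgW[of v w]]) blast
    have dM: "((\<lambda>y. v \<bullet> (M y *v w)) has_derivative frechet_derivative (\<lambda>y. W y v w) (at p)) (at p)" for v w
    proof (rule has_derivative_transform_within_open[OF _ N0])
      show "((\<lambda>y. W y v w + (v \<bullet> k0) * (k1 \<bullet> w) - (v \<bullet> k1) * (k0 \<bullet> w)) has_derivative frechet_derivative (\<lambda>y. W y v w) (at p)) (at p)"
        using dW[of v w] by (auto intro!: derivative_eq_intros)
    qed (simp add: M)
    have bM: "bilinear (\<lambda>v w. v \<bullet> (M y *v w))" for y
      unfolding bilinear_def by (auto intro!: linearI simp: inner_add_left inner_add_right matrix_vector_right_distrib matrix_vector_mult_scaleR)
    have B1: "sol p k1 = - k0"
    proof -
      have "M p *v (- k0) = k1"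
        by (rule vector_eq_ldot[THEN iffD1]) (simp add: M[OF N0(2)] bilinear_rneg[OF bil[OF N0(2)]] ker anti[OF N0(2), of _ k0] k k' inner_commute)
      then show ?thesis using sol[OF N1(2)] by metis
    qed
    have D1: "((\<lambda>y. k1 \<bullet> (M y *v sol y k1)) has_derivative (\<lambda>h. frechet_derivative (\<lambda>y. W y k1 (sol p k1)) (at p) h
        + 0 \<bullet> (M p *v sol p k1) + k1 \<bullet> (M p *v B' h))) (at p)"
      by (rule bilinear_family_derivative[OF o bM dM has_derivative_const dB])
    have D2: "((\<lambda>y. k1 \<bullet> (M y *v sol y k1)) has_derivative (\<lambda>h. 0)) (at p)"
      by (rule has_derivative_transform_within_open[OF has_derivative_const N1(1,2)]) (simp add: Msol)
    have D3: "frechet_derivative (\<lambda>y. W y k1 (sol p k1)) (at p) = frechet_derivative (\<lambda>y. W y k0 k1) (at p)"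
      by (rule frechet_derivative_eqI, rule has_derivative_transform_within_open[OF dW N0])
        (simp add: B1 bilinear_rneg[OF bil] anti[of _ k1])
    have "frechet_derivative (\<lambda>y. W y k0 k1) (at p) U + k1 \<bullet> (M p *v B' U) = 0"
      using fun_cong[OF has_derivative_unique[OF D1 D2], of U] by (simp add: D3)
    then have "frechet_derivative (\<lambda>y. W y k0 k1) (at p) U = k0 \<bullet> B' U" by (simp add: M[OF N0(2)] ker k k')
    then show ?thesis using a h(5) by (simp add: frechet_derivative_eqI[OF ds])
  qed
  obtain N2 where N2: "open N2" "p \<in> N2" "\<And>y. y \<in> N2 \<Longrightarrow> h y \<noteq> 0"
    by (rule rg_nonzero_nbhd[OF h(1) hp]) (rule that)
  \<comment> \<open>\<open>y0\<close> and \<open>y1\<close> anticipate the products of the solution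
    with \<open>k0\<close> and \<open>k1\<close>. In the equation for these products both sides
    carry the factor \<open>Q \<bullet> y\<close>; cancelling it leaves a division by the unit
    \<open>h\<close>.\<close>
  define y0 where "y0 y = (k0 \<bullet> sol y (b y)) * inverse (h y)" for y
  define y1 where "y1 y = (k1 \<bullet> sol y (b y)) * inverse (h y)" for y
  define X where "X y = (Q \<bullet> y) *\<^sub>R sol y (b y) + y1 y *\<^sub>R sol y k0 - y0 y *\<^sub>R sol y k1" for y
  show ?thesis
  proof (rule that[of "N0 \<inter> N1 \<inter> S \<inter> N2" X])
    show "open (N0 \<inter> N1 \<inter> S \<inter> N2)" "p \<in> N0 \<inter> N1 \<inter> S \<inter> N2" "N0 \<inter> N1 \<inter> S \<inter> N2 \<subseteq> N0" using N0 N1 N2 h by auto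
    show "rg r p (\<lambda>y. X y $ j)" for j
      unfolding X_def y0_def y1_def
      by (simp, intro rg_add rg_diff rg_mult rg_inner rg_inverse rgsol rgb rg_const rg_nth h(1) hp)
  next
    fix y v assume "y \<in> N0 \<inter> N1 \<inter> S \<inter> N2"
    then have y: "y \<in> N0" "y \<in> N1" "y \<in> S" "h y \<noteq> 0" using N2 by auto
    have z: "k0 \<bullet> sol y k0 = 0" "k1 \<bullet> sol y k1 = 0" "k1 \<bullet> sol y k0 = 1 - s y" "k0 \<bullet> sol y k1 = s y - 1"
      using ssk[OF y(1,2), of k0 k0] ssk[OF y(1,2), of k1 k1] ssk[OF y(1,2), of k1 k0] by (simp_all add: s_def)
    have yh: "y0 y * h y = k0 \<bullet> sol y (b y)" "y1 y * h y = k1 \<bullet> sol y (b y)" using y(4) by (simp_all add: y0_def y1_def)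
    have "k1 \<bullet> X y = (Q \<bullet> y) * (y1 y * h y) + y1 y * (1 - s y)" by (simp add: X_def inner_add_right inner_diff_right z yh)
    then have X1: "k1 \<bullet> X y = y1 y" using h(4)[OF y(3)] by (simp add: algebra_simps)
    have "k0 \<bullet> X y = (Q \<bullet> y) * (y0 y * h y) - y0 y * (s y - 1)" by (simp add: X_def inner_add_right inner_diff_right z yh)
    then have X0: "k0 \<bullet> X y = y0 y" using h(4)[OF y(3)] by (simp add: algebra_simps)
    have MX: "M y *v X y = (Q \<bullet> y) *\<^sub>R b y + y1 y *\<^sub>R k0 - y0 y *\<^sub>R k1"
      by (simp add: X_def matrix_vector_mult_diff_distrib matrix_vector_right_distrib matrix_vector_mult_scaleR Msol[OF y(2)])
    show "W y v (X y) = (Q \<bullet> y) * (b y \<bullet> v)"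
      using M[OF y(1), of v "X y"] by (simp add: MX X0 X1 inner_add_right inner_diff_right inner_commute algebra_simps)
  next
    fix y assume "y \<in> N0 \<inter> N1 \<inter> S \<inter> N2" and k0: "\<forall>w. W y k0 w = 0" and k1: "\<forall>w. W y k1 w = 0"
      and b: "b y \<bullet> k0 = 0" "b y \<bullet> k1 = 0" and Q: "Q \<bullet> y = 0"
    then have y: "y \<in> N0" "y \<in> N1" by auto
    \<comment> \<open>On the plane only the completing term acts, as a quarter turn, so
      \<open>sol y\<close> preserves the plane; since \<open>b y\<close> is orthogonal to it,
      \<open>y0\<close> and \<open>y1\<close> vanish by skew symmetry.\<close>
    have "M y *v k1 = k0" "M y *v (- k0) = k1"
      by (rule vector_eq_ldot[THEN iffD1], simp add: M[OF y(1)] bilinear_rneg[OF bil[OF y(1)]] k0 k1 anti[OF y(1), of _ k0] anti[OF y(1), of _ k1] k k' inner_commute)+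
    then have "sol y k0 = k1" "sol y k1 = - k0" using sol[OF y(2)] by metis+
    then have "k0 \<bullet> sol y (b y) = 0" "k1 \<bullet> sol y (b y) = 0"
      using ssk[OF y, of k0 "b y"] ssk[OF y, of k1 "b y"] b by simp_all
    then show "X y = 0" by (simp add: X_def y0_def y1_def Q)
  qed
qed

section \<open>The flow of the Moser field\<close>

lemma inner_emb: "emb 0 q \<bullet> y = q \<bullet> prj y"
  by (simp add: inner_vec_def UNIV_option_conv sum.reindex)

definition segment_form :: "(real^'d) dform \<Rightarrow> (real^'d) dform \<Rightarrow> real \<Rightarrow> (real^'d) dform" where
  "segment_form \<omega>\<^sub>0 \<omega>\<^sub>1 t x vs = (1 - t) * \<omega>\<^sub>0 x vs + t * \<omega>\<^sub>1 x vs"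

text \<open>In time, the pulled-back family changes by the pullback of
  \<open>\<omega>\<^sub>1 - \<omega>\<^sub>0\<close> and of the Lie derivative along
  \<open>X\<close>. The contraction of the form with \<open>X\<close> is minus the primitive of that
  difference, so closedness makes the sum vanish. The conditions on the kernel and on the
  transversal derivative are imposed at \<open>t0\<close>, and the conclusion reaches nearby
  times.\<close>

lemma moser_step:
  fixes \<omega>\<^sub>0 \<omega>\<^sub>1 :: "(real^'d) dform" and q u k0 k1 :: "real^'d" and t0 :: real
  assumes \<omega>0: "closed_two_form r \<omega>\<^sub>0" and \<omega>1: "closed_two_form r \<omega>\<^sub>1"
    and qu: "q \<bullet> u = 1"
    and tang: "\<forall>\<^sub>F x in nhds 0. q \<bullet> x = 0 \<longrightarrow> (\<forall>v w. q \<bullet> v = 0 \<longrightarrow> q \<bullet> w = 0 \<longrightarrow> \<omega>\<^sub>0 x [v, w] = \<omega>\<^sub>1 x [v, w])"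
    and deg: "\<forall>\<^sub>F x in nhds 0. q \<bullet> x = 0 \<longrightarrow> (\<forall>t. \<exists>v. v \<noteq> 0 \<and> (\<forall>w. segment_form \<omega>\<^sub>0 \<omega>\<^sub>1 t x [w, v] = 0))"
    and k: "k0 \<bullet> k0 = 1" "k1 \<bullet> k1 = 1" "k0 \<bullet> k1 = 0"
    and ker: "\<And>t w. segment_form \<omega>\<^sub>0 \<omega>\<^sub>1 t 0 [k0, w] = 0" "\<And>t w. segment_form \<omega>\<^sub>0 \<omega>\<^sub>1 t 0 [k1, w] = 0"
    and exact: "\<And>v. (\<forall>w. segment_form \<omega>\<^sub>0 \<omega>\<^sub>1 t0 0 [w, v] = 0) \<Longrightarrow> v \<in> span {k0, k1}"
    and a: "(1 - t0) * frechet_derivative (\<lambda>x. \<omega>\<^sub>0 x [k0, k1]) (at 0) u + t0 * frechet_derivative (\<lambda>x. \<omega>\<^sub>1 x [k0, k1]) (at 0) u \<noteq> 0"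
  shows "\<exists>d>0. \<forall>s. \<bar>s\<bar> < d \<longrightarrow> form_equiv r (segment_form \<omega>\<^sub>0 \<omega>\<^sub>1 t0) (segment_form \<omega>\<^sub>0 \<omega>\<^sub>1 (t0 + s))"
proof -
  obtain Na where Na: "open Na" "0 \<in> Na" "\<And>x. x \<in> Na \<Longrightarrow> alternating_form 2 (\<omega>\<^sub>0 x)"
    "\<And>x v w. x \<in> Na \<Longrightarrow> rg r x (\<lambda>x. \<omega>\<^sub>0 x [v, w])"
    "\<And>x u v w. x \<in> Na \<Longrightarrow> frechet_derivative (\<lambda>x. \<omega>\<^sub>0 x [v, w]) (at x) u - frechet_derivative (\<lambda>x. \<omega>\<^sub>0 x [u, w]) (at x) v
      + frechet_derivative (\<lambda>x. \<omega>\<^sub>0 x [u, v]) (at x) w = 0"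
    by (rule closed_two_formE[OF \<omega>0]) (rule that)
  obtain Nb where Nb: "open Nb" "0 \<in> Nb" "\<And>x. x \<in> Nb \<Longrightarrow> alternating_form 2 (\<omega>\<^sub>1 x)"
    "\<And>x v w. x \<in> Nb \<Longrightarrow> rg r x (\<lambda>x. \<omega>\<^sub>1 x [v, w])"
    "\<And>x u v w. x \<in> Nb \<Longrightarrow> frechet_derivative (\<lambda>x. \<omega>\<^sub>1 x [v, w]) (at x) u - frechet_derivative (\<lambda>x. \<omega>\<^sub>1 x [u, w]) (at x) v
      + frechet_derivative (\<lambda>x. \<omega>\<^sub>1 x [u, v]) (at x) w = 0"
    by (rule closed_two_formE[OF \<omega>1]) (rule that)
  obtain Nc where Nc: "open Nc" "0 \<in> Nc" "\<And>x v w. x \<in> Nc \<Longrightarrow> q \<bullet> x = 0 \<Longrightarrow> q \<bullet> v = 0 \<Longrightarrow> q \<bullet> w = 0 \<Longrightarrow> \<omega>\<^sub>0 x [v, w] = \<omega>\<^sub>1 x [v, w]"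
    using tang unfolding eventually_nhds by blast
  obtain Nd where Nd: "open Nd" "0 \<in> Nd" "\<And>x t. x \<in> Nd \<Longrightarrow> q \<bullet> x = 0 \<Longrightarrow> \<exists>v. v \<noteq> 0 \<and> (\<forall>w. segment_form \<omega>\<^sub>0 \<omega>\<^sub>1 t x [w, v] = 0)"
    using deg unfolding eventually_nhds by blast
  define D0 where "D0 x v w = frechet_derivative (\<lambda>x. \<omega>\<^sub>0 x [v, w]) (at x)" for x v w
  define D1 where "D1 x v w = frechet_derivative (\<lambda>x. \<omega>\<^sub>1 x [v, w]) (at x)" for x v w
  have dD0: "((\<lambda>x. \<omega>\<^sub>0 x [v, w]) has_derivative D0 x v w) (at x)" if "x \<in> Na" for x v w
    unfolding D0_def by (rule rg_has_derivative[OF Na(4)[OF that]]) blast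
  have dD1: "((\<lambda>x. \<omega>\<^sub>1 x [v, w]) has_derivative D1 x v w) (at x)" if "x \<in> Nb" for x v w
    unfolding D1_def by (rule rg_has_derivative[OF Nb(4)[OF that]]) blast
  define \<eta> where "\<eta> x v w = \<omega>\<^sub>1 x [v, w] - \<omega>\<^sub>0 x [v, w]" for x v w
  have d\<eta>: "frechet_derivative (\<lambda>x. \<eta> x v w) (at x) = (\<lambda>h. D1 x v w h - D0 x v w h)" if "x \<in> Na \<inter> Nb" for x v w
    unfolding \<eta>_def by (rule frechet_derivative_eqI, intro has_derivative_diff dD0 dD1) (use that in auto)
  note a2 = alternating_form_two
  have bl0: "bilinear (\<lambda>v w. \<omega>\<^sub>0 x [v, w])" if "x \<in> Na" for x using a2(1)[OF Na(3)[OF that]] .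
  have bl1: "bilinear (\<lambda>v w. \<omega>\<^sub>1 x [v, w])" if "x \<in> Nb" for x using a2(1)[OF Nb(3)[OF that]] .
  have bilcomb: "bilinear (\<lambda>v w. c * \<omega>\<^sub>0 x [v, w] + c' * \<omega>\<^sub>1 x [v, w])" if "x \<in> Na \<inter> Nb" for x c c'
  proof -
    have "x \<in> Na" "x \<in> Nb" using that by auto
    note 0 = bl0[OF this(1)] and 1 = bl1[OF this(2)]
    show ?thesis unfolding bilinear_def
      by (intro conjI allI linearI)
        (simp_all add: bilinear_ladd[OF 0] bilinear_radd[OF 0] bilinear_lmul[OF 0] bilinear_rmul[OF 0]
          bilinear_ladd[OF 1] bilinear_radd[OF 1] bilinear_lmul[OF 1] bilinear_rmul[OF 1] algebra_simps)
  qed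
  have Ne: "open (Na \<inter> Nb \<inter> Nc)" "0 \<in> Na \<inter> Nb \<inter> Nc" using Na Nb Nc by auto
  have bil\<eta>: "bilinear (\<eta> x)" if "x \<in> Na \<inter> Nb \<inter> Nc" for x
    using bilcomb[of x "-1" 1] that by (simp add: \<eta>_def[abs_def])
  have alt\<eta>: "\<eta> x v v = 0" if "x \<in> Na \<inter> Nb \<inter> Nc" for x v
    using a2(2)[OF Na(3)] a2(2)[OF Nb(3)] that by (simp add: \<eta>_def)
  have rg\<eta>: "rg r x (\<lambda>x. \<eta> x v w)" if "x \<in> Na \<inter> Nb \<inter> Nc" for x v w
    unfolding \<eta>_def using that by (intro rg_diff Na Nb) auto
  have cl\<eta>: "frechet_derivative (\<lambda>x. \<eta> x v w) (at x) u - frechet_derivative (\<lambda>x. \<eta> x u w) (at x) v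
      + frechet_derivative (\<lambda>x. \<eta> x u v) (at x) w = 0" if "x \<in> Na \<inter> Nb \<inter> Nc" for x u v w
  proof -
    have x: "x \<in> Na \<inter> Nb" using that by auto
    show ?thesis using Na(5)[of x v w u] Nb(5)[of x v w u] x unfolding d\<eta>[OF x] D0_def D1_def by simp
  qed
  have zero\<eta>: "\<eta> x v w = 0" if "x \<in> Na \<inter> Nb \<inter> Nc" "q \<bullet> x = 0" "q \<bullet> v = 0" "q \<bullet> w = 0" for x v w
    using Nc(3)[of x v w] that by (simp add: \<eta>_def)
  obtain \<beta> :: "real^'d \<Rightarrow> real^'d" and S where S: "open S" "0 \<in> S" and rg\<beta>: "\<And>j. rg r 0 (\<lambda>x. \<beta> x $ j)"
    and \<beta>0: "\<And>v. \<beta> 0 \<bullet> v = \<eta> 0 u v"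
    and d\<beta>: "\<And>x v w. x \<in> S \<Longrightarrow> frechet_derivative (\<lambda>x. (q \<bullet> x) * (\<beta> x \<bullet> w)) (at x) v - frechet_derivative (\<lambda>x. (q \<bullet> x) * (\<beta> x \<bullet> v)) (at x) w = \<eta> x v w"
    by (rule relative_poincare[OF qu Ne bil\<eta> alt\<eta> rg\<eta> cl\<eta> zero\<eta>]) (assumption+, rule that)
  obtain e where e: "0 < e" "smooth_on (ball 0 e) \<beta>" using rg_map_smooth[OF rg\<beta>] .
  define N' where "N' = Na \<inter> Nb \<inter> Nc \<inter> Nd \<inter> S \<inter> ball 0 e"
  have N': "open N'" "0 \<in> N'"
    unfolding N'_def by (intro open_Int open_ball Na(1) Nb(1) Nc(1) Nd(1) S(1)) (intro IntI Na(2) Nb(2) Nc(2) Nd(2) S(2), simp add: e(1))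
  define \<alpha> where "\<alpha> v x = (q \<bullet> x) * (\<beta> x \<bullet> v)" for v x
  have d\<alpha>: "(\<alpha> v has_derivative frechet_derivative (\<alpha> v) (at x)) (at x)" if "x \<in> N'" for v x
  proof -
    have d: "(\<beta> has_derivative frechet_derivative \<beta> (at x)) (at x)"
      by (rule smooth_on_has_derivative[OF e(2)]) (use that in \<open>simp add: N'_def\<close>)
    have "\<exists>f'. (\<alpha> v has_derivative f') (at x)"
      unfolding \<alpha>_def[abs_def] by (rule exI) (rule derivative_intros d has_derivative_ident)+
    then show ?thesis using frechet_derivative_eqI by blast
  qed
  \<comment> \<open>The whole family is regarded as one family over time-space, so that the field is
    regular in time and space together.\<close>
  define W where "W y v w = segment_form \<omega>\<^sub>0 \<omega>\<^sub>1 (y $ None) (prj y) [v, w]" for y :: "real^('d option)" and v w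
  let ?p = "emb t0 0 :: real^('d option)"
  define N0 where "N0 = (prj -` N' :: (real^('d option)) set)"
  have N0: "open N0" "?p \<in> N0"
    unfolding N0_def using N' by (auto intro!: open_vimage linear_continuous_on linear_prj[unfolded linear_conv_bounded_linear])
  have pN: "prj y \<in> Na" "prj y \<in> Nb" "prj y \<in> N'" "prj y \<in> Nd" "prj y \<in> S" "prj y \<in> Na \<inter> Nb" if "y \<in> N0" for y using that by (auto simp: N0_def N'_def)
  have bilW: "bilinear (W y)" if "y \<in> N0" for y
    using bilcomb[OF pN(6)[OF that], of "1 - y $ None" "y $ None"] by (simp add: W_def[abs_def] segment_form_def)
  have altW: "W y v v = 0" if "y \<in> N0" for y v
    using a2(2)[OF Na(3)[OF pN(1)[OF that]]] a2(2)[OF Nb(3)[OF pN(2)[OF that]]] by (simp add: W_def segment_form_def)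
  have antiW: "W y v w = - W y w v" if "y \<in> N0" for y v w by (rule alternating_bilinear_anti[OF bilW[OF that] altW[OF that]])
  have rgW: "rg r ?p (\<lambda>y. W y v w)" for v w
    unfolding W_def segment_form_def
    by (intro rg_add rg_mult rg_diff rg_const rg_nth rg_prj[of r _ "\<lambda>x. \<omega>\<^sub>0 x [v, w]"] rg_prj[of r _ "\<lambda>x. \<omega>\<^sub>1 x [v, w]"]) (simp_all add: Na Nb)
  define DW where "DW y v w h = (1 - y $ None) * D0 (prj y) v w h + y $ None * D1 (prj y) v w h" for y :: "real^('d option)" and v w h
  have dW: "((\<lambda>y. W y v w) has_derivative (\<lambda>h. DW y v w (prj h) + h $ None * \<eta> (prj y) v w)) (at y)" if "y \<in> N0" for y v w
  proof -
    have dprj: "(prj has_derivative prj) (at y)" by (rule linear_imp_has_derivative[OF linear_prj])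
    have 0: "((\<lambda>y. \<omega>\<^sub>0 (prj y) [v, w]) has_derivative (\<lambda>h. D0 (prj y) v w (prj h))) (at y)"
      using diff_chain_at[OF dprj dD0[OF pN(1)[OF that]]] by (simp add: o_def)
    have 1: "((\<lambda>y. \<omega>\<^sub>1 (prj y) [v, w]) has_derivative (\<lambda>h. D1 (prj y) v w (prj h))) (at y)"
      using diff_chain_at[OF dprj dD1[OF pN(2)[OF that]]] by (simp add: o_def)
    have n: "((\<lambda>y. y $ None) has_derivative (\<lambda>h. h $ None)) (at y)"
      by (rule bounded_linear_imp_has_derivative[OF bounded_linear_vec_nth])
    show ?thesis unfolding W_def segment_form_def
      by (rule has_derivative_eq_rhs[OF has_derivative_add[OF has_derivative_mult[OF has_derivative_diff[OF has_derivative_const n] 0] has_derivative_mult[OF n 1]]])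
        (simp add: fun_eq_iff DW_def \<eta>_def algebra_simps)
  qed
  have clW: "DW y u w v = DW y v w u + DW y u v w" if "y \<in> N0" for y u v w
    using Na(5)[OF pN(1)[OF that], of v w u] Nb(5)[OF pN(2)[OF that], of v w u] unfolding DW_def D0_def D1_def by algebra
  have degW: "\<exists>v. v \<noteq> 0 \<and> (\<forall>w. W y w v = 0)" if "y \<in> N0" "emb 0 q \<bullet> y = 0" for y
    using Nd(3)[OF pN(4)[OF that(1)]] that(2) by (simp add: W_def inner_emb)
  have rgb: "rg r ?p (\<lambda>y. \<beta> (prj y) $ j)" for j by (rule rg_prj) (simp add: rg\<beta>)
  have kerW: "W (emb t 0) k0 w = 0" "W (emb t 0) k1 w = 0" for t w using ker by (simp_all add: W_def)
  have aW: "frechet_derivative (\<lambda>y. W y k0 k1) (at ?p) (emb 0 u) \<noteq> 0"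
    using a by (simp add: frechet_derivative_eqI[OF dW[OF N0(2)]] DW_def D0_def D1_def)
  have exW: "v \<in> span {k0, k1}" if "\<forall>w. W ?p w v = 0" for v using exact that by (simp add: W_def)
  have QU: "emb 0 q \<bullet> emb 0 u = 1" "emb 0 q \<bullet> ?p = 0" by (simp_all add: inner_emb qu)
  obtain X N where N: "open N" "?p \<in> N" "N \<subseteq> N0" and rgX: "\<And>j. rg r ?p (\<lambda>y. X y $ j)"
    and WX: "\<And>y v. y \<in> N \<Longrightarrow> W y v (X y) = (emb 0 q \<bullet> y) * (\<beta> (prj y) \<bullet> v)"
    and X0: "\<And>y. y \<in> N \<Longrightarrow> (\<forall>w. W y k0 w = 0) \<Longrightarrow> (\<forall>w. W y k1 w = 0) \<Longrightarrow> \<beta> (prj y) \<bullet> k0 = 0 \<Longrightarrow> \<beta> (prj y) \<bullet> k1 = 0 \<Longrightarrow> emb 0 q \<bullet> y = 0 \<Longrightarrow> X y = 0"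
    by (rule moser_field[OF N0 bilW altW rgW rgb QU degW k kerW exW aW]) (assumption+, rule that)
  \<comment> \<open>At the origin \<beta> is the difference of the two forms contracted with
    \<open>u\<close>. It annihilates the common kernel plane, hence the field vanishes on the time
    axis.\<close>
  have X00: "\<forall>\<^sub>F t in nhds t0. X (emb t 0) = 0"
  proof -
    have "open ((\<lambda>t. emb t 0) -` N)" by (rule open_vimage[OF N(1) continuous_emb(2)])
    moreover have "X (emb t 0) = 0" if "emb t 0 \<in> N" for t
    proof (rule X0[OF that])
      show "\<forall>w. W (emb t 0) k0 w = 0" "\<forall>w. W (emb t 0) k1 w = 0" using kerW by blast+
      have "\<omega>\<^sub>0 0 [u, k] = 0 \<and> \<omega>\<^sub>1 0 [u, k] = 0" if "k = k0 \<or> k = k1" for k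
        using ker(1)[of 0 u] ker(1)[of 1 u] ker(2)[of 0 u] ker(2)[of 1 u] a2(3)[OF Na(3)[OF Na(2)], of u k] a2(3)[OF Nb(3)[OF Nb(2)], of u k] that
        by (auto simp: segment_form_def)
      then show "\<beta> (prj (emb t 0)) \<bullet> k0 = 0" "\<beta> (prj (emb t 0)) \<bullet> k1 = 0" by (simp_all add: \<beta>0 \<eta>_def)
    qed (simp add: inner_emb)
    ultimately show ?thesis unfolding eventually_nhds using N(2) by (intro exI[of _ "(\<lambda>t. emb t 0) -` N"]) auto
  qed
  obtain e' where e': "0 < e'" "smooth_on (ball ?p e') X" using rg_map_smooth[OF rgX] .
  define N3 where "N3 = N \<inter> ball ?p e'"
  have N3: "open N3" "?p \<in> N3" using N e' by (auto simp: N3_def)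
  define DX where "DX y h = frechet_derivative X (at y) h" for y h
  have dX: "(X has_derivative DX y) (at y)" if "y \<in> N3" for y
    unfolding DX_def by (rule smooth_on_has_derivative[OF e'(2)]) (use that in \<open>simp add: N3_def\<close>)
  \<comment> \<open>Moser's equation differentiated in a spatial direction; it takes the place of a
    calculus of Lie derivatives.\<close>
  have WX': "DW y v (X y) w + W y v (DX y (emb 0 w)) = frechet_derivative (\<alpha> v) (at (prj y)) w" if y: "y \<in> N3" for y v w
  proof -
    have yN: "y \<in> N" "y \<in> N0" using y N by (auto simp: N3_def)
    have 1: "((\<lambda>y. W y v (X y)) has_derivative (\<lambda>h. (DW y v (X y) (prj h) + h $ None * \<eta> (prj y) v (X y)) + W y 0 (X y) + W y v (DX y h))) (at y)"
      by (rule bilinear_family_derivative[OF N0(1) yN(2) bilW dW[OF yN(2)] has_derivative_const dX[OF y]])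
    have dprj: "(prj has_derivative prj) (at y)" by (rule linear_imp_has_derivative[OF linear_prj])
    have "((\<lambda>y. \<alpha> v (prj y)) has_derivative (\<lambda>h. frechet_derivative (\<alpha> v) (at (prj y)) (prj h))) (at y)"
      using diff_chain_at[OF dprj d\<alpha>[OF pN(3)[OF yN(2)]]] by (simp add: o_def)
    then have 2: "((\<lambda>y. W y v (X y)) has_derivative (\<lambda>h. frechet_derivative (\<alpha> v) (at (prj y)) (prj h))) (at y)"
      by (rule has_derivative_transform_within_open[OF _ N(1) yN(1)]) (simp add: WX inner_emb \<alpha>_def)
    from fun_cong[OF has_derivative_unique[OF 1 2], of "emb 0 w"] show ?thesis
      by (simp add: bilinear_lzero[OF bilW[OF yN(2)]])
  qed
  obtain d U \<phi> where d: "0 < d" and U: "open U" "0 \<in> U" and dg: "\<And>s. \<bar>s\<bar> < d \<Longrightarrow> diffeo_germ r (\<phi> s)" and \<phi>0: "\<And>x. \<phi> 0 x = x"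
    and \<phi>N: "\<And>s x. \<bar>s\<bar> < d \<Longrightarrow> x \<in> U \<Longrightarrow> emb (t0 + s) (\<phi> s x) \<in> N3"
    and ode: "\<And>s x. \<bar>s\<bar> < d \<Longrightarrow> x \<in> U \<Longrightarrow> ((\<lambda>s. \<phi> s x) has_vector_derivative X (emb (t0 + s) (\<phi> s x))) (at s)"
    and dif: "\<And>s x. \<bar>s\<bar> < d \<Longrightarrow> x \<in> U \<Longrightarrow> (\<phi> s has_derivative frechet_derivative (\<phi> s) (at x)) (at x)"
    and var: "\<And>s x v. \<bar>s\<bar> < d \<Longrightarrow> x \<in> U \<Longrightarrow> ((\<lambda>s. frechet_derivative (\<phi> s) (at x) v) has_vector_derivative
        frechet_derivative X (at (emb (t0 + s) (\<phi> s x))) (emb 0 (frechet_derivative (\<phi> s) (at x) v))) (at s)"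
    by (rule time_flow[OF rgX X00 N3]) (rule that)
  have I: "convex {-d<..<d}" "0 \<in> {-d<..<d}" using d by auto
  have const: "W (emb (t0 + s) (\<phi> s x)) (frechet_derivative (\<phi> s) (at x) v) (frechet_derivative (\<phi> s) (at x) w) = W (emb t0 x) v w"
    if s: "\<bar>s\<bar> < d" and x: "x \<in> U" for s x v w
  proof -
    let ?c = "\<lambda>s. emb (t0 + s) (\<phi> s x)" and ?v = "\<lambda>s. frechet_derivative (\<phi> s) (at x) v" and ?w = "\<lambda>s. frechet_derivative (\<phi> s) (at x) w"
    have "((\<lambda>s. W (?c s) (?v s) (?w s)) has_vector_derivative 0) (at \<sigma> within {-d<..<d})" if "\<sigma> \<in> {-d<..<d}" for \<sigma>
    proof -
      have \<sigma>: "\<bar>\<sigma>\<bar> < d" using that by auto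
      define y where "y = ?c \<sigma>"
      let ?V = "?v \<sigma>" and ?U = "?w \<sigma>"
      have y3: "y \<in> N3" unfolding y_def by (rule \<phi>N[OF \<sigma> x])
      then have y0: "y \<in> N0" using N by (auto simp: N3_def)
      let ?V' = "DX y (emb 0 ?V)" and ?U' = "DX y (emb 0 ?U)"
      have c': "(?c has_derivative (\<lambda>h. h *\<^sub>R emb 1 (X y))) (at \<sigma>)"
      proof -
        have "((\<lambda>s. emb (t0 + s) 0 + emb 0 (\<phi> s x)) has_vector_derivative emb 1 0 + emb 0 (X y)) (at \<sigma>)"
        proof (rule has_vector_derivative_add[OF emb_has_vector_derivative])
          have "bounded_linear (emb 0 :: real^'d \<Rightarrow> _)" using linear_emb0 by (simp add: linear_conv_bounded_linear)
          from bounded_linear.has_vector_derivative[OF this ode[OF \<sigma> x]]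
          show "((\<lambda>s. emb 0 (\<phi> s x)) has_vector_derivative emb 0 (X y)) (at \<sigma>)" by (simp only: y_def)
        qed
        then show ?thesis by (simp add: has_vector_derivative_def flip: emb_eq)
      qed
      have v': "(?v has_derivative (\<lambda>h. h *\<^sub>R ?V')) (at \<sigma>)" "(?w has_derivative (\<lambda>h. h *\<^sub>R ?U')) (at \<sigma>)"
        using var[OF \<sigma> x, of v, folded y_def] var[OF \<sigma> x, of w, folded y_def] by (simp_all add: has_vector_derivative_def DX_def)
      have dWc: "((\<lambda>s. W (?c s) a b) has_derivative (\<lambda>h. DW y a b (prj (h *\<^sub>R emb 1 (X y))) + (h *\<^sub>R emb 1 (X y)) $ None * \<eta> (prj y) a b)) (at \<sigma>)" for a b
        using diff_chain_at[OF c' dW[OF y0, unfolded y_def], folded y_def] by (simp add: o_def)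
      have "((\<lambda>s. W (?c s) (?v s) (?w s)) has_derivative
        (\<lambda>h. DW y ?V ?U (prj (h *\<^sub>R emb 1 (X y))) + (h *\<^sub>R emb 1 (X y)) $ None * \<eta> (prj y) ?V ?U + W y (h *\<^sub>R ?V') ?U + W y ?V (h *\<^sub>R ?U'))) (at \<sigma>)"
      proof (rule bilinear_family_derivative[of "{-d<..<d}" \<sigma> "\<lambda>s. W (?c s)", folded y_def, OF open_greaterThanLessThan that _ dWc v'])
        show "bilinear (W (?c s))" if "s \<in> {-d<..<d}" for s
          by (rule bilW) (use \<phi>N[of s x] x that N in \<open>auto simp: N3_def\<close>)
      qed
      then have D: "((\<lambda>s. W (?c s) (?v s) (?w s)) has_real_derivative
        DW y ?V ?U (X y) + \<eta> (prj y) ?V ?U + W y ?V' ?U + W y ?V ?U') (at \<sigma>)"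
        unfolding has_field_derivative_def by (rule has_derivative_eq_rhs)
          (simp add: fun_eq_iff linear_cmul[OF linear_prj] bilinear_lmul[OF bilW[OF y0]] bilinear_rmul[OF bilW[OF y0]]
            linear_cmul[OF bounded_linear.linear[OF has_derivative_bounded_linear[OF dD0[OF pN(1)[OF y0]]]], simplified]
            linear_cmul[OF bounded_linear.linear[OF has_derivative_bounded_linear[OF dD1[OF pN(2)[OF y0]]]], simplified]
            DW_def algebra_simps)
      \<comment> \<open>Closedness trades the derivative along \<open>X\<close> for derivatives in
        the two arguments; together with the differentiated Moser equation and the primitive of
        \<eta> everything cancels.\<close>
      have "DW y ?V ?U (X y) = DW y ?V (X y) ?U - DW y ?U (X y) ?V"
        using clW[OF y0, of ?V "X y" ?U] by simp
      moreover have "\<eta> (prj y) ?V ?U = frechet_derivative (\<alpha> ?U) (at (prj y)) ?V - frechet_derivative (\<alpha> ?V) (at (prj y)) ?U"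
        using d\<beta>[OF pN(5)[OF y0], of ?U ?V] by (simp add: \<alpha>_def[abs_def])
      ultimately have "DW y ?V ?U (X y) + \<eta> (prj y) ?V ?U + W y ?V' ?U + W y ?V ?U' = 0"
        using WX'[OF y3, of ?U ?V] WX'[OF y3, of ?V ?U] antiW[OF y0, of ?V' ?U] by linarith
      with D show ?thesis by (simp add: has_real_derivative_iff_has_vector_derivative has_vector_derivative_at_within)
    qed
    from has_vector_derivative_zero_constant[OF I(1) this]
    obtain C where C: "\<And>\<sigma>. \<sigma> \<in> {-d<..<d} \<Longrightarrow> W (?c \<sigma>) (?v \<sigma>) (?w \<sigma>) = C" by blast
    have "\<phi> 0 = (\<lambda>x. x)" by (rule ext) (rule \<phi>0)
    then show ?thesis using C[OF I(2)] C[of s] s by (simp add: frechet_derivative_eqI[OF has_derivative_ident] abs_less_iff)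
  qed
  show ?thesis
  proof (intro exI[of _ d] conjI allI impI d)
    fix s assume s: "\<bar>s\<bar> < d"
    have "pullback (\<phi> s) (segment_form \<omega>\<^sub>0 \<omega>\<^sub>1 (t0 + s)) x = segment_form \<omega>\<^sub>0 \<omega>\<^sub>1 t0 x" if x: "x \<in> U \<inter> N'" for x
    proof
      fix vs
      have "emb (t0 + s) (\<phi> s x) \<in> N0" using \<phi>N[OF s, of x] x N by (auto simp: N3_def)
      then have z: "\<phi> s x \<in> Na" "\<phi> s x \<in> Nb" "x \<in> Na" "x \<in> Nb" using pN[of "emb (t0 + s) (\<phi> s x)"] x by (auto simp: N'_def)
      show "pullback (\<phi> s) (segment_form \<omega>\<^sub>0 \<omega>\<^sub>1 (t0 + s)) x vs = segment_form \<omega>\<^sub>0 \<omega>\<^sub>1 t0 x vs"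
      proof (cases "length vs = 2")
        case True
        then obtain v w where "vs = [v, w]" by (auto simp: numeral_2_eq_2 length_Suc_conv)
        then show ?thesis using const[OF s, of x v w] x by (simp add: pullback_def W_def)
      next
        case False
        then show ?thesis using a2(4)[OF Na(3)] a2(4)[OF Nb(3)] z by (simp add: pullback_def segment_form_def)
      qed
    qed
    then have "\<forall>\<^sub>F x in nhds 0. pullback (\<phi> s) (segment_form \<omega>\<^sub>0 \<omega>\<^sub>1 (t0 + s)) x = segment_form \<omega>\<^sub>0 \<omega>\<^sub>1 t0 x"
      unfolding eventually_nhds using U N' by (intro exI[of _ "U \<inter> N'"]) auto
    then show "form_equiv r (segment_form \<omega>\<^sub>0 \<omega>\<^sub>1 t0) (segment_form \<omega>\<^sub>0 \<omega>\<^sub>1 (t0 + s))"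
      unfolding form_equiv_def using dg[OF s] by blast
  qed
qed

lemma segment_nonzero:
  fixes x y :: real
  assumes "t \<in> {0..1}" "x * y > 0" shows "(1 - t) * x + t * y \<noteq> 0"
proof (cases "x > 0")
  case True
  then have "y > 0" using assms(2) by (simp add: zero_less_mult_iff)
  then show ?thesis using True assms(1) convex_bound_lt[of "-x" 0 "-y" "1 - t" t] by auto
next
  case False
  then have "x < 0" "y < 0" using assms(2) by (auto simp: zero_less_mult_iff)
  then show ?thesis using assms(1) convex_bound_lt[of x 0 y "1 - t" t] by auto
qed

text \<open>Steps around each \<open>t\<close> are glued by connectedness. Equal signs of the two
  transversal derivatives keep that of every intermediate form away from zero.\<close>

lemma moser:
  fixes \<omega>\<^sub>0 \<omega>\<^sub>1 :: "(real^'d) dform" and q u k0 k1 :: "real^'d"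
  assumes \<omega>0: "closed_two_form r \<omega>\<^sub>0" and \<omega>1: "closed_two_form r \<omega>\<^sub>1"
    and qu: "q \<bullet> u = 1"
    and tang: "\<forall>\<^sub>F x in nhds 0. q \<bullet> x = 0 \<longrightarrow> (\<forall>v w. q \<bullet> v = 0 \<longrightarrow> q \<bullet> w = 0 \<longrightarrow> \<omega>\<^sub>0 x [v, w] = \<omega>\<^sub>1 x [v, w])"
    and deg: "\<forall>\<^sub>F x in nhds 0. q \<bullet> x = 0 \<longrightarrow> (\<forall>t. \<exists>v. v \<noteq> 0 \<and> (\<forall>w. segment_form \<omega>\<^sub>0 \<omega>\<^sub>1 t x [w, v] = 0))"
    and k: "k0 \<bullet> k0 = 1" "k1 \<bullet> k1 = 1" "k0 \<bullet> k1 = 0"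
    and ker: "\<And>t w. segment_form \<omega>\<^sub>0 \<omega>\<^sub>1 t 0 [k0, w] = 0" "\<And>t w. segment_form \<omega>\<^sub>0 \<omega>\<^sub>1 t 0 [k1, w] = 0"
    and exact: "\<And>t v. t \<in> {0..1} \<Longrightarrow> (\<forall>w. segment_form \<omega>\<^sub>0 \<omega>\<^sub>1 t 0 [w, v] = 0) \<Longrightarrow> v \<in> span {k0, k1}"
    and a: "frechet_derivative (\<lambda>x. \<omega>\<^sub>0 x [k0, k1]) (at 0) u * frechet_derivative (\<lambda>x. \<omega>\<^sub>1 x [k0, k1]) (at 0) u > 0"
  shows "form_equiv r \<omega>\<^sub>0 \<omega>\<^sub>1"
proof -
  have "form_equiv r (segment_form \<omega>\<^sub>0 \<omega>\<^sub>1 0) (segment_form \<omega>\<^sub>0 \<omega>\<^sub>1 1)"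
  proof (rule connected_steps[of "\<lambda>a b. form_equiv r (segment_form \<omega>\<^sub>0 \<omega>\<^sub>1 a) (segment_form \<omega>\<^sub>0 \<omega>\<^sub>1 b)"])
    fix t :: real assume t: "t \<in> {0..1}"
    show "\<exists>d>0. \<forall>s. \<bar>s\<bar> < d \<longrightarrow> form_equiv r (segment_form \<omega>\<^sub>0 \<omega>\<^sub>1 t) (segment_form \<omega>\<^sub>0 \<omega>\<^sub>1 (t + s))"
      by (rule moser_step[OF \<omega>0 \<omega>1 qu tang deg k ker exact[OF t] segment_nonzero[OF t a]])
  qed (erule form_equiv_sym, erule form_equiv_trans, assumption)
  moreover have "segment_form \<omega>\<^sub>0 \<omega>\<^sub>1 0 = \<omega>\<^sub>0" "segment_form \<omega>\<^sub>0 \<omega>\<^sub>1 1 = \<omega>\<^sub>1" by (simp_all add: segment_form_def fun_eq_iff)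
  ultimately show ?thesis by simp
qed

text \<open>In the cyclic sum for closedness the terms with second derivatives of \<open>F\<close>
  cancel by symmetry. In the second claim they vanish because the images of \<open>k0\<close> and
  \<open>k1\<close> lie in the kernel, so the transversal derivative on the kernel transforms like a
  tensor.\<close>

lemma pullback_two_form:
  fixes F :: "real^'d \<Rightarrow> real^'d"
  assumes F: "diffeo_germ r F" and \<omega>: "closed_two_form r \<omega>"
  shows "closed_two_form r (pullback F \<omega>)"
    and "(\<And>w. \<omega> 0 [frechet_derivative F (at 0) k0, w] = 0) \<Longrightarrow> (\<And>w. \<omega> 0 [frechet_derivative F (at 0) k1, w] = 0) \<Longrightarrow>
      frechet_derivative (\<lambda>x. pullback F \<omega> x [k0, k1]) (at 0) u
      = frechet_derivative (\<lambda>x. \<omega> x [frechet_derivative F (at 0) k0, frechet_derivative F (at 0) k1]) (at 0) (frechet_derivative F (at 0) u)"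
proof -
  obtain N where N: "open N" "0 \<in> N" "\<And>x. x \<in> N \<Longrightarrow> alternating_form 2 (\<omega> x)"
    "\<And>x v w. x \<in> N \<Longrightarrow> rg r x (\<lambda>x. \<omega> x [v, w])"
    "\<And>x u v w. x \<in> N \<Longrightarrow> frechet_derivative (\<lambda>x. \<omega> x [v, w]) (at x) u - frechet_derivative (\<lambda>x. \<omega> x [u, w]) (at x) v
      + frechet_derivative (\<lambda>x. \<omega> x [u, v]) (at x) w = 0"
    by (rule closed_two_formE[OF \<omega>]) (rule that)
  obtain U V G where U: "open U" "(0::real^'d) \<in> U" "F 0 = 0" and rgF: "\<And>x j. x \<in> U \<Longrightarrow> rg r x (\<lambda>x. F x $ j)"
    by (rule diffeo_germE[OF F]) (rule that)
  have sm: "smooth_on U F"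
  proof (rule smooth_on_open_local)
    fix x assume x: "x \<in> U"
    obtain e where e: "0 < e" "smooth_on (ball x e) F" using rg_map_smooth[OF rgF[OF x]] .
    show "\<exists>T. open T \<and> x \<in> T \<and> smooth_on T F" by (intro exI[of _ "ball x e"] conjI e(2)) (use e(1) in auto)
  qed
  define M where "M = U \<inter> F -` N"
  have M: "open M" "0 \<in> M"
    unfolding M_def using continuous_open_preimage[OF smooth_on_continuous[OF sm] U(1) N(1)] U N(2) by auto
  define DF where "DF x = frechet_derivative F (at x)" for x
  define H where "H v x = frechet_derivative (\<lambda>x. DF x v) (at x)" for v x
  define D where "D y v w = frechet_derivative (\<lambda>x. \<omega> x [v, w]) (at y)" for y v w
  have dF: "(F has_derivative DF x) (at x)" if "x \<in> U" for x
    unfolding DF_def by (rule smooth_on_has_derivative[OF sm that])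
  have dDF: "((\<lambda>x. DF x v) has_derivative H v x) (at x)" if "x \<in> U" for x v
    unfolding H_def by (rule smooth_on_has_derivative[OF _ that]) (simp add: DF_def smooth_on_frechet_derivative[OF sm])
  have Hsym: "H v x w = H w x v" if "x \<in> U" for x v w
    unfolding H_def DF_def by (rule frechet_derivative_symmetric[OF U(1) sm that])
  have rgDF: "rg r x (\<lambda>x. DF x v $ i)" if "x \<in> U" for x v i
  proof (rule rg_cong[OF U(1) that _ rg_frechet_derivative[OF rgF[OF that]]])
    show "frechet_derivative (\<lambda>x. F x $ i) (at y) v = DF y v $ i" if "y \<in> U" for y
      by (simp add: frechet_derivative_eqI[OF bounded_linear.has_derivative[OF bounded_linear_vec_nth dF[OF that]]])
  qed
  have pb: "pullback F \<omega> x [v, w] = \<omega> (F x) [DF x v, DF x w]" for x v w by (simp add: pullback_def DF_def)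
  note a2 = alternating_form_two
  have bil: "bilinear (\<lambda>v w. \<omega> (F x) [v, w])" if "x \<in> M" for x using a2(1)[OF N(3)] that by (simp add: M_def)
  have dP: "((\<lambda>x. pullback F \<omega> x [v, w]) has_derivative
      (\<lambda>h. D (F x) (DF x v) (DF x w) (DF x h) + \<omega> (F x) [H v x h, DF x w] + \<omega> (F x) [DF x v, H w x h])) (at x)" if x: "x \<in> M" for x v w
    unfolding pb
  proof (rule bilinear_family_derivative[OF M(1) x bil])
    have xU: "x \<in> U" "F x \<in> N" using x by (auto simp: M_def)
    show "((\<lambda>z. \<omega> (F z) [a, b]) has_derivative (\<lambda>h. D (F x) a b (DF x h))) (at x)" for a b
    proof -
      have "((\<lambda>y. \<omega> y [a, b]) has_derivative D (F x) a b) (at (F x))"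
        unfolding D_def by (rule rg_has_derivative[OF N(4)[OF xU(2)]]) blast
      from diff_chain_at[OF dF[OF xU(1)] this] show ?thesis by (simp add: o_def)
    qed
  qed (use x dDF in \<open>simp_all add: M_def\<close>)
  show "closed_two_form r (pullback F \<omega>)"
    unfolding closed_two_form_def
  proof (intro exI[of _ M] conjI ballI allI M)
    fix x assume x: "x \<in> M"
    then have xU: "x \<in> U" "F x \<in> N" by (auto simp: M_def)
    have lin: "linear (DF x)" using dF[OF xU(1)] has_derivative_bounded_linear bounded_linear.linear by blast
    note al = N(3)[OF xU(2)]
    show "alternating_form 2 (pullback F \<omega> x)"
      unfolding alternating_form_def
    proof (intro conjI allI impI)
      fix vs :: "(real^'d) list" and i :: nat assume "length vs = 2" "i < 2"
      then have "linear (\<lambda>v. \<omega> (F x) ((map (DF x) vs)[i := v]))" using al unfolding alternating_form_def by simp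
      from linear_compose[OF lin this] show "linear (\<lambda>v. pullback F \<omega> x (vs[i := v]))"
        by (simp add: pullback_def o_def map_update DF_def)
    next
      fix vs :: "(real^'d) list" and i j :: nat assume *: "length vs = 2" "i < j" "j < 2" "vs ! i = vs ! j"
      then obtain v w where vs: "vs = [v, w]" by (auto simp: numeral_2_eq_2 length_Suc_conv)
      have "i = 0" "j = 1" using * by auto
      then have "v = w" using *(4) vs by simp
      then show "pullback F \<omega> x vs = 0" using vs a2(2)[OF al] by (simp add: pb)
    next
      fix vs :: "(real^'d) list" assume "length vs \<noteq> 2"
      then show "pullback F \<omega> x vs = 0" using a2(4)[OF al] by (simp add: pullback_def)
    qed
    show "rg r x (\<lambda>x. pullback F \<omega> x [v, w])" for v w
    proof (rule rg_cong[OF M(1) x])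
      show "(\<Sum>i\<in>UNIV. \<Sum>j\<in>UNIV. DF y v $ i * DF y w $ j * \<omega> (F y) [axis i 1, axis j 1]) = pullback F \<omega> y [v, w]" if "y \<in> M" for y
        unfolding pb by (rule bilinear_expand[OF bil[OF that], symmetric])
      show "rg r x (\<lambda>y. \<Sum>i\<in>UNIV. \<Sum>j\<in>UNIV. DF y v $ i * DF y w $ j * \<omega> (F y) [axis i 1, axis j 1])"
      proof (intro rg_sum rg_mult rgDF xU(1))
        show "rg r x (\<lambda>y. \<omega> (F y) [axis i 1, axis j 1])" for i j
          by (rule rg_compose[where G = F, OF rgF[OF xU(1)] N(4)[OF xU(2)]])
      qed
    qed
    fix u v w
    note an = a2(3)[OF al]
    show "frechet_derivative (\<lambda>x. pullback F \<omega> x [v, w]) (at x) u - frechet_derivative (\<lambda>x. pullback F \<omega> x [u, w]) (at x) v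
      + frechet_derivative (\<lambda>x. pullback F \<omega> x [u, v]) (at x) w = 0"
      unfolding frechet_derivative_eqI[OF dP[OF x]]
      using N(5)[OF xU(2), of "DF x v" "DF x w" "DF x u"] Hsym[OF xU(1), of v u] Hsym[OF xU(1), of w u] Hsym[OF xU(1), of w v]
        an[of "H u x w" "DF x v"] an[of "H u x v" "DF x w"] an[of "H v x w" "DF x u"]
      by (simp add: D_def)
  qed
  assume "\<And>w. \<omega> 0 [frechet_derivative F (at 0) k0, w] = 0" "\<And>w. \<omega> 0 [frechet_derivative F (at 0) k1, w] = 0"
  then have "\<And>w. \<omega> 0 [DF 0 k0, w] = 0" "\<And>w. \<omega> 0 [w, DF 0 k1] = 0"
    using a2(3)[OF N(3)[OF N(2)], of _ "DF 0 k1"] by (simp_all add: DF_def)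
  then show "frechet_derivative (\<lambda>x. pullback F \<omega> x [k0, k1]) (at 0) u
      = frechet_derivative (\<lambda>x. \<omega> x [frechet_derivative F (at 0) k0, frechet_derivative F (at 0) k1]) (at 0) (frechet_derivative F (at 0) u)"
    unfolding frechet_derivative_eqI[OF dP[OF M(2)]] by (simp add: U(3) D_def DF_def)
qed

lemma pullback_wedge_power_zero:
  assumes "0 < n" "wedge_power 2 (\<omega> (F x)) n = (\<lambda>_. 0)"
  shows "wedge_power 2 (pullback F \<omega> x) n = (\<lambda>_. 0)"
proof
  fix vs
  show "wedge_power 2 (pullback F \<omega> x) n vs = 0"
  proof (cases "length vs = 2 * n")
    case True
    let ?ws = "map (frechet_derivative F (at x)) vs"
    have "pf n (\<lambda>i j. pullback F \<omega> x [vs ! i, vs ! j]) = pf n (\<lambda>i j. \<omega> (F x) [?ws ! i, ?ws ! j])"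
      by (rule pf_cong) (simp add: True pullback_def)
    then show ?thesis using wedge_power_pf[OF True, of "pullback F \<omega> x"] wedge_power_pf[of ?ws n "\<omega> (F x)"] True assms(2) by simp
  next
    case False
    obtain k where "n = Suc k" using assms(1) gr0_implies_Suc by blast
    then show ?thesis using False by (simp add: wedge_def)
  qed
qed

section \<open>Normalisation along the Martinet hypersurface\<close>

text \<open>Since the first two vectors lie in the kernel at \<open>0\<close>, only the term that differentiates their pair
  survives.\<close>

lemma martinet_derivative:
  fixes \<omega> \<Omega> :: "(real^'d) dform"
  assumes n: "CARD('d) = 2 * Suc m" and \<omega>: "closed_two_form r \<omega>" and mp: "martinet_presentation r (Suc m) \<omega> f \<Omega>"
    and k: "\<And>w. \<omega> 0 [k0, w] = 0" "\<And>w. \<omega> 0 [k1, w] = 0" and vs: "length vs = 2 * m"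
  shows "frechet_derivative f (at 0) u * \<Omega> 0 (k0 # k1 # vs) = 
    2 * Suc m * frechet_derivative (\<lambda>x. \<omega> x [k0, k1]) (at 0) u * pf m (\<lambda>i j. \<omega> 0 [vs ! i, vs ! j]) / 2 ^ Suc m"
proof -
  obtain N where N: "open N" "0 \<in> N" "\<And>x. x \<in> N \<Longrightarrow> alternating_form 2 (\<omega> x)"
    "\<And>x v w. x \<in> N \<Longrightarrow> rg r x (\<lambda>x. \<omega> x [v, w])"
    "\<And>x u v w. x \<in> N \<Longrightarrow> frechet_derivative (\<lambda>x. \<omega> x [v, w]) (at x) u - frechet_derivative (\<lambda>x. \<omega> x [u, w]) (at x) v
      + frechet_derivative (\<lambda>x. \<omega> x [u, v]) (at x) w = 0"
    by (rule closed_two_formE[OF \<omega>]) (rule that)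
  let ?vs = "k0 # k1 # vs"
  obtain M where M: "open M" "0 \<in> M" "\<And>p. p \<in> M \<Longrightarrow> wedge_power 2 (\<omega> p) (Suc m) = (\<lambda>vs. f p * \<Omega> p vs)"
    using mp unfolding martinet_presentation_def eventually_nhds by blast
  have f: "regular_germ r f" "f 0 = 0" and \<Omega>: "form_germ r CARD('d) \<Omega>"
    using mp unfolding martinet_presentation_def volume_form_germ_def by blast+
  have line: "((\<lambda>s. g (s *\<^sub>R u)) has_real_derivative frechet_derivative g (at 0) u) (at 0)" if g: "rg r 0 g" for g :: "real^'d \<Rightarrow> real"
  proof -
    have "(g has_derivative frechet_derivative g (at (0 + 0 *\<^sub>R u))) (at (0 + 0 *\<^sub>R u))"
      by (rule rg_has_derivative[OF g]) simp
    from has_derivative_along_line[OF this] show ?thesis by (simp add: has_real_derivative_iff_has_vector_derivative)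
  qed
  have rgf: "rg r 0 f" using f(1) unfolding regular_germ_def rg_def .
  have rg\<Omega>: "rg r 0 (\<lambda>p. \<Omega> p ?vs)"
    using \<Omega> n vs unfolding form_germ_def rg_def by (elim exE conjE) (auto simp del: One_nat_def)
  define J where "J = (\<lambda>s. s *\<^sub>R u) -` (N \<inter> M)"
  have J: "open J" "0 \<in> J" unfolding J_def using N M by (auto intro!: open_vimage continuous_intros)
  \<comment> \<open>Set to \<open>0\<close> outside \<open>J\<close>, because antisymmetry is
    required for all \<open>s\<close> while the form is known to be alternating only near the
    origin.\<close>
  define G where "G s i j = (if s \<in> J then \<omega> (s *\<^sub>R u) [?vs ! i, ?vs ! j] else 0)" for s i j
  define G' where "G' i j = frechet_derivative (\<lambda>x. \<omega> x [?vs ! i, ?vs ! j]) (at 0) u" for i j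
  have 1: "((\<lambda>s. pf (Suc m) (G s)) has_real_derivative 2 * Suc m * G' 0 1 * pf m (\<lambda>i j. G 0 (i + 2) (j + 2))) (at 0)"
  proof (rule pf_derivative)
    show "((\<lambda>s. G s i j) has_real_derivative G' i j) (at 0)" for i j
      unfolding has_field_derivative_def
      by (rule has_derivative_transform_within_open[OF line[OF N(4)[OF N(2)], of "?vs ! i" "?vs ! j", unfolded has_field_derivative_def] J, folded G'_def])
        (simp add: G_def)
    show "G s i j = - G s j i" for s i j
      using alternating_form_two(3)[OF N(3), of "s *\<^sub>R u" "?vs ! i" "?vs ! j"] by (simp add: G_def J_def)
    show "G 0 0 j = 0" "G 0 1 j = 0" for j using k by (simp_all add: G_def)
  qed
  have 2: "((\<lambda>s. f (s *\<^sub>R u) * \<Omega> (s *\<^sub>R u) ?vs) has_real_derivative frechet_derivative f (at 0) u * \<Omega> 0 ?vs) (at 0)"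
    using DERIV_mult[OF line[OF rgf] line[OF rg\<Omega>]] f(2) by simp
  have "((\<lambda>s. f (s *\<^sub>R u) * \<Omega> (s *\<^sub>R u) ?vs) has_real_derivative
      2 * Suc m * G' 0 1 * pf m (\<lambda>i j. G 0 (i + 2) (j + 2)) / 2 ^ Suc m) (at 0)"
    unfolding has_field_derivative_def
  proof (rule has_derivative_transform_within_open[OF _ J])
    show "pf (Suc m) (G s) / 2 ^ Suc m = f (s *\<^sub>R u) * \<Omega> (s *\<^sub>R u) ?vs" if "s \<in> J" for s
    proof -
      have "wedge_power 2 (\<omega> (s *\<^sub>R u)) (Suc m) ?vs = pf (Suc m) (\<lambda>i j. \<omega> (s *\<^sub>R u) [?vs ! i, ?vs ! j]) / 2 ^ Suc m"
        by (rule wedge_power_pf) (simp add: vs)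
      moreover have "G s = (\<lambda>i j. \<omega> (s *\<^sub>R u) [?vs ! i, ?vs ! j])" using that by (simp add: G_def fun_eq_iff)
      moreover have "wedge_power 2 (\<omega> (s *\<^sub>R u)) (Suc m) ?vs = f (s *\<^sub>R u) * \<Omega> (s *\<^sub>R u) ?vs"
        using M(3)[of "s *\<^sub>R u"] that by (simp add: J_def)
      ultimately show ?thesis by simp
    qed
    show "((\<lambda>s. pf (Suc m) (G s) / 2 ^ Suc m) has_derivative (*) (2 * Suc m * G' 0 1 * pf m (\<lambda>i j. G 0 (i + 2) (j + 2)) / 2 ^ Suc m)) (at 0)"
      using DERIV_cdivide[OF 1] unfolding has_field_derivative_def .
  qed
  from DERIV_unique[OF 2 this] J(2) show ?thesis by (simp add: G_def G'_def)
qed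

text \<open>The one-forms vanish on \<open>T\<close>, so only permutations that put the
  \<open>p\<close>-th vector first contribute, and for these the other factor sees vectors of
  \<open>T\<close> alone. Comparing forms on the hypersurface thus suffices to compare the ambient
  volume forms.\<close>

lemma wedge_one_hyperplane:
  assumes "length vs = Suc m" and T: "\<And>i. i < Suc m \<Longrightarrow> i \<noteq> p \<Longrightarrow> vs ! i \<in> T"
    and \<alpha>: "\<And>v. v \<in> T \<Longrightarrow> \<alpha> [v] = 0" "\<And>v. v \<in> T \<Longrightarrow> \<alpha>' [v] = 0" "\<alpha>' [vs ! p] = c * \<alpha> [vs ! p]"
    and \<beta>: "\<And>ws. set ws \<subseteq> T \<Longrightarrow> \<beta>' ws = c' * \<beta> ws"
  shows "wedge 1 m \<alpha>' \<beta>' vs = c * c' * wedge 1 m \<alpha> \<beta> vs"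
proof -
  have *: "of_int (sign \<sigma>) * \<alpha>' (map (\<lambda>i. vs ! \<sigma> i) [0..<1]) * \<beta>' (map (\<lambda>i. vs ! \<sigma> i) [1..<1 + m])
      = c * c' * (of_int (sign \<sigma>) * \<alpha> (map (\<lambda>i. vs ! \<sigma> i) [0..<1]) * \<beta> (map (\<lambda>i. vs ! \<sigma> i) [1..<1 + m]))"
    if \<sigma>: "\<sigma> permutes {..<1 + m}" for \<sigma>
  proof (cases "\<sigma> 0 = p")
    case True
    have "set (map (\<lambda>i. vs ! \<sigma> i) [1..<1 + m]) \<subseteq> T"
    proof
      fix x assume "x \<in> set (map (\<lambda>i. vs ! \<sigma> i) [1..<1 + m])"
      then obtain i where i: "1 \<le> i" "i < 1 + m" "x = vs ! \<sigma> i" by auto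
      have "\<sigma> i \<noteq> \<sigma> 0" using permutes_inj[OF \<sigma>] i(1) by (metis inj_eq not_one_le_zero)
      then show "x \<in> T" using T[of "\<sigma> i"] permutes_lessThan_less[OF \<sigma> i(2)] i(3) True by simp
    qed
    from \<beta>[OF this] show ?thesis using True \<alpha>(3) by simp
  next
    case False
    then have "vs ! \<sigma> 0 \<in> T" using T[of "\<sigma> 0"] permutes_lessThan_less[OF \<sigma>, of 0] by simp
    then show ?thesis using \<alpha>(1,2) by simp
  qed
  have S: "(\<Sum>\<sigma> | \<sigma> permutes {..<1 + m}. of_int (sign \<sigma>) * \<alpha>' (map (\<lambda>i. vs ! \<sigma> i) [0..<1]) * \<beta>' (map (\<lambda>i. vs ! \<sigma> i) [1..<1 + m]))
      = (\<Sum>\<sigma> | \<sigma> permutes {..<1 + m}. c * c' * (of_int (sign \<sigma>) * \<alpha> (map (\<lambda>i. vs ! \<sigma> i) [0..<1]) * \<beta> (map (\<lambda>i. vs ! \<sigma> i) [1..<1 + m])))"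
    by (rule sum.cong[OF refl]) (rule *, simp)
  show ?thesis unfolding wedge_def S sum_distrib_left[symmetric] using assms(1) by simp
qed

lemma extend_to_basis_list:
  fixes V :: "'a::euclidean_space set"
  assumes "subspace V" "distinct xs" "independent (set xs)" "set xs \<subseteq> V"
  obtains ys where "length xs + length ys = dim V" "set ys \<subseteq> V" "span (set xs \<union> set ys) = V" "independent (set xs \<union> set ys)" "distinct (xs @ ys)"
proof -
  obtain B where B: "set xs \<subseteq> B" "B \<subseteq> V" "independent B" "V \<subseteq> span B"
    using maximal_independent_subset_extend[OF assms(4,3)] by blast
  have fB: "finite B" using B(3) by (rule independent_imp_finite)
  obtain ys where ys: "set ys = B - set xs" "distinct ys" using finite_distinct_list[of "B - set xs"] fB by blast
  have u: "set xs \<union> set ys = B" using B(1) ys by auto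
  have d: "distinct (xs @ ys)" using ys assms(2) by auto
  have "length xs + length ys = card B" using distinct_card[OF d] u by simp
  also have "card B = dim V" using B by (metis basis_card_eq_dim)
  finally show ?thesis
    by (rule that) (use ys B u d span_minimal[OF B(2) assms(1)] in auto)
qed

lemma nonzero_in_hyperplane:
  fixes q :: "'a::euclidean_space"
  assumes S: "subspace S" "2 \<le> dim S"
  obtains v where "v \<in> S" "v \<noteq> 0" "q \<bullet> v = 0"
proof -
  have "S \<noteq> {0}" using S(2) by auto
  then obtain x where x: "x \<in> S" "x \<noteq> 0" using subspace_0[OF S(1)] by blast
  show ?thesis
  proof (cases "q \<bullet> x = 0")
    case False
    have "\<not> S \<subseteq> span {x}"
    proof
      assume "S \<subseteq> span {x}"
      then have "dim S \<le> 1" using dim_subset[of S "span {x}"] dim_le_card'[of "{x}"] by simp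
      then show False using S(2) by simp
    qed
    then obtain y where y: "y \<in> S" "y \<notin> span {x}" by blast
    let ?v = "y - (q \<bullet> y / (q \<bullet> x)) *\<^sub>R x"
    have "?v \<noteq> 0" using y(2) by (metis eq_iff_diff_eq_0 span_base span_mul singletonI)
    moreover have "?v \<in> S" using S(1) x y by (simp add: subspace_diff subspace_scale)
    moreover have "q \<bullet> ?v = 0" using False by (simp add: inner_diff_right)
    ultimately show ?thesis using that by blast
  qed (use x that in blast)
qed

text \<open>Each radical meets the hyperplane in a nonzero vector. As the forms agree on the
  hyperplane, every combination of them pairs both vectors to zero with it; only the pairing with
  \<open>u\<close> is left, and a suitable combination of the two vectors kills it.\<close>

lemma segment_degenerate:
  fixes \<alpha> \<alpha>' :: "'a::euclidean_space mform" and q u :: 'a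
  assumes a: "alternating_form 2 \<alpha>" "alternating_form 2 \<alpha>'" and qu: "q \<bullet> u = 1"
    and d: "2 \<le> dim (rad (\<lambda>v w. \<alpha> [v, w]) UNIV)" "2 \<le> dim (rad (\<lambda>v w. \<alpha>' [v, w]) UNIV)"
    and T: "\<And>v w. q \<bullet> v = 0 \<Longrightarrow> q \<bullet> w = 0 \<Longrightarrow> \<alpha> [v, w] = \<alpha>' [v, w]"
  shows "\<exists>v. v \<noteq> 0 \<and> (\<forall>w. (1 - t) * \<alpha> [w, v] + t * \<alpha>' [w, v] = 0)"
proof -
  note a2 = alternating_form_two
  note b = a2(1)[OF a(1)] a2(1)[OF a(2)]
  obtain \<rho> where \<rho>: "\<rho> \<in> rad (\<lambda>v w. \<alpha> [v, w]) UNIV" "\<rho> \<noteq> 0" "q \<bullet> \<rho> = 0"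
    by (rule nonzero_in_hyperplane[OF subspace_rad[OF b(1) subspace_UNIV] d(1)])
  obtain \<rho>' where \<rho>': "\<rho>' \<in> rad (\<lambda>v w. \<alpha>' [v, w]) UNIV" "\<rho>' \<noteq> 0" "q \<bullet> \<rho>' = 0"
    by (rule nonzero_in_hyperplane[OF subspace_rad[OF b(2) subspace_UNIV] d(2)])
  have z: "\<alpha> [w, \<rho>] = 0" "\<alpha>' [w, \<rho>'] = 0" for w
    using \<rho> \<rho>' a2(3)[OF a(1), of w \<rho>] a2(3)[OF a(2), of w \<rho>'] by (auto simp: rad_def)
  define B where "B w v = (1 - t) * \<alpha> [w, v] + t * \<alpha>' [w, v]" for w v
  have B: "bilinear B" unfolding B_def[abs_def] bilinear_def
    by (intro conjI allI linearI)
      (simp_all add: bilinear_ladd[OF b(1)] bilinear_radd[OF b(1)] bilinear_lmul[OF b(1)] bilinear_rmul[OF b(1)]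
        bilinear_ladd[OF b(2)] bilinear_radd[OF b(2)] bilinear_lmul[OF b(2)] bilinear_rmul[OF b(2)] algebra_simps)
  have BT: "B w \<rho> = 0" "B w \<rho>' = 0" if "q \<bullet> w = 0" for w
    using T[OF that \<rho>(3)] T[OF that \<rho>'(3)] z by (simp_all add: B_def)
  have ext: "\<forall>w. B w v = 0" if u: "B u v = 0" and t: "\<And>w. q \<bullet> w = 0 \<Longrightarrow> B w v = 0" for v
  proof
    fix w
    have "B w v = B ((q \<bullet> w) *\<^sub>R u + (w - (q \<bullet> w) *\<^sub>R u)) v" by simp
    also have "\<dots> = (q \<bullet> w) * B u v + B (w - (q \<bullet> w) *\<^sub>R u) v" by (simp only: bilinear_ladd[OF B] bilinear_lmul[OF B] real_scaleR_def)
    finally show "B w v = 0" using u t[of "w - (q \<bullet> w) *\<^sub>R u"] by (simp add: inner_diff_right qu)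
  qed
  define v where "v = B u \<rho>' *\<^sub>R \<rho> - B u \<rho> *\<^sub>R \<rho>'"
  have "\<exists>v. v \<noteq> 0 \<and> (\<forall>w. B w v = 0)"
  proof (cases "v = 0")
    case False
    have "\<forall>w. B w v = 0"
      by (rule ext) (simp_all add: v_def bilinear_rsub[OF B] bilinear_rmul[OF B] BT)
    then show ?thesis using False by blast
  next
    \<comment> \<open>The two coefficients vanish or the vectors are proportional; either way
      \<open>\<rho>\<close> alone lies in the kernel of the combination.\<close>
    case True
    have "B u \<rho> = 0"
    proof (rule ccontr)
      assume nz: "B u \<rho> \<noteq> 0"
      have "B u \<rho> *\<^sub>R \<rho>' = B u \<rho>' *\<^sub>R \<rho>" using True by (simp add: v_def)
      then have "B u \<rho>' \<noteq> 0" using nz \<rho>'(2) by auto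
      then have "\<rho> = (B u \<rho> / B u \<rho>') *\<^sub>R \<rho>'" using arg_cong[OF \<open>B u \<rho> *\<^sub>R \<rho>' = _\<close>, of "\<lambda>x. (1 / B u \<rho>') *\<^sub>R x"] by simp
      then have "\<alpha>' [u, \<rho>] = 0" using z(2)[of u] bilinear_rmul[OF b(2)] by (metis mult_zero_right real_scaleR_def)
      then show False using nz z(1)[of u] by (simp add: B_def)
    qed
    then have "\<forall>w. B w \<rho> = 0" by (rule ext) (simp add: BT)
    then show ?thesis using \<rho>(2) by blast
  qed
  then show ?thesis by (simp add: B_def)
qed

lemma volume_form_nonzero:
  fixes \<Omega> :: "(real^'d) dform"
  assumes "volume_form_germ r \<Omega>" "length vs = CARD('d)" "span (set vs) = UNIV"
  shows "\<Omega> 0 vs \<noteq> 0"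
proof
  assume z: "\<Omega> 0 vs = 0"
  have "\<Omega> 0 \<noteq> (\<lambda>_. 0)" 
    using assms(1) eventually_nhds_x_imp_x unfolding volume_form_germ_def by blast
  moreover have "alternating_form CARD('d) (\<Omega> 0)"
    using assms(1) unfolding volume_form_germ_def form_germ_def by blast
  then have "\<Omega> 0 ws = 0" for ws
    using alternating_form_zero[of "\<Omega> 0" vs ws] assms(2,3) z by simp
  ultimately show False by blast
qed

lemma martinet_presentation_gradient:
  assumes "martinet_presentation r n \<omega> f \<Omega>"
  obtains u where "frechet_derivative f (at 0) u = 1" "rg r 0 f" "linear (frechet_derivative f (at 0))"
proof -
  have "regular_germ r f" using assms unfolding martinet_presentation_def by blast
  then have rg: "rg r 0 f" unfolding regular_germ_def rg_def .
  have lin: "linear (frechet_derivative f (at 0))"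
    by (rule rg_has_derivative[OF rg]) (blast dest: has_derivative_bounded_linear bounded_linear.linear)
  have "differential f 0 \<noteq> (\<lambda>_. 0)" using assms unfolding martinet_presentation_def by blast
  then obtain vs where "differential f 0 vs \<noteq> 0" by (auto simp: fun_eq_iff)
  then obtain v where v: "frechet_derivative f (at 0) v \<noteq> 0"
    unfolding differential_def by (auto split: list.splits)
  have "frechet_derivative f (at 0) ((1 / frechet_derivative f (at 0) v) *\<^sub>R v) = 1"
    using v by (simp add: linear_cmul[OF lin])
  from that[OF this rg lin] show ?thesis .
qed

lemma closed_two_form_alternating: "closed_two_form r \<omega> \<Longrightarrow> alternating_form 2 (\<omega> 0)"
  by (erule closed_two_formE) blast

text \<open>Take a basis that starts with three kernel vectors. Two of them enter the derivative
  formula, and the third gives a zero row in the remaining Pfaffian. As the differential of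
  \<open>f\<close> is nonzero, the volume form would have to vanish on this basis.\<close>

lemma kernel_dim_two:
  fixes \<omega> \<Omega> :: "(real^'d) dform"
  assumes n: "CARD('d) = 2 * Suc m" and \<omega>: "closed_two_form r \<omega>" and mp: "martinet_presentation r (Suc m) \<omega> f \<Omega>"
  shows "dim (rad (\<lambda>v w. \<omega> 0 [v, w]) UNIV) = 2"
proof (rule ccontr)
  let ?R = "rad (\<lambda>v w. \<omega> 0 [v, w]) UNIV"
  assume "dim ?R \<noteq> 2"
  note al = closed_two_form_alternating[OF \<omega>]
  have ev: "\<forall>\<^sub>F p in nhds 0. wedge_power 2 (\<omega> p) (Suc m) = (\<lambda>vs. f p * \<Omega> p vs)" and f0: "f 0 = 0" and vol: "volume_form_germ r \<Omega>"
    using mp unfolding martinet_presentation_def by blast+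
  have "wedge_power 2 (\<omega> 0) (Suc m) = (\<lambda>_. 0)" using eventually_nhds_x_imp_x[OF ev] f0 by simp
  from wedge_power_zero_degenerate[OF al _ this] n have "3 \<le> dim ?R" using \<open>dim ?R \<noteq> 2\<close> by simp
  obtain u where u: "frechet_derivative f (at 0) u = 1" using martinet_presentation_gradient[OF mp] .
  have sub: "subspace ?R" by (rule subspace_rad[OF alternating_form_two(1)[OF al] subspace_UNIV])
  obtain ys where ys: "length ys = dim ?R" "set ys \<subseteq> ?R" "independent (set ys)" "distinct ys"
    by (rule extend_to_basis_list[OF sub, of "[]"]) (auto simp: independent_empty)
  obtain k0 k1 k2 ys' where ys': "ys = k0 # k1 # k2 # ys'"
  proof -
    have "Suc (Suc (Suc 0)) \<le> length ys" using ys(1) \<open>3 \<le> dim ?R\<close> by simp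
    then show ?thesis using that by (auto simp: Suc_le_length_iff)
  qed
  obtain zs where zs: "length ys + length zs = dim (UNIV :: (real^'d) set)" "span (set ys \<union> set zs) = UNIV"
    by (rule extend_to_basis_list[OF subspace_UNIV ys(4,3)]) auto
  let ?vs = "k2 # ys' @ zs"
  have len: "length ?vs = 2 * m" using zs(1) n by (simp add: ys' dim_UNIV)
  have k: "\<omega> 0 [k, w] = 0" if "k = k0 \<or> k = k1 \<or> k = k2" for k w using ys(2) that by (auto simp: ys' rad_def)
  have "pf m (\<lambda>i j. \<omega> 0 [?vs ! i, ?vs ! j]) = 0"
    by (rule pf_zero[of 0]) (use len k alternating_form_two(3)[OF al, of _ k2] in auto)
  then have "\<Omega> 0 (k0 # k1 # ?vs) = 0"
    using martinet_derivative[OF n \<omega> mp k k len, of k0 k1 u] u by simp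
  moreover have "\<Omega> 0 (k0 # k1 # ?vs) \<noteq> 0"
    by (rule volume_form_nonzero[OF vol]) (use len n zs(2) in \<open>simp_all add: ys' insert_commute\<close>)
  ultimately show False by simp
qed

text \<open>The linear map \<open>v \<mapsto> v + \<tau> (q \<bullet> v) u\<close> is the identity for \<open>\<tau> = 0\<close> and the reflection in \<open>ker q\<close> for
  \<open>\<tau> = -2\<close>.\<close>

lemma moser_reflected:
  fixes \<omega>\<^sub>0 \<omega>\<^sub>1 :: "(real^'d) dform" and q u k0 k1 :: "real^'d" and \<tau> :: real
  assumes G: "diffeo_germ r G" "frechet_derivative G (at 0) = (\<lambda>v. v)"
    and \<omega>0: "closed_two_form r \<omega>\<^sub>0" and \<omega>1: "closed_two_form r \<omega>\<^sub>1" and n: "CARD('d) = 2 * n" "0 < n" and qu: "q \<bullet> u = 1"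
    and tang: "\<forall>\<^sub>F x in nhds 0. q \<bullet> x = 0 \<longrightarrow> (\<forall>v w. q \<bullet> v = 0 \<longrightarrow> q \<bullet> w = 0 \<longrightarrow> pullback G \<omega>\<^sub>0 x [v, w] = pullback G \<omega>\<^sub>1 x [v, w])"
    and deg: "\<forall>\<^sub>F x in nhds 0. q \<bullet> x = 0 \<longrightarrow> wedge_power 2 (pullback G \<omega>\<^sub>0 x) n = (\<lambda>_. 0)"
      "\<forall>\<^sub>F x in nhds 0. q \<bullet> x = 0 \<longrightarrow> wedge_power 2 (pullback G \<omega>\<^sub>1 x) n = (\<lambda>_. 0)"
    and k: "k0 \<bullet> k0 = 1" "k1 \<bullet> k1 = 1" "k0 \<bullet> k1 = 0"
    and ker: "\<And>w. \<omega>\<^sub>0 0 [k0, w] = 0" "\<And>w. \<omega>\<^sub>0 0 [k1, w] = 0" "\<And>w. \<omega>\<^sub>1 0 [k0, w] = 0" "\<And>w. \<omega>\<^sub>1 0 [k1, w] = 0"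
    and \<tau>: "\<tau> = 0 \<or> \<tau> = -2 \<and> q \<bullet> k0 = 0 \<and> q \<bullet> k1 = 0"
    and exact: "\<And>t v. t \<in> {0..1} \<Longrightarrow> \<forall>w. (1 - t) * \<omega>\<^sub>0 0 [w, v] + t * \<omega>\<^sub>1 0 [w + (\<tau> * (q \<bullet> w)) *\<^sub>R u, v + (\<tau> * (q \<bullet> v)) *\<^sub>R u] = 0 \<Longrightarrow> v \<in> span {k0, k1}"
    and a: "frechet_derivative (\<lambda>x. \<omega>\<^sub>0 x [k0, k1]) (at 0) u * ((1 + \<tau>) * frechet_derivative (\<lambda>x. \<omega>\<^sub>1 x [k0, k1]) (at 0) u) > 0"
  shows "form_equiv r \<omega>\<^sub>0 \<omega>\<^sub>1"
proof -
  define A where "A v = v + (\<tau> * (q \<bullet> v)) *\<^sub>R u" for v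
  have linA: "linear A" unfolding A_def[abs_def] by (intro linearI) (simp_all add: inner_add_right algebra_simps)
  have qA: "q \<bullet> A v = (1 + \<tau>) * (q \<bullet> v)" for v using qu by (simp add: A_def inner_add_right algebra_simps)
  \<comment> \<open>For both values of \<tau> the factor \<open>1 + \<tau>\<close> by which
    \<open>q\<close> is multiplied is 1 or -1, and the map is an involution.\<close>
  have AA: "A (A v) = v" for v
  proof -
    have "A (A v) = A v + (\<tau> * (q \<bullet> A v)) *\<^sub>R u" by (simp only: A_def[of "A v"])
    also have "\<dots> = v + (\<tau> * (q \<bullet> v) + \<tau> * (q \<bullet> A v)) *\<^sub>R u" by (simp only: A_def[of v] scaleR_add_left add.assoc)
    also have "\<tau> * (q \<bullet> v) + \<tau> * (q \<bullet> A v) = 0" using \<tau> by (auto simp: qA)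
    finally show ?thesis by simp
  qed
  have Ak: "A k0 = k0" "A k1 = k1" using \<tau> by (auto simp: A_def)
  have A0: "A 0 = 0" by (simp add: A_def)
  have AT: "A v = v" if "q \<bullet> v = 0" for v using that by (simp add: A_def)
  have Au: "A u = (1 + \<tau>) *\<^sub>R u" by (simp add: A_def qu algebra_simps)
  have dA: "frechet_derivative A (at x) = A" for x by (rule frechet_derivative_eqI[OF linear_imp_has_derivative[OF linA]])
  have A: "diffeo_germ r A" by (rule diffeo_germ_linear[OF linA linA AA AA])
  have G0: "G 0 = 0" by (rule diffeo_germ_0[OF G(1)])
  let ?\<eta>0 = "pullback G \<omega>\<^sub>0" and ?\<zeta> = "pullback G \<omega>\<^sub>1" and ?\<eta>1 = "pullback A (pullback G \<omega>\<^sub>1)"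
  have \<eta>0: "closed_two_form r ?\<eta>0" and \<zeta>: "closed_two_form r ?\<zeta>" using pullback_two_form(1)[OF G(1)] \<omega>0 \<omega>1 by blast+
  have \<eta>1: "closed_two_form r ?\<eta>1" by (rule pullback_two_form(1)[OF A \<zeta>])
  have at0: "?\<eta>0 0 vs = \<omega>\<^sub>0 0 vs" "?\<zeta> 0 vs = \<omega>\<^sub>1 0 vs" "?\<eta>1 0 vs = \<omega>\<^sub>1 0 (map A vs)" for vs
    by (simp_all add: pullback_def G G0 A0 dA)
  have pe: "form_equiv r (pullback F \<omega>) \<omega>" if "diffeo_germ r F" for F \<omega> using that unfolding form_equiv_def by (intro exI[of _ F]) simp
  have "form_equiv r ?\<eta>0 ?\<eta>1"
  proof (rule moser[OF \<eta>0 \<eta>1 qu _ _ k])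
    show "\<forall>\<^sub>F x in nhds 0. q \<bullet> x = 0 \<longrightarrow> (\<forall>v w. q \<bullet> v = 0 \<longrightarrow> q \<bullet> w = 0 \<longrightarrow> ?\<eta>0 x [v, w] = ?\<eta>1 x [v, w])"
      using tang by (rule eventually_mono) (simp add: pullback_def[of A] dA AT)
    obtain N0 where N0: "open N0" "0 \<in> N0" "\<And>x. x \<in> N0 \<Longrightarrow> alternating_form 2 (?\<eta>0 x)" by (rule closed_two_formE[OF \<eta>0]) (rule that)
    obtain N1 where N1: "open N1" "0 \<in> N1" "\<And>x. x \<in> N1 \<Longrightarrow> alternating_form 2 (?\<eta>1 x)" by (rule closed_two_formE[OF \<eta>1]) (rule that)
    have "\<forall>\<^sub>F x in nhds 0. x \<in> N0" "\<forall>\<^sub>F x in nhds 0. x \<in> N1" using N0 N1 by (auto intro: eventually_nhds_in_open)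
    with deg tang show "\<forall>\<^sub>F x in nhds 0. q \<bullet> x = 0 \<longrightarrow> (\<forall>t. \<exists>v. v \<noteq> 0 \<and> (\<forall>w. segment_form ?\<eta>0 ?\<eta>1 t x [w, v] = 0))"
    proof eventually_elim
      case (elim x)
      show ?case
      proof (intro impI allI)
        fix t assume x: "q \<bullet> x = 0"
        note al = N0(3)[OF elim(4)] N1(3)[OF elim(5)]
        have w: "wedge_power 2 (?\<eta>0 x) n = (\<lambda>_. 0)" "wedge_power 2 (?\<eta>1 x) n = (\<lambda>_. 0)"
          using elim(1,2) x pullback_wedge_power_zero[OF n(2), of ?\<zeta> A x] by (simp_all add: AT)
        have d: "2 \<le> dim (rad (\<lambda>v w. ?\<eta>0 x [v, w]) UNIV)" "2 \<le> dim (rad (\<lambda>v w. ?\<eta>1 x [v, w]) UNIV)"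
          using wedge_power_zero_degenerate[OF al(1) _ w(1)] wedge_power_zero_degenerate[OF al(2) _ w(2)] n by simp_all
        have T: "?\<eta>0 x [v, w] = ?\<eta>1 x [v, w]" if "q \<bullet> v = 0" "q \<bullet> w = 0" for v w
          using elim(3) x that by (simp add: pullback_def[of A] dA AT)
        show "\<exists>v. v \<noteq> 0 \<and> (\<forall>w. segment_form ?\<eta>0 ?\<eta>1 t x [w, v] = 0)"
          unfolding segment_form_def by (rule segment_degenerate[OF al qu d T])
      qed
    qed
    show "segment_form ?\<eta>0 ?\<eta>1 t 0 [k0, w] = 0" "segment_form ?\<eta>0 ?\<eta>1 t 0 [k1, w] = 0" for t w
      by (simp_all add: segment_form_def at0 Ak ker)
    show "v \<in> span {k0, k1}" if "t \<in> {0..1}" "\<forall>w. segment_form ?\<eta>0 ?\<eta>1 t 0 [w, v] = 0" for t v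
      by (rule exact[OF that(1)]) (use that(2) in \<open>simp add: segment_form_def at0 A_def\<close>)
    have 0: "frechet_derivative (\<lambda>x. ?\<eta>0 x [k0, k1]) (at 0) u = frechet_derivative (\<lambda>x. \<omega>\<^sub>0 x [k0, k1]) (at 0) u"
      using pullback_two_form(2)[OF G(1) \<omega>0, of k0 k1 u] by (simp add: G(2) ker)
    have 1: "frechet_derivative (\<lambda>x. ?\<zeta> x [k0, k1]) (at 0) v = frechet_derivative (\<lambda>x. \<omega>\<^sub>1 x [k0, k1]) (at 0) v" for v
      using pullback_two_form(2)[OF G(1) \<omega>1, of k0 k1 v] by (simp add: G(2) ker)
    \<comment> \<open>Kernel vectors are fixed, so the reflection changes the transversal derivative
      only through \<open>A u\<close>, by the factor \<open>1 + \<tau>\<close>.\<close>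
    have 2: "frechet_derivative (\<lambda>x. ?\<eta>1 x [k0, k1]) (at 0) u = frechet_derivative (\<lambda>x. ?\<zeta> x [k0, k1]) (at 0) (A u)"
      using pullback_two_form(2)[OF A \<zeta>, of k0 k1 u] by (simp add: dA Ak at0 ker)
    have "rg r 0 (\<lambda>x. \<omega>\<^sub>1 x [k0, k1])" by (rule closed_two_formE[OF \<omega>1]) blast
    then have lin: "linear (frechet_derivative (\<lambda>x. \<omega>\<^sub>1 x [k0, k1]) (at 0))"
      by (rule rg_has_derivative) (blast dest: has_derivative_bounded_linear bounded_linear.linear)
    show "frechet_derivative (\<lambda>x. ?\<eta>0 x [k0, k1]) (at 0) u * frechet_derivative (\<lambda>x. ?\<eta>1 x [k0, k1]) (at 0) u > 0"
      using a by (simp add: 0 1 2 Au linear_cmul[OF lin])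
  qed
  then show ?thesis using pe[OF G(1), of \<omega>\<^sub>0] pe[OF G(1), of \<omega>\<^sub>1] pe[OF A, of ?\<zeta>] form_equiv_sym form_equiv_trans by metis
qed

text \<open>Straight segments in the hyperplane are mapped by \<open>G\<close> to smooth curves in
  \<open>S\<close>. Equality of the restricted forms on tangent vectors thereby becomes an identity
  on one fixed linear space.\<close>

lemma tangent_space_straightened:
  fixes G :: "real^'d \<Rightarrow> real^'d"
  assumes G: "diffeo_germ r G" and S: "\<forall>\<^sub>F x in nhds 0. q \<bullet> x = 0 \<longrightarrow> G x \<in> S"
  shows "\<forall>\<^sub>F x in nhds 0. q \<bullet> x = 0 \<longrightarrow> (\<forall>v. q \<bullet> v = 0 \<longrightarrow> frechet_derivative G (at x) v \<in> tangent_space S (G x))"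
proof -
  obtain e where e: "0 < e" "smooth_on (ball 0 e) G" using diffeo_germ_smooth[OF G] .
  obtain M where M: "open M" "0 \<in> M" "\<And>x. x \<in> M \<Longrightarrow> q \<bullet> x = 0 \<Longrightarrow> G x \<in> S" using S unfolding eventually_nhds by blast
  define N where "N = M \<inter> ball 0 e"
  have N: "open N" "0 \<in> N" using M e by (auto simp: N_def)
  have sm: "smooth_on N G" by (rule smooth_on_subset[OF e(2)]) (simp add: N_def)
  have "frechet_derivative G (at x) v \<in> tangent_space S (G x)" if x: "x \<in> N" "q \<bullet> x = 0" "q \<bullet> v = 0" for x v
  proof -
    let ?\<gamma> = "\<lambda>s::real. x + s *\<^sub>R v"
    have "open (?\<gamma> -` N)" "0 \<in> ?\<gamma> -` N" using N x by (auto intro!: open_vimage continuous_intros)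
    then obtain \<epsilon> where \<epsilon>: "0 < \<epsilon>" "ball 0 \<epsilon> \<subseteq> ?\<gamma> -` N" using open_contains_ball by blast
    have sub: "?\<gamma> s \<in> N" if "s \<in> {-\<epsilon><..<\<epsilon>}" for s using \<epsilon>(2) that by (auto simp: subset_iff)
    have "smooth_on {-\<epsilon><..<\<epsilon>} (\<lambda>s::real. s *\<^sub>R v)"
      by (intro smooth_on_bounded_linear open_greaterThanLessThan bounded_linear_scaleR_left)
    then have sm\<gamma>: "smooth_on {-\<epsilon><..<\<epsilon>} ?\<gamma>" by (intro smooth_on_add smooth_on_const open_greaterThanLessThan)
    have "smooth_on {-\<epsilon><..<\<epsilon>} (\<lambda>s. G (?\<gamma> s))"
      by (rule smooth_on_compose[OF open_greaterThanLessThan sm\<gamma> sm]) (use sub in auto)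
    moreover have "(\<lambda>s. G (?\<gamma> s)) ` {-\<epsilon><..<\<epsilon>} \<subseteq> S"
      using sub M(3) x by (auto simp: N_def inner_add_right)
    moreover have "((\<lambda>s. G (?\<gamma> s)) has_vector_derivative frechet_derivative G (at x) v) (at 0)"
      by (rule has_derivative_along_line) (use smooth_on_has_derivative[OF sm x(1)] in simp)
    ultimately show ?thesis unfolding tangent_space_def using \<epsilon>(1)
      by (intro CollectI exI[of _ "\<lambda>s. G (?\<gamma> s)"] exI[of _ \<epsilon>] conjI) simp_all
  qed
  then show ?thesis unfolding eventually_nhds using N by (intro exI[of _ N]) blast
qed

text \<open>Near the origin \<open>f\<close> composed with \<open>G\<close> vanishes along the line
  spanned by \<open>v\<close>, and \<open>G\<close> has the identity as its derivative
  there.\<close>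

lemma vector_derivative_zero_along:
  fixes f :: "real^'d \<Rightarrow> real" and G :: "real^'d \<Rightarrow> real^'d"
  assumes f: "rg r 0 f" and G: "diffeo_germ r G" "frechet_derivative G (at 0) = (\<lambda>v. v)"
    and z: "\<forall>\<^sub>F x in nhds 0. q \<bullet> x = 0 \<longrightarrow> f (G x) = 0" and v: "q \<bullet> v = 0"
  shows "frechet_derivative f (at 0) v = 0"
proof -
  have df: "(f has_derivative frechet_derivative f (at (G 0))) (at (G 0))"
    using diffeo_germ_0[OF G(1)] by (auto intro: rg_has_derivative[OF f])
  have dG: "(G has_derivative (\<lambda>v. v)) (at 0)"
    using eventually_nhds_x_imp_x[OF diffeo_germ_has_derivative[OF G(1)]] by (simp add: G(2))
  have "((\<lambda>x. f (G x)) has_derivative frechet_derivative f (at 0)) (at (0 + 0 *\<^sub>R v))"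
    using diff_chain_at[OF dG df] by (simp add: o_def diffeo_germ_0[OF G(1)])
  from has_derivative_along_line[OF this] have 1: "((\<lambda>s. f (G (s *\<^sub>R v))) has_derivative (\<lambda>h. h *\<^sub>R frechet_derivative f (at 0) v)) (at 0)"
    by (simp add: has_vector_derivative_def)
  obtain N where N: "open N" "0 \<in> N" "\<And>x. x \<in> N \<Longrightarrow> q \<bullet> x = 0 \<Longrightarrow> f (G x) = 0" using z unfolding eventually_nhds by blast
  have "((\<lambda>s. f (G (s *\<^sub>R v))) has_derivative (\<lambda>h. 0)) (at 0)"
  proof (rule has_derivative_transform_within_open[OF has_derivative_const])
    show "open ((\<lambda>s. s *\<^sub>R v) -` N)" "(0::real) \<in> (\<lambda>s. s *\<^sub>R v) -` N" using N by (auto intro!: open_vimage continuous_intros)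
    show "0 = f (G (s *\<^sub>R v))" if "s \<in> (\<lambda>s. s *\<^sub>R v) -` N" for s using N(3)[of "s *\<^sub>R v"] that v by simp
  qed
  from fun_cong[OF has_derivative_unique[OF 1 this], of 1] show ?thesis by simp
qed

text \<open>\<open>k0\<close> is taken from the intersection of \<open>K\<close> with the
  hyperplane, so \<open>k1\<close> alone decides whether \<open>K\<close> lies in the
  hyperplane.\<close>

lemma orthonormal_pair:
  fixes q :: "'a::euclidean_space"
  assumes K: "subspace K" "dim K = 2"
  obtains k0 k1 where "k0 \<in> K" "k1 \<in> K" "q \<bullet> k0 = 0" "k0 \<bullet> k0 = 1" "k1 \<bullet> k1 = 1" "k0 \<bullet> k1 = 0" "span {k0, k1} = K"
proof -
  obtain x where x: "x \<in> K" "x \<noteq> 0" "q \<bullet> x = 0" using nonzero_in_hyperplane[OF K(1), of q] K(2) by auto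
  obtain y where y: "y \<in> K" "y \<noteq> 0" "x \<bullet> y = 0" using nonzero_in_hyperplane[OF K(1), of x] K(2) by auto
  define k0 where "k0 = (1 / norm x) *\<^sub>R x"
  define k1 where "k1 = (1 / norm y) *\<^sub>R y"
  have k: "k0 \<in> K" "k1 \<in> K" "q \<bullet> k0 = 0" "k0 \<bullet> k1 = 0" using x y K(1) by (simp_all add: k0_def k1_def subspace_scale)
  have n: "k0 \<bullet> k0 = 1" "k1 \<bullet> k1 = 1" using x(2) y(2) by (simp_all add: k0_def k1_def dot_square_norm power2_eq_square)
  have ne: "k0 \<noteq> k1" "k0 \<noteq> 0" "k1 \<noteq> 0" using n k(4) by auto
  have "pairwise orthogonal {k0, k1}" using k(4) by (simp add: pairwise_insert orthogonal_def inner_commute)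
  then have ind: "independent {k0, k1}" using pairwise_orthogonal_independent ne by blast
  have "dim (span {k0, k1}) = 2" using dim_eq_card_independent[OF ind] ne by simp
  moreover have "span {k0, k1} \<subseteq> K" by (rule span_minimal[OF _ K(1)]) (use k in simp)
  ultimately have "span {k0, k1} = K"
    by (intro subspace_dim_equal[OF subspace_span K(1)]) (simp_all add: K(2))
  with k n show ?thesis using that by blast
qed

lemma singular_symplectic_germ_closed: "singular_symplectic_germ r n \<omega> \<Longrightarrow> closed_two_form r \<omega>"
  unfolding singular_symplectic_germ_def by (elim conjE) (rule closed_two_form_germ)

lemma span_insert_hyperplane:
  fixes q u :: "'a::euclidean_space"
  assumes "span S = {v. q \<bullet> v = 0}" "q \<bullet> u \<noteq> 0"
  shows "span (insert u S) = UNIV"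
proof (intro equalityI subset_UNIV subsetI)
  fix v
  have "v - (q \<bullet> v / (q \<bullet> u)) *\<^sub>R u \<in> span S" using assms by (simp add: inner_diff_right)
  then show "v \<in> span (insert u S)" by (auto simp: span_insert)
qed

theorem theorem2p3:
  fixes r :: regularity and n :: nat
    and \<omega>\<^sub>0 \<omega>\<^sub>1 :: "(real^'d) dform" and \<Sigma>\<^sub>2 :: "(real^'d) set"
  assumes "CARD('d) = 2 * n"
    and "singular_symplectic_germ r n \<omega>\<^sub>0" and "singular_symplectic_germ r n \<omega>\<^sub>1"
    and "set_germ_eq \<Sigma>\<^sub>2 (martinet n \<omega>\<^sub>0)" and "set_germ_eq \<Sigma>\<^sub>2 (martinet n \<omega>\<^sub>1)"
    and "structurally_smooth_martinet r n \<omega>\<^sub>0" and "structurally_smooth_martinet r n \<omega>\<^sub>1"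
    and "form_rank_on (tangent_space \<Sigma>\<^sub>2 0) (incl_pullback \<Sigma>\<^sub>2 \<omega>\<^sub>0 0)
       = form_rank_on (tangent_space \<Sigma>\<^sub>2 0) (incl_pullback \<Sigma>\<^sub>2 \<omega>\<^sub>1 0)"
    and "form_rank_on (tangent_space \<Sigma>\<^sub>2 0) (incl_pullback \<Sigma>\<^sub>2 \<omega>\<^sub>1 0) \<le> 2 * n - 2"
    and "same_canonical_orientation r n \<Sigma>\<^sub>2 \<omega>\<^sub>0 \<omega>\<^sub>1"
    and "eq_germ_along \<Sigma>\<^sub>2 (incl_pullback \<Sigma>\<^sub>2 \<omega>\<^sub>0) (incl_pullback \<Sigma>\<^sub>2 \<omega>\<^sub>1)"
    and "form_kernel (wedge_power 2 (\<omega>\<^sub>0 0) (n - 1)) = form_kernel (wedge_power 2 (\<omega>\<^sub>1 0) (n - 1))"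
  shows "\<exists>\<Psi> :: real^'d \<Rightarrow> real^'d. diffeo_germ r \<Psi> \<and>
           (\<forall>\<^sub>F p in nhds 0. pullback \<Psi> \<omega>\<^sub>1 p = \<omega>\<^sub>0 p)"
proof -
  obtain m where m: "n = Suc m"
  proof (cases n)
    case 0
    then show ?thesis using assms(1) by simp
  qed (rule that)
  have n: "CARD('d) = 2 * Suc m" using assms(1) m by simp
  note \<omega>0 = singular_symplectic_germ_closed[OF assms(2)] and \<omega>1 = singular_symplectic_germ_closed[OF assms(3)]
  note al = closed_two_form_alternating[OF \<omega>0] closed_two_form_alternating[OF \<omega>1]
  note a2 = alternating_form_two
  obtain \<Theta>0 \<Theta>1 where cv: "canonical_volume_form r n \<omega>\<^sub>0 \<Theta>0" "canonical_volume_form r n \<omega>\<^sub>1 \<Theta>1"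
    and so: "same_orientation \<Sigma>\<^sub>2 \<Theta>0 \<Theta>1"
    using assms(10) unfolding same_canonical_orientation_def by (elim exE conjE) (rule that)
  obtain f0 \<Omega>0 where mp0: "martinet_presentation r n \<omega>\<^sub>0 f0 \<Omega>0"
    and \<Theta>0: "\<forall>\<^sub>F p in nhds 0. p \<in> martinet n \<omega>\<^sub>0 \<longrightarrow> alternating_form (2 * n - 1) (\<Theta>0 p) \<and> wedge 1 (2 * n - 1) (differential f0 p) (\<Theta>0 p) = \<Omega>0 p"
    using cv(1) unfolding canonical_volume_form_def by (elim exE conjE) (rule that)
  obtain f1 \<Omega>1 where mp1: "martinet_presentation r n \<omega>\<^sub>1 f1 \<Omega>1"
    and \<Theta>1: "\<forall>\<^sub>F p in nhds 0. p \<in> martinet n \<omega>\<^sub>1 \<longrightarrow> alternating_form (2 * n - 1) (\<Theta>1 p) \<and> wedge 1 (2 * n - 1) (differential f1 p) (\<Theta>1 p) = \<Omega>1 p"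
    using cv(2) unfolding canonical_volume_form_def by (elim exE conjE) (rule that)
  note mp = mp0 mp1 and \<Theta> = \<Theta>0 \<Theta>1
  have fz: "f0 0 = 0" "f1 0 = 0" using mp unfolding martinet_presentation_def by blast+
  have vol: "volume_form_germ r \<Omega>0" "volume_form_germ r \<Omega>1" using mp unfolding martinet_presentation_def by blast+
  have mart: "\<forall>\<^sub>F p in nhds 0. p \<in> martinet n \<omega> \<longleftrightarrow> f p = 0" if "martinet_presentation r n \<omega> f \<Omega>" for \<omega> \<Omega> :: "(real^'d) dform" and f
  proof -
    have "\<forall>\<^sub>F p in nhds 0. wedge_power 2 (\<omega> p) n = (\<lambda>vs. f p * \<Omega> p vs)" "\<forall>\<^sub>F p in nhds 0. \<Omega> p \<noteq> (\<lambda>_. 0)"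
      using that unfolding martinet_presentation_def volume_form_germ_def by blast+
    then show ?thesis by eventually_elim (auto simp: martinet_def fun_eq_iff)
  qed
  have \<Sigma>0: "\<forall>\<^sub>F p in nhds 0. p \<in> \<Sigma>\<^sub>2 \<longleftrightarrow> p \<in> martinet n \<omega>\<^sub>0 \<and> f0 p = 0"
    using assms(4)[unfolded set_germ_eq_def] mart[OF mp(1)] by eventually_elim auto
  have \<Sigma>1: "\<forall>\<^sub>F p in nhds 0. p \<in> \<Sigma>\<^sub>2 \<longleftrightarrow> p \<in> martinet n \<omega>\<^sub>1 \<and> f1 p = 0"
    using assms(5)[unfolded set_germ_eq_def] mart[OF mp(2)] by eventually_elim auto
  have \<Sigma>f: "\<forall>\<^sub>F p in nhds 0. p \<in> \<Sigma>\<^sub>2 \<longleftrightarrow> f0 p = 0"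
    using assms(4)[unfolded set_germ_eq_def] mart[OF mp(1)] by eventually_elim auto
  define L where "L = frechet_derivative f0 (at 0)"
  obtain u where u0: "frechet_derivative f0 (at 0) u = 1" and rgf0: "rg r 0 f0" and lin0: "linear (frechet_derivative f0 (at 0))"
    by (rule martinet_presentation_gradient[OF mp(1)]) (rule that)
  note u = u0[folded L_def] and linL = lin0[folded L_def]
  obtain u1 where u1: "frechet_derivative f1 (at 0) u1 = 1" and rgf1: "rg r 0 f1" and lin1: "linear (frechet_derivative f1 (at 0))"
    by (rule martinet_presentation_gradient[OF mp(2)]) (rule that)
  define q :: "real^'d" where "q = (\<chi> i. L (axis i 1))"
  have Lq: "L v = q \<bullet> v" for v
  proof -
    have "L v = L (\<Sum>i\<in>UNIV. v $ i *\<^sub>R axis i 1)" using basis_expansion[of v] by (simp add: scalar_mult_eq_scaleR)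
    then show ?thesis by (simp add: linear_sum[OF linL] linear_cmul[OF linL] q_def inner_vec_def mult.commute)
  qed
  have qu: "q \<bullet> u = 1" using u Lq by simp
  \<comment> \<open>The defining function for \<open>\<omega>\<^sub>0\<close> is straightened; that
    for \<open>\<omega>\<^sub>1\<close> has the same zero set and so vanishes along the hyperplane
    too.\<close>
  obtain G where G: "diffeo_germ r G" "frechet_derivative G (at 0) = (\<lambda>v. v)" "\<forall>\<^sub>F x in nhds 0. f0 (G x) = L x"
    by (rule straighten[OF rgf0 fz(1) L_def u])
  have G0: "G 0 = 0" by (rule diffeo_germ_0[OF G(1)])
  note evG = diffeo_germ_eventually[OF G(1)]
  have G\<Sigma>: "\<forall>\<^sub>F x in nhds 0. q \<bullet> x = 0 \<longrightarrow> G x \<in> \<Sigma>\<^sub>2"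
    using evG[OF \<Sigma>f] G(3) by eventually_elim (simp add: Lq)
  note tan = tangent_space_straightened[OF G(1) G\<Sigma>]
  have tan0: "v \<in> tangent_space \<Sigma>\<^sub>2 0" if "q \<bullet> v = 0" for v
    using eventually_nhds_x_imp_x[OF tan] that by (simp add: G0 G(2))
  have eqS: "\<forall>\<^sub>F p in nhds 0. p \<in> \<Sigma>\<^sub>2 \<longrightarrow> (\<forall>v\<in>tangent_space \<Sigma>\<^sub>2 p. \<forall>w\<in>tangent_space \<Sigma>\<^sub>2 p. \<omega>\<^sub>0 p [v, w] = \<omega>\<^sub>1 p [v, w])"
    using assms(11)[unfolded eq_germ_along_def]
  proof eventually_elim
    case (elim p)
    show ?case
    proof (intro impI ballI)
      fix v w assume p: "p \<in> \<Sigma>\<^sub>2" and vw: "v \<in> tangent_space \<Sigma>\<^sub>2 p" "w \<in> tangent_space \<Sigma>\<^sub>2 p"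
      have "incl_pullback \<Sigma>\<^sub>2 \<omega>\<^sub>0 p [v, w] = incl_pullback \<Sigma>\<^sub>2 \<omega>\<^sub>1 p [v, w]" using elim p by simp
      then show "\<omega>\<^sub>0 p [v, w] = \<omega>\<^sub>1 p [v, w]" using vw by (simp add: incl_pullback_def restrict_form_def)
    qed
  qed
  have tang: "\<forall>\<^sub>F x in nhds 0. q \<bullet> x = 0 \<longrightarrow> (\<forall>v w. q \<bullet> v = 0 \<longrightarrow> q \<bullet> w = 0 \<longrightarrow> pullback G \<omega>\<^sub>0 x [v, w] = pullback G \<omega>\<^sub>1 x [v, w])"
    using evG[OF eqS] G\<Sigma> tan by eventually_elim (simp add: pullback_def)
  have bT: "\<omega>\<^sub>0 0 [v, w] = \<omega>\<^sub>1 0 [v, w]" if "q \<bullet> v = 0" "q \<bullet> w = 0" for v w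
    using eventually_nhds_x_imp_x[OF tang] that by (simp add: pullback_def G0 G(2))
  have deg0: "\<forall>\<^sub>F x in nhds 0. q \<bullet> x = 0 \<longrightarrow> wedge_power 2 (pullback G \<omega>\<^sub>0 x) n = (\<lambda>_. 0)"
    using evG[OF \<Sigma>0] G\<Sigma>
  proof eventually_elim
    case (elim x)
    then show ?case using pullback_wedge_power_zero[of n \<omega>\<^sub>0 G x] m by (simp add: martinet_def)
  qed
  have deg1: "\<forall>\<^sub>F x in nhds 0. q \<bullet> x = 0 \<longrightarrow> wedge_power 2 (pullback G \<omega>\<^sub>1 x) n = (\<lambda>_. 0)"
    using evG[OF \<Sigma>1] G\<Sigma>
  proof eventually_elim
    case (elim x)
    then show ?case using pullback_wedge_power_zero[of n \<omega>\<^sub>1 G x] m by (simp add: martinet_def)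
  qed
  \<comment> \<open>Both defining functions vanish on the hypersurface, so their differentials at
    the origin are proportional, with this factor.\<close>
  define c1 where "c1 = frechet_derivative f1 (at 0) u"
  have f1T: "frechet_derivative f1 (at 0) v = 0" if "q \<bullet> v = 0" for v
  proof (rule vector_derivative_zero_along[OF rgf1 G(1,2) _ that])
    show "\<forall>\<^sub>F x in nhds 0. q \<bullet> x = 0 \<longrightarrow> f1 (G x) = 0" using evG[OF \<Sigma>1] G\<Sigma> by eventually_elim auto
  qed
  have f1c: "frechet_derivative f1 (at 0) v = c1 * (q \<bullet> v)" for v
  proof -
    have "frechet_derivative f1 (at 0) (v - (q \<bullet> v) *\<^sub>R u) = 0" by (rule f1T) (simp add: inner_diff_right qu)
    then show ?thesis by (simp add: linear_diff[OF lin1] linear_cmul[OF lin1] c1_def mult.commute)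
  qed
  have c1: "c1 \<noteq> 0" using u1 f1c[of u1] by auto
  have Sig0: "0 \<in> \<Sigma>\<^sub>2" using eventually_nhds_x_imp_x[OF \<Sigma>f] fz(1) by simp
  obtain c where c: "c > 0" "\<And>vs. set vs \<subseteq> {v. q \<bullet> v = 0} \<Longrightarrow> \<Theta>1 0 vs = c * \<Theta>0 0 vs"
  proof -
    obtain c where c: "c > 0" "\<And>vs. incl_pullback \<Sigma>\<^sub>2 \<Theta>1 0 vs = c * incl_pullback \<Sigma>\<^sub>2 \<Theta>0 0 vs"
      using eventually_nhds_x_imp_x[OF so[unfolded same_orientation_def]] Sig0 by blast
    show ?thesis
    proof (rule that[OF c(1)])
      fix vs assume "set vs \<subseteq> {v. q \<bullet> v = 0}"
      then have "set vs \<subseteq> tangent_space \<Sigma>\<^sub>2 0" using tan0 by blast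
      then show "\<Theta>1 0 vs = c * \<Theta>0 0 vs" using c(2)[of vs] by (simp add: incl_pullback_def restrict_form_def)
    qed
  qed
  \<comment> \<open>The factor \<open>c1\<close> comes from the differentials and the positive
    factor \<open>c\<close> from the equal orientations.\<close>
  have \<Omega>: "\<Omega>1 0 vs = c1 * c * \<Omega>0 0 vs" if vs: "length vs = 2 * n" "\<And>i. i < 2 * n \<Longrightarrow> i \<noteq> p \<Longrightarrow> q \<bullet> (vs ! i) = 0" for vs p
  proof -
    have "0 \<in> martinet n \<omega>\<^sub>0" "0 \<in> martinet n \<omega>\<^sub>1"
      using eventually_nhds_x_imp_x[OF \<Sigma>0] eventually_nhds_x_imp_x[OF \<Sigma>1] Sig0 by auto
    then have w: "\<Omega>0 0 = wedge 1 (2 * n - 1) (differential f0 0) (\<Theta>0 0)" "\<Omega>1 0 = wedge 1 (2 * n - 1) (differential f1 0) (\<Theta>1 0)"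
      using eventually_nhds_x_imp_x[OF \<Theta>(1)] eventually_nhds_x_imp_x[OF \<Theta>(2)] by auto
    show ?thesis unfolding w
    proof (rule wedge_one_hyperplane[where T = "{v. q \<bullet> v = 0}" and p = p])
      show "length vs = Suc (2 * n - 1)" using vs m by simp
      show "vs ! i \<in> {v. q \<bullet> v = 0}" if "i < Suc (2 * n - 1)" "i \<noteq> p" for i using vs(2)[of i] that m by simp
      show "differential f0 0 [v] = 0" "differential f1 0 [v] = 0" if "v \<in> {v. q \<bullet> v = 0}" for v
        using that f1T by (simp_all add: differential_def Lq flip: L_def)
      show "differential f1 0 [vs ! p] = c1 * differential f0 0 [vs ! p]"
        by (simp add: differential_def f1c Lq flip: L_def)
    qed (rule c(2))
  qed
  let ?b0 = "\<lambda>v w. \<omega>\<^sub>0 0 [v, w]" and ?b1 = "\<lambda>v w. \<omega>\<^sub>1 0 [v, w]"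
  note b0 = a2(1,2)[OF al(1)] and b1 = a2(1,2)[OF al(2)]
  have dK: "dim (rad ?b0 UNIV) = 2" "dim (rad ?b1 UNIV) = 2"
    using kernel_dim_two[OF n \<omega>0] kernel_dim_two[OF n \<omega>1] mp m by blast+
  have sK: "subspace (rad ?b0 UNIV)" "subspace (rad ?b1 UNIV)" using subspace_rad b0 b1 subspace_UNIV by blast+
  have K: "rad ?b0 UNIV = rad ?b1 UNIV"
  proof (cases "2 \<le> n")
    case True
    then show ?thesis
      using form_kernel_wedge_power[OF al(1) _ True dK(1)] form_kernel_wedge_power[OF al(2) _ True dK(2)] assms(1,12) by simp
  next
    \<comment> \<open>For n = 1 both radicals are two-dimensional subspaces of a plane.\<close>
    case False
    then have "DIM(real^'d) = 2" using assms(1) m by simp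
    then have full: "R = UNIV" if "dim R = 2" "subspace R" for R :: "(real^'d) set"
      using dim_eq_full[of R] that by (metis span_eq_iff)
    show ?thesis using full[OF dK(1) sK(1)] full[OF dK(2) sK(2)] by simp
  qed
  obtain k0 k1 where k: "k0 \<in> rad ?b0 UNIV" "k1 \<in> rad ?b0 UNIV" "q \<bullet> k0 = 0" "k0 \<bullet> k0 = 1" "k1 \<bullet> k1 = 1" "k0 \<bullet> k1 = 0"
    and spanK: "span {k0, k1} = rad ?b0 UNIV"
    by (rule orthonormal_pair[OF sK(1) dK(1), of q])
  have ker: "\<omega>\<^sub>0 0 [k0, w] = 0" "\<omega>\<^sub>0 0 [k1, w] = 0" "\<omega>\<^sub>1 0 [k0, w] = 0" "\<omega>\<^sub>1 0 [k1, w] = 0" for w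
    using k(1,2) k(1,2)[unfolded K] by (auto simp: rad_def)
  have inK: "v \<in> span {k0, k1}" if "\<And>w. \<omega>\<^sub>0 0 [w, v] = 0" for v
    unfolding spanK using that a2(3)[OF al(1), of v] by (simp add: rad_def)
  have ne: "k0 \<noteq> k1" "k0 \<noteq> 0" "k1 \<noteq> 0" using k(4-6) by auto
  have "pairwise orthogonal {k0, k1}" using k(6) by (simp add: pairwise_insert orthogonal_def inner_commute)
  then have ind: "independent {k0, k1}" using pairwise_orthogonal_independent ne by blast
  define T where "T = {v. q \<bullet> v = 0}"
  have sT: "subspace T" unfolding T_def by (rule subspace_hyperplane)
  have dT: "dim T = 2 * n - 1" unfolding T_def using dim_hyperplane[of q] qu assms(1) by (metis DIM_cart DIM_real inner_zero_left mult.right_neutral zero_neq_one)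
  define a0 where "a0 = frechet_derivative (\<lambda>x. \<omega>\<^sub>0 x [k0, k1]) (at 0) u"
  define a1 where "a1 = frechet_derivative (\<lambda>x. \<omega>\<^sub>1 x [k0, k1]) (at 0) u"
  \<comment> \<open>\<open>c1\<close> enters twice, through the derivative of the second defining
    function and through the comparison of the volume forms. The square makes the factor
    \<open>c1 * c1 * c\<close> positive whatever the sign of \<open>c1\<close>.\<close>
  have key: "\<exists>Z>0. a1 * pf m (\<lambda>i j. \<omega>\<^sub>1 0 [vs ! i, vs ! j]) = Z * (a0 * pf m (\<lambda>i j. \<omega>\<^sub>0 0 [vs ! i, vs ! j])) \<and> a0 * pf m (\<lambda>i j. \<omega>\<^sub>0 0 [vs ! i, vs ! j]) \<noteq> 0"
    if vs: "length vs = 2 * m" "span (set (k0 # k1 # vs)) = UNIV" "\<And>i. i < 2 * n \<Longrightarrow> i \<noteq> p \<Longrightarrow> q \<bullet> ((k0 # k1 # vs) ! i) = 0" for vs p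
  proof -
    define C where "C = 2 * real (Suc m) / 2 ^ Suc m"
    have C: "C > 0" by (simp add: C_def)
    have 0: "\<Omega>0 0 (k0 # k1 # vs) = C * (a0 * pf m (\<lambda>i j. \<omega>\<^sub>0 0 [vs ! i, vs ! j]))"
      using martinet_derivative[OF n \<omega>0 mp(1)[unfolded m] ker(1,2) vs(1), of u] u by (simp add: C_def a0_def L_def)
    have 1: "c1 * \<Omega>1 0 (k0 # k1 # vs) = C * (a1 * pf m (\<lambda>i j. \<omega>\<^sub>1 0 [vs ! i, vs ! j]))"
      using martinet_derivative[OF n \<omega>1 mp(2)[unfolded m] ker(3,4) vs(1), of u] by (simp add: C_def a1_def c1_def)
    have len: "length (k0 # k1 # vs) = 2 * n" using vs(1) m by simp
    have "\<Omega>1 0 (k0 # k1 # vs) = c1 * c * \<Omega>0 0 (k0 # k1 # vs)" by (rule \<Omega>[OF len vs(3)])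
    then have "C * (a1 * pf m (\<lambda>i j. \<omega>\<^sub>1 0 [vs ! i, vs ! j])) = C * (c1 * c1 * c * (a0 * pf m (\<lambda>i j. \<omega>\<^sub>0 0 [vs ! i, vs ! j])))"
      unfolding 1[symmetric] using 0 by simp
    then have "a1 * pf m (\<lambda>i j. \<omega>\<^sub>1 0 [vs ! i, vs ! j]) = c1 * c1 * c * (a0 * pf m (\<lambda>i j. \<omega>\<^sub>0 0 [vs ! i, vs ! j]))" using C by simp
    moreover have "\<Omega>0 0 (k0 # k1 # vs) \<noteq> 0"
      by (rule volume_form_nonzero[OF vol(1) _ vs(2)]) (use len assms(1) in simp)
    then have "a0 * pf m (\<lambda>i j. \<omega>\<^sub>0 0 [vs ! i, vs ! j]) \<noteq> 0" using 0 by auto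
    moreover have "c1 * c1 > 0" using c1 not_real_square_gt_zero by blast
    then have "c1 * c1 * c > 0" using c(1) by simp
    ultimately show ?thesis by blast
  qed
  note fin = moser_reflected[OF G(1,2) \<omega>0 \<omega>1 assms(1) _ qu tang deg0 deg1 k(4-6) ker]
  have "form_equiv r \<omega>\<^sub>0 \<omega>\<^sub>1"
  proof (cases "q \<bullet> k1 = 0")
    case False
    \<comment> \<open>Projecting along \<open>k1\<close> onto the hyperplane changes neither form,
      since \<open>k1\<close> lies in both kernels; agreement on the hyperplane is thus agreement
      everywhere.\<close>
    have b01: "\<omega>\<^sub>0 0 [v, w] = \<omega>\<^sub>1 0 [v, w]" for v w
    proof -
      let ?p = "\<lambda>v. v - (q \<bullet> v / (q \<bullet> k1)) *\<^sub>R k1"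
      have T: "q \<bullet> ?p v = 0" for v using False by (simp add: inner_diff_right)
      have r: "\<omega> [?p v, ?p w] = \<omega> [v, w]" if "alternating_form 2 \<omega>" "\<And>w. \<omega> [k1, w] = 0" for \<omega>
        using a2(3)[OF that(1), of _ k1] that(2)
        by (simp add: bilinear_lsub[OF a2(1)[OF that(1)]] bilinear_rsub[OF a2(1)[OF that(1)]] bilinear_lmul[OF a2(1)[OF that(1)]] bilinear_rmul[OF a2(1)[OF that(1)]])
      show ?thesis using r[OF al(1) ker(2)] r[OF al(2) ker(4)] bT[OF T T, of v w] by simp
    qed
    obtain vs where vs: "length [k0] + length vs = dim T" "set vs \<subseteq> T" "span (set [k0] \<union> set vs) = T"
      by (rule extend_to_basis_list[OF sT, of "[k0]"]) (use k(3) ne in \<open>auto simp: T_def\<close>)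
    have len: "length vs = 2 * m" using vs(1) dT m by simp
    have "span (insert k1 (set [k0] \<union> set vs)) = UNIV" by (rule span_insert_hyperplane) (use vs(3) False in \<open>simp_all add: T_def\<close>)
    then have sp: "span (set (k0 # k1 # vs)) = UNIV" by (simp add: insert_commute)
    have hyp: "q \<bullet> ((k0 # k1 # vs) ! i) = 0" if "i < 2 * n" "i \<noteq> 1" for i
    proof (cases i)
      case 0
      then show ?thesis using k(3) by simp
    next
      case (Suc j)
      then have j: "j - 1 < length vs" "(k0 # k1 # vs) ! i = vs ! (j - 1)" using that len m by (auto simp: nth_Cons')
      then have "vs ! (j - 1) \<in> T" using vs(2) nth_mem[OF j(1)] by blast
      then show ?thesis unfolding j(2) by (simp add: T_def)
    qed
    obtain Z where "Z > 0" "a1 * pf m (\<lambda>i j. \<omega>\<^sub>1 0 [vs ! i, vs ! j]) = Z * (a0 * pf m (\<lambda>i j. \<omega>\<^sub>0 0 [vs ! i, vs ! j]))"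
      "a0 * pf m (\<lambda>i j. \<omega>\<^sub>0 0 [vs ! i, vs ! j]) \<noteq> 0" using key[OF len sp hyp] by blast
    \<comment> \<open>The Pfaffians coincide and are nonzero, so \<open>Z\<close> compares the
      transversal derivatives directly.\<close>
    then have "a1 = Z * a0" "a0 \<noteq> 0" by (simp_all add: b01)
    then have "a0 * a1 = Z * (a0 * a0)" by (simp only: mult_ac)
    moreover have "a0 * a0 > 0" using \<open>a0 \<noteq> 0\<close> not_real_square_gt_zero by blast
    ultimately have "a0 * a1 > 0" using \<open>Z > 0\<close> by (simp only: mult_pos_pos)
    show ?thesis
    proof (rule fin[of 0])
      fix t v assume "\<forall>w. (1 - t) * \<omega>\<^sub>0 0 [w, v] + t * \<omega>\<^sub>1 0 [w + (0 * (q \<bullet> w)) *\<^sub>R u, v + (0 * (q \<bullet> v)) *\<^sub>R u] = 0"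
      then show "v \<in> span {k0, k1}" by (intro inK) (simp add: b01 algebra_simps)
    qed (use \<open>a0 * a1 > 0\<close> m in \<open>simp_all add: a0_def a1_def\<close>)
  next
    case True
    have bT': "rad ?b0 T = rad ?b1 T" using bT by (auto simp: rad_def T_def)
    \<comment> \<open>The hyperplane has odd dimension and the radical even codimension in it. The
      radical of the restricted form contains the kernel plane, so its dimension is at least 3 and
      there is a further vector \<open>l\<close>, orthogonal to the hyperplane but not in the
      kernel.\<close>
    obtain mm where "dim T = 2 * mm + dim (rad ?b0 T)" using symplectic_basis(1)[OF b0 sT] by blast
    moreover have "{k0, k1} \<subseteq> rad ?b0 T" using ker k(3) True by (auto simp: rad_def T_def)
    then have "2 \<le> dim (rad ?b0 T)" using dim_subset[of "{k0, k1}" "rad ?b0 T"] dim_eq_card_independent[OF ind] ne by simp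
    ultimately have d3: "dim (rad ?b0 T) > dim (span {k0, k1})" and m1: "1 \<le> m"
      using dT m dK(1) by (simp_all add: spanK) presburger+
    then obtain l where l: "l \<in> rad ?b0 T" "l \<notin> span {k0, k1}"
      using dim_subset[of "rad ?b0 T" "span {k0, k1}"] by (meson linorder_not_less subsetI)
    have lT: "q \<bullet> l = 0" "\<And>w. q \<bullet> w = 0 \<Longrightarrow> \<omega>\<^sub>0 0 [l, w] = 0" "\<And>w. q \<bullet> w = 0 \<Longrightarrow> \<omega>\<^sub>1 0 [l, w] = 0"
      using l(1) l(1)[unfolded bT'] by (auto simp: rad_def T_def)
    obtain vs where vs: "length [k0, k1, l] + length vs = dim T" "set vs \<subseteq> T" "span (set [k0, k1, l] \<union> set vs) = T"
    proof (rule extend_to_basis_list[OF sT, of "[k0, k1, l]"])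
      have "l \<noteq> k0" "l \<noteq> k1" using l(2) span_base[of k0 "{k0, k1}"] span_base[of k1 "{k0, k1}"] by auto
      then show "distinct [k0, k1, l]" using ne by auto
      have "independent (insert l {k0, k1})" by (rule independent_insertI[OF l(2) ind])
      then show "independent (set [k0, k1, l])" by (simp add: insert_commute)
      show "set [k0, k1, l] \<subseteq> T" using k(3) True lT by (simp add: T_def)
    qed (rule that)
    obtain m' where m': "m = Suc m'" using m1 by (cases m) auto
    have len: "length (u # l # vs) = 2 * m" "length vs = 2 * m'" using vs(1) dT m m' by simp_all
    have "q \<bullet> u \<noteq> 0" unfolding qu by (rule one_neq_zero)
    then have "span (insert u (set [k0, k1, l] \<union> set vs)) = UNIV" by (rule span_insert_hyperplane[OF vs(3)[unfolded T_def]])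
    then have sp: "span (set (k0 # k1 # u # l # vs)) = UNIV" by (simp add: insert_commute)
    have hyp: "q \<bullet> ((k0 # k1 # u # l # vs) ! i) = 0" if i: "i < 2 * n" "i \<noteq> 2" for i
    proof -
      consider "i = 0" | "i = 1" | "i = 3" | "4 \<le> i" using i(2) by linarith
      then show ?thesis
      proof cases
        case 4
        then have j: "i - 4 < length vs" "(k0 # k1 # u # l # vs) ! i = vs ! (i - 4)"
          using i len m m' by (auto simp: nth_Cons' numeral_eq_Suc)
        then have "vs ! (i - 4) \<in> T" using vs(2) nth_mem[OF j(1)] by blast
        then show ?thesis unfolding j(2) by (simp add: T_def)
      qed (use k(3) True lT in \<open>simp_all add: numeral_eq_Suc\<close>)
    qed
    \<comment> \<open>Since \<open>l\<close> is orthogonal to the hyperplane, each Pfaffian factors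
      into the pairing of \<open>u\<close> with \<open>l\<close> and a part computed on the
      hyperplane, where the forms agree.\<close>
    define e0 where "e0 = \<omega>\<^sub>0 0 [u, l]"
    define e1 where "e1 = \<omega>\<^sub>1 0 [u, l]"
    define P where "P = 2 * real (Suc m') * pf m' (\<lambda>i j. \<omega>\<^sub>0 0 [vs ! i, vs ! j])"
    have qvs: "q \<bullet> x = 0" if "x \<in> set vs" for x using that vs(2) by (auto simp: T_def)
    have p0: "pf m (\<lambda>i j. \<omega>\<^sub>0 0 [(u # l # vs) ! i, (u # l # vs) ! j]) = e0 * P"
      using pf_symplectic_cons[OF b0 len(2) lT(2)[OF qvs], of u] by (simp add: P_def e0_def m')
    have "pf m' (\<lambda>i j. \<omega>\<^sub>1 0 [vs ! i, vs ! j]) = pf m' (\<lambda>i j. \<omega>\<^sub>0 0 [vs ! i, vs ! j])"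
      by (rule pf_cong, rule bT[symmetric]) (auto intro!: qvs nth_mem simp: len(2))
    then have p1: "pf m (\<lambda>i j. \<omega>\<^sub>1 0 [(u # l # vs) ! i, (u # l # vs) ! j]) = e1 * P"
      using pf_symplectic_cons[OF b1 len(2) lT(3)[OF qvs], of u] by (simp add: P_def e1_def m')
    obtain Z where Z: "Z > 0" "a1 * (e1 * P) = Z * (a0 * (e0 * P))" "a0 * (e0 * P) \<noteq> 0"
      using key[OF len(1) sp hyp] unfolding p0 p1 by blast
    then have *: "a1 * e1 = Z * (a0 * e0)" "a0 \<noteq> 0" "e0 \<noteq> 0" by auto
    then have nz: "a1 \<noteq> 0" "e1 \<noteq> 0" using Z(1) by auto
    have pos: "(a0 * a1) * (e0 * e1) > 0"
    proof -
      have "(a0 * a1) * (e0 * e1) = Z * (a0 * e0)\<^sup>2" using *(1) by (simp add: power2_eq_square algebra_simps)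
      then show ?thesis using Z(1) *(2,3) by simp
    qed
    \<comment> \<open>The products \<open>a0 * a1\<close> and \<open>e0 * e1\<close> have equal
      signs but may both be negative; reversing \<open>u\<close> corrects both at once.\<close>
    define \<tau> :: real where "\<tau> = (if a0 * a1 > 0 then 0 else -2)"
    have s: "a0 * ((1 + \<tau>) * a1) > 0" "e0 * ((1 + \<tau>) * e1) > 0"
      using pos by (auto simp: \<tau>_def zero_less_mult_iff mult_less_0_iff)
    show ?thesis
    proof (rule fin[of \<tau>])
      show "0 < n" using m by simp
      show "\<tau> = 0 \<or> \<tau> = - 2 \<and> q \<bullet> k0 = 0 \<and> q \<bullet> k1 = 0" using True k(3) by (simp add: \<tau>_def)
      show "0 < frechet_derivative (\<lambda>x. \<omega>\<^sub>0 x [k0, k1]) (at 0) u * ((1 + \<tau>) * frechet_derivative (\<lambda>x. \<omega>\<^sub>1 x [k0, k1]) (at 0) u)"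
        using s(1) by (simp add: a0_def a1_def)
      fix t v assume t: "t \<in> {0..1}" and z: "\<forall>w. (1 - t) * \<omega>\<^sub>0 0 [w, v] + t * \<omega>\<^sub>1 0 [w + (\<tau> * (q \<bullet> w)) *\<^sub>R u, v + (\<tau> * (q \<bullet> v)) *\<^sub>R u] = 0"
      have nz: "(1 - t) * e0 + t * ((1 + \<tau>) * e1) \<noteq> 0" by (rule segment_nonzero[OF t s(2)])
      \<comment> \<open>Modulo the hyperplane, which pairs to zero with \<open>l\<close>, the vector
        \<open>v\<close> is \<open>(q \<bullet> v) *\<^sub>R u\<close>.\<close>
      have lv: "\<omega> [l, v + x *\<^sub>R u] = - (x + q \<bullet> v) * \<omega> [u, l]" if "alternating_form 2 \<omega>" "\<And>w. q \<bullet> w = 0 \<Longrightarrow> \<omega> [l, w] = 0" for \<omega> x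
      proof -
        note b = a2(1)[OF that(1)]
        have "\<omega> [l, v - (q \<bullet> v) *\<^sub>R u] = 0" by (rule that(2)) (simp add: inner_diff_right qu)
        then have "\<omega> [l, v] = (q \<bullet> v) * \<omega> [l, u]" by (simp add: bilinear_rsub[OF b] bilinear_rmul[OF b])
        then show ?thesis using a2(3)[OF that(1), of u l] by (simp add: bilinear_radd[OF b] bilinear_rmul[OF b] algebra_simps)
      qed
      \<comment> \<open>Testing a kernel vector of the intermediate form with \<open>l\<close>
        forces it into the hyperplane.\<close>
      have "(1 - t) * \<omega>\<^sub>0 0 [l, v] + t * \<omega>\<^sub>1 0 [l, v + (\<tau> * (q \<bullet> v)) *\<^sub>R u] = 0" using z[rule_format, of l] lT(1) by simp
      then have "(q \<bullet> v) * ((1 - t) * e0 + t * ((1 + \<tau>) * e1)) = 0"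
        using lv[OF al(1) lT(2), of 0] lv[OF al(2) lT(3), of "\<tau> * (q \<bullet> v)"] by (simp add: e0_def e1_def algebra_simps)
      then have qv: "q \<bullet> v = 0" using nz by simp
      have vT: "\<omega>\<^sub>0 0 [w, v] = 0" "\<omega>\<^sub>1 0 [w, v] = 0" if "q \<bullet> w = 0" for w
        using z[rule_format, of w] bT[OF that qv] that qv by (simp_all add: algebra_simps)
      \<comment> \<open>Subtracting this multiple of \<open>l\<close> makes \<open>v\<close>
        orthogonal to \<open>u\<close>, and hence to everything for \<open>\<omega>\<^sub>0\<close>;
        the difference lies in the kernel plane.\<close>
      define g where "g = \<omega>\<^sub>0 0 [u, v] / e0"
      let ?v = "v - g *\<^sub>R l"
      have dec: "\<omega>\<^sub>0 0 [w, ?v] = 0" for w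
      proof -
        let ?w = "w - (q \<bullet> w) *\<^sub>R u"
        have qw: "q \<bullet> ?w = 0" by (simp add: inner_diff_right qu)
        have "\<omega>\<^sub>0 0 [?w, ?v] = 0"
          using vT(1)[OF qw] lT(2)[OF qw] a2(3)[OF al(1), of ?w l] by (simp add: bilinear_rsub[OF b0(1)] bilinear_rmul[OF b0(1)])
        moreover have "\<omega>\<^sub>0 0 [u, ?v] = 0" using *(3) by (simp add: bilinear_rsub[OF b0(1)] bilinear_rmul[OF b0(1)] g_def e0_def)
        ultimately show ?thesis by (simp add: bilinear_lsub[OF b0(1), of w] bilinear_lmul[OF b0(1)])
      qed
      have K0: "?v \<in> span {k0, k1}" by (rule inK[OF dec])
      then have "?v \<in> rad ?b1 UNIV" using spanK K by simp
      then have "\<omega>\<^sub>1 0 [u, ?v] = 0" using a2(3)[OF al(2), of u ?v] by (simp add: rad_def)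
      then have u1: "\<omega>\<^sub>1 0 [u, v] = g * e1" by (simp add: bilinear_rsub[OF b1(1)] bilinear_rmul[OF b1(1)] e1_def)
      have u0: "\<omega>\<^sub>0 0 [u, v] = g * e0" using *(3) by (simp add: g_def)
      have "u + \<tau> *\<^sub>R u = (1 + \<tau>) *\<^sub>R u" by (simp add: algebra_simps)
      \<comment> \<open>Testing with \<open>u\<close> leaves \<open>g\<close> times a number that is
        nonzero on the whole segment.\<close>
      then have "(1 - t) * \<omega>\<^sub>0 0 [u, v] + t * ((1 + \<tau>) * \<omega>\<^sub>1 0 [u, v]) = 0"
        using z[rule_format, of u] qu qv by (simp add: bilinear_lmul[OF b1(1)])
      then have "g * ((1 - t) * e0 + t * ((1 + \<tau>) * e1)) = 0" unfolding u0 u1 by (simp add: algebra_simps)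
      then have "g = 0" using nz by simp
      then show "v \<in> span {k0, k1}" using K0 by simp
    qed
  qed
  then show ?thesis unfolding form_equiv_def by blast
qed

end
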